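(* Let $g',g,d',d\in\mathbb N$, let $L$ be a $d'\times d$ NC analytic truly linear pencil and let $f:\mathcal B_{g'\times g}\to\mathcal B_L$ be a pencil ball map with $\|L\circ f(0)\|<1$. Then $$L\circ f(x)=\mathcal F_{L\circ f(0)}\big(\varphi(x)\big),$$ where $\varphi(x)=\mathcal F_{L\circ f(0)}\big(L\circ f(x)\big)$ is an NC ball map $\mathcal B_{g'\times g}\to\mathcal B_{d'\times d}$ taking $0$ to $0$; consequently there are unitaries $U:\mathbb C^d\to\mathbb C^d$, $V:\mathbb C^{d'}\to\mathbb C^{d'}$ and an NC analytic contraction-valued map $\tilde\varphi:\mathcal B_{g'\times g}\to\mathcal B_{(d'-g')\times(d-g)}$ with $\tilde\varphi(0)=0$ such that $\varphi(x)=V\begin{bmatrix}x&0\\0&\tilde\varphi(x)\end{bmatrix}U^*$.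
   Context: For $N\in\mathbb N$, $\mathcal M_{d'\times d}(N)$ is the set of $d'\times d$ block matrices $X=[X_{j\ell}]$ with $X_{j\ell}\in\mathbb C^{N\times N}$, regarded as $d'N\times dN$ matrices with the operator norm; $\mathcal M_{d'\times d}=\bigsqcup_N\mathcal M_{d'\times d}(N)$. Put $\mathcal B_{d'\times d}=\{X\in\mathcal M_{d'\times d}:\|X\|\le1\}$, $\operatorname{int}\mathcal B_{d'\times d}=\{\|X\|<1\}$. NC analytic functions: let $x=(x_{j\ell})$ be $g'g$ noncommuting variables and $\langle x\rangle$ the set of words in them; for $X\in\mathcal M_{g'\times g}(N)$, $w(X)\in\mathbb C^{N\times N}$ is the evaluation of the word $w$. For $k',k\in\mathbb N$, an NC analytic function $f:\mathcal B_{g'\times g}\to\mathcal M_{k'\times k}$ assigns to each $X\in\operatorname{int}\mathcal B_{g'\times g}$ of size $N$ a matrix $f(X)\in\mathcal M_{k'\times k}(N)$, such that: (1) there are $a_w\in\mathbb C^{k'\times k}$ and $\varepsilon>0$ such that for all $N$ and all $X\in\mathcal M_{g'\times g}(N)$ with $\|X\|<\varepsilon$, $f(X)=\sum_{\alpha=0}^\infty\sum_{|w|=\alpha}a_w\otimes w(X)$, the outer sum converging; (2) for every analytic $a$ from a domain $W\subseteq\mathbb C^K$ into $\operatorname{int}\mathcal B_{g'\times g}$ (at a fixed size), $f\circ a$ is analytic on $W$, and continuous up to $\partial W$ whenever $a$ extends continuously to $\overline W$ with values in $\operatorname{int}\mathcal B_{g'\times g}$. $f(0)$ denotes $a_\emptyset$.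 For $\|X\|=1$ and $t\in\mathbb R$, $f(e^{it}X)$ denotes $\lim_{r\nearrow1}f(re^{it}X)$ when this limit exists. An NC ball map $f:\mathcal B_{g'\times g}\to\mathcal B_{d'\times d}$ is an NC analytic function with values in $\mathcal B_{d'\times d}$ such that $\|f(e^{it}X)\|=1$ whenever $\|X\|=1$ and $f(e^{it}X)$ exists. A $d'\times d$ NC analytic truly linear pencil is $L(x)=\sum_{i=1}^{g'}\sum_{j=1}^{g}A_{ij}x_{ij}$ with $A_{ij}\in\mathbb C^{d'\times d}$; $L(X)=\sum A_{ij}\otimes X_{ij}$. Its pencil ball is $\mathcal B_L=\{X\in\mathcal M_{g'\times g}:\|L(X)\|\le1\}$. A pencil ball map $f:\mathcal B_{g'\times g}\to\mathcal B_L$ is an NC analytic function $f:\mathcal B_{g'\times g}\to\mathcal M_{g'\times g}$ with values in $\mathcal B_L$ such that $\|L(f(X))\|=1$ whenever $\|X\|=1$ and $f(X):=\lim_{r\nearrow1}f(rX)$ exists. For $v\in\mathbb C^{d'\times d}$ with $\|v\|<1$, $\mathcal F_v:\mathcal B_{d'\times d}\to\mathcal B_{d'\times d}$ is $\mathcal F_v(u)=v-(I_{d'}-vv^* )^{1/2}u(I_d-v^*u)^{-1}(I_d-v^*v)^{1/2}$, where for $u$ of size $N$ one replaces $v$ by $v\otimes I_N$ and $I_{d'},I_d$ by $I_{d'N},I_{dN}$. The block form for $\varphi$ means $\varphi(X)=(V\otimes I_N)\begin{bmatrix}X&0\\0&\tilde\varphi(X)\end{bmatrix}(U\otimes I_N)^*$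 for all $X\in\operatorname{int}\mathcal B_{g'\times g}$ of size $N$; it is understood to include $g'\le d'$, $g\le d$, and block rows or columns of size zero are absent. *)

theory Defs
  imports "HOL-Analysis.Function_Topology" "HOL-Analysis.L2_Norm"
    "Jordan_Normal_Form.Gauss_Jordan_Elimination" "Jordan_Normal_Form.Schur_Decomposition"
begin

definition vnorm :: "complex Matrix.vec \<Rightarrow> real" where
  "vnorm x = L2_set (\<lambda>i. cmod (vec_index x i)) {..<dim_vec x}"

text \<open>The set of vectors contains the zero vector, so a matrix without rows or without columns
  has norm 0.\<close>

definition op_norm :: "complex mat \<Rightarrow> real" where
  "op_norm A = (SUP x \<in> {x \<in> carrier_vec (dim_col A). vnorm x \<le> 1}. vnorm (A *\<^sub>v x))"

text \<open>The Kronecker product; \<open>kron A B\<close> is the block matrix with blocks \<open>A\<^sub>i\<^sub>j B\<close>.\<close>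

definition kron :: "complex mat \<Rightarrow> complex mat \<Rightarrow> complex mat" where
  "kron A B = Matrix.mat (dim_row A * dim_row B) (dim_col A * dim_col B)
     (\<lambda>(i, j). A $$ (i div dim_row B, j div dim_col B) * B $$ (i mod dim_row B, j mod dim_col B))"

definition unitary_mat :: "nat \<Rightarrow> complex mat \<Rightarrow> bool" where
  "unitary_mat n U \<longleftrightarrow> U \<in> carrier_mat n n \<and>
     U * mat_adjoint U = 1\<^sub>m n \<and> mat_adjoint U * U = 1\<^sub>m n"

text \<open>The order on the complex numbers used here is that of \<open>Complex_Order\<close>:
  \<open>0 \<le> z\<close> says that \<open>z\<close> is real and nonnegative.\<close>

definition psd :: "nat \<Rightarrow> complex mat \<Rightarrow> bool" where
  "psd n A \<longleftrightarrow> A \<in> carrier_mat n n \<and> mat_adjoint A = A \<and>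
     (\<forall>x \<in> carrier_vec n. 0 \<le> (A *\<^sub>v x) \<bullet>c x)"

text \<open>The square root of a positive semidefinite matrix, unspecified for any other matrix.\<close>

definition psd_sqrt :: "complex mat \<Rightarrow> complex mat" where
  "psd_sqrt A = (THE B. psd (dim_row A) B \<and> B * B = A)"

text \<open>A \<open>g' \<times> g\<close> block matrix with blocks of size \<open>N\<close> is a matrix in
  \<open>carrier_mat (g' * N) (g * N)\<close>. Since \<open>g' > 0\<close> throughout, \<open>N\<close> can be read off from the number
  of rows, so an NC function is simply a function on matrices.\<close>

definition int_ball :: "nat \<Rightarrow> nat \<Rightarrow> nat \<Rightarrow> complex mat set" where
  "int_ball g' g N = {X \<in> carrier_mat (g' * N) (g * N). op_norm X < 1}"

definition block :: "nat \<Rightarrow> complex mat \<Rightarrow> nat \<Rightarrow> nat \<Rightarrow> complex mat" where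
  "block N X j l = Matrix.mat N N (\<lambda>(p, q). X $$ (j * N + p, l * N + q))"

text \<open>A word in the variables \<open>x\<^sub>j\<^sub>l\<close> is a list of index pairs \<open>(j, l)\<close>, counted from 0.\<close>

definition words :: "nat \<Rightarrow> nat \<Rightarrow> nat \<Rightarrow> (nat \<times> nat) list set" where
  "words g' g \<alpha> = {w. set w \<subseteq> {..<g'} \<times> {..<g} \<and> length w = \<alpha>}"

definition word_eval :: "nat \<Rightarrow> complex mat \<Rightarrow> (nat \<times> nat) list \<Rightarrow> complex mat" where
  "word_eval N X w = foldr (\<lambda>(j, l) M. block N X j l * M) w (1\<^sub>m N)"

text \<open>The space of \<open>K\<close>-tuples of complex numbers, with \<open>K\<close> a term, is realised inside
  \<open>nat \<Rightarrow> complex\<close> by padding with zeros. The product topology of \<open>nat \<Rightarrow> complex\<close> induces the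
  Euclidean topology on it.\<close>

definition cspace :: "nat \<Rightarrow> (nat \<Rightarrow> complex) set" where
  "cspace K = {z. \<forall>i\<ge>K. z i = 0}"

definition cdomain :: "nat \<Rightarrow> (nat \<Rightarrow> complex) set \<Rightarrow> bool" where
  "cdomain K W \<longleftrightarrow> W \<noteq> {} \<and> openin (top_of_set (cspace K)) W \<and> connected W"

text \<open>As for \<open>analytic_on\<close> in the case of one variable, analyticity on an open set is complex
  differentiability at each of its points, here with a complex linear total derivative.\<close>

definition analytic_several :: "nat \<Rightarrow> (nat \<Rightarrow> complex) set \<Rightarrow> ((nat \<Rightarrow> complex) \<Rightarrow> complex) \<Rightarrow> bool"
  where
  "analytic_several K W F \<longleftrightarrow> (\<forall>z \<in> W. \<exists>c :: nat \<Rightarrow> complex.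
     ((\<lambda>y. (F y - F z - (\<Sum>i<K. c i * (y i - z i)))
            / complex_of_real (L2_set (\<lambda>i. cmod (y i - z i)) {..<K})) \<longlongrightarrow> 0) (at z within W))"

definition mat_analytic ::
  "nat \<Rightarrow> (nat \<Rightarrow> complex) set \<Rightarrow> nat \<Rightarrow> nat \<Rightarrow> ((nat \<Rightarrow> complex) \<Rightarrow> complex mat) \<Rightarrow> bool" where
  "mat_analytic K W m n a \<longleftrightarrow> (\<forall>z \<in> W. a z \<in> carrier_mat m n) \<and>
     (\<forall>p<m. \<forall>q<n. analytic_several K W (\<lambda>z. a z $$ (p, q)))"

definition mat_continuous ::
  "(nat \<Rightarrow> complex) set \<Rightarrow> nat \<Rightarrow> nat \<Rightarrow> ((nat \<Rightarrow> complex) \<Rightarrow> complex mat) \<Rightarrow> bool" where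
  "mat_continuous S m n a \<longleftrightarrow> (\<forall>z \<in> S. a z \<in> carrier_mat m n) \<and>
     (\<forall>p<m. \<forall>q<n. continuous_on S (\<lambda>z. a z $$ (p, q)))"

definition nc_series ::
  "nat \<Rightarrow> nat \<Rightarrow> nat \<Rightarrow> nat \<Rightarrow> (complex mat \<Rightarrow> complex mat) \<Rightarrow> ((nat \<times> nat) list \<Rightarrow> complex mat) \<Rightarrow>
   real \<Rightarrow> bool" where
  "nc_series g' g k' k f a \<epsilon> \<longleftrightarrow> \<epsilon> > 0 \<and> (\<forall>w. a w \<in> carrier_mat k' k) \<and>
     (\<forall>N>0. \<forall>X \<in> carrier_mat (g' * N) (g * N). op_norm X < \<epsilon> \<longrightarrow>
        (\<forall>p < k' * N. \<forall>q < k * N.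
           (\<lambda>\<alpha>. \<Sum>w \<in> words g' g \<alpha>. kron (a w) (word_eval N X w) $$ (p, q)) sums (f X $$ (p, q))))"

text \<open>In the last clause \<open>a\<close> stands for the continuous extension to the closure of the domain.\<close>

definition nc_analytic ::
  "nat \<Rightarrow> nat \<Rightarrow> nat \<Rightarrow> nat \<Rightarrow> (complex mat \<Rightarrow> complex mat) \<Rightarrow> bool" where
  "nc_analytic g' g k' k f \<longleftrightarrow>
     (\<forall>N>0. \<forall>X \<in> int_ball g' g N. f X \<in> carrier_mat (k' * N) (k * N)) \<and>
     (\<exists>a \<epsilon>. nc_series g' g k' k f a \<epsilon>) \<and>
     (\<forall>N>0. \<forall>K>0. \<forall>W a.
        cdomain K W \<and> mat_analytic K W (g' * N) (g * N) a \<and> a ` W \<subseteq> int_ball g' g N \<longrightarrow>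
          mat_analytic K W (k' * N) (k * N) (f \<circ> a) \<and>
          (mat_continuous (closure W) (g' * N) (g * N) a \<and> a ` closure W \<subseteq> int_ball g' g N \<longrightarrow>
             mat_continuous (closure W) (k' * N) (k * N) (f \<circ> a)))"

text \<open>\<open>f(0)\<close>, the coefficient of the empty word, is the value of \<open>f\<close> at the zero matrix of
  size \<open>N = 1\<close>; see \<open>nc_series_at_0\<close> below.\<close>

definition nc_at_0 :: "nat \<Rightarrow> nat \<Rightarrow> (complex mat \<Rightarrow> complex mat) \<Rightarrow> complex mat" where
  "nc_at_0 g' g f = f (0\<^sub>m g' g)"

text \<open>\<open>radial_limit m n f X Y\<close>: \<open>f (r X)\<close> tends to the \<open>m \<times> n\<close> matrix \<open>Y\<close> as \<open>r\<close> increases to 1.\<close>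

definition radial_limit ::
  "nat \<Rightarrow> nat \<Rightarrow> (complex mat \<Rightarrow> complex mat) \<Rightarrow> complex mat \<Rightarrow> complex mat \<Rightarrow> bool" where
  "radial_limit m n f X Y \<longleftrightarrow> Y \<in> carrier_mat m n \<and>
     (\<forall>p<m. \<forall>q<n. ((\<lambda>r. f (complex_of_real r \<cdot>\<^sub>m X) $$ (p, q)) \<longlongrightarrow> Y $$ (p, q)) (at_left 1))"

definition contraction_valued :: "nat \<Rightarrow> nat \<Rightarrow> (complex mat \<Rightarrow> complex mat) \<Rightarrow> bool" where
  "contraction_valued g' g f \<longleftrightarrow> (\<forall>N>0. \<forall>X \<in> int_ball g' g N. op_norm (f X) \<le> 1)"

definition nc_ball_map ::
  "nat \<Rightarrow> nat \<Rightarrow> nat \<Rightarrow> nat \<Rightarrow> (complex mat \<Rightarrow> complex mat) \<Rightarrow> bool" where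
  "nc_ball_map g' g d' d f \<longleftrightarrow> nc_analytic g' g d' d f \<and> contraction_valued g' g f \<and>
     (\<forall>N>0. \<forall>X \<in> carrier_mat (g' * N) (g * N). \<forall>t :: real. \<forall>Y.
        op_norm X = 1 \<and> radial_limit (d' * N) (d * N) f (cis t \<cdot>\<^sub>m X) Y \<longrightarrow> op_norm Y = 1)"

definition linear_pencil :: "nat \<Rightarrow> nat \<Rightarrow> nat \<Rightarrow> nat \<Rightarrow> (nat \<Rightarrow> nat \<Rightarrow> complex mat) \<Rightarrow> bool" where
  "linear_pencil g' g d' d A \<longleftrightarrow> (\<forall>i<g'. \<forall>j<g. A i j \<in> carrier_mat d' d)"

definition pencil_eval ::
  "nat \<Rightarrow> nat \<Rightarrow> nat \<Rightarrow> nat \<Rightarrow> (nat \<Rightarrow> nat \<Rightarrow> complex mat) \<Rightarrow> complex mat \<Rightarrow> complex mat" where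
  "pencil_eval g' g d' d A X = (let N = dim_row X div g' in
     Matrix.mat (d' * N) (d * N)
       (\<lambda>(p, q). \<Sum>i<g'. \<Sum>j<g. kron (A i j) (block N X i j) $$ (p, q)))"

definition pencil_ball_map ::
  "nat \<Rightarrow> nat \<Rightarrow> nat \<Rightarrow> nat \<Rightarrow> (nat \<Rightarrow> nat \<Rightarrow> complex mat) \<Rightarrow> (complex mat \<Rightarrow> complex mat) \<Rightarrow> bool"
  where
  "pencil_ball_map g' g d' d A f \<longleftrightarrow> nc_analytic g' g g' g f \<and>
     (\<forall>N>0. \<forall>X \<in> int_ball g' g N. op_norm (pencil_eval g' g d' d A (f X)) \<le> 1) \<and>
     (\<forall>N>0. \<forall>X \<in> carrier_mat (g' * N) (g * N). \<forall>Y.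
        op_norm X = 1 \<and> radial_limit (g' * N) (g * N) f X Y \<longrightarrow>
          op_norm (pencil_eval g' g d' d A Y) = 1)"

text \<open>The map \<open>\<F>\<^sub>v\<close>, for \<open>v\<close> with at least one row; the matrix \<open>u\<close> has blocks of size \<open>N\<close>, and \<open>V\<close>
  is \<open>v \<otimes> I\<^sub>N\<close>. The inverse exists if \<open>v\<close> has norm \<open>< 1\<close> and \<open>u\<close> has norm \<open>\<le> 1\<close>.\<close>

definition ball_auto :: "complex mat \<Rightarrow> complex mat \<Rightarrow> complex mat" where
  "ball_auto v u = (let N = dim_row u div dim_row v; V = kron v (1\<^sub>m N);
       I' = 1\<^sub>m (dim_row v * N); I = 1\<^sub>m (dim_col v * N) in
     V - psd_sqrt (I' - V * mat_adjoint V) * u * the (mat_inverse (I - mat_adjoint V * u))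
           * psd_sqrt (I - mat_adjoint V * V))"

lemma nc_series_at_0:
  assumes "nc_series g' g k' k f a \<epsilon>" and "nc_analytic g' g k' k f"
  shows "a [] = nc_at_0 g' g f"
proof -
  have dimv: "vnorm (0\<^sub>m m n *\<^sub>v x) = 0" if "x \<in> carrier_vec n" for m n x
    using that by (simp add: vnorm_def L2_set_def)
  have n0: "op_norm (0\<^sub>m m n) = 0" for m n
  proof -
    have "0\<^sub>v n \<in> {x \<in> carrier_vec n. vnorm x \<le> 1}"
      by (simp add: vnorm_def L2_set_def)
    then have "(\<lambda>x. vnorm (0\<^sub>m m n *\<^sub>v x)) ` {x \<in> carrier_vec n. vnorm x \<le> 1} = {0}"
      using dimv[of _ n m] by (auto simp: image_iff intro!: exI[of _ "0\<^sub>v n"])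
    then show ?thesis by (simp add: op_norm_def)
  qed
  have ac: "a w \<in> carrier_mat k' k" for w
    using assms(1) by (simp add: nc_series_def)
  have fc: "f (0\<^sub>m g' g) \<in> carrier_mat k' k"
    using assms(2) unfolding nc_analytic_def int_ball_def
    by (elim conjE allE[of _ "1::nat"]) (auto simp: n0)
  have entry: "f (0\<^sub>m g' g) $$ (p, q) = a [] $$ (p, q)" if "p < k'" "q < k" for p q
  proof -
    let ?s = "\<lambda>\<alpha>. \<Sum>w \<in> words g' g \<alpha>. kron (a w) (word_eval 1 (0\<^sub>m g' g) w) $$ (p, q)"
    have s: "?s sums (f (0\<^sub>m g' g) $$ (p, q))"
      using assms(1) that unfolding nc_series_def
      by (elim conjE allE[of _ "1::nat"]) (auto simp: n0)
    have "?s \<alpha> = 0" if "\<alpha> \<noteq> 0" for \<alpha>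
    proof (rule sum.neutral, rule ballI)
      fix w assume w: "w \<in> words g' g \<alpha>"
      then obtain j l w' where ww: "w = (j, l) # w'" "j < g'" "l < g"
        using \<open>\<alpha> \<noteq> 0\<close> by (cases w) (auto simp: words_def)
      have wc: "word_eval 1 (0\<^sub>m g' g) w'' \<in> carrier_mat 1 1" for w''
        by (induction w'') (auto simp: word_eval_def block_def)
      have "block 1 (0\<^sub>m g' g) j l = 0\<^sub>m 1 1"
        using ww by (auto simp: block_def)
      then have "word_eval 1 (0\<^sub>m g' g) w = 0\<^sub>m 1 1"
        using wc[of w'] ww by (simp add: word_eval_def)
      then show "kron (a w) (word_eval 1 (0\<^sub>m g' g) w) $$ (p, q) = 0"
        using \<open>p < k'\<close> \<open>q < k\<close> ac[of w] by (simp add: kron_def)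
    qed
    then have "?s sums ?s 0"
      by (intro sums_finite[of "{0}", simplified]) auto
    moreover have "words g' g 0 = {[]}" by (auto simp: words_def)
    then have "?s 0 = a [] $$ (p, q)"
      using that ac[of "[]"] by (simp add: word_eval_def kron_def)
    ultimately show ?thesis using s sums_unique2 by metis
  qed
  show ?thesis unfolding nc_at_0_def
    using ac[of "[]"] fc entry by (intro eq_matI) auto
qed

end

theory Submission
  imports Defs "HOL-Complex_Analysis.Complex_Analysis"
begin

text \<open>Write \<open>V = v \<otimes> 1\<close>, \<open>D = (1 - V\<^sup>*V)\<^sup>1\<^sup>/\<^sup>2\<close> and \<open>D' = (1 - VV\<^sup>*)\<^sup>1\<^sup>/\<^sup>2\<close>. The matrix \<open>w = \<F>\<^sub>v(u)\<close> is the
  only solution of \<open>w D\<^sup>-\<^sup>1 (1 - V\<^sup>*u) = D'\<^sup>-\<^sup>1 (V - u)\<close>, and the isometry of the Julia matrix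
  \<open>[V, -D'; D, V\<^sup>*]\<close> gives \<open>\<parallel>x\<parallel>\<^sup>2 - \<parallel>wx\<parallel>\<^sup>2 = \<parallel>y\<parallel>\<^sup>2 - \<parallel>uy\<parallel>\<^sup>2\<close> for \<open>y = (1 - V\<^sup>*u)\<^sup>-\<^sup>1Dx\<close>. Hence \<open>\<F>\<^sub>v\<close> is an
  involution of the closed ball that preserves the sphere of norm 1 (\<open>W_involution\<close>,
  \<open>W_contraction\<close>, \<open>W_norm_one\<close>). The square roots are binomial series in \<open>V\<^sup>*V\<close> and \<open>VV\<^sup>*\<close>, so they
  intertwine with \<open>V\<close> and commute with ampliations. Therefore \<open>\<phi> = \<F>\<^sub>v \<circ> L \<circ> f\<close> is the quotient of
  two noncommutative series with invertible denominator, and is again NC analytic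
  (\<open>ball_auto_nc_taylor\<close>, \<open>nc_analytic_ball_auto\<close>); moreover \<open>\<phi>(0) = \<F>\<^sub>v(v) = 0\<close>.

  The boundary behaviour of \<open>f\<close> is only used at points \<open>X\<close> of norm 1 whose blocks multiply to
  zero. There \<open>f(rX)\<close> is affine in \<open>r\<close>, so the radial limit exists, and the linear part of \<open>\<phi>\<close> at
  \<open>X\<close> has norm 1. Applied to one such point of rank one (\<open>flat_point\<close>) this is an equality case
  of the triangle inequality: if \<open>B\<^sub>i\<^sub>j\<close> are the coefficients of \<open>\<phi>\<close> in degree 1, which are contractions
  by the Schwarz lemma, there are unit vectors \<open>u\<^sub>j\<close> and \<open>v\<^sub>i\<close> with \<open>B\<^sub>i\<^sub>j u\<^sub>j = v\<^sub>i\<close> for all \<open>i\<close>, \<open>j\<close>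
  (\<open>obtain_isometric_vectors\<close>). Bounds for the norms of \<open>B\<^sub>i\<^sub>j + \<omega>B\<^sub>i\<^sub>k\<close> and \<open>B\<^sub>i\<^sub>j + \<omega>B\<^sub>k\<^sub>j\<close> with \<open>\<bar>\<omega>\<bar> = 1\<close> then force
  the \<open>u\<^sub>j\<close> and the \<open>v\<^sub>i\<close> to be orthonormal, with \<open>B\<^sub>i\<^sub>j u\<^sub>k = 0\<close> for \<open>k \<noteq> j\<close> and \<open>B\<^sub>i\<^sub>j\<^sup>* v\<^sub>k = 0\<close> for \<open>k \<noteq> i\<close>.

  If the derivative at 0 of a contractive analytic disc maps a unit vector to a unit vector, then
  the disc is linear on this vector (\<open>rigid\<close> in \<open>contractive_disc\<close>). At test points that single
  out a word \<open>w\<close> of length at least 2 (\<open>word_point\<close>) this shows that the coefficient \<open>b\<^sub>w\<close> of \<open>\<phi>\<close>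
  satisfies \<open>b\<^sub>w u\<^sub>j = 0\<close> and \<open>b\<^sub>w\<^sup>* v\<^sub>i = 0\<close>. So \<open>\<phi>(X)\<close> maps \<open>u\<^sub>j \<otimes> \<xi>\<close> to \<open>\<Sum>\<^sub>i v\<^sub>i \<otimes> X\<^sub>i\<^sub>j \<xi>\<close>, and its adjoint acts
  likewise on the \<open>v\<^sub>i\<close>. Completing the \<open>u\<^sub>j\<close> and the \<open>v\<^sub>i\<close> to the columns of unitaries \<open>U\<close> and \<open>V\<close> gives the
  block form (\<open>block_form\<close>). As \<open>X\<close> is a compression of \<open>\<phi>(X)\<close>, radial limits of \<open>\<phi>\<close> at points of
  norm 1 have norm at least 1, and \<open>\<phi>\<close> is a ball map.\<close>

section \<open>Vectors, adjoints and the operator norm\<close>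

lemma sum_lessThan_blocks: "(\<Sum>i<k * (N::nat). f i) = (\<Sum>a<k. \<Sum>n<N. f (a * N + n))"
  for f :: "nat \<Rightarrow> 'a::comm_monoid_add"
proof -
  have "(\<Sum>n = a * N..<a * N + N. f n) = (\<Sum>n<N. f (a * N + n))" for a
    using sum.shift_bounds_nat_ivl[of f 0 "a * N" N]
    by (simp add: atLeast0LessThan add.commute)
  then show ?thesis using sum.nat_group[of f N k] by simp
qed

lemma index_mat_vec:
  "A \<in> carrier_mat m n \<Longrightarrow> x \<in> carrier_vec n \<Longrightarrow> i < m \<Longrightarrow>
    vec_index (A *\<^sub>v x) i = (\<Sum>j<n. A $$ (i, j) * vec_index x j)"
  by (auto simp: scalar_prod_def lessThan_atLeast0 intro!: sum.cong)

lemma index_mat_mat: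
  "A \<in> carrier_mat m n \<Longrightarrow> B \<in> carrier_mat n k \<Longrightarrow> i < m \<Longrightarrow> j < k \<Longrightarrow>
    (A * B) $$ (i, j) = (\<Sum>l<n. A $$ (i, l) * B $$ (l, j))"
  by (auto simp: scalar_prod_def lessThan_atLeast0 intro!: sum.cong)

lemma cscalar_prod_sum:
  "x \<in> carrier_vec n \<Longrightarrow> y \<in> carrier_vec n \<Longrightarrow>
    x \<bullet>c y = (\<Sum>i<n. vec_index x i * cnj (vec_index y i))"
  for x y :: "complex Matrix.vec"
  by (auto simp: scalar_prod_def lessThan_atLeast0 intro!: sum.cong)

lemma dim_mat_adjoint [simp]:
  "dim_row (mat_adjoint A) = dim_col A" "dim_col (mat_adjoint A) = dim_row A"
  by (auto simp: mat_adjoint_def)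

lemma mat_adjoint_carrier [simp]:
  "A \<in> carrier_mat m n \<Longrightarrow> mat_adjoint A \<in> carrier_mat n m"
  by (auto intro!: carrier_matI)

lemma index_mat_adjoint [simp]:
  "i < dim_col A \<Longrightarrow> j < dim_row A \<Longrightarrow> mat_adjoint A $$ (i, j) = cnj (A $$ (j, i))"
  by (auto simp: mat_adjoint_def mat_of_rows_def)

lemma mat_adjoint_adjoint [simp]: "mat_adjoint (mat_adjoint A) = (A :: complex mat)"
  by (rule eq_matI) auto

lemma mat_adjoint_mult:
  assumes "A \<in> carrier_mat m n" "B \<in> carrier_mat n k"
  shows "mat_adjoint (A * B) = mat_adjoint B * mat_adjoint (A :: complex mat)"
proof (rule eq_matI)
  fix i j assume "i < dim_row (mat_adjoint B * mat_adjoint A)" "j < dim_col (mat_adjoint B * mat_adjoint A)"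
  then have ij: "i < k" "j < m" using assms by auto
  have "mat_adjoint (A * B) $$ (i, j) = cnj ((A * B) $$ (j, i))"
    using assms ij by (subst index_mat_adjoint) auto
  also have "\<dots> = (\<Sum>l<n. mat_adjoint B $$ (i, l) * mat_adjoint A $$ (l, j))"
    using assms ij by (subst index_mat_mat[OF assms]) (auto intro!: sum.cong)
  also have "\<dots> = (mat_adjoint B * mat_adjoint A) $$ (i, j)"
    using assms ij by (subst index_mat_mat[of _ k n _ m]) auto
  finally show "mat_adjoint (A * B) $$ (i, j) = (mat_adjoint B * mat_adjoint A) $$ (i, j)" .
qed (use assms in auto)

lemma mat_adjoint_one [simp]: "mat_adjoint (1\<^sub>m n) = (1\<^sub>m n :: complex mat)"
  by (rule eq_matI) auto

lemma mat_adjoint_minus: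
  "A \<in> carrier_mat m n \<Longrightarrow> B \<in> carrier_mat m n \<Longrightarrow>
    mat_adjoint (A - B) = mat_adjoint A - mat_adjoint (B :: complex mat)"
  by (rule eq_matI) auto

lemma cscalar_prod_adjoint:
  fixes A :: "complex mat"
  assumes "A \<in> carrier_mat m n" "x \<in> carrier_vec n" "y \<in> carrier_vec m"
  shows "(A *\<^sub>v x) \<bullet>c y = x \<bullet>c (mat_adjoint A *\<^sub>v y)"
proof -
  have "(A *\<^sub>v x) \<bullet>c y = (\<Sum>i<m. \<Sum>j<n. A $$ (i, j) * vec_index x j * cnj (vec_index y i))"
    using assms by (subst cscalar_prod_sum[of _ m])
      (auto intro!: sum.cong simp: index_mat_vec sum_distrib_right simp del: index_mult_mat_vec)
  also have "\<dots> = (\<Sum>j<n. vec_index x j * cnj (\<Sum>i<m. mat_adjoint A $$ (j, i) * vec_index y i))"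
    using assms by (subst sum.swap) (auto intro!: sum.cong simp: sum_distrib_left)
  also have "\<dots> = x \<bullet>c (mat_adjoint A *\<^sub>v y)"
    using assms by (subst cscalar_prod_sum[of _ n])
      (auto intro!: sum.cong mult_mat_vec_carrier[OF mat_adjoint_carrier[OF assms(1)] assms(3)]
        simp: index_mat_vec[of "mat_adjoint A" n m] simp del: index_mult_mat_vec)
  finally show ?thesis .
qed

lemma vnorm_nonneg [simp]: "0 \<le> vnorm x"
  by (simp add: vnorm_def L2_set_nonneg)

lemma vnorm_power2: "(vnorm x)\<^sup>2 = (\<Sum>i<dim_vec x. (cmod (vec_index x i))\<^sup>2)"
  by (simp add: vnorm_def L2_set_def sum_nonneg)

lemma cscalar_prod_self: "x \<bullet>c x = complex_of_real ((vnorm x)\<^sup>2)"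
  by (subst cscalar_prod_sum[OF carrier_vec_dim_vec carrier_vec_dim_vec])
    (simp add: vnorm_power2 complex_norm_square del: of_real_power)

lemma vnorm_zero [simp]: "vnorm (0\<^sub>v n) = 0"
  by (simp add: vnorm_def L2_set_def)

lemma vnorm_eq_0: "x \<in> carrier_vec n \<Longrightarrow> vnorm x = 0 \<longleftrightarrow> x = 0\<^sub>v n"
  by (auto simp: vnorm_def L2_set_eq_0_iff intro!: eq_vecI)

lemma vnorm_smult [simp]: "vnorm (c \<cdot>\<^sub>v x) = cmod c * vnorm x"
proof -
  have "(vnorm (c \<cdot>\<^sub>v x))\<^sup>2 = (cmod c * vnorm x)\<^sup>2"
    by (simp add: vnorm_power2 power_mult_distrib norm_mult sum_distrib_left)
  then show ?thesis by (simp add: power2_eq_iff_nonneg)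
qed

lemma index_le_vnorm: "i < dim_vec x \<Longrightarrow> cmod (vec_index x i) \<le> vnorm x"
  unfolding vnorm_def by (rule member_le_L2_set) auto

lemma cscalar_prod_le: 
  assumes "x \<in> carrier_vec n" "y \<in> carrier_vec n"
  shows "cmod (x \<bullet>c y) \<le> vnorm x * vnorm y"
proof -
  have "cmod (x \<bullet>c y) \<le> (\<Sum>i<n. \<bar>cmod (vec_index x i)\<bar> * \<bar>cmod (vec_index y i)\<bar>)"
    using assms by (subst cscalar_prod_sum) (auto intro!: order.trans[OF norm_sum] sum_mono simp: norm_mult)
  also have "\<dots> \<le> vnorm x * vnorm y"
    using L2_set_mult_ineq[of "\<lambda>i. cmod (vec_index x i)" "\<lambda>i. cmod (vec_index y i)" "{..<n}"] assms
    by (simp add: vnorm_def)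
  finally show ?thesis .
qed

text \<open>A crude bound, which shows that the supremum in the operator norm is over a bounded set.\<close>

lemma vnorm_mult_bounded:
  assumes "A \<in> carrier_mat m n" "x \<in> carrier_vec n" "vnorm x \<le> 1"
  shows "vnorm (A *\<^sub>v x) \<le> L2_set (\<lambda>i. \<Sum>j<n. cmod (A $$ (i, j))) {..<m}"
proof -
  have "cmod (vec_index (A *\<^sub>v x) i) \<le> (\<Sum>j<n. cmod (A $$ (i, j)))" if "i < m" for i
  proof -
    have "cmod (A $$ (i, j) * vec_index x j) \<le> cmod (A $$ (i, j))" if "j < n" for j
      using index_le_vnorm[of j x] assms that
      by (auto simp: norm_mult intro!: mult_left_le)
    then show ?thesis
      using assms that by (subst index_mat_vec) (auto intro!: order.trans[OF norm_sum] sum_mono)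
  qed
  then show ?thesis using assms unfolding vnorm_def by (auto intro!: L2_set_mono)
qed

lemma bdd_above_op_norm:
  "bdd_above ((\<lambda>x. vnorm (A *\<^sub>v x)) ` {x \<in> carrier_vec (dim_col A). vnorm x \<le> 1})"
  using vnorm_mult_bounded[of A "dim_row A" "dim_col A"] by (auto intro!: bdd_aboveI2)

lemma op_norm_nonneg: "0 \<le> op_norm A"
  unfolding op_norm_def
  by (rule cSUP_upper2[OF bdd_above_op_norm, of "0\<^sub>v (dim_col A)"]) auto

lemma vnorm_mult_le:
  assumes "A \<in> carrier_mat m n" "x \<in> carrier_vec n"
  shows "vnorm (A *\<^sub>v x) \<le> op_norm A * vnorm x"
proof (cases "vnorm x = 0")
  case True
  then have "x = 0\<^sub>v n" using assms vnorm_eq_0 by blast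
  then have "A *\<^sub>v x = 0\<^sub>v m" using assms by (auto intro!: eq_vecI)
  then show ?thesis using True by simp
next
  case False
  define c where "c = complex_of_real (1 / vnorm x)"
  have c: "cmod c = 1 / vnorm x" by (simp add: c_def norm_divide)
  have "vnorm (A *\<^sub>v (c \<cdot>\<^sub>v x)) \<le> op_norm A"
    unfolding op_norm_def using assms False
    by (intro cSUP_upper bdd_above_op_norm) (auto simp: c)
  moreover have "A *\<^sub>v (c \<cdot>\<^sub>v x) = c \<cdot>\<^sub>v (A *\<^sub>v x)" using assms by (rule mult_mat_vec)
  ultimately have "vnorm (A *\<^sub>v x) / vnorm x \<le> op_norm A" by (simp add: c)
  moreover have "0 < vnorm x" using False vnorm_nonneg[of x] by linarith
  ultimately show ?thesis by (simp add: pos_divide_le_eq)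
qed

lemma op_norm_leI:
  assumes "A \<in> carrier_mat m n" "0 \<le> c" "\<And>x. x \<in> carrier_vec n \<Longrightarrow> vnorm (A *\<^sub>v x) \<le> c * vnorm x"
  shows "op_norm A \<le> c"
  unfolding op_norm_def
proof (rule cSUP_least)
  show "{x \<in> carrier_vec (dim_col A). vnorm x \<le> 1} \<noteq> {}"
    by (auto intro!: exI[of _ "0\<^sub>v (dim_col A)"])
  fix x assume "x \<in> {x \<in> carrier_vec (dim_col A). vnorm x \<le> 1}"
  then show "vnorm (A *\<^sub>v x) \<le> c"
    using assms(3)[of x] assms(1,2) mult_left_le[of "vnorm x" c] by auto
qed

lemma op_norm_mult:
  assumes "A \<in> carrier_mat m n" "B \<in> carrier_mat n k"
  shows "op_norm (A * B) \<le> op_norm A * op_norm B"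
proof (rule op_norm_leI)
  fix x :: "complex Matrix.vec" assume x: "x \<in> carrier_vec k"
  have "vnorm (A * B *\<^sub>v x) = vnorm (A *\<^sub>v (B *\<^sub>v x))" using assms x by simp
  also have "\<dots> \<le> op_norm A * vnorm (B *\<^sub>v x)" using assms x by (intro vnorm_mult_le) auto
  also have "\<dots> \<le> op_norm A * (op_norm B * vnorm x)"
    using assms x by (intro mult_left_mono vnorm_mult_le op_norm_nonneg)
  finally show "vnorm (A * B *\<^sub>v x) \<le> op_norm A * op_norm B * vnorm x" by simp
qed (use assms in \<open>auto simp: op_norm_nonneg\<close>)

lemma op_norm_adjoint_le:
  assumes "A \<in> carrier_mat m n" shows "op_norm (mat_adjoint A) \<le> op_norm A"
proof (rule op_norm_leI)
  fix y :: "complex Matrix.vec" assume y: "y \<in> carrier_vec m"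
  let ?z = "mat_adjoint A *\<^sub>v y"
  have z: "?z \<in> carrier_vec n" using assms y by (auto intro!: mult_mat_vec_carrier)
  have "complex_of_real ((vnorm ?z)\<^sup>2) = (A *\<^sub>v ?z) \<bullet>c y"
    using cscalar_prod_adjoint[OF assms z y] by (simp add: cscalar_prod_self)
  then have "(vnorm ?z)\<^sup>2 = cmod ((A *\<^sub>v ?z) \<bullet>c y)" by (metis norm_of_real abs_of_nonneg zero_le_power2)
  also have "\<dots> \<le> vnorm (A *\<^sub>v ?z) * vnorm y"
    using assms y z by (intro cscalar_prod_le) auto
  also have "\<dots> \<le> op_norm A * vnorm ?z * vnorm y"
    by (intro mult_right_mono vnorm_mult_le[OF assms z] vnorm_nonneg)
  finally have "vnorm ?z * vnorm ?z \<le> (op_norm A * vnorm y) * vnorm ?z"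
    by (simp add: power2_eq_square mult_ac)
  then show "vnorm ?z \<le> op_norm A * vnorm y"
    using mult_right_le_imp_le[of "vnorm ?z" "vnorm ?z" "op_norm A * vnorm y"]
      vnorm_nonneg[of ?z] op_norm_nonneg[of A] vnorm_nonneg[of y]
    by (cases "vnorm ?z = 0") (simp_all add: less_le)
qed (use assms in \<open>auto simp: op_norm_nonneg\<close>)

lemma op_norm_adjoint: "op_norm (mat_adjoint A) = op_norm A"
  using op_norm_adjoint_le[of A "dim_row A" "dim_col A"]
    op_norm_adjoint_le[of "mat_adjoint A" "dim_col A" "dim_row A"] by simp

lemma op_norm_smult: 
  assumes "A \<in> carrier_mat m n"
  shows "op_norm (c \<cdot>\<^sub>m A) = cmod c * op_norm A"
proof -
  have le: "op_norm (c \<cdot>\<^sub>m A) \<le> cmod c * op_norm A" if "A \<in> carrier_mat m n" for c A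
    using that
  proof (intro op_norm_leI)
    fix x :: "complex Matrix.vec" assume x: "x \<in> carrier_vec n"
    have "c \<cdot>\<^sub>m A *\<^sub>v x = c \<cdot>\<^sub>v (A *\<^sub>v x)" using that x by (auto intro!: eq_vecI)
    then show "vnorm (c \<cdot>\<^sub>m A *\<^sub>v x) \<le> cmod c * op_norm A * vnorm x"
      using vnorm_mult_le[OF that x] by (simp add: mult_left_mono mult.assoc)
  qed (auto simp: op_norm_nonneg)
  show ?thesis
  proof (cases "c = 0")
    case True
    then show ?thesis using le[OF assms, of c] op_norm_nonneg[of "c \<cdot>\<^sub>m A"] by simp
  next
    case False
    have "op_norm ((1 / c) \<cdot>\<^sub>m (c \<cdot>\<^sub>m A)) \<le> cmod (1 / c) * op_norm (c \<cdot>\<^sub>m A)"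
      using assms by (intro le) auto
    moreover have "(1 / c) \<cdot>\<^sub>m (c \<cdot>\<^sub>m A) = A" using False by (auto intro!: eq_matI)
    ultimately show ?thesis using le[OF assms, of c] False by (simp add: norm_divide field_simps)
  qed
qed

lemma index_le_op_norm:
  assumes "A \<in> carrier_mat m n" "i < m" "j < n"
  shows "cmod (A $$ (i, j)) \<le> op_norm A"
proof -
  have u: "vnorm (unit_vec n j) = 1"
    using assms(3) by (simp add: vnorm_def L2_set_def if_distrib if_distribR cong: if_cong)
  have "vec_index (A *\<^sub>v unit_vec n j) i = A $$ (i, j)"
    using assms by (subst index_mat_vec) (auto simp: if_distrib cong: if_cong)
  then have "cmod (A $$ (i, j)) \<le> vnorm (A *\<^sub>v unit_vec n j)"
    using index_le_vnorm[of i "A *\<^sub>v unit_vec n j"] assms by simp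
  then show ?thesis using vnorm_mult_le[OF assms(1), of "unit_vec n j"] u by simp
qed

text \<open>The supremum in the operator norm is attained, by compactness of the unit ball of
  \<open>\<complex>\<^sup>n\<close>, which is realised inside the product space \<open>nat \<Rightarrow> complex\<close>.\<close>

lemma op_norm_attained:
  assumes A: "A \<in> carrier_mat m n" and n: "op_norm A > 0"
  obtains x where "x \<in> carrier_vec n" "vnorm x = 1" "vnorm (A *\<^sub>v x) = op_norm A"
proof -
  define B :: "(nat \<Rightarrow> complex) set" where "B = Pi\<^sub>E UNIV (\<lambda>i. if i < n then cball 0 1 else {0})"
  define K where "K = B \<inter> {f. L2_set (\<lambda>i. cmod (f i)) {..<n} \<le> 1}"
  have "compactin (product_topology (\<lambda>_. euclidean) UNIV) B"
    unfolding B_def by (subst compactin_PiE) auto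
  then have "compact B" by (simp add: euclidean_product_topology)
  moreover have "closed {f :: nat \<Rightarrow> complex. L2_set (\<lambda>i. cmod (f i)) {..<n} \<le> 1}"
    unfolding L2_set_def
    by (intro closed_Collect_le continuous_intros) (auto intro!: continuous_on_product_coordinates)
  ultimately have K: "compact K" unfolding K_def by (rule compact_Int_closed)
  have "(\<lambda>_. 0) \<in> K" by (auto simp: K_def B_def L2_set_def)
  then have K0: "K \<noteq> {}" by blast
  let ?F = "\<lambda>f. L2_set (\<lambda>i. cmod (\<Sum>j<n. A $$ (i, j) * f j)) {..<m}"
  have "continuous_on K ?F"
    unfolding L2_set_def
    by (intro continuous_intros continuous_on_subset[OF continuous_on_product_coordinates]) auto
  from continuous_attains_sup[OF K K0 this] obtain f
    where f: "f \<in> K" "\<And>h. h \<in> K \<Longrightarrow> ?F h \<le> ?F f" by auto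
  have F: "vnorm (A *\<^sub>v x) = ?F (\<lambda>i. if i < n then vec_index x i else 0)" if "x \<in> carrier_vec n" for x
    unfolding vnorm_def L2_set_def using A that
    by (auto simp: index_mat_vec simp del: index_mult_mat_vec
        intro!: arg_cong[of _ _ sqrt] sum.cong arg_cong[of _ _ "\<lambda>a. (cmod a)\<^sup>2"])
  define x where "x = Matrix.vec n f"
  have x: "x \<in> carrier_vec n" by (simp add: x_def)
  have vx: "vnorm x \<le> 1" using f(1) by (simp add: K_def vnorm_def x_def L2_set_def)
  have Fx: "vnorm (A *\<^sub>v x) = ?F f"
    unfolding F[OF x] by (auto simp: x_def L2_set_def intro!: arg_cong[of _ _ sqrt] sum.cong)
  have "op_norm A \<le> vnorm (A *\<^sub>v x)"
    unfolding op_norm_def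
  proof (rule cSUP_least)
    show "{x \<in> carrier_vec (dim_col A). vnorm x \<le> 1} \<noteq> {}"
      by (auto intro!: exI[of _ "0\<^sub>v (dim_col A)"])
    fix y assume "y \<in> {x \<in> carrier_vec (dim_col A). vnorm x \<le> 1}"
    then have y: "y \<in> carrier_vec n" "vnorm y \<le> 1" using A by auto
    have "cmod (vec_index y i) \<le> 1" if "i < n" for i
      using index_le_vnorm[of i y] y that by auto
    then have "(\<lambda>i. if i < n then vec_index y i else 0) \<in> K"
      using y by (auto simp: K_def B_def vnorm_def L2_set_def)
    then show "vnorm (A *\<^sub>v y) \<le> vnorm (A *\<^sub>v x)"
      unfolding F[OF y(1)] Fx by (rule f(2))
  qed
  moreover have "vnorm (A *\<^sub>v x) \<le> op_norm A * vnorm x" by (rule vnorm_mult_le[OF A x])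
  ultimately have "op_norm A * 1 \<le> op_norm A * vnorm x" by simp
  then have "vnorm x = 1" using n vx by (simp add: mult_le_cancel_left_pos)
  moreover have "vnorm (A *\<^sub>v x) = op_norm A"
    using \<open>op_norm A \<le> vnorm (A *\<^sub>v x)\<close> \<open>vnorm (A *\<^sub>v x) \<le> op_norm A * vnorm x\<close> \<open>vnorm x = 1\<close> by simp
  ultimately show thesis using that x by blast
qed

section \<open>Kronecker products\<close>

lemma dim_kron [simp]:
  "dim_row (kron A B) = dim_row A * dim_row B" "dim_col (kron A B) = dim_col A * dim_col B"
  by (auto simp: kron_def)

lemma kron_carrier [simp]:
  "A \<in> carrier_mat m n \<Longrightarrow> B \<in> carrier_mat k l \<Longrightarrow> kron A B \<in> carrier_mat (m * k) (n * l)"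
  by (auto intro!: carrier_matI)

lemma block_index_less: 
  assumes "a < k" "p < N"
  shows "a * N + p < k * (N::nat)"
proof -
  have "a * N + p < Suc a * N" using assms by simp
  also have "\<dots> \<le> k * N" using assms by (intro mult_le_mono1) simp
  finally show ?thesis .
qed

lemma index_kron:
  assumes "A \<in> carrier_mat m n" "B \<in> carrier_mat k l" "a < m" "b < n" "p < k" "q < l"
  shows "kron A B $$ (a * k + p, b * l + q) = A $$ (a, b) * B $$ (p, q)"
  using assms by (auto simp: kron_def block_index_less)

lemma block_index_cases:
  assumes "i < k * (N::nat)"
  obtains a p where "a < k" "p < N" "i = a * N + p"
proof
  have "N > 0" using assms by (cases N) auto
  then show "i mod N < N" by simp
  show "i div N < k" using assms by (simp add: less_mult_imp_div_less)
qed simp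

lemma eq_block_matI:
  assumes "A \<in> carrier_mat (m * k) (n * l)" "B \<in> carrier_mat (m * k) (n * l)"
    and "\<And>a b p q. a < m \<Longrightarrow> b < n \<Longrightarrow> p < k \<Longrightarrow> q < l \<Longrightarrow>
      A $$ (a * k + p, b * l + q) = B $$ (a * k + p, b * l + q)"
  shows "A = B"
  using assms by (intro eq_matI) (auto elim!: block_index_cases)

lemma kron_mult:
  assumes "A \<in> carrier_mat m n" "B \<in> carrier_mat k l" "C \<in> carrier_mat n r" "D \<in> carrier_mat l s"
  shows "kron A B * kron C D = kron (A * C) (B * D)"
proof (rule eq_block_matI[of _ m k r s])
  fix a b p q assume i: "a < m" "b < r" "p < k" "q < s"
  have "(kron A B * kron C D) $$ (a * k + p, b * s + q) =
      (\<Sum>c<n. \<Sum>t<l. kron A B $$ (a * k + p, c * l + t) * kron C D $$ (c * l + t, b * s + q))"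
    using assms i by (subst index_mat_mat[of _ "m * k" "n * l" _ "r * s"])
      (auto simp: block_index_less sum_lessThan_blocks)
  also have "\<dots> = (\<Sum>c<n. \<Sum>t<l. (A $$ (a, c) * C $$ (c, b)) * (B $$ (p, t) * D $$ (t, q)))"
    using i index_kron[OF assms(1,2) i(1) _ i(3)] index_kron[OF assms(3,4) _ i(2) _ i(4)]
    by (intro sum.cong refl) auto
  also have "\<dots> = (A * C) $$ (a, b) * (B * D) $$ (p, q)"
    by (simp only: index_mat_mat[OF assms(1,3) i(1,2)] index_mat_mat[OF assms(2,4) i(3,4)]
        sum_product)
  also have "\<dots> = kron (A * C) (B * D) $$ (a * k + p, b * s + q)"
    using assms i by (subst index_kron[of _ m r _ k s]) auto
  finally show "(kron A B * kron C D) $$ (a * k + p, b * s + q) =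
    kron (A * C) (B * D) $$ (a * k + p, b * s + q)" .
qed (use assms in auto)

lemma mat_adjoint_kron:
  assumes "A \<in> carrier_mat m n" "B \<in> carrier_mat k l"
  shows "mat_adjoint (kron A B) = kron (mat_adjoint A) (mat_adjoint B)"
  using assms
  by (intro eq_block_matI[of _ n l m k])
    (auto simp: block_index_less index_kron[OF assms] index_kron[of _ n m _ l k])

lemma kron_one [simp]: "kron (1\<^sub>m m) (1\<^sub>m n) = 1\<^sub>m (m * n)"
proof (rule eq_block_matI[of _ m n m n])
  fix a b p q assume "a < m" "b < m" "p < n" "q < n"
  moreover have "a * n + p = b * n + q \<longleftrightarrow> a = b \<and> p = q" if "p < n" "q < n"
    using that by (metis div_mult_self3 div_less mod_mult_self3 mod_less add_0_right less_nat_zero_code)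
  ultimately show "kron (1\<^sub>m m) (1\<^sub>m n) $$ (a * n + p, b * n + q) = 1\<^sub>m (m * n) $$ (a * n + p, b * n + q)"
    by (auto simp: index_kron[of _ m m _ n n] block_index_less)
qed auto

lemma kron_one_size_1 [simp]: "kron A (1\<^sub>m 1) = A"
  by (rule eq_matI) (auto simp: kron_def)

text \<open>The component of a vector of \<open>\<complex>\<^sup>k \<otimes> \<complex>\<^sup>N\<close> along the \<open>n\<close>-th basis vector of the second factor.\<close>

definition slice :: "nat \<Rightarrow> nat \<Rightarrow> complex Matrix.vec \<Rightarrow> nat \<Rightarrow> complex Matrix.vec" where
  "slice k N x n = Matrix.vec k (\<lambda>a. vec_index x (a * N + n))"

lemma slice_carrier [simp]: "slice k N x n \<in> carrier_vec k" "dim_vec (slice k N x n) = k"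
  by (auto simp: slice_def)

lemma index_slice [simp]: "a < k \<Longrightarrow> vec_index (slice k N x n) a = vec_index x (a * N + n)"
  by (auto simp: slice_def)

lemma vnorm_slices:
  "x \<in> carrier_vec (k * N) \<Longrightarrow> (vnorm x)\<^sup>2 = (\<Sum>n<N. (vnorm (slice k N x n))\<^sup>2)"
  by (simp add: vnorm_power2 sum_lessThan_blocks) (rule sum.swap)

lemma slice_kron_mult:
  assumes "A \<in> carrier_mat m k" "x \<in> carrier_vec (k * N)" "n < N"
  shows "slice m N (kron A (1\<^sub>m N) *\<^sub>v x) n = A *\<^sub>v slice k N x n"
proof (rule eq_vecI)
  fix a assume "a < dim_vec (A *\<^sub>v slice k N x n)"
  then have a: "a < m" using assms by simp
  have "(\<Sum>p<N. (if n = p then 1 else 0) * z p) = z n" for z :: "nat \<Rightarrow> complex"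
    using assms(3) by (simp add: if_distrib[of "\<lambda>t. t * _"] cong: if_cong)
  then have *: "(\<Sum>p<N. A $$ (a, b) * 1\<^sub>m N $$ (n, p) * z p) = A $$ (a, b) * z n" for b and z :: "nat \<Rightarrow> complex"
    using assms(3) by (simp add: mult.assoc sum_distrib_left[symmetric])
  have "vec_index (kron A (1\<^sub>m N) *\<^sub>v x) (a * N + n) =
      (\<Sum>b<k. \<Sum>p<N. kron A (1\<^sub>m N) $$ (a * N + n, b * N + p) * vec_index x (b * N + p))"
    using assms a by (subst index_mat_vec[of _ "m * N" "k * N"])
      (auto simp: block_index_less sum_lessThan_blocks)
  also have "\<dots> = (\<Sum>b<k. \<Sum>p<N. A $$ (a, b) * 1\<^sub>m N $$ (n, p) * vec_index x (b * N + p))"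
    using assms a by (intro sum.cong refl) (subst index_kron[of _ m k _ N N], auto)
  also have "\<dots> = (\<Sum>b<k. A $$ (a, b) * vec_index x (b * N + n))"
    by (simp only: *)
  also have "\<dots> = vec_index (A *\<^sub>v slice k N x n) a"
    using assms a by (subst index_mat_vec[of _ m k]) auto
  finally show "vec_index (slice m N (kron A (1\<^sub>m N) *\<^sub>v x) n) a = vec_index (A *\<^sub>v slice k N x n) a"
    using a by simp
qed (use assms in auto)

lemma op_norm_kron_one_le:
  assumes A: "A \<in> carrier_mat m k"
  shows "op_norm (kron A (1\<^sub>m N)) \<le> op_norm A"
proof (rule op_norm_leI)
  fix x :: "complex Matrix.vec" assume x: "x \<in> carrier_vec (k * N)"
  have "(vnorm (kron A (1\<^sub>m N) *\<^sub>v x))\<^sup>2 = (\<Sum>n<N. (vnorm (A *\<^sub>v slice k N x n))\<^sup>2)"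
    using A x by (subst vnorm_slices[of _ m N]) 
      (auto intro!: sum.cong mult_mat_vec_carrier[of _ "m*N" "k*N"] simp: slice_kron_mult)
  also have "\<dots> \<le> (\<Sum>n<N. (op_norm A * vnorm (slice k N x n))\<^sup>2)"
    by (intro sum_mono power_mono vnorm_mult_le[OF A]) auto
  also have "\<dots> = (op_norm A * vnorm x)\<^sup>2"
    by (simp add: power_mult_distrib vnorm_slices[OF x] sum_distrib_left)
  finally show "vnorm (kron A (1\<^sub>m N) *\<^sub>v x) \<le> op_norm A * vnorm x"
    by (rule power2_le_imp_le) (auto simp: op_norm_nonneg)
qed (use A in \<open>auto simp: op_norm_nonneg\<close>)

section \<open>Binomial powers of a matrix\<close>

lemma pow_mat_add:
  assumes "M \<in> carrier_mat n n"
  shows "M ^\<^sub>m (j + k) = M ^\<^sub>m j * M ^\<^sub>m k"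
proof (induction k)
  case 0
  have "M ^\<^sub>m j \<in> carrier_mat n n" using assms by simp
  then show ?case using assms by simp
next
  case (Suc k)
  have "M ^\<^sub>m j \<in> carrier_mat n n" "M ^\<^sub>m k \<in> carrier_mat n n" using assms by simp_all
  then show ?case using Suc assms by (simp add: assoc_mult_mat[of _ n n _ n _ n])
qed

lemma op_norm_one_le: "op_norm (1\<^sub>m n) \<le> 1"
  by (rule op_norm_leI[of _ n n]) auto

lemma op_norm_pow_le:
  assumes "M \<in> carrier_mat n n"
  shows "op_norm (M ^\<^sub>m k) \<le> op_norm M ^ k"
proof (induction k)
  case 0
  then show ?case using assms by (simp add: op_norm_one_le)
next
  case (Suc k)
  have "op_norm (M ^\<^sub>m k * M) \<le> op_norm (M ^\<^sub>m k) * op_norm M"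
    using assms by (intro op_norm_mult) auto
  also have "\<dots> \<le> op_norm M ^ k * op_norm M" by (intro mult_right_mono Suc op_norm_nonneg)
  finally show ?case by (simp add: mult.commute)
qed

text \<open>The power \<open>(1 - M)\<^sup>a\<close> of a matrix \<open>M\<close> of norm less than 1, as a binomial series,
  summed entry by entry.\<close>

definition binom_mat :: "real \<Rightarrow> complex mat \<Rightarrow> complex mat" where
  "binom_mat a M = Matrix.mat (dim_row M) (dim_row M)
     (\<lambda>(i, j). \<Sum>k. complex_of_real ((a gchoose k) * (-1) ^ k) * (M ^\<^sub>m k) $$ (i, j))"

lemma binom_mat_carrier [simp]:
  "M \<in> carrier_mat n n \<Longrightarrow> binom_mat a M \<in> carrier_mat n n"
  by (auto simp: binom_mat_def)

lemma summable_binom_mat: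
  assumes "M \<in> carrier_mat n n" "op_norm M < 1" "i < n" "j < n"
  shows "summable (\<lambda>k. cmod (complex_of_real ((a gchoose k) * (-1) ^ k) * (M ^\<^sub>m k) $$ (i, j)))"
proof (rule summable_comparison_test')
  have "ereal (norm (op_norm M)) < conv_radius (\<lambda>k. a gchoose k)"
    using assms(2) op_norm_nonneg[of M] by (simp add: conv_radius_gchoose one_ereal_def)
  then show "summable (\<lambda>k. norm ((a gchoose k) * op_norm M ^ k))"
    by (rule abs_summable_in_conv_radius)
  fix k :: nat
  have "cmod ((M ^\<^sub>m k) $$ (i, j)) \<le> op_norm M ^ k"
    using index_le_op_norm[of "M ^\<^sub>m k" n n i j] op_norm_pow_le[OF assms(1), of k] assms by simp
  then have "\<bar>a gchoose k\<bar> * cmod ((M ^\<^sub>m k) $$ (i, j)) \<le> \<bar>a gchoose k\<bar> * op_norm M ^ k"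
    by (intro mult_left_mono) auto
  then show "norm (cmod (complex_of_real ((a gchoose k) * (-1) ^ k) * (M ^\<^sub>m k) $$ (i, j)))
      \<le> norm ((a gchoose k) * op_norm M ^ k)"
    using op_norm_nonneg[of M] by (simp add: norm_mult abs_mult norm_power)
qed

lemma binom_mat_sums:
  assumes "M \<in> carrier_mat n n" "op_norm M < 1" "i < n" "j < n"
  shows "(\<lambda>k. complex_of_real ((a gchoose k) * (-1) ^ k) * (M ^\<^sub>m k) $$ (i, j)) sums
    (binom_mat a M $$ (i, j))"
  using summable_sums[OF summable_norm_cancel[OF summable_binom_mat[OF assms, of a]]] assms
  by (simp add: binom_mat_def)

text \<open>The Cauchy product of the two series, by Vandermonde's identity for binomial coefficients.\<close>

lemma binom_mat_mult:
  assumes M: "M \<in> carrier_mat n n" "op_norm M < 1"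
  shows "binom_mat a M * binom_mat b M = binom_mat (a + b) M"
proof (rule eq_matI)
  fix i j assume "i < dim_row (binom_mat (a + b) M)" "j < dim_col (binom_mat (a + b) M)"
  then have ij: "i < n" "j < n" using M by (auto simp: binom_mat_def)
  let ?c = "\<lambda>a k i j. complex_of_real ((a gchoose k) * (-1) ^ k) * (M ^\<^sub>m k) $$ (i, j)"
  have "(\<lambda>k. \<Sum>s\<le>k. ?c a s i l * ?c b (k - s) l j) sums
      (binom_mat a M $$ (i, l) * binom_mat b M $$ (l, j))" if l: "l < n" for l
    using Cauchy_product_sums[OF summable_binom_mat[OF M ij(1) l, of a]
        summable_binom_mat[OF M l ij(2), of b]]
      sums_unique[OF binom_mat_sums[OF M ij(1) l, of a]]
      sums_unique[OF binom_mat_sums[OF M l ij(2), of b]] by simp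
  then have "(\<lambda>k. \<Sum>l<n. \<Sum>s\<le>k. ?c a s i l * ?c b (k - s) l j) sums
      (\<Sum>l<n. binom_mat a M $$ (i, l) * binom_mat b M $$ (l, j))"
    by (intro sums_sum) auto
  also have "(\<Sum>l<n. binom_mat a M $$ (i, l) * binom_mat b M $$ (l, j)) =
      (binom_mat a M * binom_mat b M) $$ (i, j)"
    using M ij by (subst index_mat_mat[of _ n n _ n]) auto
  also have "(\<lambda>k. \<Sum>l<n. \<Sum>s\<le>k. ?c a s i l * ?c b (k - s) l j) = (\<lambda>k. ?c (a + b) k i j)"
  proof
    fix k
    have "(\<Sum>l<n. \<Sum>s\<le>k. ?c a s i l * ?c b (k - s) l j) =
       (\<Sum>s\<le>k. complex_of_real ((a gchoose s) * (b gchoose (k - s)) * (-1) ^ k) *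
         (\<Sum>l<n. (M ^\<^sub>m s) $$ (i, l) * (M ^\<^sub>m (k - s)) $$ (l, j)))"
    proof (subst sum.swap, intro sum.cong refl)
      fix s assume "s \<in> {..k}"
      then have "(-1 :: real) ^ k = (-1) ^ s * (-1) ^ (k - s)" by (simp add: power_add[symmetric])
      then show "(\<Sum>l<n. ?c a s i l * ?c b (k - s) l j) =
          complex_of_real ((a gchoose s) * (b gchoose (k - s)) * (-1) ^ k) *
         (\<Sum>l<n. (M ^\<^sub>m s) $$ (i, l) * (M ^\<^sub>m (k - s)) $$ (l, j))"
        by (simp add: sum_distrib_left mult_ac)
    qed
    also have "\<dots> = (\<Sum>s\<le>k. complex_of_real ((a gchoose s) * (b gchoose (k - s)) * (-1) ^ k) *
         (M ^\<^sub>m k) $$ (i, j))"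
    proof (intro sum.cong refl)
      fix s assume "s \<in> {..k}"
      then have "M ^\<^sub>m k = M ^\<^sub>m s * M ^\<^sub>m (k - s)" using pow_mat_add[OF M(1), of s "k - s"] by simp
      then show "complex_of_real ((a gchoose s) * (b gchoose (k - s)) * (-1) ^ k) *
         (\<Sum>l<n. (M ^\<^sub>m s) $$ (i, l) * (M ^\<^sub>m (k - s)) $$ (l, j)) =
        complex_of_real ((a gchoose s) * (b gchoose (k - s)) * (-1) ^ k) * (M ^\<^sub>m k) $$ (i, j)"
        using M ij index_mat_mat[of "M ^\<^sub>m s" n n "M ^\<^sub>m (k - s)" n i j] by simp
    qed
    also have "\<dots> = ?c (a + b) k i j"
      by (simp only: gbinomial_Vandermonde[of a b k, symmetric] atLeast0AtMost
          of_real_sum sum_distrib_right)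
    finally show "(\<Sum>l<n. \<Sum>s\<le>k. ?c a s i l * ?c b (k - s) l j) = ?c (a + b) k i j" .
  qed
  finally show "(binom_mat a M * binom_mat b M) $$ (i, j) = binom_mat (a + b) M $$ (i, j)"
    using binom_mat_sums[OF M ij] sums_unique2 by blast
qed (use M in \<open>auto simp: binom_mat_def\<close>)

lemma binom_mat_0: 
  assumes M: "M \<in> carrier_mat n n" "op_norm M < 1"
  shows "binom_mat 0 M = 1\<^sub>m n"
proof (rule eq_matI)
  fix i j assume "i < dim_row (1\<^sub>m n)" "j < dim_col (1\<^sub>m n)"
  then have ij: "i < n" "j < n" by auto
  have "(\<lambda>k. complex_of_real ((0 gchoose k) * (-1) ^ k) * (M ^\<^sub>m k) $$ (i, j)) sums
     (\<Sum>k\<in>{0}. complex_of_real ((0 gchoose k) * (-1) ^ k) * (M ^\<^sub>m k) $$ (i, j))"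
    by (intro sums_finite) (auto simp: gbinomial_0 gr0_conv_Suc)
  then show "binom_mat 0 M $$ (i, j) = 1\<^sub>m n $$ (i, j)"
    using binom_mat_sums[OF M ij, of 0] M ij sums_unique2 by fastforce
qed (use M in \<open>auto simp: binom_mat_def\<close>)

lemma binom_mat_1: 
  assumes M: "M \<in> carrier_mat n n" "op_norm M < 1"
  shows "binom_mat 1 M = 1\<^sub>m n - M"
proof (rule eq_matI)
  fix i j assume "i < dim_row (1\<^sub>m n - M)" "j < dim_col (1\<^sub>m n - M)"
  then have ij: "i < n" "j < n" using M by auto
  have "(1 gchoose k :: real) = 0" if "k > 1" for k
    using that by (metis binomial_eq_0 binomial_gbinomial of_nat_0 of_nat_1)
  then have "(\<lambda>k. complex_of_real ((1 gchoose k) * (-1) ^ k) * (M ^\<^sub>m k) $$ (i, j)) sums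
     (\<Sum>k\<in>{0,1}. complex_of_real ((1 gchoose k) * (-1) ^ k) * (M ^\<^sub>m k) $$ (i, j))"
    by (intro sums_finite) auto
  also have "(\<Sum>k\<in>{0,1}. complex_of_real ((1 gchoose k) * (-1) ^ k) * (M ^\<^sub>m k) $$ (i, j)) =
      (1\<^sub>m n - M) $$ (i, j)"
    using M ij by simp
  finally show "binom_mat 1 M $$ (i, j) = (1\<^sub>m n - M) $$ (i, j)"
    using binom_mat_sums[OF M ij, of 1] sums_unique2 by blast
qed (use M in \<open>auto simp: binom_mat_def\<close>)

lemma binom_mat_inverse:
  assumes M: "M \<in> carrier_mat n n" "op_norm M < 1"
  shows "binom_mat a M * binom_mat (- a) M = 1\<^sub>m n"
  using binom_mat_mult[OF M, of a "- a"] binom_mat_0[OF M] by simp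

lemma pow_mat_adjoint:
  assumes "M \<in> carrier_mat n n" "mat_adjoint M = (M :: complex mat)"
  shows "mat_adjoint (M ^\<^sub>m k) = M ^\<^sub>m k"
proof (induction k)
  case (Suc k)
  have "mat_adjoint (M ^\<^sub>m Suc k) = M * M ^\<^sub>m k"
    using assms Suc by (simp add: mat_adjoint_mult[of _ n n _ n])
  then show ?case using pow_mat_add[OF assms(1), of 1 k] assms by simp
qed simp

lemma binom_mat_adjoint:
  assumes M: "M \<in> carrier_mat n n" "op_norm M < 1" and h: "mat_adjoint M = M"
  shows "mat_adjoint (binom_mat a M) = binom_mat a M"
proof (rule eq_matI)
  fix i j assume "i < dim_row (binom_mat a M)" "j < dim_col (binom_mat a M)"
  then have ij: "i < n" "j < n" using M by (auto simp: binom_mat_def)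
  have "cnj ((M ^\<^sub>m k) $$ (j, i)) = (M ^\<^sub>m k) $$ (i, j)" for k
    using pow_mat_adjoint[OF M(1) h, of k] M ij index_mat_adjoint[of i "M ^\<^sub>m k" j] by simp
  then have "(\<lambda>k. complex_of_real ((a gchoose k) * (-1) ^ k) * (M ^\<^sub>m k) $$ (i, j)) sums
      cnj (binom_mat a M $$ (j, i))"
    using sums_cnj[THEN iffD2, OF binom_mat_sums[OF M ij(2,1), of a]] by simp
  then have "cnj (binom_mat a M $$ (j, i)) = binom_mat a M $$ (i, j)"
    using binom_mat_sums[OF M ij] sums_unique2 by blast
  moreover have "i < dim_col (binom_mat a M)" "j < dim_row (binom_mat a M)"
    using M ij by (auto simp: binom_mat_def)
  ultimately show "mat_adjoint (binom_mat a M) $$ (i, j) = binom_mat a M $$ (i, j)"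
    by simp
qed (use M in \<open>auto simp: binom_mat_def\<close>)

text \<open>The case of interest is \<open>M = V\<^sup>*V\<close> and \<open>M' = VV\<^sup>*\<close>.\<close>

lemma binom_mat_intertwine:
  assumes M: "M \<in> carrier_mat n n" "op_norm M < 1" and M': "M' \<in> carrier_mat m m" "op_norm M' < 1"
    and V: "V \<in> carrier_mat m n" and VM: "V * M = M' * V"
  shows "V * binom_mat a M = binom_mat a M' * V"
proof (rule eq_matI)
  fix i j assume "i < dim_row (binom_mat a M' * V)" "j < dim_col (binom_mat a M' * V)"
  then have ij: "i < m" "j < n" using M M' V by (auto simp: binom_mat_def)
  have pow: "V * M ^\<^sub>m k = M' ^\<^sub>m k * V" for k
  proof (induction k)
    case (Suc k)
    have c: "M ^\<^sub>m k \<in> carrier_mat n n" "M' ^\<^sub>m k \<in> carrier_mat m m" using M M' by simp_all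
    have "V * M ^\<^sub>m Suc k = V * M ^\<^sub>m k * M" using c M V by (simp add: assoc_mult_mat[of _ m n _ n _ n])
    also have "\<dots> = M' ^\<^sub>m k * (V * M)" using c M V Suc by (simp add: assoc_mult_mat[of _ m m _ n _ n])
    also have "\<dots> = M' ^\<^sub>m Suc k * V" using c M' V VM by (simp add: assoc_mult_mat[of _ m m _ m _ n])
    finally show ?case .
  qed (use M M' V in simp)
  let ?c = "\<lambda>k. complex_of_real ((a gchoose k) * (-1) ^ k)"
  have "(\<lambda>k. \<Sum>l<n. V $$ (i, l) * (?c k * (M ^\<^sub>m k) $$ (l, j))) sums (\<Sum>l<n. V $$ (i, l) * binom_mat a M $$ (l, j))"
    using ij by (intro sums_sum sums_mult binom_mat_sums[OF M]) auto
  also have "(\<lambda>k. \<Sum>l<n. V $$ (i, l) * (?c k * (M ^\<^sub>m k) $$ (l, j))) = (\<lambda>k. ?c k * (V * M ^\<^sub>m k) $$ (i, j))"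
    using M V ij by (subst index_mat_mat[of _ m n _ n]) (auto simp: sum_distrib_left mult_ac)
  finally have 1: "(\<lambda>k. ?c k * (V * M ^\<^sub>m k) $$ (i, j)) sums (V * binom_mat a M) $$ (i, j)"
    using M V ij by (subst index_mat_mat[of _ m n _ n]) auto
  have "(\<lambda>k. \<Sum>l<m. (?c k * (M' ^\<^sub>m k) $$ (i, l)) * V $$ (l, j)) sums (\<Sum>l<m. binom_mat a M' $$ (i, l) * V $$ (l, j))"
    using ij by (intro sums_sum sums_mult2 binom_mat_sums[OF M']) auto
  also have "(\<lambda>k. \<Sum>l<m. (?c k * (M' ^\<^sub>m k) $$ (i, l)) * V $$ (l, j)) = (\<lambda>k. ?c k * (M' ^\<^sub>m k * V) $$ (i, j))"
    using M' V ij by (subst index_mat_mat[of _ m m _ n]) (auto simp: sum_distrib_left mult_ac)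
  finally have 2: "(\<lambda>k. ?c k * (M' ^\<^sub>m k * V) $$ (i, j)) sums (binom_mat a M' * V) $$ (i, j)"
    using M' V ij by (subst index_mat_mat[of _ m m _ n]) auto
  show "(V * binom_mat a M) $$ (i, j) = (binom_mat a M' * V) $$ (i, j)"
    using 1 2 unfolding pow by (rule sums_unique2)
qed (use M M' V in \<open>auto simp: binom_mat_def\<close>)

lemma binom_mat_kron:
  assumes M: "M \<in> carrier_mat n n" "op_norm M < 1"
  shows "binom_mat a (kron M (1\<^sub>m N)) = kron (binom_mat a M) (1\<^sub>m N)"
proof (rule eq_block_matI[of _ n N n N])
  fix i j p q assume i: "i < n" "j < n" "p < N" "q < N"
  have K: "kron M (1\<^sub>m N) \<in> carrier_mat (n * N) (n * N)" "op_norm (kron M (1\<^sub>m N)) < 1"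
    using M op_norm_kron_one_le[OF M(1), of N] by auto
  have pow: "kron M (1\<^sub>m N) ^\<^sub>m k = kron (M ^\<^sub>m k) (1\<^sub>m N)" for k
  proof (induction k)
    case (Suc k)
    then show ?case using M by (simp add: kron_mult[of _ n n _ N N _ n _ N])
  qed (use M in simp)
  let ?c = "\<lambda>k. complex_of_real ((a gchoose k) * (-1) ^ k)"
  have "(\<lambda>k. ?c k * kron (M ^\<^sub>m k) (1\<^sub>m N) $$ (i * N + p, j * N + q)) sums
      binom_mat a (kron M (1\<^sub>m N)) $$ (i * N + p, j * N + q)"
    using binom_mat_sums[OF K, of "i * N + p" "j * N + q" a] i by (simp add: pow block_index_less)
  moreover have "(\<lambda>k. ?c k * kron (M ^\<^sub>m k) (1\<^sub>m N) $$ (i * N + p, j * N + q)) sums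
      kron (binom_mat a M) (1\<^sub>m N) $$ (i * N + p, j * N + q)"
    using sums_mult2[OF binom_mat_sums[OF M i(1,2), of a], of "1\<^sub>m N $$ (p, q)"] i M
    by (simp add: index_kron[of _ n n _ N N] mult.assoc)
  ultimately show "binom_mat a (kron M (1\<^sub>m N)) $$ (i * N + p, j * N + q) =
      kron (binom_mat a M) (1\<^sub>m N) $$ (i * N + p, j * N + q)"
    by (rule sums_unique2)
qed (use M in auto)

section \<open>The positive square root\<close>

lemma mult_mat_zero_vec: "A \<in> carrier_mat m n \<Longrightarrow> A *\<^sub>v 0\<^sub>v n = (0\<^sub>v m :: complex Matrix.vec)"
  by (intro eq_vecI) auto

lemma psd_adjoint_mult:
  assumes "E \<in> carrier_mat n n"
  shows "psd n (mat_adjoint E * E)"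
  unfolding psd_def
proof (intro conjI ballI)
  show "mat_adjoint E * E \<in> carrier_mat n n"
    by (rule mult_carrier_mat[OF mat_adjoint_carrier[OF assms] assms])
  show "mat_adjoint (mat_adjoint E * E) = mat_adjoint E * E"
    using assms by (simp add: mat_adjoint_mult[of _ n n _ n])
  fix x :: "complex Matrix.vec" assume x: "x \<in> carrier_vec n"
  have "(mat_adjoint E * E *\<^sub>v x) \<bullet>c x = (mat_adjoint E *\<^sub>v (E *\<^sub>v x)) \<bullet>c x"
    using assms x by (simp add: assoc_mult_mat_vec[of _ n n _ n])
  also have "\<dots> = (E *\<^sub>v x) \<bullet>c (mat_adjoint (mat_adjoint E) *\<^sub>v x)"
    using assms x by (intro cscalar_prod_adjoint) auto
  finally show "0 \<le> (mat_adjoint E * E *\<^sub>v x) \<bullet>c x" 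
    by (simp only: mat_adjoint_adjoint cscalar_prod_self)
      (simp add: less_eq_complex_def)
qed

text \<open>If \<open>B\<^sup>2 = C\<^sup>2\<close> with \<open>B\<close> positive semidefinite and \<open>C = E\<^sup>*E\<close> positive definite, then
  \<open>H = B - C\<close> satisfies \<open>BH + HC = 0\<close>; the traces of \<open>HBH\<close> and \<open>HCH\<close> are nonnegative with
  sum zero, so \<open>EH = 0\<close>.\<close>

lemma psd_sqrt_unique:
  assumes B: "psd n B" and E: "E \<in> carrier_mat n n" and F: "F \<in> carrier_mat n n" "F * E = 1\<^sub>m n"
    and BC: "B * B = (mat_adjoint E * E) * (mat_adjoint E * E)"
  shows "B = mat_adjoint E * E"
proof -
  define C where "C = mat_adjoint E * E"
  define H where "H = B - C"
  have c: "B \<in> carrier_mat n n" "C \<in> carrier_mat n n" "H \<in> carrier_mat n n"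
    using B E by (auto simp: psd_def C_def H_def)
  have psdC: "psd n C" unfolding C_def by (rule psd_adjoint_mult[OF E])
  have Hadj: "mat_adjoint H = H" 
    using B psdC c unfolding H_def by (subst mat_adjoint_minus[of _ n n]) (auto simp: psd_def)
  have "B * H + H * C = (B * B - B * C) + (B * C - C * C)"
    using c by (simp add: H_def mult_minus_distrib_mat[of _ n n _ n] minus_mult_distrib_mat[of _ n n _ _ n])
  also have "\<dots> = B * B - C * C"
    using c by (intro eq_matI) auto
  also have "\<dots> = 0\<^sub>m n n" using c BC by (auto simp: C_def)
  finally have BH: "B * H + H * C = 0\<^sub>m n n" .
  have HBH: "H * (B * H) + H * (H * C) = 0\<^sub>m n n"
    using arg_cong[OF BH, of "\<lambda>X. H * X"] c by (simp add: mult_add_distrib_mat[of _ n n _ n])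
  let ?e = "\<lambda>i. col H i"
  have entry: "(H * (X * H)) $$ (i, i) = (X *\<^sub>v ?e i) \<bullet>c ?e i" if "X \<in> carrier_mat n n" "i < n" for X i
  proof -
    have "H $$ (i, l) = cnj (H $$ (l, i))" if "l < n" for l
      using Hadj index_mat_adjoint[of i H l] c that \<open>i < n\<close> by simp
    moreover have "vec_index (X *\<^sub>v ?e i) l = (X * H) $$ (l, i)" if "l < n" for l
      using c that \<open>i < n\<close> \<open>X \<in> carrier_mat n n\<close> by simp
    ultimately show ?thesis
      using c that by (subst cscalar_prod_sum[of _ n], force, force, subst index_mat_mat[of _ n n _ n])
        (auto intro!: sum.cong simp: mult.commute simp del: index_mult_mat_vec)
  qed
  have tr: "(\<Sum>i<n. (H * (H * C)) $$ (i, i)) = (\<Sum>i<n. (H * (C * H)) $$ (i, i))"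
  proof -
    have "(\<Sum>i<n. (H * (H * C)) $$ (i, i)) = (\<Sum>i<n. \<Sum>l<n. (H * C) $$ (l, i) * H $$ (i, l))"
      using c by (intro sum.cong refl) (subst index_mat_mat[of _ n n _ n], auto simp: mult.commute)
    also have "\<dots> = (\<Sum>l<n. ((H * C) * H) $$ (l, l))"
      using c by (subst sum.swap, intro sum.cong refl) (subst index_mat_mat[of _ n n _ n], auto)
    finally show ?thesis using c by (simp add: assoc_mult_mat[of _ n n _ n _ n])
  qed
  have nn: "0 \<le> (X *\<^sub>v ?e i) \<bullet>c ?e i" if "psd n X" for X i
    using that c by (auto simp: psd_def)
  have "(\<Sum>i<n. (B *\<^sub>v ?e i) \<bullet>c ?e i) + (\<Sum>i<n. (C *\<^sub>v ?e i) \<bullet>c ?e i) =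
     (\<Sum>i<n. (H * (B * H)) $$ (i, i)) + (\<Sum>i<n. (H * (H * C)) $$ (i, i))"
    unfolding tr using c by (simp add: entry del: index_mult_mat)
  also have "\<dots> = (\<Sum>i<n. (H * (B * H) + H * (H * C)) $$ (i, i))"
    using c by (simp add: sum.distrib)
  also have "\<dots> = 0" unfolding HBH by simp
  finally have "(\<Sum>i<n. (C *\<^sub>v ?e i) \<bullet>c ?e i) = 0"
    using sum_nonneg[of "{..<n}" "\<lambda>i. (B *\<^sub>v ?e i) \<bullet>c ?e i"]
      sum_nonneg[of "{..<n}" "\<lambda>i. (C *\<^sub>v ?e i) \<bullet>c ?e i"] nn[OF B] nn[OF psdC]
    by (simp add: add_nonneg_eq_0_iff)
  then have Ci: "(C *\<^sub>v ?e i) \<bullet>c ?e i = 0" if "i < n" for i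
    using sum_nonneg_eq_0_iff[of "{..<n}" "\<lambda>i. (C *\<^sub>v ?e i) \<bullet>c ?e i"] nn[OF psdC] that by simp
  have "?e i = 0\<^sub>v n" if i: "i < n" for i
  proof -
    have e: "?e i \<in> carrier_vec n" using c by (auto intro: carrier_vecI)
    have "(C *\<^sub>v ?e i) \<bullet>c ?e i = (mat_adjoint E *\<^sub>v (E *\<^sub>v ?e i)) \<bullet>c ?e i"
      using E e unfolding C_def by (simp add: assoc_mult_mat_vec[of _ n n _ n])
    also have "\<dots> = (E *\<^sub>v ?e i) \<bullet>c (mat_adjoint (mat_adjoint E) *\<^sub>v ?e i)"
      using E e by (intro cscalar_prod_adjoint) auto
    finally have "vnorm (E *\<^sub>v ?e i) = 0"
      using Ci[OF i] by (simp add: cscalar_prod_self)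
    then have "E *\<^sub>v ?e i = 0\<^sub>v n" using E e vnorm_eq_0[of "E *\<^sub>v ?e i" n] by simp
    then have "F *\<^sub>v (E *\<^sub>v ?e i) = 0\<^sub>v n" using F by (simp add: mult_mat_zero_vec)
    moreover have "F *\<^sub>v (E *\<^sub>v ?e i) = ?e i"
      using F E e by (simp add: assoc_mult_mat_vec[of _ n n _ n, symmetric])
    ultimately show ?thesis by simp
  qed
  then have "H $$ (l, i) = 0" if "i < n" "l < n" for i l
    using that c by (metis carrier_matD index_col index_zero_vec(1))
  then have "B $$ (l, i) = C $$ (l, i)" if "i < n" "l < n" for i l
    using that c by (simp add: H_def)
  then show ?thesis using c unfolding C_def[symmetric] by (intro eq_matI) auto
qed

lemma psd_sqrt_binom:
  assumes M: "M \<in> carrier_mat n n" "op_norm M < 1" "mat_adjoint M = M"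
  shows "psd_sqrt (1\<^sub>m n - M) = binom_mat (1 / 2) M"
proof -
  \<comment> \<open>A fourth root of \<open>1 - M\<close> factors the square root as \<open>E\<^sup>*E\<close> with \<open>E\<close> invertible.\<close>
  define E where "E = binom_mat (1 / 4) M"
  have E: "E \<in> carrier_mat n n" "mat_adjoint E = E"
    using M binom_mat_adjoint[OF M] by (auto simp: E_def)
  have EE: "E * E = binom_mat (1 / 2) M" unfolding E_def by (subst binom_mat_mult[OF M(1,2)]) simp
  have sq: "binom_mat (1 / 2) M * binom_mat (1 / 2) M = 1\<^sub>m n - M"
    by (subst binom_mat_mult[OF M(1,2)]) (simp add: binom_mat_1[OF M(1,2)])
  have F: "binom_mat (- 1 / 4) M * E = 1\<^sub>m n" 
    using binom_mat_inverse[OF M(1,2), of "- 1 / 4"] by (simp add: E_def)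
  have d: "dim_row (1\<^sub>m n - M) = n" using M by simp
  show ?thesis unfolding psd_sqrt_def d
  proof (rule the_equality)
    show "psd n (binom_mat (1 / 2) M) \<and> binom_mat (1 / 2) M * binom_mat (1 / 2) M = 1\<^sub>m n - M"
      using psd_adjoint_mult[OF E(1)] E EE sq by simp
    fix B assume B: "psd n B \<and> B * B = 1\<^sub>m n - M"
    show "B = binom_mat (1 / 2) M"
      using psd_sqrt_unique[of n B E "binom_mat (- 1 / 4) M"] B E F EE sq M by simp
  qed
qed

section \<open>Inverse matrices\<close>

text \<open>Forms of the ring laws whose side conditions are equations between dimensions.\<close>

lemma mat_assoc: "dim_col A = dim_row B \<Longrightarrow> dim_col B = dim_row C \<Longrightarrow> (A * B) * C = A * (B * C)"
  for A B C :: "complex mat"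
  by (rule assoc_mult_mat[of A "dim_row A" "dim_col A" B "dim_col B" C "dim_col C"]) auto

lemma mat_vec_assoc: "dim_col A = dim_row B \<Longrightarrow> dim_col B = dim_vec x \<Longrightarrow> (A * B) *\<^sub>v x = A *\<^sub>v (B *\<^sub>v x)"
  for A B :: "complex mat"
  by (rule assoc_mult_mat_vec[of A "dim_row A" "dim_col A" B "dim_col B"]) (auto intro: carrier_vecI)

lemma mat_minus_mult: "dim_row A = dim_row B \<Longrightarrow> dim_col A = dim_col B \<Longrightarrow> dim_col B = dim_row C \<Longrightarrow>
    (A - B) * C = A * C - B * C"
  for A B C :: "complex mat"
  by (rule minus_mult_distrib_mat[of A "dim_row A" "dim_col A" B C "dim_col C"]) auto

lemma mat_mult_minus: "dim_row B = dim_row C \<Longrightarrow> dim_col B = dim_col C \<Longrightarrow> dim_col A = dim_row B \<Longrightarrow>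
    A * (B - C) = A * B - A * C"
  for A B C :: "complex mat"
  by (rule mult_minus_distrib_mat[of A "dim_row A" "dim_col A" B "dim_col B" C]) auto

lemma mat_minus_mult_vec: "dim_row A = dim_row B \<Longrightarrow> dim_col A = dim_col B \<Longrightarrow> dim_col B = dim_vec x \<Longrightarrow>
    (A - B) *\<^sub>v x = A *\<^sub>v x - B *\<^sub>v x"
  for A B :: "complex mat"
  by (rule minus_mult_distrib_mat_vec[of A "dim_row A" "dim_col A" B]) (auto intro: carrier_vecI)

lemma mat_one_mult: "dim_row A = n \<Longrightarrow> 1\<^sub>m n * A = A" "dim_col A = n \<Longrightarrow> A * 1\<^sub>m n = A"
  "dim_vec x = n \<Longrightarrow> 1\<^sub>m n *\<^sub>v x = x"
  for A :: "complex mat" and x :: "complex Matrix.vec"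
  using left_mult_one_mat[of A n "dim_col A"] right_mult_one_mat[of A "dim_row A" n]
    one_mult_mat_vec[of x n] by (auto intro: carrier_vecI)

lemmas mat_ring = mat_assoc mat_vec_assoc mat_minus_mult mat_mult_minus mat_minus_mult_vec mat_one_mult

text \<open>Matrices that compose to the identity also cancel in front of a further factor.\<close>

lemma mat_cancel:
  fixes A B X :: "complex mat" and x :: "complex Matrix.vec"
  assumes "A * B = 1\<^sub>m n" "dim_col A = dim_row B" "dim_col B = n"
  shows "dim_row X = n \<Longrightarrow> A * (B * X) = X" "dim_vec x = n \<Longrightarrow> A *\<^sub>v (B *\<^sub>v x) = x"
  using assms mat_assoc[of A B X] mat_vec_assoc[of A B x] mat_one_mult by simp_all

lemma mat_inverse_of_injective:
  fixes M :: "complex mat"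
  assumes M: "M \<in> carrier_mat n n"
    and inj: "\<And>y. y \<in> carrier_vec n \<Longrightarrow> M *\<^sub>v y = 0\<^sub>v n \<Longrightarrow> y = 0\<^sub>v n"
  shows "Determinant.det M \<noteq> 0" and "the (mat_inverse M) \<in> carrier_mat n n"
    and "M * the (mat_inverse M) = 1\<^sub>m n" and "the (mat_inverse M) * M = 1\<^sub>m n"
proof -
  show d: "Determinant.det M \<noteq> 0"
    using det_0_iff_vec_prod_zero_field[OF M] inj by blast
  then have "mat_inverse M \<noteq> None"
    using mat_inverse(1)[OF M, of undefined] det_non_zero_imp_unit[OF M d, of undefined] by metis
  then obtain R where R: "mat_inverse M = Some R" by blast
  show "the (mat_inverse M) \<in> carrier_mat n n" "M * the (mat_inverse M) = 1\<^sub>m n"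
    "the (mat_inverse M) * M = 1\<^sub>m n"
    using mat_inverse(2)[OF M R] R by auto
qed

section \<open>Automorphisms of the ball of matrices\<close>

lemma vnorm_add_power2:
  assumes "a \<in> carrier_vec n" "b \<in> carrier_vec n"
  shows "(vnorm (a + b))\<^sup>2 = (vnorm a)\<^sup>2 + (vnorm b)\<^sup>2 + 2 * Re (a \<bullet>c b)"
proof -
  have *: "(cmod (z + w))\<^sup>2 = (cmod z)\<^sup>2 + (cmod w)\<^sup>2 + 2 * Re (z * cnj w)" for z w
    by (simp only: cmod_power2) (simp add: power2_eq_square algebra_simps)
  show ?thesis using assms
    by (simp add: cscalar_prod_sum[OF assms] vnorm_power2 sum.distrib sum_distrib_left *)
qed

lemma vnorm_diff_power2:
  assumes "a \<in> carrier_vec n" "b \<in> carrier_vec n"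
  shows "(vnorm (a - b))\<^sup>2 = (vnorm a)\<^sup>2 + (vnorm b)\<^sup>2 - 2 * Re (a \<bullet>c b)"
proof -
  have *: "(cmod (z - w))\<^sup>2 = (cmod z)\<^sup>2 + (cmod w)\<^sup>2 - 2 * Re (z * cnj w)" for z w
    by (simp only: cmod_power2) (simp add: power2_eq_square algebra_simps)
  show ?thesis using assms
    by (simp add: cscalar_prod_sum[OF assms] vnorm_power2 sum.distrib sum_subtractf sum_distrib_left *)
qed

lemma cscalar_prod_diff_add:
  fixes z t :: "complex Matrix.vec"
  assumes z: "z \<in> carrier_vec n" and t: "t \<in> carrier_vec n"
  shows "z \<bullet>c (z - t) + z \<bullet>c t = z \<bullet>c z"
proof -
  have "z \<bullet>c (z - t) = (\<Sum>i<n. vec_index z i * cnj (vec_index z i - vec_index t i))"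
    using z t by (subst cscalar_prod_sum[OF z minus_carrier_vec[OF z t]]) (auto intro!: sum.cong)
  then show ?thesis
    by (simp add: cscalar_prod_sum[OF z t] cscalar_prod_sum[OF z z] sum.distrib[symmetric] ring_distribs)
qed

text \<open>A strict contraction \<open>V\<close> with its defect operators \<open>D = (1 - V\<^sup>*V)\<^sup>1\<^sup>/\<^sup>2\<close> and
  \<open>D' = (1 - VV\<^sup>*)\<^sup>1\<^sup>/\<^sup>2\<close> and their inverses.\<close>

locale strict_contraction =
  fixes V :: "complex mat" and p q :: nat
  assumes V [simp]: "V \<in> carrier_mat p q" and V_lt: "op_norm V < 1"
begin

abbreviation "Vs \<equiv> mat_adjoint V"
definition "D = binom_mat (1 / 2) (Vs * V)"
definition "D' = binom_mat (1 / 2) (V * Vs)"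
definition "Di = binom_mat (- 1 / 2) (Vs * V)"
definition "Di' = binom_mat (- 1 / 2) (V * Vs)"

lemma VsV [simp]: "Vs * V \<in> carrier_mat q q" "V * Vs \<in> carrier_mat p p" "Vs \<in> carrier_mat q p"
  using mult_carrier_mat[OF mat_adjoint_carrier[OF V] V] mult_carrier_mat[OF V mat_adjoint_carrier[OF V]]
  by auto

lemma dim_V [simp]: "dim_row V = p" "dim_col V = q" by (rule carrier_matD[OF V])+

lemma norm_lt: "op_norm (Vs * V) < 1" "op_norm (V * Vs) < 1"
proof -
  have "op_norm V * op_norm V < 1"
    using V_lt op_norm_nonneg[of V] by (metis mult_less_cancel_left2 mult_strict_mono less_le
        mult_eq_0_iff zero_less_one linorder_not_le mult.right_neutral)
  then show "op_norm (Vs * V) < 1" "op_norm (V * Vs) < 1"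
    using op_norm_mult[of Vs q p V q] op_norm_mult[of V p q Vs p] by (auto simp: op_norm_adjoint)
qed

lemma selfadjoint: "mat_adjoint (Vs * V) = Vs * V" "mat_adjoint (V * Vs) = V * Vs"
  by (simp_all add: mat_adjoint_mult[of _ q p _ q] mat_adjoint_mult[of _ p q _ p])

lemma carrier [simp]: "D \<in> carrier_mat q q" "Di \<in> carrier_mat q q"
  "D' \<in> carrier_mat p p" "Di' \<in> carrier_mat p p"
  by (simp_all add: D_def D'_def Di_def Di'_def)

lemma dims [simp]: "dim_row D = q" "dim_col D = q" "dim_row Di = q" "dim_col Di = q"
    "dim_row D' = p" "dim_col D' = p" "dim_row Di' = p" "dim_col Di' = p"
  by (rule carrier[THEN carrier_matD(1)] carrier[THEN carrier_matD(2)])+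

lemma D_square: "D * D = 1\<^sub>m q - Vs * V" "D' * D' = 1\<^sub>m p - V * Vs"
  using binom_mat_mult[OF VsV(1) norm_lt(1), of "1 / 2" "1 / 2"] binom_mat_1[OF VsV(1) norm_lt(1)]
    binom_mat_mult[OF VsV(2) norm_lt(2), of "1 / 2" "1 / 2"] binom_mat_1[OF VsV(2) norm_lt(2)]
  by (simp_all add: D_def D'_def)

lemma D_inverse: "D * Di = 1\<^sub>m q" "Di * D = 1\<^sub>m q" "D' * Di' = 1\<^sub>m p" "Di' * D' = 1\<^sub>m p"
  using binom_mat_inverse[OF VsV(1) norm_lt(1), of "1 / 2"]
    binom_mat_inverse[OF VsV(1) norm_lt(1), of "- 1 / 2"]
    binom_mat_inverse[OF VsV(2) norm_lt(2), of "1 / 2"]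
    binom_mat_inverse[OF VsV(2) norm_lt(2), of "- 1 / 2"]
  by (simp_all add: D_def D'_def Di_def Di'_def)

lemma D_adjoint: "mat_adjoint D = D" "mat_adjoint D' = D'"
  using binom_mat_adjoint[OF VsV(1) norm_lt(1) selfadjoint(1)]
    binom_mat_adjoint[OF VsV(2) norm_lt(2) selfadjoint(2)]
  by (simp_all add: D_def D'_def)

lemma D_intertwine: "V * D = D' * V" "V * Di = Di' * V" "Vs * D' = D * Vs" "Vs * Di' = Di * Vs"
proof -
  have a: "V * (Vs * V) = (V * Vs) * V" "Vs * (V * Vs) = (Vs * V) * Vs"
    by (simp_all add: assoc_mult_mat[of _ p q _ p _ q] assoc_mult_mat[of _ q p _ q _ p])
  show "V * D = D' * V" "V * Di = Di' * V" "Vs * D' = D * Vs" "Vs * Di' = Di * Vs"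
    unfolding D_def D'_def Di_def Di'_def
    using binom_mat_intertwine[OF VsV(1) norm_lt(1) VsV(2) norm_lt(2) V a(1)]
      binom_mat_intertwine[OF VsV(2) norm_lt(2) VsV(1) norm_lt(1) VsV(3) a(2)] by simp_all
qed

lemmas D_cancel = D_inverse D_inverse[THEN mat_cancel(1), simplified] D_inverse[THEN mat_cancel(2), simplified]

text \<open>The matrix \<open>[V, -D'; D, V\<^sup>*]\<close> is isometric.\<close>

lemma julia_isometric:
  assumes x: "x \<in> carrier_vec q" and s: "s \<in> carrier_vec p"
  shows "(vnorm (V *\<^sub>v x - D' *\<^sub>v s))\<^sup>2 + (vnorm (D *\<^sub>v x + Vs *\<^sub>v s))\<^sup>2 = (vnorm x)\<^sup>2 + (vnorm s)\<^sup>2"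
proof -
  have c: "V *\<^sub>v x \<in> carrier_vec p" "D' *\<^sub>v s \<in> carrier_vec p" "D *\<^sub>v x \<in> carrier_vec q"
    "Vs *\<^sub>v s \<in> carrier_vec q"
    using mult_mat_vec_carrier[OF V x] mult_mat_vec_carrier[OF carrier(3) s]
      mult_mat_vec_carrier[OF carrier(1) x] mult_mat_vec_carrier[OF VsV(3) s] by auto
  have defect: "(vnorm (A *\<^sub>v z))\<^sup>2 + (vnorm (B *\<^sub>v z))\<^sup>2 = (vnorm z)\<^sup>2"
    if A: "A \<in> carrier_mat m n" and B: "B \<in> carrier_mat n n" "mat_adjoint B = B" 
      "B * B = 1\<^sub>m n - mat_adjoint A * A" and z: "z \<in> carrier_vec n" for A B m n z
  proof -
    have As: "mat_adjoint A \<in> carrier_mat n m" using A by simp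
    have AA: "mat_adjoint A * A \<in> carrier_mat n n" by (rule mult_carrier_mat[OF As A])
    have z1: "(mat_adjoint A * A) *\<^sub>v z = mat_adjoint A *\<^sub>v (A *\<^sub>v z)" by (rule assoc_mult_mat_vec[OF As A z])
    have "complex_of_real ((vnorm (B *\<^sub>v z))\<^sup>2) = z \<bullet>c (B *\<^sub>v (B *\<^sub>v z))"
      using cscalar_prod_adjoint[OF B(1) z mult_mat_vec_carrier[OF B(1) z]] B(2)
      by (simp add: cscalar_prod_self)
    also have "B *\<^sub>v (B *\<^sub>v z) = (1\<^sub>m n - mat_adjoint A * A) *\<^sub>v z"
      using assoc_mult_mat_vec[OF B(1) B(1) z] unfolding B(3) by (rule sym)
    also have "\<dots> = z - (mat_adjoint A * A) *\<^sub>v z"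
      using AA z by (simp add: minus_mult_distrib_mat_vec[of _ n n])
    finally have 1: "complex_of_real ((vnorm (B *\<^sub>v z))\<^sup>2) = z \<bullet>c (z - (mat_adjoint A * A) *\<^sub>v z)" .
    have 2: "complex_of_real ((vnorm (A *\<^sub>v z))\<^sup>2) = z \<bullet>c ((mat_adjoint A * A) *\<^sub>v z)"
      using cscalar_prod_adjoint[OF A z mult_mat_vec_carrier[OF A z]] z1
      by (simp add: cscalar_prod_self)
    have "z \<bullet>c (z - (mat_adjoint A * A) *\<^sub>v z) + z \<bullet>c ((mat_adjoint A * A) *\<^sub>v z) = z \<bullet>c z"
      by (rule cscalar_prod_diff_add[OF z mult_mat_vec_carrier[OF AA z]])
    then have "complex_of_real ((vnorm (B *\<^sub>v z))\<^sup>2 + (vnorm (A *\<^sub>v z))\<^sup>2) = of_real ((vnorm z)\<^sup>2)"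
      using 1 2 by (simp add: cscalar_prod_self)
    then show ?thesis unfolding of_real_eq_iff by simp
  qed
  have "(V *\<^sub>v x) \<bullet>c (D' *\<^sub>v s) = x \<bullet>c (Vs *\<^sub>v (D' *\<^sub>v s))"
    by (rule cscalar_prod_adjoint[OF V x c(2)])
  also have "Vs *\<^sub>v (D' *\<^sub>v s) = D *\<^sub>v (Vs *\<^sub>v s)"
    using D_intertwine(3) s assoc_mult_mat_vec[OF VsV(3) carrier(3) s]
      assoc_mult_mat_vec[OF carrier(1) VsV(3) s] by simp
  also have "x \<bullet>c (D *\<^sub>v (Vs *\<^sub>v s)) = (D *\<^sub>v x) \<bullet>c (Vs *\<^sub>v s)"
    using cscalar_prod_adjoint[OF carrier(1) x c(4)] D_adjoint by simp
  finally have cross: "(V *\<^sub>v x) \<bullet>c (D' *\<^sub>v s) = (D *\<^sub>v x) \<bullet>c (Vs *\<^sub>v s)" .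
  have "(vnorm (V *\<^sub>v x))\<^sup>2 + (vnorm (D *\<^sub>v x))\<^sup>2 = (vnorm x)\<^sup>2"
    using D_adjoint D_square x by (intro defect[of V p q]) auto
  moreover have "(vnorm (Vs *\<^sub>v s))\<^sup>2 + (vnorm (D' *\<^sub>v s))\<^sup>2 = (vnorm s)\<^sup>2"
    using D_adjoint D_square s by (intro defect[of Vs q p]) auto
  ultimately show ?thesis
    by (simp add: vnorm_diff_power2[OF c(1,2)] vnorm_add_power2[OF c(3,4)] cross)
qed

text \<open>The resolvent of \<open>V\<^sup>*u\<close>, and the automorphism \<open>\<F>\<^sub>V\<close> with its square roots written as binomial
  series; see \<open>ball_auto_eq\<close>.\<close>

definition "R u = the (mat_inverse (1\<^sub>m q - Vs * u))"
definition "W u = V - D' * u * R u * D"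

context
  fixes u :: "complex mat"
  assumes u: "u \<in> carrier_mat p q" and u_le: "op_norm u \<le> 1"
begin

lemma dim_u: "dim_row u = p" "dim_col u = q" using u by auto

lemma Vsu: "Vs * u \<in> carrier_mat q q" "1\<^sub>m q - Vs * u \<in> carrier_mat q q"
  using dim_u by (auto intro!: carrier_matI)

lemma resolvent_injective:
  assumes y: "y \<in> carrier_vec q" "(1\<^sub>m q - Vs * u) *\<^sub>v y = 0\<^sub>v q"
  shows "y = 0\<^sub>v q"
proof -
  have c: "(Vs * u) *\<^sub>v y \<in> carrier_vec q" by (rule mult_mat_vec_carrier[OF Vsu(1) y(1)])
  have "0\<^sub>v q = y - (Vs * u) *\<^sub>v y"
    unfolding y(2)[symmetric] using y(1) dim_u by (simp add: mat_ring)
  then have "vec_index (y - (Vs * u) *\<^sub>v y) i = 0" if "i < q" for i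
    using that by (metis index_zero_vec(1))
  then have yy: "vec_index y i = vec_index ((Vs * u) *\<^sub>v y) i" if "i < q" for i
    using c that by (auto simp del: index_mult_mat_vec)
  have "y = (Vs * u) *\<^sub>v y" using y(1) c yy by (intro eq_vecI) auto
  then have "vnorm y \<le> op_norm (Vs * u) * vnorm y" using vnorm_mult_le[OF Vsu(1) y(1)] by simp
  also have "\<dots> \<le> op_norm V * vnorm y"
  proof (rule mult_right_mono)
    have "op_norm (Vs * u) \<le> op_norm V * op_norm u"
      using op_norm_mult[OF VsV(3) u] by (simp add: op_norm_adjoint)
    also have "\<dots> \<le> op_norm V" using u_le op_norm_nonneg[of V] by (simp add: mult_left_le)
    finally show "op_norm (Vs * u) \<le> op_norm V" .
  qed simp
  finally have "vnorm y = 0"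
    using V_lt by (metis mult_le_cancel_right1 vnorm_nonneg not_less order_le_imp_less_or_eq)
  then show ?thesis using y vnorm_eq_0 by blast
qed

lemma det_resolvent: "Determinant.det (1\<^sub>m q - Vs * u) \<noteq> 0"
  using mat_inverse_of_injective(1)[OF Vsu(2)] resolvent_injective by blast

lemma R_carrier [simp]: "R u \<in> carrier_mat q q"
  and R_inverse: "(1\<^sub>m q - Vs * u) * R u = 1\<^sub>m q" "R u * (1\<^sub>m q - Vs * u) = 1\<^sub>m q"
  using mat_inverse_of_injective(2-4)[OF Vsu(2)] resolvent_injective unfolding R_def by blast+

lemma dim_R [simp]: "dim_row (R u) = q" "dim_col (R u) = q"
  by (rule carrier_matD[OF R_carrier])+

lemma W_carrier [simp]: "W u \<in> carrier_mat p q"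
  unfolding W_def by (auto intro!: carrier_matI)

lemma V_resolvent: "V * (1\<^sub>m q - Vs * u) = V - V * (Vs * u)" "D' * (D' * u) = u - V * (Vs * u)"
proof -
  show "V * (1\<^sub>m q - Vs * u) = V - V * (Vs * u)" using dim_u by (simp add: mat_ring)
  have "D' * (D' * u) = (D' * D') * u" using dim_u by (simp add: mat_ring)
  then show "D' * (D' * u) = u - V * (Vs * u)" unfolding D_square using dim_u by (simp add: mat_ring)
qed

text \<open>An equation between polynomials in \<open>u\<close> and \<open>W u\<close> that determines \<open>W u\<close>; it survives passage to
  limits and to power series.\<close>

lemma W_mult: "W u * (Di * (1\<^sub>m q - Vs * u)) = Di' * (V - u)"
proof -
  define B where "B = 1\<^sub>m q - Vs * u"
  have B: "dim_row B = q" "dim_col B = q" "R u * B = 1\<^sub>m q" using dim_u R_inverse by (auto simp: B_def)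
  have "V * (Di * B) = V * Di * B" using B by (simp add: mat_ring)
  then have 1: "V * (Di * B) = Di' * (V * B)" using B by (simp add: D_intertwine mat_ring)
  have "W u * (Di * B) = V * (Di * B) - D' * u"
    unfolding W_def using B dim_u by (simp add: mat_ring D_cancel)
  also have "D' * u = Di' * (D' * (D' * u))" using dim_u by (simp add: D_cancel)
  finally have "W u * (Di * B) = Di' * (V - V * (Vs * u)) - Di' * (u - V * (Vs * u))"
    unfolding 1 V_resolvent(2) unfolding B_def V_resolvent(1) .
  also have "\<dots> = Di' * ((V - V * (Vs * u)) - (u - V * (Vs * u)))"
    using dim_u by (intro mat_mult_minus[symmetric]) auto
  also have "(V - V * (Vs * u)) - (u - V * (Vs * u)) = V - u"
    using dim_u by (intro eq_matI) auto
  finally show ?thesis unfolding B_def .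
qed

lemma W_unique:
  assumes S: "S \<in> carrier_mat p q" and eq: "S * (Di * (1\<^sub>m q - Vs * u)) = Di' * (V - u)"
  shows "S = W u"
proof -
  define B where "B = 1\<^sub>m q - Vs * u"
  have B: "dim_row B = q" "dim_col B = q" "B * R u = 1\<^sub>m q" using dim_u R_inverse by (auto simp: B_def)
  have BR: "B * (R u * X) = X" if "dim_row X = q" for X
    using B that by (intro mat_cancel(1)) auto
  have cancel: "T * (Di * B) * (R u * D) = T" if "T \<in> carrier_mat p q" for T
    using that B by (simp add: mat_ring BR D_cancel)
  show ?thesis using cancel[OF S] cancel[OF W_carrier] eq W_mult by (simp add: B_def)
qed

text \<open>The defect identity: the Julia matrix maps the pair of \<open>x\<close> and \<open>u y\<close> to the pair of \<open>W u x\<close> and \<open>y\<close>.\<close>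

lemma W_norm:
  assumes y: "y \<in> carrier_vec q" and x: "x = Di *\<^sub>v ((1\<^sub>m q - Vs * u) *\<^sub>v y)"
  shows "(vnorm x)\<^sup>2 - (vnorm (W u *\<^sub>v x))\<^sup>2 = (vnorm y)\<^sup>2 - (vnorm (u *\<^sub>v y))\<^sup>2"
proof -
  define B where "B = 1\<^sub>m q - Vs * u"
  have B: "dim_row B = q" "dim_col B = q" "R u * B = 1\<^sub>m q" using dim_u R_inverse by (auto simp: B_def)
  have dy: "dim_vec y = q" using y by simp
  have dx: "dim_vec x = q" by (simp add: x)
  have Dx: "D *\<^sub>v x = B *\<^sub>v y"
    unfolding x B_def[symmetric] using B by (simp add: D_cancel)
  have "D *\<^sub>v x + Vs *\<^sub>v (u *\<^sub>v y) = (y - Vs *\<^sub>v (u *\<^sub>v y)) + Vs *\<^sub>v (u *\<^sub>v y)"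
    unfolding Dx B_def using dim_u dy by (simp add: mat_ring)
  also have "\<dots> = y" using dy by (intro eq_vecI) auto
  finally have 1: "D *\<^sub>v x + Vs *\<^sub>v (u *\<^sub>v y) = y" .
  have "R u *\<^sub>v (B *\<^sub>v y) = y"
    using B dy by (intro mat_cancel(2)) auto
  then have 2: "W u *\<^sub>v x = V *\<^sub>v x - D' *\<^sub>v (u *\<^sub>v y)"
    unfolding W_def using dx dim_u by (simp add: mat_ring Dx)
  have "u *\<^sub>v y \<in> carrier_vec p" by (rule mult_mat_vec_carrier[OF u y])
  from julia_isometric[OF carrier_vecI[OF dx] this] show ?thesis unfolding 1 2 by simp
qed

lemma W_contraction: "op_norm (W u) \<le> 1"
proof (rule op_norm_leI[OF W_carrier])
  fix x :: "complex Matrix.vec" assume x: "x \<in> carrier_vec q"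
  define y where "y = R u *\<^sub>v (D *\<^sub>v x)"
  have Dx: "D *\<^sub>v x \<in> carrier_vec q" by (rule mult_mat_vec_carrier[OF carrier(1) x])
  have y: "y \<in> carrier_vec q" unfolding y_def by (rule mult_mat_vec_carrier[OF R_carrier Dx])
  have "(1\<^sub>m q - Vs * u) *\<^sub>v y = D *\<^sub>v x"
    unfolding y_def using Dx by (simp add: assoc_mult_mat_vec[OF Vsu(2) R_carrier, symmetric] R_inverse)
  then have "x = Di *\<^sub>v ((1\<^sub>m q - Vs * u) *\<^sub>v y)"
    using x by (simp add: assoc_mult_mat_vec[of _ q q _ q, symmetric] D_inverse)
  from W_norm[OF y this] have "(vnorm x)\<^sup>2 - (vnorm (W u *\<^sub>v x))\<^sup>2 = (vnorm y)\<^sup>2 - (vnorm (u *\<^sub>v y))\<^sup>2" .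
  moreover have "vnorm (u *\<^sub>v y) \<le> 1 * vnorm y"
    by (rule order.trans[OF vnorm_mult_le[OF u y] mult_right_mono[OF u_le vnorm_nonneg]])
  then have "(vnorm (u *\<^sub>v y))\<^sup>2 \<le> (vnorm y)\<^sup>2" by (intro power_mono) auto
  ultimately have "(vnorm (W u *\<^sub>v x))\<^sup>2 \<le> (vnorm x)\<^sup>2" by linarith
  then show "vnorm (W u *\<^sub>v x) \<le> 1 * vnorm x" using power2_le_imp_le[OF _ vnorm_nonneg] by simp
qed simp

text \<open>The defect identity at a vector \<open>y\<close> where \<open>u\<close> attains its norm.\<close>

lemma W_norm_one:
  assumes "op_norm u = 1"
  shows "op_norm (W u) = 1"
proof -
  from op_norm_attained[OF u] assms obtain y
    where y: "y \<in> carrier_vec q" "vnorm y = 1" "vnorm (u *\<^sub>v y) = 1" by auto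
  define x where "x = Di *\<^sub>v ((1\<^sub>m q - Vs * u) *\<^sub>v y)"
  have By: "(1\<^sub>m q - Vs * u) *\<^sub>v y \<in> carrier_vec q" by (rule mult_mat_vec_carrier[OF Vsu(2) y(1)])
  have x: "x \<in> carrier_vec q" unfolding x_def by (rule mult_mat_vec_carrier[OF carrier(2) By])
  have "(vnorm x)\<^sup>2 - (vnorm (W u *\<^sub>v x))\<^sup>2 = 0"
    using W_norm[OF y(1) x_def] y by simp
  then have eq: "vnorm (W u *\<^sub>v x) = vnorm x" using vnorm_nonneg by (simp add: power2_eq_iff_nonneg)
  have "vnorm x \<noteq> 0"
  proof
    assume "vnorm x = 0"
    then have "x = 0\<^sub>v q" using x vnorm_eq_0 by blast
    then have "D *\<^sub>v x = 0\<^sub>v q" by (simp add: mult_mat_zero_vec[OF carrier(1)])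
    moreover have "D *\<^sub>v x = (1\<^sub>m q - Vs * u) *\<^sub>v y"
      unfolding x_def using By by (simp add: assoc_mult_mat_vec[of _ q q _ q, symmetric] D_inverse)
    ultimately have "y = 0\<^sub>v q" using resolvent_injective y by simp
    then show False using y by simp
  qed
  moreover have "vnorm x \<le> op_norm (W u) * vnorm x"
    using vnorm_mult_le[OF W_carrier x] eq by simp
  ultimately have "1 \<le> op_norm (W u)" 
    using vnorm_nonneg[of x] by (simp add: mult_le_cancel_right1)
  then show ?thesis using W_contraction by simp
qed

end

text \<open>With \<open>w = W u\<close>, multiplying \<open>W_mult\<close> by \<open>V\<^sup>*\<close> gives \<open>1 - V\<^sup>*w = D (1 - V\<^sup>*u)\<^sup>-\<^sup>1 D\<close>, so \<open>u\<close> satisfies the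
  equation that determines \<open>W w\<close>.\<close>

lemma W_involution:
  assumes u: "u \<in> carrier_mat p q" and u_le: "op_norm u \<le> 1"
  shows "W (W u) = u"
proof -
  define w where "w = W u"
  define B where "B = 1\<^sub>m q - Vs * u"
  have w: "w \<in> carrier_mat p q" "op_norm w \<le> 1"
    using W_carrier[OF assms] W_contraction[OF assms] by (auto simp: w_def)
  note dim_u = dim_u[OF assms] and dim_w = dim_u[OF w] and dim_R = dim_R[OF assms]
  have B: "dim_row B = q" "dim_col B = q" "B * R u = 1\<^sub>m q"
    using dim_u R_inverse[OF assms] by (auto simp: B_def)
  have BR: "B * (R u * X) = X" if "dim_row X = q" for X
    using B that dim_R by (intro mat_cancel(1)) auto
  have Vw: "Vs * (w * (Di * B)) = Di * (Vs * V - Vs * u)"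
  proof -
    have "Vs * (w * (Di * B)) = (Vs * Di') * (V - u)"
      using W_mult[OF assms] dim_u by (simp add: B_def w_def mat_assoc)
    then show ?thesis using dim_u by (simp add: D_intertwine(4) mat_ring)
  qed
  have "(1\<^sub>m q - Vs * w) * (Di * B) = Di * B - Vs * (w * (Di * B))"
    using dim_w B by (simp add: mat_ring)
  also have "\<dots> = Di * (B - (Vs * V - Vs * u))"
    unfolding Vw using B dim_u by (intro mat_mult_minus[symmetric]) auto
  also have "B - (Vs * V - Vs * u) = 1\<^sub>m q - Vs * V"
    unfolding B_def using dim_u by (intro eq_matI) auto
  also have "Di * (1\<^sub>m q - Vs * V) = D"
    unfolding D_square(1)[symmetric] by (simp add: D_cancel)
  finally have 1: "(1\<^sub>m q - Vs * w) * (Di * B) = D" .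
  have cancel: "T * (Di * B) * (R u * D) = T" if "dim_col T = q" for T
    using that B dim_R by (simp add: mat_ring BR D_cancel)
  have Bw_eq: "1\<^sub>m q - Vs * w = D * (R u * D)"
    using cancel[of "1\<^sub>m q - Vs * w"] 1 dim_w by simp
  have "u * (Di * (1\<^sub>m q - Vs * w)) = u * (R u * D)"
    unfolding Bw_eq using dim_R by (simp add: D_cancel)
  moreover have "Di' * (V - w) = u * (R u * D)"
  proof -
    have "V - w = D' * (u * (R u * D))"
      unfolding w_def W_def using dim_u dim_R by (subst mat_assoc, simp, simp, subst mat_assoc, simp, simp)
        (intro eq_matI, auto)
    then show ?thesis using dim_u by (simp add: D_cancel)
  qed
  ultimately show ?thesis using W_unique[OF w u] by (simp add: w_def)
qed

end

lemma strict_contraction_kron: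
  assumes "v \<in> carrier_mat m n" "op_norm v < 1"
  shows "strict_contraction (kron v (1\<^sub>m N)) (m * N) (n * N)"
  using assms op_norm_kron_one_le[OF assms(1), of N] by unfold_locales auto

lemma ball_auto_eq:
  assumes v: "v \<in> carrier_mat m n" "op_norm v < 1" and m: "m > 0" and u: "u \<in> carrier_mat (m * N) (n * N)"
  shows "ball_auto v u = strict_contraction.W (kron v (1\<^sub>m N)) (n * N) u"
proof -
  interpret strict_contraction "kron v (1\<^sub>m N)" "m * N" "n * N"
    by (rule strict_contraction_kron[OF v])
  have dv: "dim_row v = m" "dim_col v = n" using v by auto
  have N: "dim_row u div m = N" using u m by simp
  show ?thesis
    unfolding ball_auto_def Let_def dv N W_def R_def D_def D'_def
      psd_sqrt_binom[OF VsV(1) norm_lt(1) selfadjoint(1)] psd_sqrt_binom[OF VsV(2) norm_lt(2) selfadjoint(2)] ..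
qed

section \<open>Matrix-valued analytic functions\<close>

text \<open>Analyticity in several variables, continuity and holomorphy all give algebras of scalar
  functions that are closed under inversion of nonvanishing functions; the matrix-valued functions
  with entries in such an algebra are then closed under products and inversion.\<close>

locale inverse_closed_algebra =
  fixes S :: "'z set" and alg :: "('z \<Rightarrow> complex) \<Rightarrow> bool"
  assumes alg_const: "alg (\<lambda>_. c)"
    and alg_add: "alg F \<Longrightarrow> alg G \<Longrightarrow> alg (\<lambda>z. F z + G z)"
    and alg_mult: "alg F \<Longrightarrow> alg G \<Longrightarrow> alg (\<lambda>z. F z * G z)"
    and alg_inverse: "alg F \<Longrightarrow> (\<And>z. z \<in> S \<Longrightarrow> F z \<noteq> 0) \<Longrightarrow> alg (\<lambda>z. inverse (F z))"
    and alg_cong: "alg F \<Longrightarrow> (\<And>z. z \<in> S \<Longrightarrow> F z = G z) \<Longrightarrow> alg G"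
begin

text \<open>The matrix-valued functions of fixed dimensions with entries in the algebra.\<close>

definition mat_alg :: "nat \<Rightarrow> nat \<Rightarrow> ('z \<Rightarrow> complex mat) \<Rightarrow> bool" where
  "mat_alg m n F \<longleftrightarrow> (\<forall>z\<in>S. F z \<in> carrier_mat m n) \<and> (\<forall>i<m. \<forall>j<n. alg (\<lambda>z. F z $$ (i, j)))"

lemma mat_algD: "mat_alg m n F \<Longrightarrow> z \<in> S \<Longrightarrow> F z \<in> carrier_mat m n"
  "mat_alg m n F \<Longrightarrow> i < m \<Longrightarrow> j < n \<Longrightarrow> alg (\<lambda>z. F z $$ (i, j))"
  by (auto simp: mat_alg_def)

lemma mat_algI:
  assumes "\<And>z. z \<in> S \<Longrightarrow> F z \<in> carrier_mat m n" 
    and "\<And>i j. i < m \<Longrightarrow> j < n \<Longrightarrow> alg (G i j)"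
    and "\<And>i j z. i < m \<Longrightarrow> j < n \<Longrightarrow> z \<in> S \<Longrightarrow> G i j z = F z $$ (i, j)"
  shows "mat_alg m n F"
  unfolding mat_alg_def
proof (intro conjI ballI allI impI)
  fix i j assume "i < m" "j < n"
  then show "alg (\<lambda>z. F z $$ (i, j))" using alg_cong[OF assms(2)[of i j]] assms(3)[of i j] by simp
qed (rule assms(1))

lemma alg_sum: "(\<And>i. i \<in> I \<Longrightarrow> alg (F i)) \<Longrightarrow> alg (\<lambda>z. \<Sum>i\<in>I. F i z)"
  by (induction I rule: infinite_finite_induct) (auto intro: alg_const alg_add)

lemma alg_prod: "(\<And>i. i \<in> I \<Longrightarrow> alg (F i)) \<Longrightarrow> alg (\<lambda>z. \<Prod>i\<in>I. F i z)"
  by (induction I rule: infinite_finite_induct) (auto intro: alg_const alg_mult)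

lemma alg_diff: "alg F \<Longrightarrow> alg G \<Longrightarrow> alg (\<lambda>z. F z - G z)"
  using alg_add[of F "\<lambda>z. (-1) * G z"] alg_mult[OF alg_const[of "-1"], of G] by simp

lemma mat_alg_const: "A \<in> carrier_mat m n \<Longrightarrow> mat_alg m n (\<lambda>_. A)"
  by (auto simp: mat_alg_def alg_const)

lemma mat_alg_cong: "mat_alg m n F \<Longrightarrow> (\<And>z. z \<in> S \<Longrightarrow> F z = G z) \<Longrightarrow> mat_alg m n G"
proof (rule mat_algI[where G = "\<lambda>i j z. F z $$ (i, j)"])
  assume F: "mat_alg m n F" and eq: "\<And>z. z \<in> S \<Longrightarrow> F z = G z"
  show "G z \<in> carrier_mat m n" if "z \<in> S" for z using mat_algD(1)[OF F that] eq[OF that] by simp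
  show "alg (\<lambda>z. F z $$ (i, j))" if "i < m" "j < n" for i j using mat_algD(2)[OF F that] .
  show "F z $$ (i, j) = G z $$ (i, j)" if "z \<in> S" for i j z using eq[OF that] by simp
qed

lemma mat_alg_diff: 
  assumes "mat_alg m n F" "mat_alg m n G" shows "mat_alg m n (\<lambda>z. F z - G z)"
proof (rule mat_algI[where G = "\<lambda>i j z. F z $$ (i, j) - G z $$ (i, j)"])
  show "F z - G z \<in> carrier_mat m n" if "z \<in> S" for z
    using mat_algD(1)[OF assms(1) that] mat_algD(1)[OF assms(2) that] by auto
  show "F z $$ (i, j) - G z $$ (i, j) = (F z - G z) $$ (i, j)" if "i < m" "j < n" "z \<in> S" for i j z
    using mat_algD(1)[OF assms(1) that(3)] mat_algD(1)[OF assms(2) that(3)] that by auto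
qed (use assms in \<open>auto intro: alg_diff mat_algD(2)\<close>)

lemma mat_alg_mult: 
  assumes "mat_alg m n F" "mat_alg n k G" shows "mat_alg m k (\<lambda>z. F z * G z)"
proof (rule mat_algI[where G = "\<lambda>i j z. \<Sum>l<n. F z $$ (i, l) * G z $$ (l, j)"])
  show "F z * G z \<in> carrier_mat m k" if "z \<in> S" for z
    using mat_algD(1)[OF assms(1) that] mat_algD(1)[OF assms(2) that] by auto
  show "(\<Sum>l<n. F z $$ (i, l) * G z $$ (l, j)) = (F z * G z) $$ (i, j)"
    if "i < m" "j < k" "z \<in> S" for i j z
    using index_mat_mat[OF mat_algD(1)[OF assms(1) that(3)] mat_algD(1)[OF assms(2) that(3)] that(1,2)] by simp
qed (use assms in \<open>auto intro!: alg_sum alg_mult mat_algD(2)\<close>)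

lemma alg_det:
  assumes "mat_alg n n F" shows "alg (\<lambda>z. Determinant.det (F z))"
proof (rule alg_cong)
  show "alg (\<lambda>z. \<Sum>p\<in>{p. p permutes {0..<n}}. signof p * (\<Prod>i = 0..<n. F z $$ (i, p i)))"
    using assms by (intro alg_sum alg_mult alg_const alg_prod mat_algD(2)[OF assms]) (auto simp: permutes_def)
  show "(\<Sum>p\<in>{p. p permutes {0..<n}}. signof p * (\<Prod>i = 0..<n. F z $$ (i, p i))) = Determinant.det (F z)"
    if "z \<in> S" for z using det_def'[OF mat_algD(1)[OF assms that]] by simp
qed

text \<open>The entries of the inverse are cofactors divided by the determinant.\<close>

lemma mat_alg_inverse:
  assumes F: "mat_alg n n F" and d: "\<And>z. z \<in> S \<Longrightarrow> Determinant.det (F z) \<noteq> 0"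
  shows "mat_alg n n (\<lambda>z. the (mat_inverse (F z)))"
proof -
  have inv: "the (mat_inverse M) \<in> carrier_mat n n \<and>
      (\<forall>i<n. \<forall>j<n. the (mat_inverse M) $$ (i, j) = inverse (Determinant.det M) * cofactor M j i)"
    if M: "M \<in> carrier_mat n n" and "Determinant.det M \<noteq> 0" for M :: "complex mat"
  proof -
    have "y = 0\<^sub>v n" if "y \<in> carrier_vec n" "M *\<^sub>v y = 0\<^sub>v n" for y
      using that det_0_iff_vec_prod_zero_field[OF M] \<open>Determinant.det M \<noteq> 0\<close> by blast
    note R = mat_inverse_of_injective[OF M this]
    let ?R = "the (mat_inverse M)"
    have a: "adj_mat M \<in> carrier_mat n n" by (rule adj_mat(1)[OF M])
    have "adj_mat M = ?R * (M * adj_mat M)"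
      using R M a by (simp add: assoc_mult_mat[of _ n n _ n _ n, symmetric])
    also have "\<dots> = Determinant.det M \<cdot>\<^sub>m ?R"
      using R by (simp add: adj_mat(2)[OF M] mult_smult_distrib[of _ n n _ n])
    finally have eq: "adj_mat M = Determinant.det M \<cdot>\<^sub>m ?R" .
    have "cofactor M j i = Determinant.det M * ?R $$ (i, j)" if "i < n" "j < n" for i j
      using arg_cong[OF eq, of "\<lambda>A. A $$ (i, j)"] that M R by (simp add: adj_mat_def)
    then show ?thesis using R(2) \<open>Determinant.det M \<noteq> 0\<close> by simp
  qed
  show ?thesis
  proof (rule mat_algI[where G = "\<lambda>i j z. inverse (Determinant.det (F z)) * cofactor (F z) j i"])
    show "the (mat_inverse (F z)) \<in> carrier_mat n n" if "z \<in> S" for z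
      using inv[OF mat_algD(1)[OF F that] d[OF that]] by blast
    show "inverse (Determinant.det (F z)) * cofactor (F z) j i = the (mat_inverse (F z)) $$ (i, j)" 
      if "i < n" "j < n" "z \<in> S" for i j z
      using inv[OF mat_algD(1)[OF F that(3)] d[OF that(3)]] that by simp
    fix i j assume ij: "i < n" "j < n"
    have "mat_alg (n - 1) (n - 1) (\<lambda>z. mat_delete (F z) j i)"
    proof (rule mat_algI[where G = "\<lambda>a b z. F z $$ (if a < j then a else Suc a, if b < i then b else Suc b)"])
      show "mat_delete (F z) j i \<in> carrier_mat (n - 1) (n - 1)" if "z \<in> S" for z
        using mat_algD(1)[OF F that] by (auto simp: mat_delete_def intro!: carrier_matI)
      show "alg (\<lambda>z. F z $$ (if a < j then a else Suc a, if b < i then b else Suc b))"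
        if "a < n - 1" "b < n - 1" for a b
        using that by (intro mat_algD(2)[OF F]) auto
      show "F z $$ (if a < j then a else Suc a, if b < i then b else Suc b) = mat_delete (F z) j i $$ (a, b)"
        if "a < n - 1" "b < n - 1" "z \<in> S" for a b z
        using mat_algD(1)[OF F that(3)] that by (simp add: mat_delete_def)
    qed
    then show "alg (\<lambda>z. inverse (Determinant.det (F z)) * cofactor (F z) j i)"
      unfolding cofactor_def using d
      by (intro alg_mult alg_inverse alg_det[OF F] alg_const alg_det) auto
  qed
qed

lemma mat_alg_W:
  assumes "strict_contraction V p q" and u: "mat_alg p q u" "\<And>z. z \<in> S \<Longrightarrow> op_norm (u z) \<le> 1"
  shows "mat_alg p q (\<lambda>z. strict_contraction.W V q (u z))"
proof -
  interpret strict_contraction V p q by fact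
  have "mat_alg q q (\<lambda>z. R (u z))"
    unfolding R_def using det_resolvent[OF mat_algD(1)[OF u(1)] u(2)]
    by (intro mat_alg_inverse mat_alg_diff mat_alg_mult[of _ p] mat_alg_const u(1)) auto
  then show ?thesis
    unfolding W_def by (intro mat_alg_diff mat_alg_mult[of _ q] mat_alg_mult[of _ p] mat_alg_const u(1)) auto
qed

end

text \<open>Analyticity in several variables is preserved by sums, products and inverses.\<close>

lemma continuous_on_L2_dist: "continuous_on UNIV (\<lambda>y. L2_set (\<lambda>i. cmod (y i - z i)) {..<K})"
  unfolding L2_set_def by (intro continuous_intros) (auto intro!: continuous_on_product_coordinates)

lemma tendsto_coordinate: "((\<lambda>y :: nat \<Rightarrow> complex. y i) \<longlongrightarrow> z i) (at z within W)"
proof -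
  have "continuous_on UNIV (\<lambda>y :: nat \<Rightarrow> complex. y i)" by (rule continuous_on_product_coordinates)
  then have "((\<lambda>y :: nat \<Rightarrow> complex. y i) \<longlongrightarrow> z i) (at z within UNIV)" by (simp add: continuous_on_def)
  then show ?thesis by (rule tendsto_within_subset) simp
qed

lemma L2_dist_eq_0:
  assumes "y \<in> cspace K" "z \<in> cspace K" "L2_set (\<lambda>i. cmod (y i - z i)) {..<K} = 0"
  shows "y = z"
proof
  fix i
  show "y i = z i"
  proof (cases "i < K")
    case True
    then show ?thesis using assms(3) by (simp add: L2_set_eq_0_iff)
  qed (use assms in \<open>simp add: cspace_def\<close>)
qed

lemma linear_le_L2_dist:
  "cmod (\<Sum>i<K. c i * (y i - z i)) \<le> (\<Sum>i<K. cmod (c i)) * L2_set (\<lambda>i. cmod (y i - z i)) {..<K}"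
  for y z :: "nat \<Rightarrow> complex"
proof -
  have "cmod (y i - z i) \<le> L2_set (\<lambda>i. cmod (y i - z i)) {..<K}" if "i < K" for i
    by (rule member_le_L2_set[where f = "\<lambda>i. cmod (y i - z i)"]) (use that in auto)
  then show ?thesis
    unfolding sum_distrib_right
    by (intro order.trans[OF norm_sum] sum_mono) (auto intro!: mult_left_mono simp: norm_mult)
qed

text \<open>The Euclidean distance in the first \<open>K\<close> coordinates, as a complex number since it occurs as a
  denominator of complex difference quotients.\<close>

definition cdist :: "nat \<Rightarrow> (nat \<Rightarrow> complex) \<Rightarrow> (nat \<Rightarrow> complex) \<Rightarrow> complex" where
  "cdist K z y = complex_of_real (L2_set (\<lambda>i. cmod (y i - z i)) {..<K})"

context
  fixes K :: nat and W :: "(nat \<Rightarrow> complex) set"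
  assumes W: "W \<subseteq> cspace K"
begin

lemma analytic_several_alt:
  "analytic_several K W F \<longleftrightarrow> (\<forall>z \<in> W. \<exists>c :: nat \<Rightarrow> complex.
     ((\<lambda>y. (F y - F z - (\<Sum>i<K. c i * (y i - z i))) / cdist K z y) \<longlongrightarrow> 0) (at z within W))"
  by (simp add: analytic_several_def cdist_def)

lemma eventually_cdist: "z \<in> W \<Longrightarrow> eventually (\<lambda>y. y \<in> W \<and> cdist K z y \<noteq> 0) (at z within W)"
  unfolding eventually_at_filter cdist_def using L2_dist_eq_0 W by (auto intro!: always_eventually)

lemma tendsto_cdist: "(cdist K z \<longlongrightarrow> 0) (at z within W)"
proof -
  have "isCont (\<lambda>y. L2_set (\<lambda>i. cmod (y i - z i)) {..<K}) z"
    using continuous_on_L2_dist[of z K] by (simp add: continuous_on_eq_continuous_at)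
  then have "((\<lambda>y. L2_set (\<lambda>i. cmod (y i - z i)) {..<K}) \<longlongrightarrow> 0) (at z within W)"
    by (auto simp: isCont_def L2_set_def intro: tendsto_within_subset)
  from tendsto_of_real[OF this, where 'a = complex] show ?thesis by (simp add: cdist_def[abs_def])
qed

lemma tendsto_linear: "((\<lambda>y. \<Sum>i<K. c i * (y i - z i)) \<longlongrightarrow> 0) (at z within W)"
  for z :: "nat \<Rightarrow> complex"
  by (intro tendsto_null_sum tendsto_mult_right_zero)
    (auto intro!: tendsto_eq_intros tendsto_coordinate)

lemma analytic_several_tendsto:
  assumes z: "z \<in> W" 
    and lim: "((\<lambda>y. (F y - F z - (\<Sum>i<K. c i * (y i - z i))) / cdist K z y) \<longlongrightarrow> 0) (at z within W)"
  shows "(F \<longlongrightarrow> F z) (at z within W)"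
proof -
  have "((\<lambda>y. (F y - F z - (\<Sum>i<K. c i * (y i - z i))) / cdist K z y * cdist K z y +
      (\<Sum>i<K. c i * (y i - z i)) + F z) \<longlongrightarrow> 0 * 0 + 0 + F z) (at z within W)"
    by (intro tendsto_intros lim tendsto_cdist tendsto_linear)
  moreover have "eventually (\<lambda>y. (F y - F z - (\<Sum>i<K. c i * (y i - z i))) / cdist K z y * cdist K z y +
      (\<Sum>i<K. c i * (y i - z i)) + F z = F y) (at z within W)"
    using eventually_cdist[OF z] by eventually_elim simp
  ultimately show ?thesis using Lim_transform_eventually by fastforce
qed

text \<open>A linear form is bounded by a multiple of the distance.\<close>

lemma tendsto_linear_mult:
  assumes z: "z \<in> W" and G: "(G \<longlongrightarrow> 0) (at z within W)"
  shows "((\<lambda>y. (\<Sum>i<K. c i * (y i - z i)) / cdist K z y * G y) \<longlongrightarrow> 0) (at z within W)"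
proof (rule Lim_null_comparison)
  show "eventually (\<lambda>y. norm ((\<Sum>i<K. c i * (y i - z i)) / cdist K z y * G y) \<le>
      (\<Sum>i<K. cmod (c i)) * cmod (G y)) (at z within W)"
    using eventually_cdist[OF z]
  proof eventually_elim
    case (elim y)
    then have "L2_set (\<lambda>i. cmod (y i - z i)) {..<K} > 0"
      using L2_set_nonneg[of "\<lambda>i. cmod (y i - z i)" "{..<K}"] by (auto simp: cdist_def less_le)
    then have "cmod ((\<Sum>i<K. c i * (y i - z i)) / cdist K z y) \<le> (\<Sum>i<K. cmod (c i))"
      using linear_le_L2_dist[of c y z K] by (simp add: norm_divide cdist_def pos_divide_le_eq)
    from mult_right_mono[OF this norm_ge_zero[of "G y"]] show ?case by (simp only: norm_mult)
  qed
  show "((\<lambda>y. (\<Sum>i<K. cmod (c i)) * cmod (G y)) \<longlongrightarrow> 0) (at z within W)"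
    using G by (intro tendsto_mult_right_zero tendsto_norm_zero)
qed

lemma inverse_closed_algebra_analytic_several:
  "inverse_closed_algebra W (analytic_several K W)"
proof
  show "analytic_several K W (\<lambda>_. c)" for c
    unfolding analytic_several_alt by (auto intro!: exI[of _ "\<lambda>_. 0"])
next
  fix F G assume F: "analytic_several K W F" and G: "analytic_several K W G"
  show "analytic_several K W (\<lambda>z. F z + G z)"
    unfolding analytic_several_alt
  proof
    fix z assume z: "z \<in> W"
    from F z obtain c where c: "((\<lambda>y. (F y - F z - (\<Sum>i<K. c i * (y i - z i))) / cdist K z y) \<longlongrightarrow> 0) (at z within W)"
      unfolding analytic_several_alt by blast
    from G z obtain d where d: "((\<lambda>y. (G y - G z - (\<Sum>i<K. d i * (y i - z i))) / cdist K z y) \<longlongrightarrow> 0) (at z within W)"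
      unfolding analytic_several_alt by blast
    show "\<exists>c. ((\<lambda>y. (F y + G y - (F z + G z) - (\<Sum>i<K. c i * (y i - z i))) / cdist K z y) \<longlongrightarrow> 0) (at z within W)"
    proof (intro exI[of _ "\<lambda>i. c i + d i"])
      have "(F y - F z - A) / q + (G y - G z - B) / q = (F y + G y - (F z + G z) - (A + B)) / q" for y A B q
        by (simp add: add_divide_distrib diff_divide_distrib)
      with tendsto_add[OF c d]
      show "((\<lambda>y. (F y + G y - (F z + G z) - (\<Sum>i<K. (c i + d i) * (y i - z i))) / cdist K z y) \<longlongrightarrow> 0) (at z within W)"
        by (simp add: sum.distrib distrib_right)
    qed
  qed
  show "analytic_several K W (\<lambda>z. F z * G z)"
    unfolding analytic_several_alt
  proof
    fix z assume z: "z \<in> W"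
    from F z obtain c where c: "((\<lambda>y. (F y - F z - (\<Sum>i<K. c i * (y i - z i))) / cdist K z y) \<longlongrightarrow> 0) (at z within W)"
      unfolding analytic_several_alt by blast
    from G z obtain d where d: "((\<lambda>y. (G y - G z - (\<Sum>i<K. d i * (y i - z i))) / cdist K z y) \<longlongrightarrow> 0) (at z within W)"
      unfolding analytic_several_alt by blast
    have Gz: "(G \<longlongrightarrow> G z) (at z within W)" by (rule analytic_several_tendsto[OF z d])
    then have "((\<lambda>y. G y - G z) \<longlongrightarrow> 0) (at z within W)" using LIM_zero_iff by blast
    note 3 = tendsto_linear_mult[OF z this, of c]
    \<comment> \<open>The product rule: the remainder of \<open>F G\<close> in terms of those of \<open>F\<close> and \<open>G\<close>.\<close>
    have "((\<lambda>y. (F y - F z - (\<Sum>i<K. c i * (y i - z i))) / cdist K z y * G y +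
        F z * ((G y - G z - (\<Sum>i<K. d i * (y i - z i))) / cdist K z y) +
        (\<Sum>i<K. c i * (y i - z i)) / cdist K z y * (G y - G z)) \<longlongrightarrow> 0 * G z + F z * 0 + 0) (at z within W)"
      by (intro tendsto_intros c d Gz 3)
    moreover have "(F y - F z - A) / q * g + F z * ((g - G z - B) / q) + A / q * (g - G z) =
        (F y * g - F z * G z - (G z * A + F z * B)) / q" for y A B q g
      by (simp add: divide_simps) (simp add: algebra_simps)
    ultimately show "\<exists>c. ((\<lambda>y. (F y * G y - F z * G z - (\<Sum>i<K. c i * (y i - z i))) / cdist K z y) \<longlongrightarrow> 0) (at z within W)"
      by (intro exI[of _ "\<lambda>i. G z * c i + F z * d i"])
        (simp add: sum.distrib sum_distrib_left distrib_right mult.assoc)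
  qed
next
  fix F assume F: "analytic_several K W F" and nz: "\<And>z. z \<in> W \<Longrightarrow> F z \<noteq> 0"
  show "analytic_several K W (\<lambda>z. inverse (F z))"
    unfolding analytic_several_alt
  proof
    fix z assume z: "z \<in> W"
    from F z obtain c where c: "((\<lambda>y. (F y - F z - (\<Sum>i<K. c i * (y i - z i))) / cdist K z y) \<longlongrightarrow> 0) (at z within W)"
      unfolding analytic_several_alt by blast
    have Fz: "(F \<longlongrightarrow> F z) (at z within W)" by (rule analytic_several_tendsto[OF z c])
    have "((\<lambda>y. inverse (F z) * (inverse (F z) - inverse (F y))) \<longlongrightarrow> inverse (F z) * (inverse (F z) - inverse (F z))) (at z within W)"
      by (intro tendsto_intros Fz nz z)
    then have "((\<lambda>y. inverse (F z) * (inverse (F z) - inverse (F y))) \<longlongrightarrow> 0) (at z within W)" by simp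
    note 2 = tendsto_linear_mult[OF z this, of c]
    \<comment> \<open>The quotient rule: the remainder of \<open>1 / F\<close> in terms of that of \<open>F\<close>.\<close>
    have "((\<lambda>y. - ((F y - F z - (\<Sum>i<K. c i * (y i - z i))) / cdist K z y * (inverse (F y) * inverse (F z))) +
        (\<Sum>i<K. c i * (y i - z i)) / cdist K z y * (inverse (F z) * (inverse (F z) - inverse (F y)))) \<longlongrightarrow>
        - (0 * (inverse (F z) * inverse (F z))) + 0) (at z within W)"
      by (intro tendsto_intros c Fz nz z 2)
    moreover have "eventually (\<lambda>y. - ((F y - F z - (\<Sum>i<K. c i * (y i - z i))) / cdist K z y * (inverse (F y) * inverse (F z))) +
        (\<Sum>i<K. c i * (y i - z i)) / cdist K z y * (inverse (F z) * (inverse (F z) - inverse (F y))) =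
        (inverse (F y) - inverse (F z) - (\<Sum>i<K. (- c i * inverse (F z) * inverse (F z)) * (y i - z i))) / cdist K z y) (at z within W)"
      using eventually_cdist[OF z]
    proof eventually_elim
      case (elim y)
      have s: "(\<Sum>i<K. (- c i * inverse (F z) * inverse (F z)) * (y i - z i)) =
          - (\<Sum>i<K. c i * (y i - z i)) * inverse (F z) * inverse (F z)"
        by (simp add: sum_distrib_left sum_distrib_right sum_negf mult_ac)
      have a: "- ((a - b - s) / q * (inverse a * inverse b)) + s / q * (inverse b * (inverse b - inverse a)) =
          (inverse a - inverse b - - s * inverse b * inverse b) / q" if "a \<noteq> 0" "b \<noteq> 0" "q \<noteq> 0" for a b s q :: complex
        using that by (simp add: field_simps)
      show ?case unfolding s using nz[of y] nz[OF z] elim by (intro a) auto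
    qed
    ultimately have "((\<lambda>y. (inverse (F y) - inverse (F z) - (\<Sum>i<K. (- c i * inverse (F z) * inverse (F z)) * (y i - z i))) / cdist K z y) \<longlongrightarrow>
        - (0 * (inverse (F z) * inverse (F z))) + 0) (at z within W)"
      by (rule Lim_transform_eventually)
    then show "\<exists>c. ((\<lambda>y. (inverse (F y) - inverse (F z) - (\<Sum>i<K. c i * (y i - z i))) / cdist K z y) \<longlongrightarrow> 0) (at z within W)"
      by (intro exI[of _ "\<lambda>i. - c i * inverse (F z) * inverse (F z)"]) simp
  qed
next
  fix F G assume F: "analytic_several K W F" and eq: "\<And>z. z \<in> W \<Longrightarrow> F z = G z"
  show "analytic_several K W G"
    unfolding analytic_several_alt
  proof
    fix z assume z: "z \<in> W"
    from F z obtain c where c: "((\<lambda>y. (F y - F z - (\<Sum>i<K. c i * (y i - z i))) / cdist K z y) \<longlongrightarrow> 0) (at z within W)"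
      unfolding analytic_several_alt by blast
    have "eventually (\<lambda>y. (F y - F z - (\<Sum>i<K. c i * (y i - z i))) / cdist K z y = 
       (G y - G z - (\<Sum>i<K. c i * (y i - z i))) / cdist K z y) (at z within W)"
      using eventually_cdist[OF z] by eventually_elim (use eq z in simp)
    from Lim_transform_eventually[OF c this]
    show "\<exists>c. ((\<lambda>y. (G y - G z - (\<Sum>i<K. c i * (y i - z i))) / cdist K z y) \<longlongrightarrow> 0) (at z within W)"
      by (intro exI[of _ c])
  qed
qed

end

lemma inverse_closed_algebra_continuous: "inverse_closed_algebra S (continuous_on S)"
  for S :: "'a::topological_space set"
proof
  show "continuous_on S (\<lambda>_. c)" for c by (rule continuous_on_const)
  fix F G :: "'a \<Rightarrow> complex" assume F: "continuous_on S F"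
  show "continuous_on S (\<lambda>z. inverse (F z))" if "\<And>z. z \<in> S \<Longrightarrow> F z \<noteq> 0"
    using that by (intro continuous_on_inverse F) auto
  show "continuous_on S G" if "\<And>z. z \<in> S \<Longrightarrow> F z = G z"
    using F that continuous_on_cong[of S S F G] by simp
  assume G: "continuous_on S G"
  show "continuous_on S (\<lambda>z. F z + G z)" by (rule continuous_on_add[OF F G])
  show "continuous_on S (\<lambda>z. F z * G z)" by (rule continuous_on_mult[OF F G])
qed

section \<open>Functions of one variable\<close>

text \<open>The identification of \<open>\<complex>\<close> with \<open>cspace 1\<close>.\<close>

definition one_var :: "complex \<Rightarrow> nat \<Rightarrow> complex" where
  "one_var \<zeta> = (\<lambda>i. if i = 0 then \<zeta> else 0)"

lemma continuous_on_one_var: "continuous_on S one_var"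
proof (rule continuous_on_coordinatewise_then_product)
  show "continuous_on S (\<lambda>x. one_var x i)" for i
    by (cases "i = 0") (auto simp: one_var_def)
qed

lemma one_var_image: "one_var ` B = {z \<in> cspace 1. z 0 \<in> B}"
proof -
  have "z = one_var (z 0)" if "z \<in> cspace 1" for z
    using that by (auto simp: one_var_def cspace_def Suc_le_eq)
  then show ?thesis by (auto simp: one_var_def cspace_def)
qed

lemma cdomain_one_var:
  assumes "open B" "connected B" "B \<noteq> {}"
  shows "cdomain 1 (one_var ` B)"
  unfolding cdomain_def
proof (intro conjI)
  show "one_var ` B \<noteq> {}" using assms by simp
  show "connected (one_var ` B)" using assms continuous_on_one_var by (intro connected_continuous_image)
  have "open ((\<lambda>z :: nat \<Rightarrow> complex. z 0) -` B)"
    using assms(1) by (rule open_vimage) (rule continuous_on_product_coordinates)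
  then show "openin (top_of_set (cspace 1)) (one_var ` B)"
    unfolding one_var_image openin_open by (intro exI[of _ "(\<lambda>z. z 0) -` B"]) auto
qed

lemma analytic_several_one_var:
  assumes "open B" and F: "analytic_several 1 (one_var ` B) F"
  shows "(\<lambda>\<zeta>. F (one_var \<zeta>)) holomorphic_on B"
  unfolding holomorphic_on_open[OF assms(1)]
proof
  fix \<zeta> assume \<zeta>: "\<zeta> \<in> B"
  from F \<zeta> obtain c :: "nat \<Rightarrow> complex" where c:
    "((\<lambda>y. (F y - F (one_var \<zeta>) - (\<Sum>i<1. c i * (y i - one_var \<zeta> i))) /
      complex_of_real (L2_set (\<lambda>i. cmod (y i - one_var \<zeta> i)) {..<1})) \<longlongrightarrow> 0) (at (one_var \<zeta>) within one_var ` B)"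
    unfolding analytic_several_def by blast
  have inj: "one_var y = one_var x \<longleftrightarrow> y = x" for x y
    by (metis one_var_def)
  have "(one_var \<longlongrightarrow> one_var \<zeta>) (at \<zeta>)"
    using continuous_on_one_var[of UNIV] by (simp add: continuous_on_eq_continuous_at isCont_def)
  moreover have "eventually (\<lambda>y. y \<in> B \<and> y \<noteq> \<zeta>) (at \<zeta>)"
    using assms(1) \<zeta> eventually_at_in_open[of B \<zeta>] by simp
  ultimately have "filterlim one_var (at (one_var \<zeta>) within one_var ` B) (at \<zeta>)"
    unfolding filterlim_at by (auto simp: inj elim!: eventually_mono)
  note lim = filterlim_compose[OF c this]
  have "(\<Sum>i<1. c i * (one_var y i - one_var \<zeta> i)) = c 0 * (y - \<zeta>)"
    "L2_set (\<lambda>i. cmod (one_var y i - one_var \<zeta> i)) {..<1} = cmod (y - \<zeta>)" for y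
    by (simp_all add: one_var_def L2_set_def)
  with lim
  have lim: "((\<lambda>y. (F (one_var y) - F (one_var \<zeta>) - c 0 * (y - \<zeta>)) / complex_of_real (cmod (y - \<zeta>))) \<longlongrightarrow> 0) (at \<zeta>)"
    by (simp only:)
  have "((\<lambda>y. (F (one_var y) - F (one_var \<zeta>) - c 0 * (y - \<zeta>)) / (y - \<zeta>)) \<longlongrightarrow> 0) (at \<zeta>)"
  proof (rule tendsto_norm_zero_cancel)
    have "norm ((F (one_var y) - F (one_var \<zeta>) - c 0 * (y - \<zeta>)) / (y - \<zeta>)) =
      norm ((F (one_var y) - F (one_var \<zeta>) - c 0 * (y - \<zeta>)) / complex_of_real (cmod (y - \<zeta>)))" for y
      by (simp only: norm_divide norm_of_real abs_norm_cancel)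
    then show "((\<lambda>y. norm ((F (one_var y) - F (one_var \<zeta>) - c 0 * (y - \<zeta>)) / (y - \<zeta>))) \<longlongrightarrow> 0) (at \<zeta>)"
      using tendsto_norm_zero[OF lim] by presburger
  qed
  then have "((\<lambda>y. (F (one_var y) - F (one_var \<zeta>) - c 0 * (y - \<zeta>)) / (y - \<zeta>) + c 0) \<longlongrightarrow> 0 + c 0) (at \<zeta>)"
    by (intro tendsto_intros)
  moreover have "eventually (\<lambda>y. (F (one_var y) - F (one_var \<zeta>) - c 0 * (y - \<zeta>)) / (y - \<zeta>) + c 0 =
      (F (one_var y) - F (one_var \<zeta>)) / (y - \<zeta>)) (at \<zeta>)"
    unfolding eventually_at_filter by (intro always_eventually) (simp add: diff_divide_distrib)
  ultimately have "((\<lambda>\<zeta>. F (one_var \<zeta>)) has_field_derivative c 0) (at \<zeta>)"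
    unfolding has_field_derivative_iff using Lim_transform_eventually by fastforce
  then show "\<exists>f'. ((\<lambda>\<zeta>. F (one_var \<zeta>)) has_field_derivative f') (at \<zeta>)" by blast
qed

section \<open>Noncommutative power series\<close>

lemma word_eval_Nil [simp]: "word_eval N X [] = 1\<^sub>m N"
  by (simp add: word_eval_def)

lemma word_eval_Cons [simp]: "word_eval N X (x # w) = block N X (fst x) (snd x) * word_eval N X w"
  by (simp add: word_eval_def split: prod.splits)

lemma block_carrier [simp]: "block N X j l \<in> carrier_mat N N"
  by (simp add: block_def)

lemma word_eval_carrier [simp]: "word_eval N X w \<in> carrier_mat N N"
  by (induction w) (auto intro!: mult_carrier_mat[OF block_carrier])

lemma dim_word_eval [simp]: "dim_row (word_eval N X w) = N" "dim_col (word_eval N X w) = N"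
  by (rule carrier_matD[OF word_eval_carrier])+

lemma dim_block [simp]: "dim_row (block N X j l) = N" "dim_col (block N X j l) = N"
  by (rule carrier_matD[OF block_carrier])+

lemma word_eval_append: "word_eval N X (v @ w) = word_eval N X v * word_eval N X w"
  by (induction v) (simp_all add: mat_ring)

lemma words_0 [simp]: "words g' g 0 = {[]}"
  by (auto simp: words_def)

lemma finite_words [simp]: "finite (words g' g \<alpha>)"
  unfolding words_def by (rule finite_lists_length_eq) simp

lemma block_smult:
  assumes "X \<in> carrier_mat (g' * N) (g * N)" "j < g'" "l < g"
  shows "block N (z \<cdot>\<^sub>m X) j l = z \<cdot>\<^sub>m block N X j l"
  using assms by (intro eq_matI) (auto simp: block_def block_index_less)

lemma word_eval_smult:
  assumes X: "X \<in> carrier_mat (g' * N) (g * N)" and w: "set w \<subseteq> {..<g'} \<times> {..<g}"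
  shows "word_eval N (z \<cdot>\<^sub>m X) w = z ^ length w \<cdot>\<^sub>m word_eval N X w"
  using w
proof (induction w)
  case Nil
  then show ?case by (intro eq_matI) auto
next
  case (Cons x w)
  obtain j l where x: "x = (j, l)" "j < g'" "l < g" using Cons.prems by (cases x) auto
  have "z \<cdot>\<^sub>m block N X j l * (z ^ length w \<cdot>\<^sub>m word_eval N X w) =
     z ^ Suc (length w) \<cdot>\<^sub>m (block N X j l * word_eval N X w)"
    by (simp add: mult_smult_distrib[of _ N N _ N] mult_smult_assoc_mat[of _ N N _ N])
      (intro eq_matI, auto)
  then show ?case using Cons x block_smult[OF X x(2,3), of z] by simp
qed

text \<open>The \<open>(p, q)\<close> entry of the homogeneous part of degree \<open>\<alpha>\<close> of the series with coefficients
  \<open>a\<close>.\<close>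

definition nc_coeff ::
  "nat \<Rightarrow> nat \<Rightarrow> nat \<Rightarrow> ((nat \<times> nat) list \<Rightarrow> complex mat) \<Rightarrow> complex mat \<Rightarrow> nat \<Rightarrow> nat \<Rightarrow> nat \<Rightarrow> complex" where
  "nc_coeff g' g N a X \<alpha> p q = (\<Sum>w\<in>words g' g \<alpha>. kron (a w) (word_eval N X w) $$ (p, q))"

lemma nc_coeff_smult:
  assumes X: "X \<in> carrier_mat (g' * N) (g * N)" and a: "\<And>w. a w \<in> carrier_mat k' k"
    and "p < k' * N" "q < k * N"
  shows "nc_coeff g' g N a (z \<cdot>\<^sub>m X) \<alpha> p q = z ^ \<alpha> * nc_coeff g' g N a X \<alpha> p q"
  unfolding nc_coeff_def sum_distrib_left
proof (rule sum.cong[OF refl])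
  fix w assume "w \<in> words g' g \<alpha>"
  then have w: "word_eval N (z \<cdot>\<^sub>m X) w = z ^ \<alpha> \<cdot>\<^sub>m word_eval N X w"
    using word_eval_smult[OF X, of w z] by (auto simp: words_def)
  obtain b s c t where "b < k'" "s < N" "p = b * N + s" "c < k" "t < N" "q = c * N + t"
    using assms(3,4) by (metis block_index_cases)
  then show "kron (a w) (word_eval N (z \<cdot>\<^sub>m X) w) $$ (p, q) = z ^ \<alpha> * kron (a w) (word_eval N X w) $$ (p, q)"
    unfolding w by (simp add: index_kron[OF a, of _ N N])
qed

text \<open>Points of the closed unit ball at size \<open>N\<close>; NC functions are evaluated at \<open>\<zeta>X\<close> with \<open>\<bar>\<zeta>\<bar> < 1\<close> only.\<close>

definition closed_ball :: "nat \<Rightarrow> nat \<Rightarrow> nat \<Rightarrow> complex mat set" where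
  "closed_ball g' g N = {X \<in> carrier_mat (g' * N) (g * N). op_norm X \<le> 1}"

lemma smult_int_ball:
  assumes "X \<in> closed_ball g' g N" "cmod z < 1"
  shows "z \<cdot>\<^sub>m X \<in> int_ball g' g N"
proof -
  have "cmod z * op_norm X \<le> cmod z * 1"
    using assms by (intro mult_left_mono) (auto simp: closed_ball_def)
  then have "cmod z * op_norm X < 1" using assms(2) by simp
  then show ?thesis using assms by (auto simp: closed_ball_def int_ball_def op_norm_smult)
qed

lemma int_ball_eq_smult:
  assumes "X \<in> int_ball g' g N"
  obtains r :: real and Y where "0 < r" "r < 1" "Y \<in> closed_ball g' g N" "X = complex_of_real r \<cdot>\<^sub>m Y"
proof
  let ?r = "(1 + op_norm X) / 2"
  show r: "0 < ?r" "?r < 1" using assms op_norm_nonneg[of X] by (auto simp: int_ball_def)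
  have X: "X \<in> carrier_mat (g' * N) (g * N)" "op_norm X < 1" using assms by (auto simp: int_ball_def)
  have "cmod (1 / complex_of_real ?r) = 1 / ?r" using r by (simp only: norm_divide norm_one norm_of_real)
  moreover have "1 / ?r * op_norm X \<le> 1" using r X by (simp add: divide_simps)
  ultimately show "(1 / complex_of_real ?r) \<cdot>\<^sub>m X \<in> closed_ball g' g N"
    using X by (simp add: closed_ball_def op_norm_smult[OF X(1)])
  show "X = complex_of_real ?r \<cdot>\<^sub>m ((1 / complex_of_real ?r) \<cdot>\<^sub>m X)"
    using r by (intro eq_matI) (auto simp del: of_real_add of_real_divide)
qed

text \<open>All functions below are studied along the discs \<open>\<zeta> \<mapsto> \<zeta>X\<close> with \<open>\<parallel>X\<parallel> \<le> 1\<close>: \<open>disc_analytic\<close>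
  asks for holomorphy there, and \<open>nc_taylor\<close> says that the Taylor coefficients at \<open>0\<close> are
  the homogeneous parts of a noncommutative power series.\<close>

definition disc_analytic :: "nat \<Rightarrow> nat \<Rightarrow> nat \<Rightarrow> nat \<Rightarrow> (complex mat \<Rightarrow> complex mat) \<Rightarrow> bool" where
  "disc_analytic g' g k' k F \<longleftrightarrow> (\<forall>N>0. \<forall>X\<in>closed_ball g' g N.
     (\<forall>z. cmod z < 1 \<longrightarrow> F (z \<cdot>\<^sub>m X) \<in> carrier_mat (k' * N) (k * N)) \<and>
     (\<forall>p<k' * N. \<forall>q<k * N. (\<lambda>z. F (z \<cdot>\<^sub>m X) $$ (p, q)) holomorphic_on ball 0 1))"

definition nc_taylor ::
  "nat \<Rightarrow> nat \<Rightarrow> nat \<Rightarrow> nat \<Rightarrow> (complex mat \<Rightarrow> complex mat) \<Rightarrow> ((nat \<times> nat) list \<Rightarrow> complex mat) \<Rightarrow> bool"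
  where
  "nc_taylor g' g k' k F a \<longleftrightarrow> (\<forall>w. a w \<in> carrier_mat k' k) \<and>
     (\<forall>N>0. \<forall>X\<in>closed_ball g' g N. \<forall>p<k' * N. \<forall>q<k * N.
       (\<lambda>z. F (z \<cdot>\<^sub>m X) $$ (p, q)) has_fps_expansion Abs_fps (\<lambda>\<alpha>. nc_coeff g' g N a X \<alpha> p q))"

lemma disc_analyticD:
  assumes "disc_analytic g' g k' k F" "N > 0" "X \<in> closed_ball g' g N"
  shows "cmod z < 1 \<Longrightarrow> F (z \<cdot>\<^sub>m X) \<in> carrier_mat (k' * N) (k * N)"
    "p < k' * N \<Longrightarrow> q < k * N \<Longrightarrow> (\<lambda>z. F (z \<cdot>\<^sub>m X) $$ (p, q)) holomorphic_on ball 0 1"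
  using assms by (auto simp: disc_analytic_def)

lemma nc_taylorD:
  assumes "nc_taylor g' g k' k F a"
  shows "a w \<in> carrier_mat k' k"
    "N > 0 \<Longrightarrow> X \<in> closed_ball g' g N \<Longrightarrow> p < k' * N \<Longrightarrow> q < k * N \<Longrightarrow>
       (\<lambda>z. F (z \<cdot>\<^sub>m X) $$ (p, q)) has_fps_expansion Abs_fps (\<lambda>\<alpha>. nc_coeff g' g N a X \<alpha> p q)"
  using assms by (auto simp: nc_taylor_def)

lemma nc_analytic_compose:
  assumes f: "nc_analytic g' g k' k f" and N: "N > 0" and K: "K > 0"
    and W: "cdomain K W" and a: "mat_analytic K W (g' * N) (g * N) a" "a ` W \<subseteq> int_ball g' g N"
  shows "mat_analytic K W (k' * N) (k * N) (f \<circ> a)"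
    and "mat_continuous (closure W) (g' * N) (g * N) a \<Longrightarrow> a ` closure W \<subseteq> int_ball g' g N \<Longrightarrow>
      mat_continuous (closure W) (k' * N) (k * N) (f \<circ> a)"
proof -
  note f[unfolded nc_analytic_def, THEN conjunct2, THEN conjunct2, rule_format, OF N K conjI[OF W conjI[OF a]]]
  then show "mat_analytic K W (k' * N) (k * N) (f \<circ> a)"
    "mat_continuous (closure W) (g' * N) (g * N) a \<Longrightarrow> a ` closure W \<subseteq> int_ball g' g N \<Longrightarrow>
      mat_continuous (closure W) (k' * N) (k * N) (f \<circ> a)"
    by simp_all
qed

lemma nc_analytic_disc_analytic:
  assumes f: "nc_analytic g' g k' k f"
  shows "disc_analytic g' g k' k f"
  unfolding disc_analytic_def
proof (intro allI impI ballI conjI)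
  fix N :: nat and X assume N: "N > 0" and X: "X \<in> closed_ball g' g N"
  show "f (z \<cdot>\<^sub>m X) \<in> carrier_mat (k' * N) (k * N)" if "cmod z < 1" for z
    using f N smult_int_ball[OF X that] by (auto simp: nc_analytic_def)
  fix p q assume pq: "p < k' * N" "q < k * N"
  define W where "W = one_var ` ball 0 1"
  define a where "a = (\<lambda>z :: nat \<Rightarrow> complex. z 0 \<cdot>\<^sub>m X)"
  have Xc: "X \<in> carrier_mat (g' * N) (g * N)" using X by (simp add: closed_ball_def)
  have "cdomain 1 W" unfolding W_def by (rule cdomain_one_var) auto
  moreover have "mat_analytic 1 W (g' * N) (g * N) a"
    unfolding mat_analytic_def
  proof (intro conjI ballI allI impI)
    show "a z \<in> carrier_mat (g' * N) (g * N)" for z using Xc by (simp add: a_def)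
    fix i j assume "i < g' * N" "j < g * N"
    then have "a y $$ (i, j) = y 0 * X $$ (i, j)" for y using Xc by (simp add: a_def)
    then show "analytic_several 1 W (\<lambda>z. a z $$ (i, j))"
      unfolding analytic_several_def
      by (intro ballI exI[of _ "\<lambda>_. X $$ (i, j)"]) (simp add: algebra_simps)
  qed
  moreover have "a ` W \<subseteq> int_ball g' g N"
    using smult_int_ball[OF X] by (auto simp: W_def a_def one_var_def)
  ultimately have "mat_analytic 1 W (k' * N) (k * N) (f \<circ> a)"
    by (intro nc_analytic_compose[OF f N]) auto
  then have "analytic_several 1 W (\<lambda>z. f (a z) $$ (p, q))" using pq by (auto simp: mat_analytic_def)
  from analytic_several_one_var[OF _ this[unfolded W_def]]
  show "(\<lambda>z. f (z \<cdot>\<^sub>m X) $$ (p, q)) holomorphic_on ball 0 1"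
    by (simp add: a_def one_var_def)
qed

lemma has_fps_expansionI_sums:
  fixes c :: "nat \<Rightarrow> complex"
  assumes e: "e > 0" and s: "\<And>z. cmod z < e \<Longrightarrow> (\<lambda>n. c n * z ^ n) sums f z"
  shows "f has_fps_expansion Abs_fps c"
  unfolding has_fps_expansion_def
proof
  have "cmod (of_real (e / 2)) \<le> conv_radius c"
    using e by (intro conv_radius_geI sums_summable[OF s]) auto
  then show "fps_conv_radius (Abs_fps c) > 0"
    using e by (auto simp: fps_conv_radius_def intro: less_le_trans[rotated])
  have "eventually (\<lambda>z :: complex. z \<in> ball 0 e) (nhds 0)" using e by (intro eventually_nhds_in_open) auto
  then show "eventually (\<lambda>z. eval_fps (Abs_fps c) z = f z) (nhds 0)"
  proof eventually_elim
    case (elim z)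
    then show ?case using sums_unique[OF s[of z]] by (simp add: eval_fps_def)
  qed
qed

lemma nc_analytic_nc_taylor:
  assumes "nc_analytic g' g k' k f"
  obtains a where "nc_taylor g' g k' k f a"
proof -
  obtain a e where a: "nc_series g' g k' k f a e" using assms unfolding nc_analytic_def by blast
  have e: "e > 0" and ac: "\<And>w. a w \<in> carrier_mat k' k" using a by (auto simp: nc_series_def)
  have "nc_taylor g' g k' k f a"
    unfolding nc_taylor_def
  proof (intro conjI allI impI ballI ac)
    fix N :: nat and X p q assume N: "N > 0" and X: "X \<in> closed_ball g' g N" and pq: "p < k' * N" "q < k * N"
    have Xc: "X \<in> carrier_mat (g' * N) (g * N)" "op_norm X \<le> 1" using X by (auto simp: closed_ball_def)
    show "(\<lambda>z. f (z \<cdot>\<^sub>m X) $$ (p, q)) has_fps_expansion Abs_fps (\<lambda>\<alpha>. nc_coeff g' g N a X \<alpha> p q)"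
    proof (rule has_fps_expansionI_sums[OF e])
      fix z assume z: "cmod z < e"
      have "cmod z * op_norm X \<le> cmod z" using Xc by (simp add: mult_left_le)
      then have "op_norm (z \<cdot>\<^sub>m X) < e" using z by (simp add: op_norm_smult[OF Xc(1)])
      then have "(\<lambda>\<alpha>. nc_coeff g' g N a (z \<cdot>\<^sub>m X) \<alpha> p q) sums (f (z \<cdot>\<^sub>m X) $$ (p, q))"
        using a N Xc pq unfolding nc_series_def nc_coeff_def by auto
      then show "(\<lambda>\<alpha>. nc_coeff g' g N a X \<alpha> p q * z ^ \<alpha>) sums (f (z \<cdot>\<^sub>m X) $$ (p, q))"
        by (simp add: nc_coeff_smult[OF Xc(1) ac pq] mult.commute)
    qed
  qed
  then show thesis by (rule that)
qed

text \<open>The Taylor series converges on the whole disc of holomorphy, so a series that represents an NC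
  function near \<open>0\<close> does so on the open unit ball.\<close>

lemma nc_taylor_sums:
  assumes F: "disc_analytic g' g k' k F" "nc_taylor g' g k' k F a"
    and "N > 0" "X \<in> closed_ball g' g N" "p < k' * N" "q < k * N" "cmod z < 1"
  shows "(\<lambda>\<alpha>. nc_coeff g' g N a X \<alpha> p q * z ^ \<alpha>) sums (F (z \<cdot>\<^sub>m X) $$ (p, q))"
  using has_fps_expansion_imp_sums_complex[OF nc_taylorD(2)[OF F(2) assms(3-6)], of 1 z]
    disc_analyticD(2)[OF F(1) assms(3-6)] assms(7) by (simp add: one_ereal_def)

lemma nc_taylor_nc_series:
  assumes F: "disc_analytic g' g k' k F" "nc_taylor g' g k' k F a"
  shows "nc_series g' g k' k F a 1"
  unfolding nc_series_def
proof (intro conjI allI impI ballI)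
  note ac = nc_taylorD(1)[OF F(2)]
  fix N :: nat and X p q
  assume N: "0 < N" and "X \<in> carrier_mat (g' * N) (g * N)" "op_norm X < 1" and pq: "p < k' * N" "q < k * N"
  then have "X \<in> int_ball g' g N" by (simp add: int_ball_def)
  then obtain r :: real and Y where r: "0 < r" "r < 1" "Y \<in> closed_ball g' g N" "X = complex_of_real r \<cdot>\<^sub>m Y"
    by (rule int_ball_eq_smult)
  have Y: "Y \<in> carrier_mat (g' * N) (g * N)" using r by (simp add: closed_ball_def)
  have "(\<lambda>\<alpha>. nc_coeff g' g N a Y \<alpha> p q * complex_of_real r ^ \<alpha>) sums (F X $$ (p, q))"
    unfolding r(4) using r by (intro nc_taylor_sums[OF F N r(3) pq]) auto
  then show "(\<lambda>\<alpha>. \<Sum>w\<in>words g' g \<alpha>. kron (a w) (word_eval N X w) $$ (p, q)) sums (F X $$ (p, q))"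
    unfolding nc_coeff_def[symmetric] r(4) nc_coeff_smult[OF Y ac pq] by (simp add: mult.commute)
qed (use nc_taylorD(1)[OF F(2)] in auto)

subsection \<open>Linear operations on series\<close>

lemma nc_coeff_mult_left:
  assumes Q: "Q \<in> carrier_mat k'' k'" and a: "\<And>w. a w \<in> carrier_mat k' k"
    and pq: "p < k'' * N" "q < k * N"
  shows "nc_coeff g' g N (\<lambda>w. Q * a w) X \<alpha> p q =
    (\<Sum>r<k' * N. kron Q (1\<^sub>m N) $$ (p, r) * nc_coeff g' g N a X \<alpha> r q)"
proof -
  have "kron (Q * a w) (word_eval N X w) $$ (p, q) =
      (\<Sum>r<k' * N. kron Q (1\<^sub>m N) $$ (p, r) * kron (a w) (word_eval N X w) $$ (r, q))" for w
  proof -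
    have "kron (Q * a w) (word_eval N X w) = kron Q (1\<^sub>m N) * kron (a w) (word_eval N X w)"
      using kron_mult[OF Q one_carrier_mat[of N] a[of w] word_eval_carrier[of N X w]] by (simp add: mat_one_mult)
    then show ?thesis
      using index_mat_mat[OF kron_carrier[OF Q one_carrier_mat] kron_carrier[OF a word_eval_carrier] pq] by simp
  qed
  then have "nc_coeff g' g N (\<lambda>w. Q * a w) X \<alpha> p q = (\<Sum>w\<in>words g' g \<alpha>. 
      \<Sum>r<k' * N. kron Q (1\<^sub>m N) $$ (p, r) * kron (a w) (word_eval N X w) $$ (r, q))"
    by (simp add: nc_coeff_def)
  then show ?thesis unfolding nc_coeff_def sum_distrib_left by (subst (asm) sum.swap)
qed

lemma has_fps_expansion_lincomb:
  fixes F :: "'i \<Rightarrow> complex \<Rightarrow> complex"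
  assumes "\<And>r. r \<in> I \<Longrightarrow> F r has_fps_expansion Abs_fps (c r)" "finite I"
  shows "(\<lambda>z. \<Sum>r\<in>I. b r * F r z) has_fps_expansion Abs_fps (\<lambda>\<alpha>. \<Sum>r\<in>I. b r * c r (\<alpha> :: nat))"
proof -
  have "(\<lambda>z. \<Sum>r\<in>I. b r * F r z) has_fps_expansion (\<Sum>r\<in>I. fps_const (b r) * Abs_fps (c r))"
    using assms by (intro fps_expansion_intros) auto
  also have "(\<Sum>r\<in>I. fps_const (b r) * Abs_fps (c r)) = Abs_fps (\<lambda>\<alpha>. \<Sum>r\<in>I. b r * c r \<alpha>)"
    by (rule fps_ext) (simp add: fps_sum_nth)
  finally show ?thesis .
qed

text \<open>The coefficients of \<open>X \<mapsto> P \<otimes> 1 - (Q \<otimes> 1) F(X)\<close>.\<close>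

definition affine_coeff ::
  "complex mat \<Rightarrow> complex mat \<Rightarrow> ((nat \<times> nat) list \<Rightarrow> complex mat) \<Rightarrow> (nat \<times> nat) list \<Rightarrow> complex mat" where
  "affine_coeff P Q a w = (if w = [] then P - Q * a w else - (1 :: complex) \<cdot>\<^sub>m (Q * a w))"

lemma affine_coeff_carrier:
  "P \<in> carrier_mat k'' k \<Longrightarrow> Q \<in> carrier_mat k'' k' \<Longrightarrow> a w \<in> carrier_mat k' k \<Longrightarrow>
    affine_coeff P Q a w \<in> carrier_mat k'' k"
  by (auto simp: affine_coeff_def intro!: carrier_matI)

lemma has_fps_expansion_affine:
  assumes F: "nc_taylor g' g k' k F a" and P: "P \<in> carrier_mat k'' k" and Q: "Q \<in> carrier_mat k'' k'"
    and N: "N > 0" and X: "X \<in> closed_ball g' g N" and pq: "p < k'' * N" "q < k * N"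
    and G: "\<And>z. cmod z < 1 \<Longrightarrow> F (z \<cdot>\<^sub>m X) \<in> carrier_mat (k' * N) (k * N)"
  shows "(\<lambda>z. (kron P (1\<^sub>m N) - kron Q (1\<^sub>m N) * F (z \<cdot>\<^sub>m X)) $$ (p, q)) has_fps_expansion
    Abs_fps (\<lambda>\<alpha>. nc_coeff g' g N (affine_coeff P Q a) X \<alpha> p q)"
proof -
  note ac = nc_taylorD(1)[OF F]
  define H where "H = (\<lambda>z. kron P (1\<^sub>m N) $$ (p, q) - (\<Sum>r<k' * N. kron Q (1\<^sub>m N) $$ (p, r) * F (z \<cdot>\<^sub>m X) $$ (r, q)))"
  have Hexp: "H has_fps_expansion fps_const (kron P (1\<^sub>m N) $$ (p, q)) -
      Abs_fps (\<lambda>\<alpha>. \<Sum>r<k' * N. kron Q (1\<^sub>m N) $$ (p, r) * nc_coeff g' g N a X \<alpha> r q)"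
    unfolding H_def using pq nc_taylorD(2)[OF F N X]
    by (intro fps_expansion_intros has_fps_expansion_lincomb) auto
  have ev: "eventually (\<lambda>z :: complex. z \<in> ball 0 1) (nhds 0)" by (rule eventually_nhds_in_open) auto
  have "eventually (\<lambda>z. H z = (kron P (1\<^sub>m N) - kron Q (1\<^sub>m N) * F (z \<cdot>\<^sub>m X)) $$ (p, q)) (nhds 0)"
    using ev
  proof eventually_elim
    case (elim z)
    then have "F (z \<cdot>\<^sub>m X) \<in> carrier_mat (k' * N) (k * N)" using G by simp
    then show ?case using P Q pq
      index_mat_mat[of "kron Q (1\<^sub>m N)" "k'' * N" "k' * N" "F (z \<cdot>\<^sub>m X)" "k * N" p q]
      by (simp add: H_def)
  qed
  moreover have "fps_const (kron P (1\<^sub>m N) $$ (p, q)) -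
      Abs_fps (\<lambda>\<alpha>. \<Sum>r<k' * N. kron Q (1\<^sub>m N) $$ (p, r) * nc_coeff g' g N a X \<alpha> r q) =
      Abs_fps (\<lambda>\<alpha>. nc_coeff g' g N (affine_coeff P Q a) X \<alpha> p q)"
  proof (rule fps_ext)
    fix \<alpha>
    obtain b s c t where i: "b < k''" "s < N" "p = b * N + s" "c < k" "t < N" "q = c * N + t"
      using pq by (metis block_index_cases)
    have Qa: "Q * a w \<in> carrier_mat k'' k" for w using Q ac by simp
    have "(if \<alpha> = 0 then kron P (1\<^sub>m N) $$ (p, q) else 0) - nc_coeff g' g N (\<lambda>w. Q * a w) X \<alpha> p q =
      nc_coeff g' g N (affine_coeff P Q a) X \<alpha> p q"
    proof (cases "\<alpha> = 0")
      case True
      have PQ: "P - Q * a [] \<in> carrier_mat k'' k" using Qa[of "[]"] by (rule minus_carrier_mat)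
      have m: "(P - Q * a []) $$ (b, c) = P $$ (b, c) - (Q * a []) $$ (b, c)"
        using i carrier_matD[OF Qa[of "[]"]] by (intro index_minus_mat(1)) metis+
      have "kron (P - Q * a []) (1\<^sub>m N) $$ (p, q) = kron P (1\<^sub>m N) $$ (p, q) - kron (Q * a []) (1\<^sub>m N) $$ (p, q)"
        unfolding i(3,6) index_kron[OF PQ one_carrier_mat i(1,4,2,5)] index_kron[OF P one_carrier_mat i(1,4,2,5)]
          index_kron[OF Qa one_carrier_mat i(1,4,2,5)] m by (rule left_diff_distrib)
      then show ?thesis using True by (simp add: nc_coeff_def affine_coeff_def)
    next
      case False
      have "nc_coeff g' g N (affine_coeff P Q a) X \<alpha> p q = - nc_coeff g' g N (\<lambda>w. Q * a w) X \<alpha> p q"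
        unfolding nc_coeff_def sum_negf[symmetric]
      proof (rule sum.cong[OF refl])
        fix w assume "w \<in> words g' g \<alpha>"
        then have "w \<noteq> []" using False by (auto simp: words_def)
        moreover have "- (1 :: complex) \<cdot>\<^sub>m (Q * a w) \<in> carrier_mat k'' k" using Qa[of w] by simp
        ultimately show "kron (affine_coeff P Q a w) (word_eval N X w) $$ (p, q) =
          - kron (Q * a w) (word_eval N X w) $$ (p, q)"
          using Qa[of w] i Q ac[of w] 
          by (simp add: affine_coeff_def index_kron[of _ k'' k _ N N] del: index_mult_mat(1))
      qed
      then show ?thesis using False by simp
    qed
    then show "fps_nth (fps_const (kron P (1\<^sub>m N) $$ (p, q)) -
      Abs_fps (\<lambda>\<alpha>. \<Sum>r<k' * N. kron Q (1\<^sub>m N) $$ (p, r) * nc_coeff g' g N a X \<alpha> r q)) \<alpha> =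
      fps_nth (Abs_fps (\<lambda>\<alpha>. nc_coeff g' g N (affine_coeff P Q a) X \<alpha> p q)) \<alpha>"
      by (simp add: nc_coeff_mult_left[OF Q ac pq])
  qed
  ultimately show ?thesis using Hexp has_fps_expansion_cong by metis
qed

subsection \<open>Division of series\<close>

lemma sum_words_split:
  assumes "i \<le> \<alpha>"
  shows "(\<Sum>w\<in>words g' g \<alpha>. h (take i w) (drop i w)) =
    (\<Sum>u\<in>words g' g i. \<Sum>v\<in>words g' g (\<alpha> - i). h u v)"
proof -
  have "(\<Sum>u\<in>words g' g i. \<Sum>v\<in>words g' g (\<alpha> - i). h u v) =
      (\<Sum>(u, v)\<in>words g' g i \<times> words g' g (\<alpha> - i). h u v)"
    by (simp add: sum.cartesian_product)
  also have "\<dots> = (\<Sum>w\<in>words g' g \<alpha>. h (take i w) (drop i w))"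
    by (rule sum.reindex_bij_witness[where i = "\<lambda>w. (take i w, drop i w)" and j = "\<lambda>(u, v). u @ v"])
      (use assms in \<open>auto simp: words_def dest: in_set_takeD in_set_dropD\<close>)
  finally show ?thesis by simp
qed

text \<open>Multiplication of noncommutative series is convolution over factorisations of words.\<close>

lemma nc_coeff_convolution:
  assumes b: "\<And>w. b w \<in> carrier_mat k' n" and m: "\<And>w. m w \<in> carrier_mat n k"
    and h: "\<And>w. h w \<in> carrier_mat k' k"
    and conv: "\<And>w a c. a < k' \<Longrightarrow> c < k \<Longrightarrow> h w $$ (a, c) = (\<Sum>i\<le>length w. (b (take i w) * m (drop i w)) $$ (a, c))"
    and pq: "p < k' * N" "q < k * N"
  shows "(\<Sum>i\<le>\<alpha>. \<Sum>r<n * N. nc_coeff g' g N b X i p r * nc_coeff g' g N m X (\<alpha> - i) r q) =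
    nc_coeff g' g N h X \<alpha> p q"
proof -
  let ?e = "word_eval N X"
  obtain a s c t where i: "a < k'" "s < N" "p = a * N + s" "c < k" "t < N" "q = c * N + t"
    using pq by (metis block_index_cases)
  have bm: "b u * m v \<in> carrier_mat k' k" for u v by (rule mult_carrier_mat[OF b m])
  have "nc_coeff g' g N h X \<alpha> p q =
      (\<Sum>w\<in>words g' g \<alpha>. \<Sum>j\<le>\<alpha>. (b (take j w) * m (drop j w)) $$ (a, c) * ?e w $$ (s, t))"
    unfolding nc_coeff_def
  proof (rule sum.cong[OF refl])
    fix w assume "w \<in> words g' g \<alpha>"
    then have "length w = \<alpha>" by (simp add: words_def)
    then show "kron (h w) (?e w) $$ (p, q) = (\<Sum>j\<le>\<alpha>. (b (take j w) * m (drop j w)) $$ (a, c) * ?e w $$ (s, t))"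
      unfolding i(3,6) index_kron[OF h word_eval_carrier i(1,4,2,5)] conv[OF i(1,4)] sum_distrib_right by simp
  qed
  also have "\<dots> = (\<Sum>j\<le>\<alpha>. \<Sum>w\<in>words g' g \<alpha>. (b (take j w) * m (drop j w)) $$ (a, c) * ?e (take j w @ drop j w) $$ (s, t))"
    by (subst sum.swap) (simp only: append_take_drop_id)
  also have "\<dots> = (\<Sum>j\<le>\<alpha>. \<Sum>u\<in>words g' g j. \<Sum>v\<in>words g' g (\<alpha> - j). (b u * m v) $$ (a, c) * ?e (u @ v) $$ (s, t))"
  proof (rule sum.cong[OF refl])
    fix j assume "j \<in> {..\<alpha>}"
    then have "j \<le> \<alpha>" by simp
    from sum_words_split[OF this, of "\<lambda>u v. (b u * m v) $$ (a, c) * ?e (u @ v) $$ (s, t)" g' g]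
    show "(\<Sum>w\<in>words g' g \<alpha>. (b (take j w) * m (drop j w)) $$ (a, c) * ?e (take j w @ drop j w) $$ (s, t)) =
      (\<Sum>u\<in>words g' g j. \<Sum>v\<in>words g' g (\<alpha> - j). (b u * m v) $$ (a, c) * ?e (u @ v) $$ (s, t))" .
  qed
  also have "\<dots> = (\<Sum>j\<le>\<alpha>. \<Sum>r<n * N. nc_coeff g' g N b X j p r * nc_coeff g' g N m X (\<alpha> - j) r q)"
  proof (rule sum.cong[OF refl])
    fix j
    have "(b u * m v) $$ (a, c) * ?e (u @ v) $$ (s, t) =
        (\<Sum>r<n * N. kron (b u) (?e u) $$ (p, r) * kron (m v) (?e v) $$ (r, q))" for u v
    proof -
      have "(b u * m v) $$ (a, c) * ?e (u @ v) $$ (s, t) = kron (b u * m v) (?e u * ?e v) $$ (p, q)"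
        unfolding i(3,6) word_eval_append
        by (rule index_kron[OF bm mult_carrier_mat[OF word_eval_carrier word_eval_carrier] i(1,4,2,5), symmetric])
      also have "kron (b u * m v) (?e u * ?e v) = kron (b u) (?e u) * kron (m v) (?e v)"
        by (rule kron_mult[OF b word_eval_carrier m word_eval_carrier, symmetric])
      also have "(\<dots>) $$ (p, q) = (\<Sum>r<n * N. kron (b u) (?e u) $$ (p, r) * kron (m v) (?e v) $$ (r, q))"
        by (rule index_mat_mat[OF kron_carrier[OF b word_eval_carrier] kron_carrier[OF m word_eval_carrier] pq])
      finally show ?thesis .
    qed
    then have "(\<Sum>u\<in>words g' g j. \<Sum>v\<in>words g' g (\<alpha> - j). (b u * m v) $$ (a, c) * ?e (u @ v) $$ (s, t)) =
        (\<Sum>u\<in>words g' g j. \<Sum>v\<in>words g' g (\<alpha> - j). \<Sum>r<n * N. kron (b u) (?e u) $$ (p, r) * kron (m v) (?e v) $$ (r, q))"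
      by simp
    also have "\<dots> = (\<Sum>u\<in>words g' g j. \<Sum>r<n * N. \<Sum>v\<in>words g' g (\<alpha> - j). kron (b u) (?e u) $$ (p, r) * kron (m v) (?e v) $$ (r, q))"
      by (rule sum.cong[OF refl], rule sum.swap)
    also have "\<dots> = (\<Sum>r<n * N. \<Sum>u\<in>words g' g j. \<Sum>v\<in>words g' g (\<alpha> - j). kron (b u) (?e u) $$ (p, r) * kron (m v) (?e v) $$ (r, q))"
      by (rule sum.swap)
    also have "\<dots> = (\<Sum>r<n * N. nc_coeff g' g N b X j p r * nc_coeff g' g N m X (\<alpha> - j) r q)"
      unfolding nc_coeff_def sum_product ..
    finally show "(\<Sum>u\<in>words g' g j. \<Sum>v\<in>words g' g (\<alpha> - j). (b u * m v) $$ (a, c) * ?e (u @ v) $$ (s, t)) =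
      (\<Sum>r<n * N. nc_coeff g' g N b X j p r * nc_coeff g' g N m X (\<alpha> - j) r q)" .
  qed
  finally show ?thesis by (rule sym)
qed

text \<open>The coefficients of the quotient \<open>h m\<^sup>-\<^sup>1\<close>, where \<open>r\<close> is the inverse of the constant
  coefficient of \<open>m\<close>, by recursion on the length of the word.\<close>

function quot_coeff where
  "quot_coeff k' n h m r w = Matrix.mat k' n (\<lambda>(a, c). h w $$ (a, c) -
     (\<Sum>i<length w. (quot_coeff k' n h m r (take i w) * m (drop i w)) $$ (a, c))) * (r :: complex mat)"
  by auto
termination by (relation "Wellfounded.measure (\<lambda>(_, _, _, _, _, w). length w)") auto

declare quot_coeff.simps [simp del]

lemma quot_coeff_carrier: "r \<in> carrier_mat n n \<Longrightarrow> quot_coeff k' n h m r w \<in> carrier_mat k' n"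
  by (subst quot_coeff.simps) (rule mult_carrier_mat[of _ _ n], auto)

lemma quot_coeff_convolution:
  assumes r: "r \<in> carrier_mat n n" and m: "\<And>w. m w \<in> carrier_mat n n" and rm: "r * m [] = 1\<^sub>m n"
    and ac: "a < k'" "c < n"
  shows "h w $$ (a, c) = (\<Sum>i\<le>length w. (quot_coeff k' n h m r (take i w) * m (drop i w)) $$ (a, c))"
proof -
  let ?T = "Matrix.mat k' n (\<lambda>(a, c). h w $$ (a, c) -
     (\<Sum>i<length w. (quot_coeff k' n h m r (take i w) * m (drop i w)) $$ (a, c)))"
  have "quot_coeff k' n h m r w * m [] = ?T * r * m []" by (subst quot_coeff.simps) (rule refl)
  also have "\<dots> = ?T" using r m[of "[]"] rm by (subst mat_assoc) (auto simp: mat_one_mult)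
  finally have "(quot_coeff k' n h m r w * m []) $$ (a, c) = h w $$ (a, c) -
     (\<Sum>i<length w. (quot_coeff k' n h m r (take i w) * m (drop i w)) $$ (a, c))"
    using ac by simp
  moreover have "{..length w} = insert (length w) {..<length w}" by auto
  ultimately show ?thesis by simp
qed

lemma has_fps_expansion_ev_cong:
  "f has_fps_expansion F \<Longrightarrow> eventually (\<lambda>z. f z = h z) (nhds 0) \<Longrightarrow> h has_fps_expansion F"
  using has_fps_expansion_cong[OF _ refl] by blast

text \<open>If \<open>S M = H\<close> where \<open>M\<close> and \<open>H\<close> have noncommutative Taylor series and the constant coefficient of
  \<open>M\<close> is invertible, then so has \<open>S\<close>. The Taylor coefficients of \<open>S\<close> along each disc and those given by
  \<open>quot_coeff\<close> solve the same convolution equation, which determines them degree by degree.\<close>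

lemma nc_taylor_divide:
  fixes M H :: "nat \<Rightarrow> complex mat \<Rightarrow> complex \<Rightarrow> complex mat"
  assumes S: "disc_analytic g' g k' n S"
    and m: "\<And>w. m w \<in> carrier_mat n n" and h: "\<And>w. h w \<in> carrier_mat k' n"
    and r: "r \<in> carrier_mat n n" "r * m [] = 1\<^sub>m n" "m [] * r = 1\<^sub>m n"
    and Mc: "\<And>N X z. N > 0 \<Longrightarrow> X \<in> closed_ball g' g N \<Longrightarrow> cmod z < 1 \<Longrightarrow> M N X z \<in> carrier_mat (n * N) (n * N)"
    and M: "\<And>N X p q. N > 0 \<Longrightarrow> X \<in> closed_ball g' g N \<Longrightarrow> p < n * N \<Longrightarrow> q < n * N \<Longrightarrow>
      (\<lambda>z. M N X z $$ (p, q)) has_fps_expansion Abs_fps (\<lambda>\<alpha>. nc_coeff g' g N m X \<alpha> p q)"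
    and H: "\<And>N X p q. N > 0 \<Longrightarrow> X \<in> closed_ball g' g N \<Longrightarrow> p < k' * N \<Longrightarrow> q < n * N \<Longrightarrow>
      (\<lambda>z. H N X z $$ (p, q)) has_fps_expansion Abs_fps (\<lambda>\<alpha>. nc_coeff g' g N h X \<alpha> p q)"
    and eq: "\<And>N X z. N > 0 \<Longrightarrow> X \<in> closed_ball g' g N \<Longrightarrow> cmod z < 1 \<Longrightarrow> S (z \<cdot>\<^sub>m X) * M N X z = H N X z"
  shows "nc_taylor g' g k' n S (quot_coeff k' n h m r)"
  unfolding nc_taylor_def
proof (intro conjI allI impI ballI)
  let ?b = "quot_coeff k' n h m r"
  have b: "?b w \<in> carrier_mat k' n" for w by (rule quot_coeff_carrier[OF r(1)])
  then show "?b w \<in> carrier_mat k' n" for w .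
  fix N :: nat and X p q assume N: "N > 0" and X: "X \<in> closed_ball g' g N" and pq: "p < k' * N" "q < n * N"
  define \<sigma> where "\<sigma> = (\<lambda>l. fps_expansion (\<lambda>z. S (z \<cdot>\<^sub>m X) $$ (p, l)) 0)"
  have \<sigma>: "(\<lambda>z. S (z \<cdot>\<^sub>m X) $$ (p, l)) has_fps_expansion \<sigma> l" if "l < n * N" for l
    unfolding \<sigma>_def using disc_analyticD(2)[OF S N X pq(1) that]
    by (intro has_fps_expansion_fps_expansion[of "ball 0 1"]) auto
  have ev: "eventually (\<lambda>z :: complex. z \<in> ball 0 1) (nhds 0)" by (rule eventually_nhds_in_open) auto
  have conv: "(\<Sum>i\<le>\<alpha>. \<Sum>l<n * N. fps_nth (\<sigma> l) i * nc_coeff g' g N m X (\<alpha> - i) l s) = nc_coeff g' g N h X \<alpha> p s"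
    if s: "s < n * N" for \<alpha> s
  proof -
    let ?\<mu> = "\<lambda>l. Abs_fps (\<lambda>\<alpha>. nc_coeff g' g N m X \<alpha> l s)"
    have "(\<lambda>z. \<Sum>l<n * N. S (z \<cdot>\<^sub>m X) $$ (p, l) * M N X z $$ (l, s)) has_fps_expansion (\<Sum>l<n * N. \<sigma> l * ?\<mu> l)"
      using s by (intro fps_expansion_intros \<sigma> M[OF N X]) auto
    moreover have "eventually (\<lambda>z. (\<Sum>l<n * N. S (z \<cdot>\<^sub>m X) $$ (p, l) * M N X z $$ (l, s)) = H N X z $$ (p, s)) (nhds 0)"
      using ev
    proof eventually_elim
      case (elim z)
      then have z: "cmod z < 1" by simp
      show ?case unfolding eq[OF N X z, symmetric]
        by (rule index_mat_mat[OF disc_analyticD(1)[OF S N X z] Mc[OF N X z] pq(1) s, symmetric])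
    qed
    ultimately have "(\<lambda>z. H N X z $$ (p, s)) has_fps_expansion (\<Sum>l<n * N. \<sigma> l * ?\<mu> l)"
      by (rule has_fps_expansion_ev_cong)
    from fps_expansion_unique_complex[OF this H[OF N X pq(1) s]]
    have "fps_nth (\<Sum>l<n * N. \<sigma> l * ?\<mu> l) \<alpha> = nc_coeff g' g N h X \<alpha> p s" by simp
    then show ?thesis
      by (subst sum.swap) (simp add: fps_sum_nth fps_mult_nth atLeast0AtMost)
  qed
  have conv_b: "(\<Sum>i\<le>\<alpha>. \<Sum>l<n * N. nc_coeff g' g N ?b X i p l * nc_coeff g' g N m X (\<alpha> - i) l s) = nc_coeff g' g N h X \<alpha> p s"
    if s: "s < n * N" for \<alpha> s
    by (rule nc_coeff_convolution[OF b m h quot_coeff_convolution[where m = m, OF r(1) m r(2)] pq(1) s])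
  have "fps_nth (\<sigma> l) \<alpha> = nc_coeff g' g N ?b X \<alpha> p l" if "l < n * N" for \<alpha> l
    using that
  proof (induction \<alpha> arbitrary: l rule: less_induct)
    case (less \<alpha>)
    let ?\<delta> = "\<lambda>l. fps_nth (\<sigma> l) \<alpha> - nc_coeff g' g N ?b X \<alpha> p l"
    have z: "(\<Sum>l<n * N. ?\<delta> l * kron (m []) (1\<^sub>m N) $$ (l, s)) = 0" if s: "s < n * N" for s
    proof -
      have split: "(\<Sum>i\<le>\<alpha>. f i) = (\<Sum>i<\<alpha>. f i) + f \<alpha>" for f :: "nat \<Rightarrow> complex"
        by (cases \<alpha>) (simp_all add: lessThan_Suc_atMost)
      have "(\<Sum>i<\<alpha>. \<Sum>l<n * N. fps_nth (\<sigma> l) i * nc_coeff g' g N m X (\<alpha> - i) l s) =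
        (\<Sum>i<\<alpha>. \<Sum>l<n * N. nc_coeff g' g N ?b X i p l * nc_coeff g' g N m X (\<alpha> - i) l s)"
        using less.IH by (intro sum.cong refl) simp
      moreover have "y = z" if "x + y = c" "x' + z = c" "x = x'" for x x' y z c :: complex
        using that by (metis add_left_cancel)
      ultimately have "(\<Sum>l<n * N. fps_nth (\<sigma> l) \<alpha> * nc_coeff g' g N m X (\<alpha> - \<alpha>) l s) =
          (\<Sum>l<n * N. nc_coeff g' g N ?b X \<alpha> p l * nc_coeff g' g N m X (\<alpha> - \<alpha>) l s)"
        using conv[OF s, of \<alpha>, unfolded split] conv_b[OF s, of \<alpha>, unfolded split] by blast
      then show ?thesis by (simp add: nc_coeff_def left_diff_distrib sum_subtractf)
    qed
    have one: "(\<Sum>s<n * N. kron (m []) (1\<^sub>m N) $$ (t, s) * kron r (1\<^sub>m N) $$ (s, l)) = (if t = l then 1 else 0)"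
      if "t < n * N" for t
    proof -
      have "kron (m []) (1\<^sub>m N) * kron r (1\<^sub>m N) = 1\<^sub>m (n * N)"
        using kron_mult[OF m one_carrier_mat r(1) one_carrier_mat, of "[]" N] r(3) by (simp add: mat_one_mult)
      then show ?thesis
        using index_mat_mat[OF kron_carrier[OF m one_carrier_mat] kron_carrier[OF r(1) one_carrier_mat] that less.prems, of "[]"]
          that less.prems by simp
    qed
    have "?\<delta> l = (\<Sum>t<n * N. ?\<delta> t * (if t = l then 1 else 0))"
      using less.prems by (simp add: if_distrib cong: if_cong)
    also have "\<dots> = (\<Sum>t<n * N. ?\<delta> t * (\<Sum>s<n * N. kron (m []) (1\<^sub>m N) $$ (t, s) * kron r (1\<^sub>m N) $$ (s, l)))"
      by (intro sum.cong refl) (simp add: one)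
    also have "\<dots> = (\<Sum>s<n * N. (\<Sum>t<n * N. ?\<delta> t * kron (m []) (1\<^sub>m N) $$ (t, s)) * kron r (1\<^sub>m N) $$ (s, l))"
      unfolding sum_distrib_left sum_distrib_right by (subst sum.swap) (simp add: mult.assoc)
    also have "\<dots> = 0" using z by simp
    finally show ?case by simp
  qed
  then have "\<sigma> q = Abs_fps (\<lambda>\<alpha>. nc_coeff g' g N ?b X \<alpha> p q)"
    using pq by (intro fps_ext) simp
  then show "(\<lambda>z. S (z \<cdot>\<^sub>m X) $$ (p, q)) has_fps_expansion Abs_fps (\<lambda>\<alpha>. nc_coeff g' g N ?b X \<alpha> p q)"
    using \<sigma>[OF pq(2)] by simp
qed

section \<open>Composition with a linear pencil and with a ball automorphism\<close>

lemma pencil_eval_carrier: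
  assumes "X \<in> carrier_mat (g' * N) (g * N)" "g' > 0"
  shows "pencil_eval g' g d' d A X \<in> carrier_mat (d' * N) (d * N)"
  using assms by (auto simp: pencil_eval_def Let_def)

lemma index_pencil_eval:
  assumes A: "linear_pencil g' g d' d A" and X: "X \<in> carrier_mat (g' * N) (g * N)" and g': "g' > 0"
    and i: "a < d'" "s < N" "c < d" "t < N"
  shows "pencil_eval g' g d' d A X $$ (a * N + s, c * N + t) =
    (\<Sum>i<g'. \<Sum>j<g. A i j $$ (a, c) * X $$ (i * N + s, j * N + t))"
proof -
  have N: "dim_row X div g' = N" using X g' by simp
  have "kron (A k l) (block N X k l) $$ (a * N + s, c * N + t) = A k l $$ (a, c) * X $$ (k * N + s, l * N + t)"
    if "k < g'" "l < g" for k l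
  proof -
    have "A k l \<in> carrier_mat d' d" using A that by (auto simp: linear_pencil_def)
    from index_kron[OF this block_carrier i(1,3,2,4)] show ?thesis using i by (simp add: block_def)
  qed
  then show ?thesis
    unfolding pencil_eval_def Let_def N using i by (simp add: block_index_less)
qed

context inverse_closed_algebra
begin

lemma mat_alg_pencil:
  assumes A: "linear_pencil g' g d' d A" and g': "g' > 0" and F: "mat_alg (g' * N) (g * N) F"
  shows "mat_alg (d' * N) (d * N) (\<lambda>z. pencil_eval g' g d' d A (F z))"
proof (rule mat_algI[where G = "\<lambda>p q z. \<Sum>i<g'. \<Sum>j<g. A i j $$ (p div N, q div N) *
    F z $$ (i * N + p mod N, j * N + q mod N)"])
  show "pencil_eval g' g d' d A (F z) \<in> carrier_mat (d' * N) (d * N)" if "z \<in> S" for z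
    by (rule pencil_eval_carrier[OF mat_algD(1)[OF F that] g'])
  fix p q assume pq: "p < d' * N" "q < d * N"
  obtain a s c t where i: "a < d'" "s < N" "p = a * N + s" "c < d" "t < N" "q = c * N + t"
    using pq by (metis block_index_cases)
  have st: "p div N = a" "p mod N = s" "q div N = c" "q mod N = t" using i by auto
  show "alg (\<lambda>z. \<Sum>i<g'. \<Sum>j<g. A i j $$ (p div N, q div N) * F z $$ (i * N + p mod N, j * N + q mod N))"
    unfolding st using i by (intro alg_sum alg_mult alg_const mat_algD(2)[OF F]) (auto simp: block_index_less)
  show "(\<Sum>i<g'. \<Sum>j<g. A i j $$ (p div N, q div N) * F z $$ (i * N + p mod N, j * N + q mod N)) =
      pencil_eval g' g d' d A (F z) $$ (p, q)" if "z \<in> S" for z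
    unfolding st by (rule index_pencil_eval[OF A mat_algD(1)[OF F that] g' i(1,2,4,5), symmetric, folded i(3,6)])
qed

end

lemma inverse_closed_algebra_holomorphic: "inverse_closed_algebra S (\<lambda>f. f holomorphic_on S)"
proof
  fix F G :: "complex \<Rightarrow> complex" assume F: "F holomorphic_on S"
  show "(\<lambda>z. inverse (F z)) holomorphic_on S" if "\<And>z. z \<in> S \<Longrightarrow> F z \<noteq> 0"
    using that by (intro holomorphic_intros F) auto
  show "G holomorphic_on S" if "\<And>z. z \<in> S \<Longrightarrow> F z = G z"
    using holomorphic_transform[OF F that] .
  assume G: "G holomorphic_on S"
  show "(\<lambda>z. F z + G z) holomorphic_on S" "(\<lambda>z. F z * G z) holomorphic_on S"
    by (intro holomorphic_intros F G)+
qed simp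

interpretation disc: inverse_closed_algebra "ball 0 1" "\<lambda>f. f holomorphic_on ball 0 1"
  by (rule inverse_closed_algebra_holomorphic)

lemma disc_analytic_alt:
  "disc_analytic g' g k' k F \<longleftrightarrow> (\<forall>N>0. \<forall>X\<in>closed_ball g' g N. disc.mat_alg (k' * N) (k * N) (\<lambda>z. F (z \<cdot>\<^sub>m X)))"
  unfolding disc_analytic_def disc.mat_alg_def by (simp add: Ball_def)

lemma nc_taylor_pencil:
  assumes A: "linear_pencil g' g d' d A" and g': "g' > 0"
    and F: "disc_analytic h' h g' g F" "nc_taylor h' h g' g F a"
  shows "nc_taylor h' h d' d (\<lambda>X. pencil_eval g' g d' d A (F X)) (\<lambda>w. pencil_eval g' g d' d A (a w))"
  unfolding nc_taylor_def
proof (intro conjI allI impI ballI)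
  note a = nc_taylorD(1)[OF F(2)]
  have a1: "a w \<in> carrier_mat (g' * 1) (g * 1)" for w using a by simp
  have La: "pencil_eval g' g d' d A (a w) \<in> carrier_mat d' d" for w
    using pencil_eval_carrier[OF a1 g', of d' d A] by simp
  then show "pencil_eval g' g d' d A (a w) \<in> carrier_mat d' d" for w .
  fix N :: nat and X p q assume N: "N > 0" and X: "X \<in> closed_ball h' h N" and pq: "p < d' * N" "q < d * N"
  obtain b s c t where i: "b < d'" "s < N" "p = b * N + s" "c < d" "t < N" "q = c * N + t"
    using pq by (metis block_index_cases)
  let ?I = "{..<g'} \<times> {..<g}"
  have "(\<lambda>z. \<Sum>(i, j)\<in>?I. A i j $$ (b, c) * F (z \<cdot>\<^sub>m X) $$ (i * N + s, j * N + t)) has_fps_expansion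
      Abs_fps (\<lambda>\<alpha>. \<Sum>(i, j)\<in>?I. A i j $$ (b, c) * nc_coeff h' h N a X \<alpha> (i * N + s) (j * N + t))"
    using has_fps_expansion_lincomb[of ?I "\<lambda>(i, j) z. F (z \<cdot>\<^sub>m X) $$ (i * N + s, j * N + t)"
        "\<lambda>(i, j) \<alpha>. nc_coeff h' h N a X \<alpha> (i * N + s) (j * N + t)" "\<lambda>(i, j). A i j $$ (b, c)"]
      nc_taylorD(2)[OF F(2) N X] i by (auto simp: case_prod_beta block_index_less)
  moreover have "eventually (\<lambda>z. (\<Sum>(i, j)\<in>?I. A i j $$ (b, c) * F (z \<cdot>\<^sub>m X) $$ (i * N + s, j * N + t)) =
      pencil_eval g' g d' d A (F (z \<cdot>\<^sub>m X)) $$ (p, q)) (nhds 0)"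
  proof -
    have "eventually (\<lambda>z :: complex. z \<in> ball 0 1) (nhds 0)" by (rule eventually_nhds_in_open) auto
    then show ?thesis
    proof eventually_elim
      case (elim z)
      then have "F (z \<cdot>\<^sub>m X) \<in> carrier_mat (g' * N) (g * N)" using disc_analyticD(1)[OF F(1) N X] by simp
      from index_pencil_eval[OF A this g' i(1,2,4,5)] show ?case
        unfolding i(3,6) by (simp add: sum.cartesian_product)
    qed
  qed
  moreover have "(\<Sum>(i, j)\<in>?I. A i j $$ (b, c) * nc_coeff h' h N a X \<alpha> (i * N + s) (j * N + t)) =
      nc_coeff h' h N (\<lambda>w. pencil_eval g' g d' d A (a w)) X \<alpha> p q" for \<alpha>
  proof -
    have "kron (pencil_eval g' g d' d A (a w)) (word_eval N X w) $$ (p, q) =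
        (\<Sum>(i, j)\<in>?I. A i j $$ (b, c) * kron (a w) (word_eval N X w) $$ (i * N + s, j * N + t))" for w
    proof -
      have "kron (pencil_eval g' g d' d A (a w)) (word_eval N X w) $$ (p, q) =
          pencil_eval g' g d' d A (a w) $$ (b * 1 + 0, c * 1 + 0) * word_eval N X w $$ (s, t)"
        unfolding i(3,6) by (simp add: index_kron[OF La word_eval_carrier i(1,4,2,5)])
      also have "pencil_eval g' g d' d A (a w) $$ (b * 1 + 0, c * 1 + 0) = (\<Sum>i<g'. \<Sum>j<g. A i j $$ (b, c) * a w $$ (i, j))"
        using index_pencil_eval[OF A a1[of w] g' i(1) _ i(4), of 0 0] by simp
      also have "\<dots> * word_eval N X w $$ (s, t) =
          (\<Sum>(i, j)\<in>?I. A i j $$ (b, c) * kron (a w) (word_eval N X w) $$ (i * N + s, j * N + t))"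
        unfolding sum.cartesian_product sum_distrib_right using i
        by (intro sum.cong refl) (auto simp: index_kron[OF a word_eval_carrier])
      finally show ?thesis .
    qed
    then show ?thesis
      unfolding nc_coeff_def by (simp add: case_prod_beta sum_distrib_left) (rule sum.swap)
  qed
  ultimately show "(\<lambda>z. pencil_eval g' g d' d A (F (z \<cdot>\<^sub>m X)) $$ (p, q)) has_fps_expansion
      Abs_fps (\<lambda>\<alpha>. nc_coeff h' h N (\<lambda>w. pencil_eval g' g d' d A (a w)) X \<alpha> p q)"
    by (simp only:) (rule has_fps_expansion_ev_cong)
qed

lemma disc_analytic_pencil:
  assumes "linear_pencil g' g d' d A" "g' > 0" "disc_analytic h' h g' g F"
  shows "disc_analytic h' h d' d (\<lambda>X. pencil_eval g' g d' d A (F X))"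
  using assms disc.mat_alg_pencil[OF assms(1,2)] unfolding disc_analytic_alt by blast

text \<open>The automorphism \<open>\<F>\<^sub>v\<close> commutes with ampliations, since the defect operators do. So the
  identity \<open>\<F>\<^sub>v(u) D\<^sup>-\<^sup>1 (1 - V\<^sup>*u) = D'\<^sup>-\<^sup>1 (V - u)\<close> exhibits the composition as a quotient of
  noncommutative series.\<close>

context
  fixes v :: "complex mat" and d' d :: nat
  assumes v: "v \<in> carrier_mat d' d" "op_norm v < 1" and d': "d' > 0"
begin

interpretation v: strict_contraction v d' d by unfold_locales (use v in auto)

lemma defect_kron:
  "strict_contraction.Di (kron v (1\<^sub>m N)) = kron v.Di (1\<^sub>m N)"
  "strict_contraction.Di' (kron v (1\<^sub>m N)) = kron v.Di' (1\<^sub>m N)"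
proof -
  interpret V: strict_contraction "kron v (1\<^sub>m N)" "d' * N" "d * N" by (rule strict_contraction_kron[OF v])
  have adj: "mat_adjoint (kron v (1\<^sub>m N)) = kron (mat_adjoint v) (1\<^sub>m N)"
    using mat_adjoint_kron[OF v(1) one_carrier_mat] by simp
  have "mat_adjoint (kron v (1\<^sub>m N)) * kron v (1\<^sub>m N) = kron (mat_adjoint v * v) (1\<^sub>m N)"
    "kron v (1\<^sub>m N) * mat_adjoint (kron v (1\<^sub>m N)) = kron (v * mat_adjoint v) (1\<^sub>m N)"
    unfolding adj using kron_mult[OF v.VsV(3) one_carrier_mat v(1) one_carrier_mat, of N]
      kron_mult[OF v(1) one_carrier_mat v.VsV(3) one_carrier_mat, of N] by (simp_all add: mat_one_mult)
  then show "V.Di = kron v.Di (1\<^sub>m N)" "V.Di' = kron v.Di' (1\<^sub>m N)"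
    unfolding V.Di_def V.Di'_def v.Di_def v.Di'_def
    using binom_mat_kron[OF v.VsV(1) v.norm_lt(1)] binom_mat_kron[OF v.VsV(2) v.norm_lt(2)] by simp_all
qed

lemma resolvent_kron:
  assumes u: "u \<in> carrier_mat (d' * N) (d * N)"
  shows "strict_contraction.Di (kron v (1\<^sub>m N)) * (1\<^sub>m (d * N) - mat_adjoint (kron v (1\<^sub>m N)) * u) =
      kron v.Di (1\<^sub>m N) - kron (v.Di * mat_adjoint v) (1\<^sub>m N) * u"
    "strict_contraction.Di' (kron v (1\<^sub>m N)) * (kron v (1\<^sub>m N) - u) =
      kron (v.Di' * v) (1\<^sub>m N) - kron v.Di' (1\<^sub>m N) * u"
proof -
  have adj: "mat_adjoint (kron v (1\<^sub>m N)) = kron (mat_adjoint v) (1\<^sub>m N)"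
    using mat_adjoint_kron[OF v(1) one_carrier_mat] by simp
  have d: "dim_row u = d' * N" "dim_col u = d * N" using u by auto
  have 1: "kron v.Di (1\<^sub>m N) * kron (mat_adjoint v) (1\<^sub>m N) = kron (v.Di * mat_adjoint v) (1\<^sub>m N)"
    "kron v.Di' (1\<^sub>m N) * kron v (1\<^sub>m N) = kron (v.Di' * v) (1\<^sub>m N)"
    using kron_mult[OF v.carrier(2) one_carrier_mat v.VsV(3) one_carrier_mat, of N]
      kron_mult[OF v.carrier(4) one_carrier_mat v(1) one_carrier_mat, of N] by (simp_all add: mat_one_mult)
  show "strict_contraction.Di (kron v (1\<^sub>m N)) * (1\<^sub>m (d * N) - mat_adjoint (kron v (1\<^sub>m N)) * u) =
      kron v.Di (1\<^sub>m N) - kron (v.Di * mat_adjoint v) (1\<^sub>m N) * u"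
    unfolding defect_kron adj 1(1)[symmetric] using d v by (simp add: mat_ring)
  show "strict_contraction.Di' (kron v (1\<^sub>m N)) * (kron v (1\<^sub>m N) - u) =
      kron (v.Di' * v) (1\<^sub>m N) - kron v.Di' (1\<^sub>m N) * u"
    unfolding defect_kron 1(2)[symmetric] using d v by (simp add: mat_ring)
qed

lemma ball_auto_disc_analytic:
  assumes U: "disc_analytic g' g d' d U"
    and le: "\<And>N X. N > 0 \<Longrightarrow> X \<in> int_ball g' g N \<Longrightarrow> op_norm (U X) \<le> 1"
  shows "disc_analytic g' g d' d (\<lambda>X. ball_auto v (U X))"
  unfolding disc_analytic_alt
proof (intro allI impI ballI)
  fix N :: nat and X assume N: "N > 0" and X: "X \<in> closed_ball g' g N"
  have "disc.mat_alg (d' * N) (d * N) (\<lambda>z. U (z \<cdot>\<^sub>m X))" using U N X unfolding disc_analytic_alt by blast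
  moreover have "op_norm (U (z \<cdot>\<^sub>m X)) \<le> 1" if "z \<in> ball 0 1" for z
    using le[OF N smult_int_ball[OF X]] that by simp
  ultimately have "disc.mat_alg (d' * N) (d * N) (\<lambda>z. strict_contraction.W (kron v (1\<^sub>m N)) (d * N) (U (z \<cdot>\<^sub>m X)))"
    by (rule disc.mat_alg_W[OF strict_contraction_kron[OF v]])
  then show "disc.mat_alg (d' * N) (d * N) (\<lambda>z. ball_auto v (U (z \<cdot>\<^sub>m X)))"
  proof (rule disc.mat_alg_cong)
    show "strict_contraction.W (kron v (1\<^sub>m N)) (d * N) (U (z \<cdot>\<^sub>m X)) = ball_auto v (U (z \<cdot>\<^sub>m X))"
      if "z \<in> ball 0 1" for z
      using that by (intro ball_auto_eq[OF v d', symmetric] disc_analyticD(1)[OF U N X]) simp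
  qed
qed

lemma ball_auto_nc_taylor:
  assumes U: "disc_analytic g' g d' d U" "nc_taylor g' g d' d U c"
    and le: "\<And>N X. N > 0 \<Longrightarrow> X \<in> int_ball g' g N \<Longrightarrow> op_norm (U X) \<le> 1" and c0: "op_norm (c []) \<le> 1"
  obtains b where "nc_taylor g' g d' d (\<lambda>X. ball_auto v (U X)) b"
proof -
  note cc = nc_taylorD(1)[OF U(2)]
  have m0: "affine_coeff v.Di (v.Di * mat_adjoint v) c [] = v.Di * (1\<^sub>m d - mat_adjoint v * c [])"
    using cc[of "[]"] by (simp add: affine_coeff_def mat_ring)
  have inv: "(v.R (c []) * v.D) * (v.Di * (1\<^sub>m d - mat_adjoint v * c [])) = 1\<^sub>m d"
    "(v.Di * (1\<^sub>m d - mat_adjoint v * c [])) * (v.R (c []) * v.D) = 1\<^sub>m d"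
    using cc[of "[]"] v.R_inverse[OF cc c0] v.dim_R[OF cc c0] mat_cancel(1)[OF v.R_inverse(1)[OF cc c0], of v.D]
    by (simp_all add: mat_assoc v.D_cancel)
  have "nc_taylor g' g d' d (\<lambda>X. ball_auto v (U X))
     (quot_coeff d' d (affine_coeff (v.Di' * v) v.Di' c) (affine_coeff v.Di (v.Di * mat_adjoint v) c) (v.R (c []) * v.D))"
  proof (rule nc_taylor_divide[where M = "\<lambda>N X z. kron v.Di (1\<^sub>m N) - kron (v.Di * mat_adjoint v) (1\<^sub>m N) * U (z \<cdot>\<^sub>m X)"
        and H = "\<lambda>N X z. kron (v.Di' * v) (1\<^sub>m N) - kron v.Di' (1\<^sub>m N) * U (z \<cdot>\<^sub>m X)"])
    show "disc_analytic g' g d' d (\<lambda>X. ball_auto v (U X))" by (rule ball_auto_disc_analytic[OF U(1) le])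
    have DV: "v.Di * mat_adjoint v \<in> carrier_mat d d'" "v.Di' * v \<in> carrier_mat d' d"
      using v by (auto intro!: carrier_matI)
    show "affine_coeff v.Di (v.Di * mat_adjoint v) c w \<in> carrier_mat d d" 
      "affine_coeff (v.Di' * v) v.Di' c w \<in> carrier_mat d' d" for w
      by (rule affine_coeff_carrier[OF v.carrier(2) DV(1) cc] affine_coeff_carrier[OF DV(2) v.carrier(4) cc])+
    show "v.R (c []) * v.D \<in> carrier_mat d d" using v.dim_R[OF cc c0] by (auto intro!: carrier_matI)
    show "v.R (c []) * v.D * affine_coeff v.Di (v.Di * mat_adjoint v) c [] = 1\<^sub>m d"
      "affine_coeff v.Di (v.Di * mat_adjoint v) c [] * (v.R (c []) * v.D) = 1\<^sub>m d"
      unfolding m0 by (rule inv)+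
    fix N :: nat and X assume N: "N > 0" and X: "X \<in> closed_ball g' g N"
    note Uc = disc_analyticD(1)[OF U(1) N X]
    show "kron v.Di (1\<^sub>m N) - kron (v.Di * mat_adjoint v) (1\<^sub>m N) * U (z \<cdot>\<^sub>m X) \<in> carrier_mat (d * N) (d * N)"
      if "cmod z < 1" for z
      using Uc[OF that] DV by (auto intro!: carrier_matI)
    show "(\<lambda>z. (kron v.Di (1\<^sub>m N) - kron (v.Di * mat_adjoint v) (1\<^sub>m N) * U (z \<cdot>\<^sub>m X)) $$ (p, q)) has_fps_expansion
      Abs_fps (\<lambda>\<alpha>. nc_coeff g' g N (affine_coeff v.Di (v.Di * mat_adjoint v) c) X \<alpha> p q)"
      if "p < d * N" "q < d * N" for p q
      by (rule has_fps_expansion_affine[OF U(2) v.carrier(2) DV(1) N X that Uc])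
    show "(\<lambda>z. (kron (v.Di' * v) (1\<^sub>m N) - kron v.Di' (1\<^sub>m N) * U (z \<cdot>\<^sub>m X)) $$ (p, q)) has_fps_expansion
      Abs_fps (\<lambda>\<alpha>. nc_coeff g' g N (affine_coeff (v.Di' * v) v.Di' c) X \<alpha> p q)"
      if "p < d' * N" "q < d * N" for p q
      by (rule has_fps_expansion_affine[OF U(2) DV(2) v.carrier(4) N X that Uc])
    show "ball_auto v (U (z \<cdot>\<^sub>m X)) * (kron v.Di (1\<^sub>m N) - kron (v.Di * mat_adjoint v) (1\<^sub>m N) * U (z \<cdot>\<^sub>m X)) =
      kron (v.Di' * v) (1\<^sub>m N) - kron v.Di' (1\<^sub>m N) * U (z \<cdot>\<^sub>m X)" if z: "cmod z < 1" for z
    proof -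
      interpret V: strict_contraction "kron v (1\<^sub>m N)" "d' * N" "d * N" by (rule strict_contraction_kron[OF v])
      show ?thesis
        unfolding resolvent_kron[OF Uc[OF z], symmetric] ball_auto_eq[OF v d' Uc[OF z]]
        by (rule V.W_mult[OF Uc[OF z] le[OF N smult_int_ball[OF X z]]])
    qed
  qed
  then show thesis by (rule that)
qed

end

section \<open>The Schwarz lemma\<close>

text \<open>The Schwarz lemma for functions into the closed disc; the maximum principle reduces it to the
  open disc.\<close>

lemma Schwarz_lemma_le:
  assumes f: "f holomorphic_on ball 0 1" "f 0 = 0" and le: "\<And>z. cmod z < 1 \<Longrightarrow> cmod (f z) \<le> 1"
    and z: "cmod z < 1"
  shows "cmod (f z) \<le> cmod z" "cmod (deriv f 0) \<le> 1" "deriv f 0 = 1 \<Longrightarrow> f z = z"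
proof -
  have lt: "cmod (f w) < 1" if w: "cmod w < 1" for w
  proof (rule ccontr)
    assume "\<not> cmod (f w) < 1"
    then have "cmod (f x) \<le> cmod (f w)" if "x \<in> ball 0 1" for x using le[of x] that by auto
    then have "f constant_on ball 0 1"
      using w by (intro maximum_modulus_principle[OF f(1), of "ball 0 1" w]) auto
    then have "f w = f 0" using w by (auto simp: constant_on_def)
    then show False using \<open>\<not> cmod (f w) < 1\<close> f(2) by simp
  qed
  note S = Schwarz_Lemma[OF f lt z]
  show "cmod (f z) \<le> cmod z" by (rule S(1))
  show "cmod (deriv f 0) \<le> 1" by (rule S(2))
  assume d: "deriv f 0 = 1"
  then obtain a where a: "\<And>w. cmod w < 1 \<Longrightarrow> f w = a * w" using S(3) by auto
  have "deriv f 0 = deriv (\<lambda>w. a * w) 0"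
  proof (rule deriv_cong_ev)
    have "eventually (\<lambda>w :: complex. w \<in> ball 0 1) (nhds 0)" by (rule eventually_nhds_in_open) auto
    then show "eventually (\<lambda>w. f w = a * w) (nhds 0)" by eventually_elim (simp add: a)
  qed simp
  then have "a = 1" using d by simp
  then show "f z = z" using a[OF z] by simp
qed

lemma sesquilinear_sum:
  assumes "A \<in> carrier_mat m n" "x \<in> carrier_vec n" "y \<in> carrier_vec m"
  shows "(A *\<^sub>v x) \<bullet>c y = (\<Sum>p<m. \<Sum>q<n. A $$ (p, q) * (vec_index x q * cnj (vec_index y p)))"
  using assms by (subst cscalar_prod_sum[OF mult_mat_vec_carrier[OF assms(1,2)] assms(3)])
    (auto intro!: sum.cong simp: index_mat_vec[OF assms(1,2)] sum_distrib_right mult.assoc simp del: index_mult_mat_vec)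

lemma cscalar_prod_smult:
  fixes x y :: "complex Matrix.vec"
  assumes "x \<in> carrier_vec n" "y \<in> carrier_vec n"
  shows "(c \<cdot>\<^sub>v x) \<bullet>c y = c * (x \<bullet>c y)" "x \<bullet>c (c \<cdot>\<^sub>v y) = cnj c * (x \<bullet>c y)"
  using assms by (simp_all add: cscalar_prod_sum[of _ n] sum_distrib_left mult_ac)

lemma cscalar_prod_cnj:
  fixes x y :: "complex Matrix.vec"
  assumes "x \<in> carrier_vec n" "y \<in> carrier_vec n"
  shows "y \<bullet>c x = cnj (x \<bullet>c y)"
  using assms by (simp add: cscalar_prod_sum[of _ n] mult_ac)

lemma op_norm_le_sesquilinear:
  assumes A: "A \<in> carrier_mat m n" and c: "c \<ge> 0"
    and le: "\<And>x y. x \<in> carrier_vec n \<Longrightarrow> y \<in> carrier_vec m \<Longrightarrow> vnorm x = 1 \<Longrightarrow> vnorm y = 1 \<Longrightarrow> cmod ((A *\<^sub>v x) \<bullet>c y) \<le> c"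
  shows "op_norm A \<le> c"
proof (cases "op_norm A = 0")
  case False
  then have "op_norm A > 0" using op_norm_nonneg[of A] by simp
  then obtain x where x: "x \<in> carrier_vec n" "vnorm x = 1" "vnorm (A *\<^sub>v x) = op_norm A"
    by (rule op_norm_attained[OF A])
  define y where "y = complex_of_real (1 / op_norm A) \<cdot>\<^sub>v (A *\<^sub>v x)"
  have Ax: "A *\<^sub>v x \<in> carrier_vec m" by (rule mult_mat_vec_carrier[OF A x(1)])
  have y: "y \<in> carrier_vec m" "vnorm y = 1" using Ax x \<open>op_norm A > 0\<close> by (auto simp: y_def norm_divide)
  have "(A *\<^sub>v x) \<bullet>c y = complex_of_real (1 / op_norm A) * complex_of_real ((op_norm A)\<^sup>2)"
    unfolding y_def cscalar_prod_smult(2)[OF Ax Ax] cscalar_prod_self x(3) by simp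
  also have "\<dots> = complex_of_real (op_norm A)" using \<open>op_norm A > 0\<close> by (simp add: power2_eq_square)
  finally show ?thesis using le[OF x(1) y(1) x(2) y(2)] \<open>op_norm A > 0\<close> by simp
qed (use c in simp)

text \<open>A contractive analytic family of matrices \<open>G\<close> with \<open>G(0) = 0\<close>. If its derivative at \<open>0\<close>
  maps a unit vector \<open>x\<close> to a unit vector \<open>y\<close>, then \<open>G(z)x = zy\<close> and \<open>G(z)\<^sup>*y = z\<^sup>*x\<close> on the whole
  disc.\<close>

locale contractive_disc =
  fixes G :: "complex \<Rightarrow> complex mat" and G1 :: "complex mat" and m n :: nat
  assumes carrier: "\<And>z. cmod z < 1 \<Longrightarrow> G z \<in> carrier_mat m n"
    and holo: "\<And>p q. p < m \<Longrightarrow> q < n \<Longrightarrow> (\<lambda>z. G z $$ (p, q)) holomorphic_on ball 0 1"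
    and le: "\<And>z. cmod z < 1 \<Longrightarrow> op_norm (G z) \<le> 1"
    and zero: "\<And>p q. p < m \<Longrightarrow> q < n \<Longrightarrow> G 0 $$ (p, q) = 0"
    and G1: "G1 \<in> carrier_mat m n"
    and deriv: "\<And>p q. p < m \<Longrightarrow> q < n \<Longrightarrow> deriv (\<lambda>z. G z $$ (p, q)) 0 = G1 $$ (p, q)"
begin

lemma sesquilinear:
  assumes x: "x \<in> carrier_vec n" "vnorm x = 1" and y: "y \<in> carrier_vec m" "vnorm y = 1" and z: "cmod z < 1"
  shows "cmod ((G z *\<^sub>v x) \<bullet>c y) \<le> cmod z" "cmod ((G1 *\<^sub>v x) \<bullet>c y) \<le> 1"
    "(G1 *\<^sub>v x) \<bullet>c y = 1 \<Longrightarrow> (G z *\<^sub>v x) \<bullet>c y = z"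
proof -
  define h where "h = (\<lambda>z. \<Sum>p<m. \<Sum>q<n. G z $$ (p, q) * (vec_index x q * cnj (vec_index y p)))"
  have h: "h w = (G w *\<^sub>v x) \<bullet>c y" if "cmod w < 1" for w
    unfolding h_def by (rule sesquilinear_sum[OF carrier[OF that] x(1) y(1), symmetric])
  have h_hol: "h holomorphic_on ball 0 1" unfolding h_def by (intro holomorphic_intros holo) auto
  have h0: "h 0 = 0" by (simp add: h_def zero)
  have h_le: "cmod (h w) \<le> 1" if "cmod w < 1" for w
  proof -
    have "cmod ((G w *\<^sub>v x) \<bullet>c y) \<le> vnorm (G w *\<^sub>v x) * vnorm y"
      by (rule cscalar_prod_le[OF mult_mat_vec_carrier[OF carrier[OF that] x(1)] y(1)])
    also have "\<dots> \<le> op_norm (G w) * vnorm x" using vnorm_mult_le[OF carrier[OF that] x(1)] y by simp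
    also have "\<dots> \<le> 1" using le[OF that] x by simp
    finally show ?thesis unfolding h[OF that] .
  qed
  have der: "((\<lambda>z. G z $$ (p, q)) has_field_derivative G1 $$ (p, q)) (at 0)" if "p < m" "q < n" for p q
    using holomorphic_derivI[OF holo[OF that] open_ball, of 0] deriv[OF that] by simp
  have "(h has_field_derivative (\<Sum>p<m. \<Sum>q<n. G1 $$ (p, q) * (vec_index x q * cnj (vec_index y p)))) (at 0)"
    unfolding h_def by (intro DERIV_sum DERIV_cmult_right der) auto
  then have h1: "deriv h 0 = (G1 *\<^sub>v x) \<bullet>c y"
    unfolding sesquilinear_sum[OF G1 x(1) y(1)] by (rule DERIV_imp_deriv)
  note S = Schwarz_lemma_le[OF h_hol h0 h_le z]
  show "cmod ((G z *\<^sub>v x) \<bullet>c y) \<le> cmod z" "cmod ((G1 *\<^sub>v x) \<bullet>c y) \<le> 1"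
    "(G1 *\<^sub>v x) \<bullet>c y = 1 \<Longrightarrow> (G z *\<^sub>v x) \<bullet>c y = z"
    using S unfolding h1 h[OF z] by auto
qed

lemma deriv_contraction: "op_norm G1 \<le> 1"
  using sesquilinear(2)[where z = 0] by (intro op_norm_le_sesquilinear[OF G1]) auto

lemma norm_le: "cmod z < 1 \<Longrightarrow> op_norm (G z) \<le> cmod z"
  using sesquilinear(1) by (intro op_norm_le_sesquilinear[OF carrier]) auto

lemma rigid:
  assumes x: "x \<in> carrier_vec n" "vnorm x = 1" and y: "vnorm y = 1" and xy: "G1 *\<^sub>v x = y" and z: "cmod z < 1"
  shows "G z *\<^sub>v x = z \<cdot>\<^sub>v y" "mat_adjoint (G z) *\<^sub>v y = cnj z \<cdot>\<^sub>v x"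
proof -
  have yc: "y \<in> carrier_vec m" unfolding xy[symmetric] by (rule mult_mat_vec_carrier[OF G1 x(1)])
  note Gz = carrier[OF z]
  have Gzx: "G z *\<^sub>v x \<in> carrier_vec m" by (rule mult_mat_vec_carrier[OF Gz x(1)])
  have Gzy: "mat_adjoint (G z) *\<^sub>v y \<in> carrier_vec n"
    by (rule mult_mat_vec_carrier[OF mat_adjoint_carrier[OF Gz] yc])
  have ip: "(G z *\<^sub>v x) \<bullet>c y = z"
    by (rule sesquilinear(3)[OF x yc y z]) (simp add: xy cscalar_prod_self y)
  have eqI: "a = b" if "a \<in> carrier_vec k" "b \<in> carrier_vec k" "vnorm a \<le> cmod z" "vnorm b = cmod z"
    "Re (a \<bullet>c b) = (cmod z)\<^sup>2" for a b k
  proof -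
    have "(vnorm a)\<^sup>2 \<le> (cmod z)\<^sup>2" using that(3) by (intro power_mono) auto
    then have "(vnorm (a - b))\<^sup>2 \<le> 0" using vnorm_diff_power2[OF that(1,2)] that(4,5) by simp
    then have "vnorm (a - b) = 0" by simp
    then have 0: "a - b = 0\<^sub>v k" using that(1,2) vnorm_eq_0[of "a - b" k] by simp
    have "vec_index a i = vec_index b i" if "i < k" for i
      using arg_cong[OF 0, of "\<lambda>v. vec_index v i"] that \<open>a \<in> carrier_vec k\<close> \<open>b \<in> carrier_vec k\<close> by simp
    then show ?thesis using that(1,2) by (intro eq_vecI) auto
  qed
  have le1: "vnorm (G z *\<^sub>v x) \<le> cmod z" using vnorm_mult_le[OF Gz x(1)] norm_le[OF z] x(2) by simp
  have le2: "vnorm (mat_adjoint (G z) *\<^sub>v y) \<le> cmod z"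
    using vnorm_mult_le[OF mat_adjoint_carrier[OF Gz] yc] norm_le[OF z] y by (simp add: op_norm_adjoint)
  have Re_cnj: "Re (cnj z * z) = (cmod z)\<^sup>2" "Re (z * cnj z) = (cmod z)\<^sup>2"
    by (simp_all only: cmod_power2) (simp_all add: power2_eq_square)
  have "(G z *\<^sub>v x) \<bullet>c (z \<cdot>\<^sub>v y) = cnj z * z" by (simp add: cscalar_prod_smult(2)[OF Gzx yc] ip)
  then have "Re ((G z *\<^sub>v x) \<bullet>c (z \<cdot>\<^sub>v y)) = (cmod z)\<^sup>2" by (simp only: Re_cnj)
  then show "G z *\<^sub>v x = z \<cdot>\<^sub>v y"
    using y yc Gzx le1 by (intro eqI[of _ m]) auto
  have "(mat_adjoint (G z) *\<^sub>v y) \<bullet>c x = cnj ((G z *\<^sub>v x) \<bullet>c y)"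
    using cscalar_prod_cnj[OF x(1) Gzy] cscalar_prod_adjoint[OF Gz x(1) yc] by simp
  then have "(mat_adjoint (G z) *\<^sub>v y) \<bullet>c (cnj z \<cdot>\<^sub>v x) = z * cnj z"
    by (simp add: cscalar_prod_smult(2)[OF Gzy x(1)] ip)
  then have "Re ((mat_adjoint (G z) *\<^sub>v y) \<bullet>c (cnj z \<cdot>\<^sub>v x)) = (cmod z)\<^sup>2" by (simp only: Re_cnj)
  then show "mat_adjoint (G z) *\<^sub>v y = cnj z \<cdot>\<^sub>v x"
    using x Gzy le2 by (intro eqI[of _ n]) auto
qed

end

section \<open>Radial limits of matrices\<close>

text \<open>Entrywise convergence as \<open>r\<close> increases to 1, for matrices of fixed dimensions when \<open>0 < r < 1\<close>.\<close>

definition mat_tendsto :: "nat \<Rightarrow> nat \<Rightarrow> (real \<Rightarrow> complex mat) \<Rightarrow> complex mat \<Rightarrow> bool" where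
  "mat_tendsto m n A Y \<longleftrightarrow> Y \<in> carrier_mat m n \<and> (\<forall>r. 0 < r \<and> r < 1 \<longrightarrow> A r \<in> carrier_mat m n) \<and>
    (\<forall>p<m. \<forall>q<n. ((\<lambda>r. A r $$ (p, q)) \<longlongrightarrow> Y $$ (p, q)) (at_left 1))"

lemma eventually_at_left_1: "eventually (\<lambda>r :: real. 0 < r \<and> r < 1) (at_left 1)"
  using eventually_at_left[of 0 "1 :: real"] by (auto intro: exI[of _ 0])

lemma mat_tendstoI:
  assumes "Y \<in> carrier_mat m n" "\<And>r. 0 < r \<Longrightarrow> r < 1 \<Longrightarrow> A r \<in> carrier_mat m n"
    and "\<And>p q. p < m \<Longrightarrow> q < n \<Longrightarrow> (H p q \<longlongrightarrow> Y $$ (p, q)) (at_left 1)"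
    and "\<And>p q r. p < m \<Longrightarrow> q < n \<Longrightarrow> 0 < r \<Longrightarrow> r < 1 \<Longrightarrow> H p q r = A r $$ (p, q)"
  shows "mat_tendsto m n A Y"
  unfolding mat_tendsto_def
proof (intro conjI allI impI)
  fix p q assume pq: "p < m" "q < n"
  have "eventually (\<lambda>r. H p q r = A r $$ (p, q)) (at_left 1)"
    using eventually_at_left_1 by eventually_elim (use assms(4)[OF pq] in auto)
  with assms(3)[OF pq] show "((\<lambda>r. A r $$ (p, q)) \<longlongrightarrow> Y $$ (p, q)) (at_left 1)"
    by (rule Lim_transform_eventually)
qed (use assms in auto)

lemma mat_tendstoD:
  assumes "mat_tendsto m n A Y"
  shows "Y \<in> carrier_mat m n" "0 < r \<Longrightarrow> r < 1 \<Longrightarrow> A r \<in> carrier_mat m n"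
    "p < m \<Longrightarrow> q < n \<Longrightarrow> ((\<lambda>r. A r $$ (p, q)) \<longlongrightarrow> Y $$ (p, q)) (at_left 1)"
  using assms by (auto simp: mat_tendsto_def)

lemma mat_tendsto_const: "Y \<in> carrier_mat m n \<Longrightarrow> mat_tendsto m n (\<lambda>_. Y) Y"
  by (simp add: mat_tendsto_def)

lemma mat_tendsto_mult:
  assumes A: "mat_tendsto m n A Y" and B: "mat_tendsto n k B Z"
  shows "mat_tendsto m k (\<lambda>r. A r * B r) (Y * Z)"
proof (rule mat_tendstoI)
  show "Y * Z \<in> carrier_mat m k" by (rule mult_carrier_mat[OF mat_tendstoD(1)[OF A] mat_tendstoD(1)[OF B]])
  show "A r * B r \<in> carrier_mat m k" if "0 < r" "r < 1" for r
    by (rule mult_carrier_mat[OF mat_tendstoD(2)[OF A that] mat_tendstoD(2)[OF B that]])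
  fix p q assume pq: "p < m" "q < k"
  show "((\<lambda>r. \<Sum>l<n. A r $$ (p, l) * B r $$ (l, q)) \<longlongrightarrow> (Y * Z) $$ (p, q)) (at_left 1)"
    unfolding index_mat_mat[OF mat_tendstoD(1)[OF A] mat_tendstoD(1)[OF B] pq]
    using pq by (intro tendsto_intros mat_tendstoD(3)[OF A] mat_tendstoD(3)[OF B]) auto
  show "(\<Sum>l<n. A r $$ (p, l) * B r $$ (l, q)) = (A r * B r) $$ (p, q)" if "0 < r" "r < 1" for r
    by (rule index_mat_mat[OF mat_tendstoD(2)[OF A that] mat_tendstoD(2)[OF B that] pq, symmetric])
qed

lemma mat_tendsto_diff:
  assumes A: "mat_tendsto m n A Y" and B: "mat_tendsto m n B Z"
  shows "mat_tendsto m n (\<lambda>r. A r - B r) (Y - Z)"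
proof (rule mat_tendstoI)
  show "Y - Z \<in> carrier_mat m n" by (rule minus_carrier_mat[OF mat_tendstoD(1)[OF B]])
  show "A r - B r \<in> carrier_mat m n" if "0 < r" "r < 1" for r
    by (rule minus_carrier_mat[OF mat_tendstoD(2)[OF B that]])
  fix p q assume pq: "p < m" "q < n"
  show "((\<lambda>r. A r $$ (p, q) - B r $$ (p, q)) \<longlongrightarrow> (Y - Z) $$ (p, q)) (at_left 1)"
    using tendsto_diff[OF mat_tendstoD(3)[OF A pq] mat_tendstoD(3)[OF B pq]]
      mat_tendstoD(1)[OF A] mat_tendstoD(1)[OF B] pq by simp
  show "A r $$ (p, q) - B r $$ (p, q) = (A r - B r) $$ (p, q)" if "0 < r" "r < 1" for r
    using mat_tendstoD(2)[OF A that] mat_tendstoD(2)[OF B that] pq by simp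
qed

lemma mat_tendsto_unique:
  assumes A: "mat_tendsto m n A Y" and B: "mat_tendsto m n B Z"
    and eq: "\<And>r. 0 < r \<Longrightarrow> r < 1 \<Longrightarrow> A r = B r"
  shows "Y = Z"
proof (rule eq_matI)
  fix p q assume "p < dim_row Z" "q < dim_col Z"
  then have pq: "p < m" "q < n" using mat_tendstoD(1)[OF B] by auto
  have "eventually (\<lambda>r. A r $$ (p, q) = B r $$ (p, q)) (at_left 1)"
    using eventually_at_left_1 by eventually_elim (use eq in auto)
  from Lim_transform_eventually[OF mat_tendstoD(3)[OF A pq] this]
  show "Y $$ (p, q) = Z $$ (p, q)"
    using mat_tendstoD(3)[OF B pq] by (intro tendsto_unique[OF trivial_limit_at_left_real]) auto
qed (use mat_tendstoD(1)[OF A] mat_tendstoD(1)[OF B] in auto)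

lemma mat_tendsto_contraction:
  assumes A: "mat_tendsto m n A Y" and le: "\<And>r. 0 < r \<Longrightarrow> r < 1 \<Longrightarrow> op_norm (A r) \<le> 1"
  shows "op_norm Y \<le> 1"
proof (rule op_norm_le_sesquilinear[OF mat_tendstoD(1)[OF A]])
  fix x y :: "complex Matrix.vec"
  assume x: "x \<in> carrier_vec n" "vnorm x = 1" and y: "y \<in> carrier_vec m" "vnorm y = 1"
  let ?s = "\<lambda>B. \<Sum>p<m. \<Sum>q<n. B $$ (p, q) * (vec_index x q * cnj (vec_index y p))"
  have lim: "((\<lambda>r. ?s (A r)) \<longlongrightarrow> ?s Y) (at_left 1)"
    by (intro tendsto_intros mat_tendstoD(3)[OF A]) auto
  have ev: "eventually (\<lambda>r. cmod (?s (A r)) \<le> 1) (at_left 1)"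
    using eventually_at_left_1
  proof eventually_elim
    case (elim r)
    then have r: "0 < r" "r < 1" by auto
    note Ar = mat_tendstoD(2)[OF A r]
    have "cmod ((A r *\<^sub>v x) \<bullet>c y) \<le> vnorm (A r *\<^sub>v x) * vnorm y"
      by (rule cscalar_prod_le[OF mult_mat_vec_carrier[OF Ar x(1)] y(1)])
    also have "\<dots> \<le> op_norm (A r) * vnorm x" using vnorm_mult_le[OF Ar x(1)] y by simp
    also have "\<dots> \<le> 1" using le[OF r] x by simp
    finally show ?case unfolding sesquilinear_sum[OF Ar x(1) y(1)] .
  qed
  show "cmod ((Y *\<^sub>v x) \<bullet>c y) \<le> 1"
    unfolding sesquilinear_sum[OF mat_tendstoD(1)[OF A] x(1) y(1)]
    by (rule tendsto_upperbound[OF tendsto_norm[OF lim] ev trivial_limit_at_left_real])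
qed simp

lemma radial_limit_mat_tendsto:
  assumes "radial_limit m n f X Y" "\<And>r. 0 < r \<Longrightarrow> r < 1 \<Longrightarrow> f (complex_of_real r \<cdot>\<^sub>m X) \<in> carrier_mat m n"
  shows "mat_tendsto m n (\<lambda>r. f (complex_of_real r \<cdot>\<^sub>m X)) Y"
  using assms by (auto simp: radial_limit_def mat_tendsto_def)

lemma mat_tendsto_pencil:
  assumes L: "linear_pencil g' g d' d A" and g': "g' > 0" and F: "mat_tendsto (g' * N) (g * N) F Y"
  shows "mat_tendsto (d' * N) (d * N) (\<lambda>r. pencil_eval g' g d' d A (F r)) (pencil_eval g' g d' d A Y)"
proof (rule mat_tendstoI[where H = "\<lambda>p q r. pencil_eval g' g d' d A (F r) $$ (p, q)"])
  show "pencil_eval g' g d' d A Y \<in> carrier_mat (d' * N) (d * N)"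
    by (rule pencil_eval_carrier[OF mat_tendstoD(1)[OF F] g'])
  show "pencil_eval g' g d' d A (F r) \<in> carrier_mat (d' * N) (d * N)" if "0 < r" "r < 1" for r
    by (rule pencil_eval_carrier[OF mat_tendstoD(2)[OF F that] g'])
  fix p q assume pq: "p < d' * N" "q < d * N"
  obtain a s c t where i: "a < d'" "s < N" "p = a * N + s" "c < d" "t < N" "q = c * N + t"
    using pq by (metis block_index_cases)
  note ix = index_pencil_eval[OF L _ g' i(1,2,4,5), folded i(3,6)]
  have "((\<lambda>r. \<Sum>i<g'. \<Sum>j<g. A i j $$ (a, c) * F r $$ (i * N + s, j * N + t)) \<longlongrightarrow>
      pencil_eval g' g d' d A Y $$ (p, q)) (at_left 1)"
    unfolding ix[OF mat_tendstoD(1)[OF F]] using i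
    by (intro tendsto_intros mat_tendstoD(3)[OF F]) (auto simp: block_index_less)
  moreover have "eventually (\<lambda>r. (\<Sum>i<g'. \<Sum>j<g. A i j $$ (a, c) * F r $$ (i * N + s, j * N + t)) =
      pencil_eval g' g d' d A (F r) $$ (p, q)) (at_left 1)"
    using eventually_at_left_1 by eventually_elim (simp add: ix[OF mat_tendstoD(2)[OF F]])
  ultimately show "((\<lambda>r. pencil_eval g' g d' d A (F r) $$ (p, q)) \<longlongrightarrow> pencil_eval g' g d' d A Y $$ (p, q)) (at_left 1)"
    by (rule Lim_transform_eventually)
qed simp

section \<open>Nilpotent points of the sphere\<close>

text \<open>At a point whose blocks multiply to zero a series reduces to its affine part.\<close>

definition square_zero :: "nat \<Rightarrow> nat \<Rightarrow> nat \<Rightarrow> complex mat \<Rightarrow> bool" where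
  "square_zero g' g N X \<longleftrightarrow> (\<forall>i<g'. \<forall>j<g. \<forall>k<g'. \<forall>l<g. block N X i j * block N X k l = 0\<^sub>m N N)"

lemma square_zero_nc_coeff:
  assumes sq: "square_zero g' g N X" and a: "\<And>w. a w \<in> carrier_mat k' k"
    and pq: "p < k' * N" "q < k * N" and \<alpha>: "\<alpha> \<ge> 2"
  shows "nc_coeff g' g N a X \<alpha> p q = 0"
  unfolding nc_coeff_def
proof (rule sum.neutral, rule ballI)
  fix w assume w: "w \<in> words g' g \<alpha>"
  then obtain x y v where v: "w = x # y # v" using \<alpha>
    by (cases w; cases "tl w") (auto simp: words_def)
  then have "fst x < g'" "snd x < g" "fst y < g'" "snd y < g" using w by (auto simp: words_def)
  then have "block N X (fst x) (snd x) * block N X (fst y) (snd y) = 0\<^sub>m N N" using sq by (simp add: square_zero_def)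
  then have "block N X (fst x) (snd x) * (block N X (fst y) (snd y) * word_eval N X v) = 0\<^sub>m N N"
    using mat_assoc[of "block N X (fst x) (snd x)" "block N X (fst y) (snd y)" "word_eval N X v"]
      left_mult_zero_mat[of "word_eval N X v" N N] by simp
  then have e: "word_eval N X w = 0\<^sub>m N N" by (simp add: v)
  obtain b s c t where i: "b < k'" "s < N" "p = b * N + s" "c < k" "t < N" "q = c * N + t"
    using pq by (metis block_index_cases)
  show "kron (a w) (word_eval N X w) $$ (p, q) = 0"
    unfolding i(3,6) index_kron[OF a word_eval_carrier i(1,4,2,5)] unfolding e using i by simp
qed

lemma square_zero_affine:
  assumes F: "disc_analytic g' g k' k F" "nc_taylor g' g k' k F a" and N: "N > 0"
    and X: "X \<in> closed_ball g' g N" "square_zero g' g N X" and pq: "p < k' * N" "q < k * N" and z: "cmod z < 1"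
  shows "F (z \<cdot>\<^sub>m X) $$ (p, q) = nc_coeff g' g N a X 0 p q + nc_coeff g' g N a X 1 p q * z"
proof -
  have "(\<lambda>\<alpha>. nc_coeff g' g N a X \<alpha> p q * z ^ \<alpha>) sums (\<Sum>\<alpha>\<in>{0,1}. nc_coeff g' g N a X \<alpha> p q * z ^ \<alpha>)"
  proof (rule sums_finite)
    fix \<alpha> :: nat assume "\<alpha> \<notin> {0, 1}"
    then have "\<alpha> \<ge> 2" by auto
    then show "nc_coeff g' g N a X \<alpha> p q * z ^ \<alpha> = 0"
      using square_zero_nc_coeff[OF X(2) nc_taylorD(1)[OF F(2)] pq] by simp
  qed simp
  with nc_taylor_sums[OF F N X(1) pq z] show ?thesis using sums_unique2 by fastforce
qed

section \<open>Vectors on which the linear part is isometric\<close>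

text \<open>If \<open>M\<^sup>*\<close> attains its norm at \<open>w\<close>, then \<open>w\<close> is an eigenvector of \<open>MM\<^sup>*\<close>.\<close>

lemma mult_adjoint_of_norm:
  assumes M: "M \<in> carrier_mat m n" and le: "(op_norm M)\<^sup>2 \<le> s"
    and w: "w \<in> carrier_vec m" "vnorm w = 1" and eq: "(vnorm (mat_adjoint M *\<^sub>v w))\<^sup>2 = s"
  shows "M *\<^sub>v (mat_adjoint M *\<^sub>v w) = complex_of_real s \<cdot>\<^sub>v w"
proof -
  define y where "y = mat_adjoint M *\<^sub>v w"
  define t where "t = M *\<^sub>v y"
  have y: "y \<in> carrier_vec n" unfolding y_def by (rule mult_mat_vec_carrier[OF mat_adjoint_carrier[OF M] w(1)])
  have t: "t \<in> carrier_vec m" unfolding t_def by (rule mult_mat_vec_carrier[OF M y])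
  have s0: "s \<ge> 0" using eq by (metis zero_le_power2)
  have "t \<bullet>c w = y \<bullet>c y" unfolding t_def by (subst cscalar_prod_adjoint[OF M y w(1)]) (simp add: y_def)
  then have tw: "t \<bullet>c w = complex_of_real s" using eq by (simp add: cscalar_prod_self y_def)
  have "(vnorm t)\<^sup>2 \<le> (op_norm M * vnorm y)\<^sup>2"
    unfolding t_def by (intro power_mono vnorm_mult_le[OF M y]) simp
  also have "\<dots> \<le> s * s"
    using le eq s0 by (simp add: power_mult_distrib y_def mult_right_mono)
  finally have tt: "(vnorm t)\<^sup>2 \<le> s * s" .
  have sw: "complex_of_real s \<cdot>\<^sub>v w \<in> carrier_vec m" using w by simp
  have "(vnorm (t - complex_of_real s \<cdot>\<^sub>v w))\<^sup>2 = (vnorm t)\<^sup>2 + s * s - 2 * (s * s)"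
    unfolding vnorm_diff_power2[OF t sw] cscalar_prod_smult(2)[OF t w(1)] tw
    using w s0 by (simp add: power2_eq_square)
  then have "(vnorm (t - complex_of_real s \<cdot>\<^sub>v w))\<^sup>2 \<le> 0" using tt by simp
  then have 0: "t - complex_of_real s \<cdot>\<^sub>v w = 0\<^sub>v m" using t sw vnorm_eq_0[of "t - complex_of_real s \<cdot>\<^sub>v w" m] by simp
  have "vec_index t i = vec_index (complex_of_real s \<cdot>\<^sub>v w) i" if "i < m" for i
    using arg_cong[OF 0, of "\<lambda>v. vec_index v i"] that t w by simp
  then have "t = complex_of_real s \<cdot>\<^sub>v w" using t w by (intro eq_vecI) auto
  then show ?thesis by (simp add: t_def y_def)
qed

lemma mult_vec_add_smult:
  fixes C1 C2 :: "complex mat"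
  assumes "C1 \<in> carrier_mat m n" "C2 \<in> carrier_mat m n" "x \<in> carrier_vec n"
  shows "(C1 + \<omega> \<cdot>\<^sub>m C2) *\<^sub>v x = C1 *\<^sub>v x + \<omega> \<cdot>\<^sub>v (C2 *\<^sub>v x)"
proof (rule eq_vecI)
  fix i assume "i < dim_vec (C1 *\<^sub>v x + \<omega> \<cdot>\<^sub>v (C2 *\<^sub>v x))"
  then have i: "i < m" using assms by simp
  have c: "C1 + \<omega> \<cdot>\<^sub>m C2 \<in> carrier_mat m n" using assms by simp
  show "vec_index ((C1 + \<omega> \<cdot>\<^sub>m C2) *\<^sub>v x) i = vec_index (C1 *\<^sub>v x + \<omega> \<cdot>\<^sub>v (C2 *\<^sub>v x)) i"
    using assms i by (simp add: index_mat_vec[OF c assms(3) i] index_mat_vec[OF assms(1,3) i]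
        index_mat_vec[OF assms(2,3) i] sum.distrib sum_distrib_left distrib_right mult.assoc del: index_mult_mat_vec)
qed (use assms in auto)

text \<open>Let \<open>C\<^sub>1\<close> and \<open>C\<^sub>2\<close> map unit vectors \<open>x\<^sub>1\<close> and \<open>x\<^sub>2\<close> to the same unit vector \<open>w\<close>, let their adjoints map
  \<open>w\<close> back, and let the combinations \<open>C\<^sub>1 + \<omega>C\<^sub>2\<close> have norm at most \<open>\<surd>2\<close>, as for the two entries of a
  contractive row. Then \<open>x\<^sub>1\<close> and \<open>x\<^sub>2\<close> are orthogonal, and \<open>C\<^sub>1 x\<^sub>2 = 0\<close>. The adjoint of \<open>C\<^sub>1 + \<omega>C\<^sub>2\<close> maps \<open>w\<close>
  to a vector of squared norm \<open>2 + 2 Re (\<omega>\<langle>x\<^sub>1, x\<^sub>2\<rangle>)\<close>, which is at most 2 for all fourth roots of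
  unity \<open>\<omega>\<close>; then the norm is attained at \<open>w\<close>, and \<open>\<omega> = 1\<close> and \<open>\<omega> = \<i>\<close> give \<open>C\<^sub>1 x\<^sub>2 = 0\<close>.\<close>

lemma row_contraction_orthogonal:
  assumes C: "C1 \<in> carrier_mat m n" "C2 \<in> carrier_mat m n"
    and w: "w \<in> carrier_vec m" "vnorm w = 1"
    and x: "x1 \<in> carrier_vec n" "x2 \<in> carrier_vec n" "vnorm x1 = 1" "vnorm x2 = 1"
    and Cx: "C1 *\<^sub>v x1 = w" "C2 *\<^sub>v x2 = w" and Cw: "mat_adjoint C1 *\<^sub>v w = x1" "mat_adjoint C2 *\<^sub>v w = x2"
    and le: "\<And>\<omega>. cmod \<omega> = 1 \<Longrightarrow> (op_norm (C1 + \<omega> \<cdot>\<^sub>m C2))\<^sup>2 \<le> 2"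
  shows "x1 \<bullet>c x2 = 0" "C1 *\<^sub>v x2 = 0\<^sub>v m"
proof -
  have M: "C1 + \<omega> \<cdot>\<^sub>m C2 \<in> carrier_mat m n" for \<omega> using C by simp
  have adj: "mat_adjoint (C1 + \<omega> \<cdot>\<^sub>m C2) *\<^sub>v w = x1 + cnj \<omega> \<cdot>\<^sub>v x2" for \<omega>
  proof -
    have "mat_adjoint (C1 + \<omega> \<cdot>\<^sub>m C2) = mat_adjoint C1 + cnj \<omega> \<cdot>\<^sub>m mat_adjoint C2"
      using C by (intro eq_matI) auto
    then show ?thesis
      using mult_vec_add_smult[OF mat_adjoint_carrier[OF C(1)] mat_adjoint_carrier[OF C(2)] w(1)] Cw by simp
  qed
  have x2': "cnj \<omega> \<cdot>\<^sub>v x2 \<in> carrier_vec n" for \<omega> using x by simp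
  have norm: "(vnorm (x1 + cnj \<omega> \<cdot>\<^sub>v x2))\<^sup>2 = 2 + 2 * Re (\<omega> * (x1 \<bullet>c x2))" if "cmod \<omega> = 1" for \<omega>
    unfolding vnorm_add_power2[OF x(1) x2'] cscalar_prod_smult(2)[OF x(1,2)] using x that by simp
  have "Re (\<omega> * (x1 \<bullet>c x2)) \<le> 0" if \<omega>: "cmod \<omega> = 1" for \<omega>
  proof -
    let ?M = "C1 + \<omega> \<cdot>\<^sub>m C2"
    have "(vnorm (mat_adjoint ?M *\<^sub>v w))\<^sup>2 \<le> (op_norm ?M * vnorm w)\<^sup>2"
      using vnorm_mult_le[OF mat_adjoint_carrier[OF M] w(1)] by (intro power_mono) (simp_all add: op_norm_adjoint)
    also have "\<dots> \<le> 2" using le[OF \<omega>] w by simp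
    finally show ?thesis unfolding adj norm[OF \<omega>] by simp
  qed
  from this[of 1] this[of "-1"] this[of \<i>] this[of "-\<i>"]
  show orth: "x1 \<bullet>c x2 = 0" by (simp add: complex_eq_iff)
  have sum0: "vec_index (\<omega> \<cdot>\<^sub>v (C2 *\<^sub>v x1) + cnj \<omega> \<cdot>\<^sub>v (C1 *\<^sub>v x2)) i = 0" if \<omega>: "cmod \<omega> = 1" and i: "i < m" for \<omega> i
  proof -
    let ?M = "C1 + \<omega> \<cdot>\<^sub>m C2"
    have "(vnorm (mat_adjoint ?M *\<^sub>v w))\<^sup>2 = 2" unfolding adj norm[OF \<omega>] orth by simp
    from mult_adjoint_of_norm[OF M le[OF \<omega>] w this]
    have "?M *\<^sub>v (x1 + cnj \<omega> \<cdot>\<^sub>v x2) = 2 \<cdot>\<^sub>v w" unfolding adj by simp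
    moreover have "?M *\<^sub>v (x1 + cnj \<omega> \<cdot>\<^sub>v x2) = ?M *\<^sub>v x1 + cnj \<omega> \<cdot>\<^sub>v (?M *\<^sub>v x2)"
      using mult_add_distrib_mat_vec[OF M x(1) x2'] mult_mat_vec[OF M x(2)] by simp
    ultimately have "vec_index (?M *\<^sub>v x1 + cnj \<omega> \<cdot>\<^sub>v (?M *\<^sub>v x2)) i = 2 * vec_index w i" using w i by simp
    then have "(vec_index w i + \<omega> * vec_index (C2 *\<^sub>v x1) i) +
        cnj \<omega> * (vec_index (C1 *\<^sub>v x2) i + \<omega> * vec_index w i) = 2 * vec_index w i"
      unfolding mult_vec_add_smult[OF C x(1)] mult_vec_add_smult[OF C x(2)] Cx
      using C x w i by (simp del: index_mult_mat_vec)
    moreover have "cnj \<omega> * \<omega> = 1" using \<omega> complex_norm_square[of \<omega>] by (simp add: mult.commute)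
    then have "cnj \<omega> * (\<omega> * vec_index w i) = vec_index w i" by (simp add: mult.assoc[symmetric])
    ultimately show ?thesis using C i by (simp add: distrib_left del: index_mult_mat_vec)
  qed
  show "C1 *\<^sub>v x2 = 0\<^sub>v m"
  proof (rule eq_vecI)
    fix i assume "i < dim_vec (0\<^sub>v m)"
    then have i: "i < m" by simp
    from sum0[of 1, OF _ i] sum0[of \<i>, OF _ i]
    have "vec_index (C2 *\<^sub>v x1) i + vec_index (C1 *\<^sub>v x2) i = 0"
      "\<i> * vec_index (C2 *\<^sub>v x1) i - \<i> * vec_index (C1 *\<^sub>v x2) i = 0"
      using C i by (simp_all del: index_mult_mat_vec)
    then have "vec_index (C1 *\<^sub>v x2) i = 0" by (simp add: complex_eq_iff)
    then show "vec_index (C1 *\<^sub>v x2) i = vec_index (0\<^sub>v m) i" using i by simp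
  qed (use C in simp)
qed

text \<open>The deviation of finitely many numbers from their mean.\<close>

lemma sum_cmod_diff_mean:
  fixes z :: "nat \<Rightarrow> complex"
  assumes "n > 0"
  shows "(\<Sum>j<n. (cmod (z j - (\<Sum>k<n. z k) / of_nat n))\<^sup>2) = (\<Sum>j<n. (cmod (z j))\<^sup>2) - (cmod (\<Sum>k<n. z k))\<^sup>2 / real n"
proof -
  define s where "s = (\<Sum>k<n. z k)"
  have *: "(cmod (z j - s / of_nat n))\<^sup>2 = (cmod (z j))\<^sup>2 + (cmod s)\<^sup>2 / (real n)\<^sup>2 - 2 * Re (z j * cnj s) / real n" for j
    by (simp only: cmod_power2) (simp add: power2_eq_square algebra_simps add_divide_distrib)
  have "(\<Sum>j<n. (cmod (z j - s / of_nat n))\<^sup>2) =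
      (\<Sum>j<n. (cmod (z j))\<^sup>2) + (cmod s)\<^sup>2 / real n - 2 * (\<Sum>j<n. Re (z j * cnj s)) / real n"
    unfolding * sum.distrib sum_subtractf sum_divide_distrib[symmetric] sum_distrib_left[symmetric] using assms
    by (simp add: power2_eq_square)
  also have "(\<Sum>j<n. Re (z j * cnj s)) = Re (s * cnj s)"
    unfolding Re_sum[symmetric] sum_distrib_right[symmetric] s_def[symmetric] ..
  also have "Re (s * cnj s) = (cmod s)\<^sup>2" by (simp only: cmod_power2) (simp add: power2_eq_square)
  finally show ?thesis by (simp add: s_def)
qed

text \<open>A matrix with one nonzero row, with two entries \<open>1/\<surd>2\<close> and \<open>\<omega>/\<surd>2\<close>.\<close>

definition two_entries :: "nat \<Rightarrow> nat \<Rightarrow> nat \<Rightarrow> nat \<Rightarrow> nat \<Rightarrow> complex \<Rightarrow> complex mat" where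
  "two_entries m n i j k \<omega> = Matrix.mat m n (\<lambda>(p, q). if p = i \<and> q = j then 1 / complex_of_real (sqrt 2)
     else if p = i \<and> q = k then \<omega> / complex_of_real (sqrt 2) else 0)"

lemma two_entries_carrier [simp]: "two_entries m n i j k \<omega> \<in> carrier_mat m n"
  by (simp add: two_entries_def)

lemma op_norm_two_entries:
  assumes ijk: "i < m" "j < n" "k < n" "j \<noteq> k" and \<omega>: "cmod \<omega> = 1"
  shows "op_norm (two_entries m n i j k \<omega>) \<le> 1"
proof (rule op_norm_leI[OF two_entries_carrier])
  fix x :: "complex Matrix.vec" assume x: "x \<in> carrier_vec n"
  let ?X = "two_entries m n i j k \<omega>"
  let ?c = "complex_of_real (sqrt 2)"
  have entry: "vec_index (?X *\<^sub>v x) p = (if p = i then (vec_index x j + \<omega> * vec_index x k) / ?c else 0)" if p: "p < m" for p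
  proof -
    have "vec_index (?X *\<^sub>v x) p = (\<Sum>q<n. (if q = j then (if p = i then vec_index x j / ?c else 0) else 0) +
        (if q = k then (if p = i then \<omega> * vec_index x k / ?c else 0) else 0))"
      unfolding index_mat_vec[OF two_entries_carrier x p]
      using p ijk by (intro sum.cong refl) (auto simp: two_entries_def)
    also have "\<dots> = (if p = i then (vec_index x j + \<omega> * vec_index x k) / ?c else 0)"
      using ijk by (simp add: sum.distrib add_divide_distrib)
    finally show ?thesis .
  qed
  have "(vnorm (?X *\<^sub>v x))\<^sup>2 = (\<Sum>p<m. if p = i then (cmod ((vec_index x j + \<omega> * vec_index x k) / ?c))\<^sup>2 else 0)"
  proof -
    have "dim_vec (?X *\<^sub>v x) = m" using carrier_matD[OF two_entries_carrier[of m n i j k \<omega>]] by simp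
    then show ?thesis unfolding vnorm_power2
      by (simp only:) (intro sum.cong refl, simp add: entry del: index_mult_mat_vec)
  qed
  also have "\<dots> = (cmod (vec_index x j + \<omega> * vec_index x k))\<^sup>2 / 2"
    using ijk by (simp add: norm_divide power_divide)
  also have "\<dots> \<le> (cmod (vec_index x j) + cmod (vec_index x k))\<^sup>2 / 2"
  proof -
    have "cmod (vec_index x j + \<omega> * vec_index x k) \<le> cmod (vec_index x j) + cmod (vec_index x k)"
      using norm_triangle_ineq[of "vec_index x j" "\<omega> * vec_index x k"] \<omega> by (simp add: norm_mult)
    then show ?thesis by (intro divide_right_mono power_mono) auto
  qed
  also have "\<dots> \<le> (cmod (vec_index x j))\<^sup>2 + (cmod (vec_index x k))\<^sup>2"
    using zero_le_power2[of "cmod (vec_index x j) - cmod (vec_index x k)"]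
    by (simp add: power2_eq_square algebra_simps)
  also have "\<dots> = (\<Sum>q\<in>{j, k}. (cmod (vec_index x q))\<^sup>2)" using ijk by simp
  also have "\<dots> \<le> (vnorm x)\<^sup>2"
    unfolding vnorm_power2 using ijk x by (intro sum_mono2) auto
  finally show "vnorm (?X *\<^sub>v x) \<le> 1 * vnorm x" using power2_le_imp_le[OF _ vnorm_nonneg] by simp
qed simp

text \<open>A contraction-valued function with \<open>\<phi>(0) = 0\<close> and Taylor coefficients \<open>b\<close>, whose homogeneous part of
  degree 1 has norm 1 at all points of norm 1 whose blocks multiply to zero. The structure theorem
  needs no other information on the boundary.\<close>

locale ball_map_zero =
  fixes g' g d' d :: nat and \<phi> :: "complex mat \<Rightarrow> complex mat" and b :: "(nat \<times> nat) list \<Rightarrow> complex mat"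
  assumes pos: "0 < g'" "0 < g" "0 < d'" "0 < d"
    and hol: "disc_analytic g' g d' d \<phi>" and taylor: "nc_taylor g' g d' d \<phi> b"
    and contr: "\<And>N X. N > 0 \<Longrightarrow> X \<in> int_ball g' g N \<Longrightarrow> op_norm (\<phi> X) \<le> 1"
    and b0: "b [] = 0\<^sub>m d' d"
    and isometric: "\<And>N X. N > 0 \<Longrightarrow> X \<in> carrier_mat (g' * N) (g * N) \<Longrightarrow> op_norm X = 1 \<Longrightarrow> square_zero g' g N X \<Longrightarrow>
      op_norm (Matrix.mat (d' * N) (d * N) (\<lambda>(p, q). nc_coeff g' g N b X 1 p q)) = 1"
begin

text \<open>The homogeneous part \<open>\<Sum>\<^sub>i\<^sub>j B\<^sub>i\<^sub>j \<otimes> X\<^sub>i\<^sub>j\<close> of degree 1 at \<open>X\<close>, and its coefficients \<open>B\<^sub>i\<^sub>j\<close>.\<close>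

definition lin_part :: "nat \<Rightarrow> complex mat \<Rightarrow> complex mat" where
  "lin_part N X = Matrix.mat (d' * N) (d * N) (\<lambda>(p, q). nc_coeff g' g N b X 1 p q)"

definition B :: "nat \<Rightarrow> nat \<Rightarrow> complex mat" where "B i j = b [(i, j)]"

lemma b_carrier [simp]: "b w \<in> carrier_mat d' d" by (rule nc_taylorD(1)[OF taylor])

lemma B_carrier [simp]: "B i j \<in> carrier_mat d' d" by (simp add: B_def)

lemma dim_B [simp]: "dim_row (B i j) = d'" "dim_col (B i j) = d" by (rule carrier_matD[OF B_carrier])+

lemma lin_part_carrier [simp]: "lin_part N X \<in> carrier_mat (d' * N) (d * N)"
  by (simp add: lin_part_def)

lemma sum_words_1: "(\<Sum>w\<in>words g' g 1. h w) = (\<Sum>i<g'. \<Sum>j<g. h [(i, j)])"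
proof -
  have "words g' g 1 = (\<lambda>x. [x]) ` ({..<g'} \<times> {..<g})"
    by (auto simp: words_def length_Suc_conv)
  then have "(\<Sum>w\<in>words g' g 1. h w) = (\<Sum>x\<in>{..<g'} \<times> {..<g}. h [x])"
    by (simp add: sum.reindex inj_on_def)
  then show ?thesis by (simp add: sum.cartesian_product case_prod_beta)
qed

lemma index_lin_part:
  assumes i: "a < d'" "s < N" "c < d" "t < N"
  shows "lin_part N X $$ (a * N + s, c * N + t) = (\<Sum>i<g'. \<Sum>j<g. B i j $$ (a, c) * X $$ (i * N + s, j * N + t))"
proof -
  have "lin_part N X $$ (a * N + s, c * N + t) = nc_coeff g' g N b X 1 (a * N + s) (c * N + t)"
    using i by (simp add: lin_part_def block_index_less)
  also have "\<dots> = (\<Sum>i<g'. \<Sum>j<g. B i j $$ (a, c) * X $$ (i * N + s, j * N + t))"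
    unfolding nc_coeff_def sum_words_1 using i
    by (intro sum.cong refl) (simp add: index_kron[of _ d' d _ N N] B_def block_def right_mult_one_mat[of _ N N] block_index_less)
  finally show ?thesis .
qed

lemma contractive_disc:
  assumes N: "N > 0" and X: "X \<in> closed_ball g' g N"
  shows "contractive_disc (\<lambda>z. \<phi> (z \<cdot>\<^sub>m X)) (lin_part N X) (d' * N) (d * N)"
proof
  show "\<phi> (z \<cdot>\<^sub>m X) \<in> carrier_mat (d' * N) (d * N)" if "cmod z < 1" for z
    by (rule disc_analyticD(1)[OF hol N X that])
  show "op_norm (\<phi> (z \<cdot>\<^sub>m X)) \<le> 1" if "cmod z < 1" for z by (rule contr[OF N smult_int_ball[OF X that]])
  fix p q assume pq: "p < d' * N" "q < d * N"
  show "(\<lambda>z. \<phi> (z \<cdot>\<^sub>m X) $$ (p, q)) holomorphic_on ball 0 1" by (rule disc_analyticD(2)[OF hol N X pq])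
  note F = nc_taylorD(2)[OF taylor N X pq]
  obtain a s c t where i: "a < d'" "s < N" "p = a * N + s" "c < d" "t < N" "q = c * N + t"
    using pq by (metis block_index_cases)
  have "nc_coeff g' g N b X 0 p q = 0"
    using i by (simp add: nc_coeff_def b0 index_kron[of _ d' d _ N N])
  then show "\<phi> (0 \<cdot>\<^sub>m X) $$ (p, q) = 0"
    using has_fps_expansion_imp_0_eq_fps_nth_0[OF F] by simp
  show "deriv (\<lambda>z. \<phi> (z \<cdot>\<^sub>m X) $$ (p, q)) 0 = lin_part N X $$ (p, q)"
    using fps_nth_fps_expansion[OF F, of 1] pq by (simp add: lin_part_def)
qed simp

text \<open>At size \<open>N = 1\<close> the linear part is \<open>\<Sum>\<^sub>i\<^sub>j x\<^sub>i\<^sub>j B\<^sub>i\<^sub>j\<close>, a contraction by the Schwarz lemma if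
  \<open>\<parallel>x\<parallel> \<le> 1\<close>.\<close>

lemma scalar_contraction:
  assumes x: "x \<in> carrier_mat g' g" "op_norm x \<le> 1"
    and C: "C \<in> carrier_mat d' d" "\<And>a c. a < d' \<Longrightarrow> c < d \<Longrightarrow> C $$ (a, c) = (\<Sum>i<g'. \<Sum>j<g. B i j $$ (a, c) * x $$ (i, j))"
  shows "op_norm C \<le> 1"
proof -
  have X: "x \<in> closed_ball g' g 1" using x by (simp add: closed_ball_def)
  interpret contractive_disc "\<lambda>z. \<phi> (z \<cdot>\<^sub>m x)" "lin_part 1 x" "d' * 1" "d * 1"
    by (rule contractive_disc[OF _ X]) simp
  have "lin_part 1 x = C"
  proof (rule eq_matI)
    fix a c assume "a < dim_row C" "c < dim_col C"
    then have "a < d'" "c < d" using C by auto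
    then show "lin_part 1 x $$ (a, c) = C $$ (a, c)"
      using index_lin_part[of a 0 1 c 0 x] C(2) by simp
  qed (use C in \<open>auto simp: lin_part_def\<close>)
  then show ?thesis using deriv_contraction by simp
qed

lemma sum_sum_delta: "i < m \<Longrightarrow> j < n \<Longrightarrow> (\<Sum>p<m. \<Sum>q<n. if p = i \<and> q = j then h p q else 0) = (h i j :: complex)"
  for i j m n :: nat
proof -
  assume "i < m" "j < n"
  moreover have "(\<Sum>q<n. if p = i \<and> q = j then h p q else 0) = (if p = i then h p j else 0)" for p
    using \<open>j < n\<close> by (cases "p = i") auto
  ultimately show ?thesis by simp
qed

lemma B_contraction:
  assumes ij: "i < g'" "j < g"
  shows "op_norm (B i j) \<le> 1"
proof (rule scalar_contraction)
  let ?E = "Matrix.mat g' g (\<lambda>(p, q). if p = i \<and> q = j then 1 else 0)"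
  show "?E \<in> carrier_mat g' g" by simp
  show "op_norm ?E \<le> 1"
  proof (rule op_norm_leI[of _ g' g])
    fix x :: "complex Matrix.vec" assume x: "x \<in> carrier_vec g"
    have "vec_index (?E *\<^sub>v x) p = (if p = i then vec_index x j else 0)" if "p < g'" for p
    proof -
      have "vec_index (?E *\<^sub>v x) p = (\<Sum>q<g. if q = j then (if p = i then vec_index x j else 0) else 0)"
        unfolding index_mat_vec[of ?E g' g, OF _ x that, simplified] using that by (intro sum.cong) auto
      then show ?thesis using ij by simp
    qed
    moreover have "dim_vec (?E *\<^sub>v x) = g'" by simp
    ultimately have "(vnorm (?E *\<^sub>v x))\<^sup>2 = (\<Sum>p<g'. if p = i then (cmod (vec_index x j))\<^sup>2 else 0)"
      unfolding vnorm_power2 by (simp only:) (intro sum.cong refl, simp)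
    also have "\<dots> = (cmod (vec_index x j))\<^sup>2" using ij by simp
    also have "\<dots> \<le> (vnorm x)\<^sup>2" using index_le_vnorm[of j x] x ij by (intro power_mono) auto
    finally show "vnorm (?E *\<^sub>v x) \<le> 1 * vnorm x" using power2_le_imp_le[OF _ vnorm_nonneg] by simp
  qed auto
  fix a c assume "a < d'" "c < d"
  have "(\<Sum>p<g'. \<Sum>q<g. B p q $$ (a, c) * ?E $$ (p, q)) = (\<Sum>p<g'. \<Sum>q<g. if p = i \<and> q = j then B p q $$ (a, c) else 0)"
    by (intro sum.cong refl) auto
  then show "B i j $$ (a, c) = (\<Sum>p<g'. \<Sum>q<g. B p q $$ (a, c) * ?E $$ (p, q))"
    using sum_sum_delta[OF ij] by simp
qed simp

lemma op_norm_sqrt2: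
  assumes "C \<in> carrier_mat m n" "op_norm ((1 / complex_of_real (sqrt 2)) \<cdot>\<^sub>m C) \<le> 1"
  shows "(op_norm C)\<^sup>2 \<le> 2"
proof -
  have "op_norm C \<le> sqrt 2" using assms by (simp add: op_norm_smult[OF assms(1)] norm_divide)
  then have "(op_norm C)\<^sup>2 \<le> (sqrt 2)\<^sup>2" by (intro power_mono op_norm_nonneg)
  then show ?thesis by simp
qed

lemma B_row_contraction:
  assumes ij: "i < g'" "j < g" "k < g" "j \<noteq> k" and \<omega>: "cmod \<omega> = 1"
  shows "(op_norm (B i j + \<omega> \<cdot>\<^sub>m B i k))\<^sup>2 \<le> 2"
proof (rule op_norm_sqrt2[of _ d' d])
  let ?E = "two_entries g' g i j k \<omega>"
  show "op_norm ((1 / complex_of_real (sqrt 2)) \<cdot>\<^sub>m (B i j + \<omega> \<cdot>\<^sub>m B i k)) \<le> 1"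
  proof (rule scalar_contraction[OF two_entries_carrier op_norm_two_entries[OF ij \<omega>]])
    fix a c assume ac: "a < d'" "c < d"
    have "(\<Sum>p<g'. \<Sum>q<g. B p q $$ (a, c) * ?E $$ (p, q)) =
        (\<Sum>p<g'. \<Sum>q<g. (if p = i \<and> q = j then B p q $$ (a, c) / complex_of_real (sqrt 2) else 0) +
          (if p = i \<and> q = k then B p q $$ (a, c) * \<omega> / complex_of_real (sqrt 2) else 0))"
      using ij by (intro sum.cong refl) (auto simp: two_entries_def)
    also have "\<dots> = B i j $$ (a, c) / complex_of_real (sqrt 2) + B i k $$ (a, c) * \<omega> / complex_of_real (sqrt 2)"
      unfolding sum.distrib sum_sum_delta[OF ij(1,2)] sum_sum_delta[OF ij(1,3)] ..
    finally show "((1 / complex_of_real (sqrt 2)) \<cdot>\<^sub>m (B i j + \<omega> \<cdot>\<^sub>m B i k)) $$ (a, c) =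
        (\<Sum>p<g'. \<Sum>q<g. B p q $$ (a, c) * ?E $$ (p, q))"
      using ac by (simp add: add_divide_distrib mult.commute)
  qed simp
qed simp

lemma B_column_contraction:
  assumes ij: "j < g" "i < g'" "k < g'" "i \<noteq> k" and \<omega>: "cmod \<omega> = 1"
  shows "(op_norm (mat_adjoint (B i j) + \<omega> \<cdot>\<^sub>m mat_adjoint (B k j)))\<^sup>2 \<le> 2"
proof (rule op_norm_sqrt2[of _ d d'])
  let ?M = "mat_adjoint (B i j) + \<omega> \<cdot>\<^sub>m mat_adjoint (B k j)"
  let ?E = "mat_adjoint (two_entries g g' j i k \<omega>)"
  have "op_norm (mat_adjoint ((1 / complex_of_real (sqrt 2)) \<cdot>\<^sub>m ?M)) \<le> 1"
  proof (rule scalar_contraction[of ?E])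
    show "?E \<in> carrier_mat g' g" by (rule mat_adjoint_carrier[OF two_entries_carrier])
    show "op_norm ?E \<le> 1" unfolding op_norm_adjoint by (rule op_norm_two_entries[OF ij \<omega>])
    show "mat_adjoint ((1 / complex_of_real (sqrt 2)) \<cdot>\<^sub>m ?M) \<in> carrier_mat d' d" by (auto intro!: carrier_matI)
    fix a c assume ac: "a < d'" "c < d"
    have E: "?E $$ (p, q) = (if p = i \<and> q = j then 1 / complex_of_real (sqrt 2) else if p = k \<and> q = j then cnj \<omega> / complex_of_real (sqrt 2) else 0)"
      if "p < g'" "q < g" for p q
      using that by (subst index_mat_adjoint) (auto simp: two_entries_def)
    have "(\<Sum>p<g'. \<Sum>q<g. B p q $$ (a, c) * ?E $$ (p, q)) =
        (\<Sum>p<g'. \<Sum>q<g. (if p = i \<and> q = j then B p q $$ (a, c) / complex_of_real (sqrt 2) else 0) +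
          (if p = k \<and> q = j then B p q $$ (a, c) * cnj \<omega> / complex_of_real (sqrt 2) else 0))"
      using ij by (intro sum.cong refl) (auto simp: E)
    also have "\<dots> = B i j $$ (a, c) / complex_of_real (sqrt 2) + B k j $$ (a, c) * cnj \<omega> / complex_of_real (sqrt 2)"
      unfolding sum.distrib sum_sum_delta[OF ij(2,1)] sum_sum_delta[OF ij(3,1)] ..
    finally show "mat_adjoint ((1 / complex_of_real (sqrt 2)) \<cdot>\<^sub>m ?M) $$ (a, c) =
        (\<Sum>p<g'. \<Sum>q<g. B p q $$ (a, c) * ?E $$ (p, q))"
      using ac by (simp add: add_divide_distrib mult.commute)
  qed
  then show "op_norm ((1 / complex_of_real (sqrt 2)) \<cdot>\<^sub>m ?M) \<le> 1" by (simp only: op_norm_adjoint)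
qed (auto intro!: carrier_matI)

end

text \<open>The nilpotent test point \<open>(g'g)\<^sup>-\<^sup>1\<^sup>/\<^sup>2 \<Sum>\<^sub>i\<^sub>j E\<^sub>i\<^sub>j \<otimes> E\<^sub>i\<^sub>,\<^sub>g\<^sub>'\<^sub>+\<^sub>j\<close>, a rank one matrix of norm 1.
  The column indices \<open>g' + j\<close> differ from all row indices \<open>i\<close>, so the blocks multiply to zero.\<close>

definition flat_point :: "nat \<Rightarrow> nat \<Rightarrow> complex mat" where
  "flat_point g' g = Matrix.mat (g' * (g' + g)) (g * (g' + g)) (\<lambda>(p, q).
     if p mod (g' + g) = p div (g' + g) \<and> q mod (g' + g) = g' + q div (g' + g)
     then 1 / complex_of_real (sqrt (real (g' * g))) else 0)"

lemma flat_point_carrier [simp]: "flat_point g' g \<in> carrier_mat (g' * (g' + g)) (g * (g' + g))"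
  by (simp add: flat_point_def)

lemma index_flat_point:
  assumes "i < g'" "s < g' + g" "j < g" "t < g' + g"
  shows "flat_point g' g $$ (i * (g' + g) + s, j * (g' + g) + t) =
    (if s = i \<and> t = g' + j then 1 / complex_of_real (sqrt (real (g' * g))) else 0)"
  using assms by (simp add: flat_point_def block_index_less)

lemma sum_lessThan_add: "(\<Sum>s<m + n. f s) = (\<Sum>s<m. f s) + (\<Sum>j<n. f (m + j))"
  for f :: "nat \<Rightarrow> 'a::comm_monoid_add"
  by (induction n) (simp_all add: add.assoc)

lemma square_zero_flat_point: "square_zero g' g (g' + g) (flat_point g' g)"
  unfolding square_zero_def
proof (intro allI impI)
  fix i j k l assume ij: "i < g'" "j < g" "k < g'" "l < g"
  let ?N = "g' + g"
  show "block ?N (flat_point g' g) i j * block ?N (flat_point g' g) k l = 0\<^sub>m ?N ?N"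
  proof (rule eq_matI)
    fix s t assume "s < dim_row (0\<^sub>m ?N ?N)" "t < dim_col (0\<^sub>m ?N ?N)"
    then have st: "s < ?N" "t < ?N" by auto
    have "(block ?N (flat_point g' g) i j * block ?N (flat_point g' g) k l) $$ (s, t) =
        (\<Sum>r<?N. block ?N (flat_point g' g) i j $$ (s, r) * block ?N (flat_point g' g) k l $$ (r, t))"
      by (rule index_mat_mat[OF block_carrier block_carrier st])
    also have "\<dots> = 0"
      using st ij by (intro sum.neutral) (auto simp: block_def index_flat_point)
    finally show "(block ?N (flat_point g' g) i j * block ?N (flat_point g' g) k l) $$ (s, t) = 0\<^sub>m ?N ?N $$ (s, t)"
      using st by simp
  qed auto
qed

lemma vnorm_flat_point:
  assumes pos: "g' > 0" "g > 0" and x: "x \<in> carrier_vec (g * (g' + g))"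
  shows "(vnorm (flat_point g' g *\<^sub>v x))\<^sup>2 = (cmod (\<Sum>j<g. vec_index x (j * (g' + g) + (g' + j))))\<^sup>2 / real g"
proof -
  let ?N = "g' + g" and ?k = "1 / complex_of_real (sqrt (real (g' * g)))"
  let ?S = "\<Sum>j<g. vec_index x (j * ?N + (g' + j))"
  have entry: "vec_index (flat_point g' g *\<^sub>v x) (i * ?N + s) = (if s = i then ?k * ?S else 0)"
    if ii: "i < g'" "s < ?N" for i s
  proof -
    have "vec_index (flat_point g' g *\<^sub>v x) (i * ?N + s) =
        (\<Sum>j<g. \<Sum>t<?N. flat_point g' g $$ (i * ?N + s, j * ?N + t) * vec_index x (j * ?N + t))"
      unfolding index_mat_vec[OF flat_point_carrier x block_index_less[OF ii]] sum_lessThan_blocks ..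
    also have "\<dots> = (\<Sum>j<g. \<Sum>t<?N. if t = g' + j then (if s = i then ?k * vec_index x (j * ?N + t) else 0) else 0)"
      using ii by (intro sum.cong refl) (auto simp: index_flat_point)
    also have "\<dots> = (\<Sum>j<g. if s = i then ?k * vec_index x (j * ?N + (g' + j)) else 0)"
      by (intro sum.cong refl) simp
    finally show ?thesis by (simp add: sum_distrib_left)
  qed
  have d: "dim_vec (flat_point g' g *\<^sub>v x) = g' * ?N" using carrier_matD[OF flat_point_carrier[of g' g]] by simp
  have "(vnorm (flat_point g' g *\<^sub>v x))\<^sup>2 = (\<Sum>i<g'. \<Sum>s<?N. if s = i then (cmod (?k * ?S))\<^sup>2 else 0)"
    unfolding vnorm_power2 d sum_lessThan_blocks
    by (intro sum.cong refl) (simp add: entry del: index_mult_mat_vec)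
  also have "\<dots> = (\<Sum>i<g'. (cmod (?k * ?S))\<^sup>2)" by (intro sum.cong refl) simp
  also have "\<dots> = (cmod ?S)\<^sup>2 / real g"
    using pos by (simp add: norm_mult norm_divide power_mult_distrib power_divide)
  finally show ?thesis .
qed

lemma op_norm_flat_point:
  assumes pos: "g' > 0" "g > 0"
  shows "op_norm (flat_point g' g) = 1"
proof (rule antisym)
  let ?N = "g' + g"
  show "op_norm (flat_point g' g) \<le> 1"
  proof (rule op_norm_leI[OF flat_point_carrier])
    fix x :: "complex Matrix.vec" assume x: "x \<in> carrier_vec (g * ?N)"
    let ?y = "\<lambda>j. vec_index x (j * ?N + (g' + j))"
    have "(cmod (\<Sum>j<g. ?y j))\<^sup>2 / real g \<le> (\<Sum>j<g. (cmod (?y j))\<^sup>2)"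
      using sum_cmod_diff_mean[OF pos(2), of ?y] sum_nonneg[of "{..<g}" "\<lambda>j. (cmod (?y j - (\<Sum>k<g. ?y k) / of_nat g))\<^sup>2"] by simp
    also have "\<dots> \<le> (\<Sum>j<g. \<Sum>t<?N. (cmod (vec_index x (j * ?N + t)))\<^sup>2)"
    proof (rule sum_mono)
      fix j assume "j \<in> {..<g}"
      then show "(cmod (?y j))\<^sup>2 \<le> (\<Sum>t<?N. (cmod (vec_index x (j * ?N + t)))\<^sup>2)"
        by (intro member_le_sum[of "g' + j" _ "\<lambda>t. (cmod (vec_index x (j * ?N + t)))\<^sup>2"]) auto
    qed
    also have "\<dots> = (vnorm x)\<^sup>2" using x unfolding vnorm_power2 by (simp add: sum_lessThan_blocks)
    finally have "(vnorm (flat_point g' g *\<^sub>v x))\<^sup>2 \<le> (vnorm x)\<^sup>2" unfolding vnorm_flat_point[OF pos x] .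
    then show "vnorm (flat_point g' g *\<^sub>v x) \<le> 1 * vnorm x" using power2_le_imp_le[OF _ vnorm_nonneg] by simp
  qed simp
  define x where "x = Matrix.vec (g * ?N) (\<lambda>q. if q mod ?N = g' + q div ?N then 1 else 0 :: complex)"
  have x: "x \<in> carrier_vec (g * ?N)" by (simp add: x_def)
  have xi: "vec_index x (j * ?N + t) = (if t = g' + j then 1 else 0)" if "j < g" "t < ?N" for j t
    using that by (simp add: x_def block_index_less)
  have "(vnorm x)\<^sup>2 = (\<Sum>j<g. \<Sum>t<?N. if t = g' + j then 1 else 0)"
    unfolding vnorm_power2 carrier_vecD[OF x] sum_lessThan_blocks by (intro sum.cong refl) (simp add: xi)
  also have "\<dots> = (\<Sum>j<g. 1)" by (intro sum.cong refl) simp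
  finally have nx: "(vnorm x)\<^sup>2 = real g" by simp
  have "(\<Sum>j<g. vec_index x (j * ?N + (g' + j))) = (\<Sum>j<g. 1)"
    by (intro sum.cong refl) (simp add: xi)
  then have "(vnorm (flat_point g' g *\<^sub>v x))\<^sup>2 = real g"
    unfolding vnorm_flat_point[OF pos x] using pos by (simp add: power2_eq_square)
  then have "vnorm (flat_point g' g *\<^sub>v x) = vnorm x"
    using nx vnorm_nonneg by (metis power2_eq_iff_nonneg)
  moreover have "vnorm x > 0" using nx pos vnorm_nonneg[of x] by (metis less_le of_nat_0_less_iff power_zero_numeral less_irrefl)
  ultimately show "1 \<le> op_norm (flat_point g' g)"
    using vnorm_mult_le[OF flat_point_carrier x] by (simp add: mult_le_cancel_right1)
qed

context ball_map_zero
begin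

text \<open>Since \<open>lin_part\<close> attains its norm 1 at the flat point, equality must hold in all of the
  triangle and Cauchy--Schwarz inequalities that bound it by means of \<open>\<parallel>B i j\<parallel> \<le> 1\<close>. So all
  \<open>B i j\<close> are isometric on suitable vectors \<open>u j\<close>, with values \<open>v i\<close> depending on \<open>i\<close> only.\<close>

lemma obtain_isometric_vectors:
  obtains u v where "\<And>j. j < g \<Longrightarrow> u j \<in> carrier_vec d \<and> vnorm (u j) = 1"
    and "\<And>i. i < g' \<Longrightarrow> v i \<in> carrier_vec d' \<and> vnorm (v i) = 1"
    and "\<And>i j. i < g' \<Longrightarrow> j < g \<Longrightarrow> B i j *\<^sub>v u j = v i"
proof -
  let ?N = "g' + g" and ?k = "1 / complex_of_real (sqrt (real (g' * g)))"
  let ?X = "flat_point g' g"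
  let ?S = "lin_part ?N ?X"
  have S1: "op_norm ?S = 1"
    unfolding lin_part_def
    by (rule isometric[OF _ flat_point_carrier op_norm_flat_point[OF pos(1,2)] square_zero_flat_point]) (use pos in simp)
  then have "op_norm ?S > 0" by simp
  then obtain \<xi> where \<xi>0: "\<xi> \<in> carrier_vec (d * ?N)" "vnorm \<xi> = 1" "vnorm (?S *\<^sub>v \<xi>) = op_norm ?S"
    by (rule op_norm_attained[OF lin_part_carrier])
  note \<xi> = \<xi>0(1,2) \<xi>0(3)[unfolded S1]
  define u where "u = (\<lambda>j. slice d ?N \<xi> (g' + j))"
  define y where "y = (\<lambda>i j a. vec_index (B i j *\<^sub>v u j) a)"
  have uc: "u j \<in> carrier_vec d" for j by (simp add: u_def)
  have yB: "y i j a = (\<Sum>c<d. B i j $$ (a, c) * vec_index \<xi> (c * ?N + (g' + j)))" if "a < d'" for i j a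
    unfolding y_def index_mat_vec[OF B_carrier uc that] by (simp add: u_def)
  have S: "vec_index (?S *\<^sub>v \<xi>) (a * ?N + s) = (if s < g' then ?k * (\<Sum>j<g. y s j a) else 0)"
    if as: "a < d'" "s < ?N" for a s
  proof -
    have "vec_index (?S *\<^sub>v \<xi>) (a * ?N + s) = (\<Sum>c<d. \<Sum>t<?N. ?S $$ (a * ?N + s, c * ?N + t) * vec_index \<xi> (c * ?N + t))"
      unfolding index_mat_vec[OF lin_part_carrier \<xi>(1) block_index_less[OF as]] sum_lessThan_blocks ..
    also have "\<dots> = (\<Sum>c<d. \<Sum>t<?N. \<Sum>i<g'. \<Sum>j<g. (if t = g' + j then (if s = i then ?k * (B i j $$ (a, c) * vec_index \<xi> (c * ?N + t)) else 0) else 0))"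
      unfolding atomize_eq
    proof (intro sum.cong refl)
      fix c t assume "c \<in> {..<d}" "t \<in> {..<?N}"
      then show "?S $$ (a * ?N + s, c * ?N + t) * vec_index \<xi> (c * ?N + t) =
        (\<Sum>i<g'. \<Sum>j<g. (if t = g' + j then (if s = i then ?k * (B i j $$ (a, c) * vec_index \<xi> (c * ?N + t)) else 0) else 0))"
        using as by (subst index_lin_part) (auto simp: index_flat_point sum_distrib_right intro!: sum.cong)
    qed
    also have "\<dots> = (\<Sum>i<g'. \<Sum>j<g. \<Sum>c<d. \<Sum>t<?N. (if t = g' + j then (if s = i then ?k * (B i j $$ (a, c) * vec_index \<xi> (c * ?N + t)) else 0) else 0))"
    proof -
      have "(\<Sum>c<d. \<Sum>t<?N. \<Sum>i<g'. \<Sum>j<g. F c t i j) = (\<Sum>i<g'. \<Sum>j<g. \<Sum>c<d. \<Sum>t<?N. F c t i j)" for F :: "nat \<Rightarrow> nat \<Rightarrow> nat \<Rightarrow> nat \<Rightarrow> complex"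
      proof -
        have "(\<Sum>c<d. \<Sum>t<?N. \<Sum>i<g'. \<Sum>j<g. F c t i j) = (\<Sum>c<d. \<Sum>i<g'. \<Sum>t<?N. \<Sum>j<g. F c t i j)"
          by (rule sum.cong[OF refl]) (rule sum.swap)
        also have "\<dots> = (\<Sum>i<g'. \<Sum>c<d. \<Sum>t<?N. \<Sum>j<g. F c t i j)" by (rule sum.swap)
        also have "\<dots> = (\<Sum>i<g'. \<Sum>c<d. \<Sum>j<g. \<Sum>t<?N. F c t i j)"
          by (rule sum.cong[OF refl], rule sum.cong[OF refl]) (rule sum.swap)
        also have "\<dots> = (\<Sum>i<g'. \<Sum>j<g. \<Sum>c<d. \<Sum>t<?N. F c t i j)"
          by (rule sum.cong[OF refl]) (rule sum.swap)
        finally show ?thesis .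
      qed
      then show ?thesis .
    qed
    also have "\<dots> = (\<Sum>i<g'. if s = i then ?k * (\<Sum>j<g. y i j a) else 0)"
    proof (intro sum.cong refl)
      fix i
      have "(\<Sum>j<g. \<Sum>c<d. \<Sum>t<?N. (if t = g' + j then (if s = i then ?k * (B i j $$ (a, c) * vec_index \<xi> (c * ?N + t)) else 0) else 0)) =
          (\<Sum>j<g. \<Sum>c<d. if s = i then ?k * (B i j $$ (a, c) * vec_index \<xi> (c * ?N + (g' + j))) else 0)"
        by (intro sum.cong refl) simp
      then show "(\<Sum>j<g. \<Sum>c<d. \<Sum>t<?N. (if t = g' + j then (if s = i then ?k * (B i j $$ (a, c) * vec_index \<xi> (c * ?N + t)) else 0) else 0)) =
          (if s = i then ?k * (\<Sum>j<g. y i j a) else 0)"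
        using as by (simp add: yB sum_distrib_left)
    qed
    also have "\<dots> = (if s < g' then ?k * (\<Sum>j<g. y s j a) else 0)" by simp
    finally show ?thesis .
  qed
  have dS: "dim_vec (?S *\<^sub>v \<xi>) = d' * ?N" using carrier_matD[OF lin_part_carrier[of ?N ?X]] by simp
  have "1 = (\<Sum>a<d'. \<Sum>s<?N. (cmod (vec_index (?S *\<^sub>v \<xi>) (a * ?N + s)))\<^sup>2)"
    using \<xi>(3) vnorm_power2[of "?S *\<^sub>v \<xi>"] unfolding dS sum_lessThan_blocks by simp
  also have "\<dots> = (\<Sum>a<d'. \<Sum>s<?N. if s < g' then (cmod (\<Sum>j<g. y s j a))\<^sup>2 / real (g' * g) else 0)"
    by (intro sum.cong refl) (simp add: S norm_mult norm_divide power_mult_distrib power_divide del: index_mult_mat_vec)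
  also have "\<dots> = (\<Sum>a<d'. \<Sum>s<g'. (cmod (\<Sum>j<g. y s j a))\<^sup>2 / real (g' * g))"
    unfolding sum_lessThan_add by simp
  also have "\<dots> = (\<Sum>s<g'. \<Sum>a<d'. (cmod (\<Sum>j<g. y s j a))\<^sup>2) / real (g' * g)"
    by (subst sum.swap) (simp only: sum_divide_distrib)
  finally have sum1: "(\<Sum>i<g'. \<Sum>a<d'. (cmod (\<Sum>j<g. y i j a))\<^sup>2) = real g' * real g"
    using pos by (simp add: field_simps)
  have "(\<Sum>j<g. (vnorm (u j))\<^sup>2) \<le> (\<Sum>t<?N. (vnorm (slice d ?N \<xi> t))\<^sup>2)"
    unfolding sum_lessThan_add u_def by (simp add: sum_nonneg)
  then have sum2: "(\<Sum>j<g. (vnorm (u j))\<^sup>2) \<le> 1" using vnorm_slices[OF \<xi>(1)] \<xi>(2) by simp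
  \<comment> \<open>Up to a positive factor, \<open>v i\<close> will be the mean of the vectors \<open>B i j *\<^sub>v u j\<close> over \<open>j\<close>.\<close>
  define m where "m = (\<lambda>i a. (\<Sum>j<g. y i j a) / of_nat g)"
  have yn: "(\<Sum>a<d'. (cmod (y i j a))\<^sup>2) = (vnorm (B i j *\<^sub>v u j))\<^sup>2" for i j
    unfolding vnorm_power2 by (simp add: y_def del: index_mult_mat_vec(1))
  have le: "(vnorm (B i j *\<^sub>v u j))\<^sup>2 \<le> (vnorm (u j))\<^sup>2" if "i < g'" "j < g" for i j
  proof -
    have "vnorm (B i j *\<^sub>v u j) \<le> 1 * vnorm (u j)"
      using vnorm_mult_le[OF B_carrier uc] mult_right_mono[OF B_contraction[OF that] vnorm_nonneg] order_trans by blast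
    then show ?thesis by (intro power_mono) auto
  qed
  \<comment> \<open>The sum of these nonnegative defects is at most 0.\<close>
  define T where "T = (\<lambda>i j. (\<Sum>a<d'. (cmod (y i j a - m i a))\<^sup>2) + ((vnorm (u j))\<^sup>2 - (vnorm (B i j *\<^sub>v u j))\<^sup>2))"
  have T0: "T i j \<ge> 0" if "i < g'" "j < g" for i j
    unfolding T_def using le[OF that] by (simp add: sum_nonneg)
  have "(\<Sum>i<g'. \<Sum>j<g. \<Sum>a<d'. (cmod (y i j a - m i a))\<^sup>2) = (\<Sum>i<g'. \<Sum>a<d'. \<Sum>j<g. (cmod (y i j a - m i a))\<^sup>2)"
    by (rule sum.cong[OF refl]) (rule sum.swap)
  also have "\<dots> = (\<Sum>i<g'. \<Sum>a<d'. (\<Sum>j<g. (cmod (y i j a))\<^sup>2) - (cmod (\<Sum>j<g. y i j a))\<^sup>2 / real g)"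
    unfolding m_def sum_cmod_diff_mean[OF pos(2)] ..
  also have "\<dots> = (\<Sum>i<g'. \<Sum>a<d'. \<Sum>j<g. (cmod (y i j a))\<^sup>2) - real g'"
    unfolding sum_subtractf sum_divide_distrib[symmetric] sum1 using pos by simp
  also have "(\<Sum>i<g'. \<Sum>a<d'. \<Sum>j<g. (cmod (y i j a))\<^sup>2) = (\<Sum>i<g'. \<Sum>j<g. (vnorm (B i j *\<^sub>v u j))\<^sup>2)"
    unfolding yn[symmetric] by (rule sum.cong[OF refl]) (rule sum.swap)
  finally have "(\<Sum>i<g'. \<Sum>j<g. T i j) = real g' * (\<Sum>j<g. (vnorm (u j))\<^sup>2) - real g'"
    unfolding T_def sum.distrib sum_subtractf by simp
  also have "\<dots> \<le> 0" using sum2 by (simp add: mult_left_le)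
  finally have "(\<Sum>i<g'. \<Sum>j<g. T i j) \<le> 0" .
  moreover have "0 \<le> (\<Sum>i<g'. \<Sum>j<g. T i j)" using T0 by (intro sum_nonneg) auto
  ultimately have "(\<Sum>i<g'. \<Sum>j<g. T i j) = 0" by simp
  then have "(\<Sum>j<g. T i j) = 0" if "i < g'" for i
    using that T0 by (subst (asm) sum_nonneg_eq_0_iff) (auto intro!: sum_nonneg)
  then have T: "T i j = 0" if "i < g'" "j < g" for i j
    using that T0 sum_nonneg_eq_0_iff[of "{..<g}" "T i"] by simp
  have Tsplit: "(\<Sum>a<d'. (cmod (y i j a - m i a))\<^sup>2) = 0" "(vnorm (B i j *\<^sub>v u j))\<^sup>2 = (vnorm (u j))\<^sup>2" if "i < g'" "j < g" for i j
  proof -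
    have "0 \<le> (\<Sum>a<d'. (cmod (y i j a - m i a))\<^sup>2)" by (simp add: sum_nonneg)
    then show "(\<Sum>a<d'. (cmod (y i j a - m i a))\<^sup>2) = 0" "(vnorm (B i j *\<^sub>v u j))\<^sup>2 = (vnorm (u j))\<^sup>2"
      using T[OF that] le[OF that] unfolding T_def by linarith+
  qed
  define w where "w = (\<lambda>i. Matrix.vec d' (m i))"
  have Bw: "B i j *\<^sub>v u j = w i" if "i < g'" "j < g" for i j
  proof (rule eq_vecI)
    fix a assume "a < dim_vec (w i)"
    then have a: "a < d'" by (simp add: w_def)
    have "(cmod (y i j a - m i a))\<^sup>2 = 0"
      using Tsplit(1)[OF that] a sum_nonneg_eq_0_iff[of "{..<d'}" "\<lambda>a. (cmod (y i j a - m i a))\<^sup>2"] by simp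
    then show "vec_index (B i j *\<^sub>v u j) a = vec_index (w i) a" using a by (simp add: y_def w_def)
  qed (simp add: w_def)
  \<comment> \<open>All \<open>u j\<close> and \<open>w i\<close> have the same norm, which is not 0; rescaling makes them unit vectors.\<close>
  define \<rho> where "\<rho> = vnorm (w 0)"
  have nu: "vnorm (u j) = \<rho>" if "j < g" for j
    using Tsplit(2)[OF pos(1) that] unfolding Bw[OF pos(1) that] \<rho>_def by (simp add: power2_eq_iff_nonneg)
  have nw: "vnorm (w i) = \<rho>" if "i < g'" for i
    using Tsplit(2)[OF that pos(2)] unfolding Bw[OF that pos(2)] nu[OF pos(2)]
    by (simp add: power2_eq_iff_nonneg \<rho>_def)
  have "\<rho> \<noteq> 0"
  proof
    assume "\<rho> = 0"
    then have "(vnorm (w i))\<^sup>2 = 0" if "i < g'" for i using nw[OF that] by simp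
    then have "m i a = 0" if "i < g'" "a < d'" for i a
      using that sum_nonneg_eq_0_iff[of "{..<d'}" "\<lambda>a. (cmod (m i a))\<^sup>2"] by (auto simp: vnorm_power2 w_def)
    then have "(\<Sum>i<g'. \<Sum>a<d'. (cmod (\<Sum>j<g. y i j a))\<^sup>2) = 0" using pos by (simp add: m_def)
    then show False using sum1 pos by simp
  qed
  then have \<rho>: "\<rho> > 0" unfolding \<rho>_def by (simp add: less_le)
  let ?r = "complex_of_real (1 / \<rho>)"
  show thesis
  proof (rule that)
    show "?r \<cdot>\<^sub>v u j \<in> carrier_vec d \<and> vnorm (?r \<cdot>\<^sub>v u j) = 1" if "j < g" for j
      using uc nu[OF that] \<rho> by (simp add: norm_divide)
    show "?r \<cdot>\<^sub>v w i \<in> carrier_vec d' \<and> vnorm (?r \<cdot>\<^sub>v w i) = 1" if "i < g'" for i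
      using nw[OF that] \<rho> by (simp add: norm_divide w_def)
    show "B i j *\<^sub>v (?r \<cdot>\<^sub>v u j) = ?r \<cdot>\<^sub>v w i" if "i < g'" "j < g" for i j
      using mult_mat_vec[OF B_carrier uc] Bw[OF that] by simp
  qed
qed

end

text \<open>A function as above together with unit vectors on which the coefficients \<open>B\<^sub>i\<^sub>j\<close> are isometric. They
  turn out to be two orthonormal families.\<close>

locale ball_map_frame = ball_map_zero +
  fixes u v :: "nat \<Rightarrow> complex Matrix.vec"
  assumes u: "\<And>j. j < g \<Longrightarrow> u j \<in> carrier_vec d \<and> vnorm (u j) = 1"
    and v: "\<And>i. i < g' \<Longrightarrow> v i \<in> carrier_vec d' \<and> vnorm (v i) = 1"
    and Bu: "\<And>i j. i < g' \<Longrightarrow> j < g \<Longrightarrow> B i j *\<^sub>v u j = v i"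
begin

lemma Bv: assumes "i < g'" "j < g" shows "mat_adjoint (B i j) *\<^sub>v v i = u j"
proof -
  have "(op_norm (mat_adjoint (B i j)))\<^sup>2 \<le> 1"
    using B_contraction[OF assms] op_norm_nonneg by (simp add: op_norm_adjoint power_le_one)
  then have "mat_adjoint (B i j) *\<^sub>v (mat_adjoint (mat_adjoint (B i j)) *\<^sub>v u j) = complex_of_real 1 \<cdot>\<^sub>v u j"
    using u[OF assms(2)] v[OF assms(1)] Bu[OF assms]
    by (intro mult_adjoint_of_norm[OF mat_adjoint_carrier[OF B_carrier]]) simp_all
  then show ?thesis using Bu[OF assms] by simp
qed

lemma u_orthogonal: "j < g \<Longrightarrow> k < g \<Longrightarrow> j \<noteq> k \<Longrightarrow> u j \<bullet>c u k = 0"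
  and Bu_zero: "i < g' \<Longrightarrow> j < g \<Longrightarrow> k < g \<Longrightarrow> j \<noteq> k \<Longrightarrow> B i j *\<^sub>v u k = 0\<^sub>v d'"
proof -
  have *: "u j \<bullet>c u k = 0 \<and> B i j *\<^sub>v u k = 0\<^sub>v d'" if "i < g'" "j < g" "k < g" "j \<noteq> k" for i j k
    using row_contraction_orthogonal[OF B_carrier B_carrier _ _ _ _ _ _ Bu[OF that(1,2)] Bu[OF that(1,3)] Bv[OF that(1,2)] Bv[OF that(1,3)]
      B_row_contraction[OF that]] u[OF that(2)] u[OF that(3)] v[OF that(1)] by simp
  from *[OF pos(1)] show "j < g \<Longrightarrow> k < g \<Longrightarrow> j \<noteq> k \<Longrightarrow> u j \<bullet>c u k = 0" by blast
  from * show "i < g' \<Longrightarrow> j < g \<Longrightarrow> k < g \<Longrightarrow> j \<noteq> k \<Longrightarrow> B i j *\<^sub>v u k = 0\<^sub>v d'" by blast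
qed

lemma v_orthogonal: "i < g' \<Longrightarrow> k < g' \<Longrightarrow> i \<noteq> k \<Longrightarrow> v i \<bullet>c v k = 0"
  and Bv_zero: "i < g' \<Longrightarrow> k < g' \<Longrightarrow> j < g \<Longrightarrow> i \<noteq> k \<Longrightarrow> mat_adjoint (B i j) *\<^sub>v v k = 0\<^sub>v d"
proof -
  have *: "v i \<bullet>c v k = 0 \<and> mat_adjoint (B i j) *\<^sub>v v k = 0\<^sub>v d" if "j < g" "i < g'" "k < g'" "i \<noteq> k" for i j k
    using row_contraction_orthogonal[OF mat_adjoint_carrier[OF B_carrier] mat_adjoint_carrier[OF B_carrier] _ _ _ _ _ _
      Bv[OF that(2,1)] Bv[OF that(3,1)] _ _ B_column_contraction[OF that]]
      Bu[OF that(2,1)] Bu[OF that(3,1)] u[OF that(1)] v[OF that(2)] v[OF that(3)] by simp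
  from *[OF pos(2)] show "i < g' \<Longrightarrow> k < g' \<Longrightarrow> i \<noteq> k \<Longrightarrow> v i \<bullet>c v k = 0" by blast
  from * show "i < g' \<Longrightarrow> k < g' \<Longrightarrow> j < g \<Longrightarrow> i \<noteq> k \<Longrightarrow> mat_adjoint (B i j) *\<^sub>v v k = 0\<^sub>v d" by blast
qed

end

section \<open>Vanishing of the higher coefficients on the frame\<close>

text \<open>The vector \<open>x \<otimes> e\<^sub>t\<close> of \<open>\<complex>\<^sup>k \<otimes> \<complex>\<^sup>N\<close>.\<close>

definition tensor_unit :: "nat \<Rightarrow> nat \<Rightarrow> complex Matrix.vec \<Rightarrow> nat \<Rightarrow> complex Matrix.vec" where
  "tensor_unit k N x t = Matrix.vec (k * N) (\<lambda>p. if p mod N = t then vec_index x (p div N) else 0)"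

lemma tensor_unit_carrier [simp]: "tensor_unit k N x t \<in> carrier_vec (k * N)"
  by (simp add: tensor_unit_def)

lemma dim_tensor_unit [simp]: "dim_vec (tensor_unit k N x t) = k * N"
  by (simp add: tensor_unit_def)

lemma index_tensor_unit:
  "a < k \<Longrightarrow> s < N \<Longrightarrow> vec_index (tensor_unit k N x t) (a * N + s) = (if s = t then vec_index x a else 0)"
  by (simp add: tensor_unit_def block_index_less)

lemma vnorm_tensor_unit:
  assumes "x \<in> carrier_vec k" "t < N"
  shows "vnorm (tensor_unit k N x t) = vnorm x"
proof -
  have "(vnorm (tensor_unit k N x t))\<^sup>2 = (\<Sum>a<k. \<Sum>s<N. if s = t then (cmod (vec_index x a))\<^sup>2 else 0)"
    unfolding vnorm_power2 carrier_vecD[OF tensor_unit_carrier] sum_lessThan_blocks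
    by (intro sum.cong refl) (simp add: index_tensor_unit)
  also have "\<dots> = (vnorm x)\<^sup>2" using assms by (simp add: vnorm_power2)
  finally show ?thesis by (simp add: power2_eq_iff_nonneg)
qed

text \<open>A matrix of zeros and ones with at most one nonzero entry in each row and column is
  contractive.\<close>

lemma op_norm_partial_permutation:
  assumes A: "A \<in> carrier_mat m n" and entry: "\<And>p q. p < m \<Longrightarrow> q < n \<Longrightarrow> A $$ (p, q) = (if \<rho> p q then 1 else 0)"
    and row: "\<And>p q q'. p < m \<Longrightarrow> q < n \<Longrightarrow> q' < n \<Longrightarrow> \<rho> p q \<Longrightarrow> \<rho> p q' \<Longrightarrow> q = q'"
    and col: "\<And>p p' q. p < m \<Longrightarrow> p' < m \<Longrightarrow> q < n \<Longrightarrow> \<rho> p q \<Longrightarrow> \<rho> p' q \<Longrightarrow> p = p'"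
  shows "op_norm A \<le> 1"
proof (rule op_norm_leI[OF A])
  fix x :: "complex Matrix.vec" assume x: "x \<in> carrier_vec n"
  have Ax: "(cmod (vec_index (A *\<^sub>v x) p))\<^sup>2 = (\<Sum>q<n. if \<rho> p q then (cmod (vec_index x q))\<^sup>2 else 0)" if p: "p < m" for p
  proof (cases "\<exists>q<n. \<rho> p q")
    case True
    then obtain q where q: "q < n" "\<rho> p q" by blast
    have eq: "\<rho> p q' \<longleftrightarrow> q' = q" if "q' < n" for q' using row[OF p that q(1)] q that by blast
    have "vec_index (A *\<^sub>v x) p = (\<Sum>q'<n. if q' = q then vec_index x q' else 0)"
      unfolding index_mat_vec[OF A x p] using p by (intro sum.cong refl) (auto simp: entry eq)
    moreover have "(\<Sum>q'<n. if \<rho> p q' then (cmod (vec_index x q'))\<^sup>2 else 0) = (\<Sum>q'<n. if q' = q then (cmod (vec_index x q'))\<^sup>2 else 0)"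
      by (intro sum.cong refl) (simp add: eq)
    ultimately show ?thesis using q by simp
  next
    case False
    then have "vec_index (A *\<^sub>v x) p = 0"
      unfolding index_mat_vec[OF A x p] using p by (intro sum.neutral) (auto simp: entry)
    then show ?thesis using False by (simp del: index_mult_mat_vec)
  qed
  have d: "dim_vec (A *\<^sub>v x) = m" using A by simp
  have "(vnorm (A *\<^sub>v x))\<^sup>2 = (\<Sum>p<m. \<Sum>q<n. if \<rho> p q then (cmod (vec_index x q))\<^sup>2 else 0)"
    unfolding vnorm_power2 d by (intro sum.cong refl) (simp add: Ax del: index_mult_mat_vec)
  also have "\<dots> = (\<Sum>q<n. \<Sum>p<m. if \<rho> p q then (cmod (vec_index x q))\<^sup>2 else 0)" by (rule sum.swap)
  also have "\<dots> \<le> (\<Sum>q<n. (cmod (vec_index x q))\<^sup>2)"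
  proof (rule sum_mono)
    fix q assume "q \<in> {..<n}"
    then have q: "q < n" by simp
    show "(\<Sum>p<m. if \<rho> p q then (cmod (vec_index x q))\<^sup>2 else 0) \<le> (cmod (vec_index x q))\<^sup>2"
    proof (cases "\<exists>p<m. \<rho> p q")
      case True
      then obtain p where p: "p < m" "\<rho> p q" by blast
      have "\<rho> p' q \<longleftrightarrow> p' = p" if "p' < m" for p' using col[OF that p(1) q] p by blast
      then have "(\<Sum>p'<m. if \<rho> p' q then (cmod (vec_index x q))\<^sup>2 else 0) = (\<Sum>p'<m. if p' = p then (cmod (vec_index x q))\<^sup>2 else 0)"
        by (intro sum.cong refl) simp
      then show ?thesis using p by simp
    next
      case False
      then have "(\<Sum>p<m. if \<rho> p q then (cmod (vec_index x q))\<^sup>2 else 0) = 0" by (intro sum.neutral) auto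
      then show ?thesis by simp
    qed
  qed
  also have "\<dots> = (vnorm x)\<^sup>2" using x by (simp add: vnorm_power2)
  finally show "vnorm (A *\<^sub>v x) \<le> 1 * vnorm x" using power2_le_imp_le[OF _ vnorm_nonneg] by simp
qed simp

text \<open>For a word \<open>w = (i\<^sub>1, j\<^sub>1) \<dots> (i\<^sub>\<alpha>, j\<^sub>\<alpha>)\<close> the shift \<open>\<Sum>\<^sub>k E\<^bsub>i\<^sub>k j\<^sub>k\<^esub> \<otimes> E\<^bsub>k-1,k\<^esub>\<close> singles out \<open>w\<close>
  among all words of length \<open>\<alpha>\<close>. Two further units, placed in fresh coordinates, make it isometric
  at \<open>e\<^bsub>j\<^sub>0\<^esub> \<otimes> e\<^sub>\<alpha>\<close> and coisometric at \<open>e\<^bsub>i\<^sub>0\<^esub> \<otimes> e\<^sub>0\<close> unless it is so already.\<close>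

definition word_rel :: "(nat \<times> nat) list \<Rightarrow> nat \<Rightarrow> nat \<Rightarrow> nat \<Rightarrow> nat \<Rightarrow> nat \<Rightarrow> nat \<Rightarrow> bool" where
  "word_rel w i0 j0 i k j m \<longleftrightarrow>
     k < length w \<and> m = Suc k \<and> w ! k = (i, j) \<or>
     k = Suc (length w) \<and> m = length w \<and> i = 0 \<and> j = j0 \<and> j0 \<noteq> snd (w ! (length w - 1)) \<or>
     k = 0 \<and> m = length w + 2 \<and> i = i0 \<and> j = 0 \<and> i0 \<noteq> fst (w ! 0)"

lemma word_rel_inj:
  assumes w: "length w \<ge> 2"
  shows "word_rel w i0 j0 i k j m \<Longrightarrow> word_rel w i0 j0 i k j' m' \<Longrightarrow> j = j' \<and> m = m'"
    and "word_rel w i0 j0 i k j m \<Longrightarrow> word_rel w i0 j0 i' k' j m \<Longrightarrow> i = i' \<and> k = k'"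
proof -
  show "j = j' \<and> m = m'" if "word_rel w i0 j0 i k j m" "word_rel w i0 j0 i k j' m'"
    using that w unfolding word_rel_def by (elim disjE conjE) auto
  have last: "k = length w - 1" if "length w = Suc k" for k using that by simp
  show "i = i' \<and> k = k'" if "word_rel w i0 j0 i k j m" "word_rel w i0 j0 i' k' j m"
    using that w last[of k] last[of k'] unfolding word_rel_def by (elim disjE conjE) force+
qed

text \<open>The test point for \<open>w\<close>, at size \<open>\<alpha> + 3\<close>: the coordinates \<open>0, \<dots>, \<alpha>\<close> carry the shift, and \<open>\<alpha> + 1\<close> and \<open>\<alpha> + 2\<close>
  are the fresh coordinates of the further units.\<close>

definition word_point :: "nat \<Rightarrow> nat \<Rightarrow> (nat \<times> nat) list \<Rightarrow> nat \<Rightarrow> nat \<Rightarrow> complex mat" where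
  "word_point g' g w i0 j0 = (let N = length w + 3 in Matrix.mat (g' * N) (g * N) (\<lambda>(p, q).
     if word_rel w i0 j0 (p div N) (p mod N) (q div N) (q mod N) then 1 else 0))"

lemma word_point_carrier: "word_point g' g w i0 j0 \<in> carrier_mat (g' * (length w + 3)) (g * (length w + 3))"
  by (simp add: word_point_def Let_def)

lemma index_word_point:
  assumes "i < g'" "k < length w + 3" "j < g" "m < length w + 3"
  shows "word_point g' g w i0 j0 $$ (i * (length w + 3) + k, j * (length w + 3) + m) =
    (if word_rel w i0 j0 i k j m then 1 else 0)"
  using block_index_less[OF assms(1,2)] block_index_less[OF assms(3,4)] assms
  by (simp add: word_point_def Let_def)

lemma op_norm_word_point:
  assumes w: "length w \<ge> 2"
  shows "op_norm (word_point g' g w i0 j0) \<le> 1"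
proof (rule op_norm_partial_permutation[OF word_point_carrier])
  let ?N = "length w + 3"
  have pair: "p = q" if "p div ?N = q div ?N" "p mod ?N = q mod ?N" for p q
    using that by (metis div_mult_mod_eq)
  show "word_point g' g w i0 j0 $$ (p, q) = (if word_rel w i0 j0 (p div ?N) (p mod ?N) (q div ?N) (q mod ?N) then 1 else 0)"
    if "p < g' * ?N" "q < g * ?N" for p q
    using that by (simp add: word_point_def Let_def)
  show "q = q'" if "word_rel w i0 j0 (p div ?N) (p mod ?N) (q div ?N) (q mod ?N)"
    "word_rel w i0 j0 (p div ?N) (p mod ?N) (q' div ?N) (q' mod ?N)" for p q q'
    using word_rel_inj(1)[OF w that] pair by blast
  show "p = p'" if "word_rel w i0 j0 (p div ?N) (p mod ?N) (q div ?N) (q mod ?N)"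
    "word_rel w i0 j0 (p' div ?N) (p' mod ?N) (q div ?N) (q mod ?N)" for p p' q
    using word_rel_inj(2)[OF w that] pair by blast
qed

text \<open>The only chain of units from coordinate \<open>k \<le> \<alpha>\<close> to coordinate \<open>\<alpha>\<close> spells the rest of \<open>w\<close>: no unit has
  the column coordinate \<open>\<alpha> + 1\<close> or the row coordinate \<open>\<alpha> + 2\<close>.\<close>

lemma word_eval_word_point:
  assumes w: "length w \<ge> 2" and v: "set v \<subseteq> {..<g'} \<times> {..<g}" and k: "k \<le> length w"
  shows "word_eval (length w + 3) (word_point g' g w i0 j0) v $$ (k, length w) = (if v = drop k w then 1 else 0)"
  using v k
proof (induction v arbitrary: k)
  case Nil
  then show ?case by auto
next
  case (Cons x v)
  let ?N = "length w + 3" and ?X = "word_point g' g w i0 j0"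
  obtain i j where x: "x = (i, j)" "i < g'" "j < g" using Cons.prems by (cases x) auto
  have bl: "block ?N ?X i j $$ (k, m) = (if word_rel w i0 j0 i k j m then 1 else 0)" if "k < ?N" "m < ?N" for k m
    using that x by (simp add: block_def index_word_point)
  \<comment> \<open>A chain that moves to the coordinate \<open>\<alpha> + 2\<close> cannot be continued.\<close>
  have far: "word_eval ?N ?X v $$ (length w + 2, length w) = 0"
  proof (cases v)
    case (Cons y v')
    then have y: "fst y < g'" "snd y < g" using Cons.prems by auto
    have "block ?N ?X (fst y) (snd y) $$ (length w + 2, m) = 0" if "m < ?N" for m
      using that y index_word_point[of "fst y" g' "length w + 2" w "snd y" g m i0 j0]
      by (simp add: block_def word_rel_def)
    then show ?thesis unfolding Cons word_eval_Cons
      by (subst index_mat_mat[OF block_carrier word_eval_carrier]) auto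
  qed simp
  have "word_eval ?N ?X (x # v) $$ (k, length w) = (\<Sum>m<?N. block ?N ?X i j $$ (k, m) * word_eval ?N ?X v $$ (m, length w))"
    using Cons.prems x by (simp only: word_eval_Cons fst_conv snd_conv)
      (rule index_mat_mat[OF block_carrier word_eval_carrier], auto)
  also have "\<dots> = (\<Sum>m<?N. if m = Suc k then (if k < length w \<and> w ! k = (i, j) then word_eval ?N ?X v $$ (Suc k, length w) else 0) else 0)"
  proof (intro sum.cong refl)
    fix m assume "m \<in> {..<?N}"
    then show "block ?N ?X i j $$ (k, m) * word_eval ?N ?X v $$ (m, length w) =
      (if m = Suc k then (if k < length w \<and> w ! k = (i, j) then word_eval ?N ?X v $$ (Suc k, length w) else 0) else 0)"
      using Cons.prems far by (auto simp: bl word_rel_def)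
  qed
  also have "\<dots> = (if k < length w \<and> w ! k = (i, j) then word_eval ?N ?X v $$ (Suc k, length w) else 0)"
    using Cons.prems by simp
  also have "\<dots> = (if x # v = drop k w then 1 else 0)"
  proof (cases "k < length w")
    case True
    then have "drop k w = w ! k # drop (Suc k) w" by (rule Cons_nth_drop_Suc[symmetric])
    then show ?thesis using Cons.IH[of "Suc k"] Cons.prems True x by auto
  qed simp
  finally show ?case .
qed

context ball_map_frame
begin

lemma lin_part_column:
  assumes j: "j < g" and i: "a < d'" "s < N" "t < N"
  shows "(\<Sum>c<d. lin_part N X $$ (a * N + s, c * N + t) * vec_index (u j) c) = (\<Sum>i<g'. vec_index (v i) a * X $$ (i * N + s, j * N + t))"
proof -
  have "(\<Sum>c<d. lin_part N X $$ (a * N + s, c * N + t) * vec_index (u j) c) =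
      (\<Sum>c<d. \<Sum>i<g'. \<Sum>k<g. B i k $$ (a, c) * X $$ (i * N + s, k * N + t) * vec_index (u j) c)"
    using i by (intro sum.cong refl) (simp add: index_lin_part sum_distrib_right)
  also have "\<dots> = (\<Sum>i<g'. \<Sum>c<d. \<Sum>k<g. B i k $$ (a, c) * X $$ (i * N + s, k * N + t) * vec_index (u j) c)"
    by (rule sum.swap)
  also have "\<dots> = (\<Sum>i<g'. vec_index (v i) a * X $$ (i * N + s, j * N + t))"
  proof (intro sum.cong refl)
    fix i assume "i \<in> {..<g'}"
    then have i': "i < g'" by simp
    have B_u: "(\<Sum>c<d. B i k $$ (a, c) * vec_index (u j) c) = (if k = j then vec_index (v i) a else 0)" if "k < g" for k
      using Bu[OF i' j] Bu_zero[OF i' that j] index_mat_vec[OF B_carrier _ i(1), of "u j" i k] u[OF j] i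
      by (auto simp del: index_mult_mat_vec)
    have "(\<Sum>c<d. \<Sum>k<g. B i k $$ (a, c) * X $$ (i * N + s, k * N + t) * vec_index (u j) c) =
        (\<Sum>k<g. (\<Sum>c<d. B i k $$ (a, c) * vec_index (u j) c) * X $$ (i * N + s, k * N + t))"
      by (subst sum.swap) (simp add: sum_distrib_left sum_distrib_right mult_ac)
    also have "\<dots> = (\<Sum>k<g. if k = j then vec_index (v i) a * X $$ (i * N + s, k * N + t) else 0)"
      by (intro sum.cong refl) (simp add: B_u)
    finally show "(\<Sum>c<d. \<Sum>k<g. B i k $$ (a, c) * X $$ (i * N + s, k * N + t) * vec_index (u j) c) =
        vec_index (v i) a * X $$ (i * N + s, j * N + t)"
      using j by simp
  qed
  finally show ?thesis .
qed

lemma lin_part_row: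
  assumes k: "k < g'" and i: "s < N" "c < d" "t < N"
  shows "(\<Sum>a<d'. lin_part N X $$ (a * N + s, c * N + t) * cnj (vec_index (v k) a)) =
    (\<Sum>j<g. cnj (vec_index (u j) c) * X $$ (k * N + s, j * N + t))"
proof -
  have B_v: "(\<Sum>a<d'. B i j $$ (a, c) * cnj (vec_index (v k) a)) = (if i = k then cnj (vec_index (u j) c) else 0)"
    if "i < g'" "j < g" for i j
  proof -
    have "(\<Sum>a<d'. B i j $$ (a, c) * cnj (vec_index (v k) a)) = cnj (vec_index (mat_adjoint (B i j) *\<^sub>v v k) c)"
      using v[OF k] i by (subst index_mat_vec[OF mat_adjoint_carrier[OF B_carrier]]) auto
    then show ?thesis using Bv[OF k that(2)] Bv_zero[OF that(1) k that(2)] i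
      by (auto simp del: index_mult_mat_vec)
  qed
  have "(\<Sum>a<d'. lin_part N X $$ (a * N + s, c * N + t) * cnj (vec_index (v k) a)) =
      (\<Sum>a<d'. \<Sum>i<g'. \<Sum>j<g. B i j $$ (a, c) * X $$ (i * N + s, j * N + t) * cnj (vec_index (v k) a))"
    using i by (intro sum.cong refl) (simp add: index_lin_part sum_distrib_right)
  also have "\<dots> = (\<Sum>i<g'. \<Sum>a<d'. \<Sum>j<g. B i j $$ (a, c) * X $$ (i * N + s, j * N + t) * cnj (vec_index (v k) a))"
    by (rule sum.swap)
  also have "\<dots> = (\<Sum>i<g'. if i = k then (\<Sum>j<g. cnj (vec_index (u j) c) * X $$ (i * N + s, j * N + t)) else 0)"
  proof (intro sum.cong refl)
    fix i assume "i \<in> {..<g'}"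
    then have "(\<Sum>j<g. (\<Sum>a<d'. B i j $$ (a, c) * cnj (vec_index (v k) a)) * X $$ (i * N + s, j * N + t)) =
        (if i = k then (\<Sum>j<g. cnj (vec_index (u j) c) * X $$ (i * N + s, j * N + t)) else 0)"
      by (simp add: B_v)
    then show "(\<Sum>a<d'. \<Sum>j<g. B i j $$ (a, c) * X $$ (i * N + s, j * N + t) * cnj (vec_index (v k) a)) =
        (if i = k then (\<Sum>j<g. cnj (vec_index (u j) c) * X $$ (i * N + s, j * N + t)) else 0)"
      by (subst sum.swap) (simp add: sum_distrib_left sum_distrib_right mult_ac)
  qed
  finally show ?thesis using k by simp
qed

lemma lin_part_tensor_unit:
  assumes j: "j < g" and t: "t < N" and i: "i < g'" "s < N"
    and X: "\<And>k r. k < g' \<Longrightarrow> r < N \<Longrightarrow> X $$ (k * N + r, j * N + t) = (if k = i \<and> r = s then 1 else 0)"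
  shows "lin_part N X *\<^sub>v tensor_unit d N (u j) t = tensor_unit d' N (v i) s"
proof (rule eq_vecI)
  fix p assume "p < dim_vec (tensor_unit d' N (v i) s)"
  then have "p < d' * N" by (simp add: tensor_unit_def)
  then obtain a r where ar: "a < d'" "r < N" "p = a * N + r" by (rule block_index_cases)
  have "vec_index (lin_part N X *\<^sub>v tensor_unit d N (u j) t) p =
      (\<Sum>c<d. \<Sum>q<N. if q = t then lin_part N X $$ (a * N + r, c * N + q) * vec_index (u j) c else 0)"
    unfolding ar(3) index_mat_vec[OF lin_part_carrier tensor_unit_carrier block_index_less[OF ar(1,2)]] sum_lessThan_blocks
    by (intro sum.cong refl) (simp add: index_tensor_unit)
  also have "\<dots> = (\<Sum>c<d. lin_part N X $$ (a * N + r, c * N + t) * vec_index (u j) c)"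
    using t by simp
  also have "\<dots> = (\<Sum>k<g'. if k = i then (if r = s then vec_index (v k) a else 0) else 0)"
    unfolding lin_part_column[OF j ar(1,2) t] using ar by (intro sum.cong refl) (simp add: X)
  also have "\<dots> = vec_index (tensor_unit d' N (v i) s) p" using i ar by (simp add: index_tensor_unit)
  finally show "vec_index (lin_part N X *\<^sub>v tensor_unit d N (u j) t) p = vec_index (tensor_unit d' N (v i) s) p" .
qed (use carrier_matD[OF lin_part_carrier[of N X]] in \<open>simp add: tensor_unit_def\<close>)

text \<open>If column \<open>(j, t)\<close> of \<open>X\<close> is the unit vector \<open>(i, s)\<close>, then the linear part at \<open>X\<close> maps the unit vector
  \<open>u\<^sub>j \<otimes> e\<^sub>t\<close> to the unit vector \<open>v\<^sub>i \<otimes> e\<^sub>s\<close>, and the Schwarz lemma applies.\<close>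

lemma rigid_tensor_unit:
  assumes N: "N > 0" and X: "X \<in> closed_ball g' g N" and j: "j < g" and t: "t < N" and i: "i < g'" "s < N"
    and Xe: "\<And>k r. k < g' \<Longrightarrow> r < N \<Longrightarrow> X $$ (k * N + r, j * N + t) = (if k = i \<and> r = s then 1 else 0)"
    and z: "cmod z < 1"
  shows "\<phi> (z \<cdot>\<^sub>m X) *\<^sub>v tensor_unit d N (u j) t = z \<cdot>\<^sub>v tensor_unit d' N (v i) s"
    "mat_adjoint (\<phi> (z \<cdot>\<^sub>m X)) *\<^sub>v tensor_unit d' N (v i) s = cnj z \<cdot>\<^sub>v tensor_unit d N (u j) t"
proof -
  interpret C: contractive_disc "\<lambda>z. \<phi> (z \<cdot>\<^sub>m X)" "lin_part N X" "d' * N" "d * N"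
    by (rule contractive_disc[OF N X])
  have n: "vnorm (tensor_unit d N (u j) t) = 1" "vnorm (tensor_unit d' N (v i) s) = 1"
    using u[OF j] v[OF i(1)] t i by (simp_all add: vnorm_tensor_unit)
  note R = C.rigid[OF tensor_unit_carrier n lin_part_tensor_unit[OF j t i Xe] z]
  show "\<phi> (z \<cdot>\<^sub>m X) *\<^sub>v tensor_unit d N (u j) t = z \<cdot>\<^sub>v tensor_unit d' N (v i) s"
    "mat_adjoint (\<phi> (z \<cdot>\<^sub>m X)) *\<^sub>v tensor_unit d' N (v i) s = cnj z \<cdot>\<^sub>v tensor_unit d N (u j) t"
    using R by auto
qed

text \<open>A linear functional of the entries of \<open>\<phi>(zX)\<close> that is linear in \<open>z\<close> annihilates the coefficients of
  degree at least 2.\<close>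

lemma linear_imp_coeff_zero:
  assumes N: "N > 0" and X: "X \<in> closed_ball g' g N" and I: "finite I"
    and P: "\<And>r. r \<in> I \<Longrightarrow> p r < d' * N \<and> q r < d * N"
    and lin: "\<And>z. cmod z < 1 \<Longrightarrow> (\<Sum>r\<in>I. k r * \<phi> (z \<cdot>\<^sub>m X) $$ (p r, q r)) = z * y"
    and \<alpha>: "\<alpha> \<ge> 2"
  shows "(\<Sum>r\<in>I. k r * nc_coeff g' g N b X \<alpha> (p r) (q r)) = 0"
proof -
  have "(\<lambda>z. \<Sum>r\<in>I. k r * \<phi> (z \<cdot>\<^sub>m X) $$ (p r, q r)) has_fps_expansion
      Abs_fps (\<lambda>\<alpha>. \<Sum>r\<in>I. k r * nc_coeff g' g N b X \<alpha> (p r) (q r))"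
    using P by (intro has_fps_expansion_lincomb nc_taylorD(2)[OF taylor N X] I) auto
  moreover have "eventually (\<lambda>z. (\<Sum>r\<in>I. k r * \<phi> (z \<cdot>\<^sub>m X) $$ (p r, q r)) = z * y) (nhds 0)"
  proof -
    have "eventually (\<lambda>z :: complex. z \<in> ball 0 1) (nhds 0)" by (rule eventually_nhds_in_open) auto
    then show ?thesis by eventually_elim (simp add: lin)
  qed
  ultimately have "(\<lambda>z. z * y) has_fps_expansion Abs_fps (\<lambda>\<alpha>. \<Sum>r\<in>I. k r * nc_coeff g' g N b X \<alpha> (p r) (q r))"
    by (rule has_fps_expansion_ev_cong)
  moreover have "(\<lambda>z. z * y) has_fps_expansion (fps_X * fps_const y)"
    by (intro fps_expansion_intros)
  ultimately have "Abs_fps (\<lambda>\<alpha>. \<Sum>r\<in>I. k r * nc_coeff g' g N b X \<alpha> (p r) (q r)) = fps_X * fps_const y"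
    by (rule fps_expansion_unique_complex)
  from arg_cong[OF this, of "\<lambda>F. fps_nth F \<alpha>"] show ?thesis using \<alpha> by simp
qed

lemma nc_coeff_word_point:
  assumes w: "length w \<ge> 2" "set w \<subseteq> {..<g'} \<times> {..<g}" and ac: "a < d'" "c < d"
  shows "nc_coeff g' g (length w + 3) b (word_point g' g w i0 j0) (length w) (a * (length w + 3) + 0) (c * (length w + 3) + length w)
    = b w $$ (a, c)"
proof -
  let ?N = "length w + 3" and ?X = "word_point g' g w i0 j0"
  have "nc_coeff g' g ?N b ?X (length w) (a * ?N + 0) (c * ?N + length w) =
      (\<Sum>v\<in>words g' g (length w). if v = w then b v $$ (a, c) else 0)"
    unfolding nc_coeff_def
  proof (intro sum.cong refl)
    fix v assume "v \<in> words g' g (length w)"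
    then have "set v \<subseteq> {..<g'} \<times> {..<g}" by (simp add: words_def)
    from word_eval_word_point[OF w(1) this, of 0]
    have "word_eval ?N ?X v $$ (0, length w) = (if v = w then 1 else 0)" by simp
    then show "kron (b v) (word_eval ?N ?X v) $$ (a * ?N + 0, c * ?N + length w) = (if v = w then b v $$ (a, c) else 0)"
      by (subst index_kron[OF b_carrier word_eval_carrier ac]) auto
  qed
  then show ?thesis using w by (simp add: words_def[of g' g "length w"] finite_words[unfolded words_def])
qed

lemma word_point_closed_ball: "length w \<ge> 2 \<Longrightarrow> word_point g' g w i0 j0 \<in> closed_ball g' g (length w + 3)"
  using word_point_carrier op_norm_word_point by (simp add: closed_ball_def)

text \<open>At the test point for \<open>w\<close> the vector \<open>\<phi>(zX)(u\<^sub>j \<otimes> e\<^sub>\<alpha>)\<close> is linear in \<open>z\<close>; the component along \<open>e\<^sub>0\<close> of its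
  coefficient of degree \<open>\<alpha>\<close> is \<open>b\<^sub>w u\<^sub>j\<close>.\<close>

lemma coeff_column_zero:
  assumes w: "length w \<ge> 2" "set w \<subseteq> {..<g'} \<times> {..<g}" and j: "j < g" and a: "a < d'"
  shows "(\<Sum>c<d. b w $$ (a, c) * vec_index (u j) c) = 0"
proof -
  let ?N = "length w + 3" and ?X = "word_point g' g w 0 j" and ?\<alpha> = "length w"
  have wl: "w ! (?\<alpha> - 1) \<in> {..<g'} \<times> {..<g}" 
  proof -
    have "w ! (?\<alpha> - 1) \<in> set w" using w by (intro nth_mem) auto
    then show ?thesis using w(2) by blast
  qed
  \<comment> \<open>The unit in column \<open>(j, \<alpha>)\<close> belongs to the last letter of \<open>w\<close>, or else is the further unit.\<close>
  obtain i s where i: "i < g'" "s < ?N"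
    and rel: "\<And>k r. word_rel w 0 j k r j ?\<alpha> \<longleftrightarrow> k = i \<and> r = s"
  proof (cases "snd (w ! (?\<alpha> - 1)) = j")
    case True
    then obtain i where i: "w ! (?\<alpha> - 1) = (i, j)" by (cases "w ! (?\<alpha> - 1)") auto
    show thesis
    proof (rule that[of i "?\<alpha> - 1"])
      show "word_rel w 0 j k r j ?\<alpha> \<longleftrightarrow> k = i \<and> r = ?\<alpha> - 1" for k r
      proof
        assume "word_rel w 0 j k r j ?\<alpha>"
        then have "r = ?\<alpha> - 1 \<and> w ! r = (k, j)" using True by (auto simp: word_rel_def)
        then show "k = i \<and> r = ?\<alpha> - 1" using i by auto
      next
        assume "k = i \<and> r = ?\<alpha> - 1"
        then show "word_rel w 0 j k r j ?\<alpha>" using i w by (auto simp: word_rel_def)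
      qed
    qed (use wl i w in auto)
  next
    case False
    have last: "w ! r = w ! (?\<alpha> - 1)" if "?\<alpha> = Suc r" for r using that by simp
    show thesis
    proof (rule that[of 0 "Suc ?\<alpha>"])
      show "word_rel w 0 j k r j ?\<alpha> \<longleftrightarrow> k = 0 \<and> r = Suc ?\<alpha>" for k r
      proof
        assume "word_rel w 0 j k r j ?\<alpha>"
        then show "k = 0 \<and> r = Suc ?\<alpha>"
          unfolding word_rel_def using False last[of r] by (elim disjE conjE) auto
      next
        assume "k = 0 \<and> r = Suc ?\<alpha>"
        then show "word_rel w 0 j k r j ?\<alpha>" unfolding word_rel_def using False by simp
      qed
    qed (use pos in auto)
  qed
  have "(\<Sum>q<d * ?N. vec_index (tensor_unit d ?N (u j) ?\<alpha>) q * nc_coeff g' g ?N b ?X ?\<alpha> (a * ?N + 0) q) = 0"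
  proof (rule linear_imp_coeff_zero[OF _ word_point_closed_ball[OF w(1)] _ _ _ w(1)])
    have p: "a * ?N + 0 < d' * ?N" using a by (intro block_index_less) auto
    then show "a * ?N + 0 < d' * ?N \<and> q < d * ?N" if "q \<in> {..<d * ?N}" for q using that by simp
    fix z :: complex assume z: "cmod z < 1"
    have "\<phi> (z \<cdot>\<^sub>m ?X) *\<^sub>v tensor_unit d ?N (u j) ?\<alpha> = z \<cdot>\<^sub>v tensor_unit d' ?N (v i) s"
      using j i by (intro rigid_tensor_unit(1)[OF _ word_point_closed_ball[OF w(1)] j _ i _ z])
        (auto simp: index_word_point rel)
    from arg_cong[OF this, of "\<lambda>y. vec_index y (a * ?N + 0)"]
    show "(\<Sum>q<d * ?N. vec_index (tensor_unit d ?N (u j) ?\<alpha>) q * \<phi> (z \<cdot>\<^sub>m ?X) $$ (a * ?N + 0, q)) =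
        z * vec_index (tensor_unit d' ?N (v i) s) (a * ?N + 0)"
      using index_mat_vec[OF disc_analyticD(1)[OF hol _ word_point_closed_ball[OF w(1)] z] tensor_unit_carrier p]
        carrier_vecD[OF tensor_unit_carrier[of d' ?N "v i" s]] p by (simp add: mult.commute)
  qed simp_all
  also have "(\<Sum>q<d * ?N. vec_index (tensor_unit d ?N (u j) ?\<alpha>) q * nc_coeff g' g ?N b ?X ?\<alpha> (a * ?N + 0) q) =
      (\<Sum>c<d. \<Sum>t<?N. if t = ?\<alpha> then vec_index (u j) c * nc_coeff g' g ?N b ?X ?\<alpha> (a * ?N + 0) (c * ?N + t) else 0)"
    unfolding sum_lessThan_blocks by (intro sum.cong refl) (simp add: index_tensor_unit)
  also have "\<dots> = (\<Sum>c<d. b w $$ (a, c) * vec_index (u j) c)"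
    by (intro sum.cong refl) (simp add: nc_coeff_word_point[OF w a, simplified])
  finally show ?thesis .
qed

text \<open>Likewise \<open>b\<^sub>w\<^sup>* v\<^sub>i\<close> is the component along \<open>e\<^sub>\<alpha>\<close> of the coefficient of degree \<open>\<alpha>\<close> of \<open>\<phi>(zX)\<^sup>*(v\<^sub>i \<otimes> e\<^sub>0)\<close>.\<close>

lemma coeff_row_zero:
  assumes w: "length w \<ge> 2" "set w \<subseteq> {..<g'} \<times> {..<g}" and i: "i < g'" and c: "c < d"
  shows "(\<Sum>a<d'. b w $$ (a, c) * cnj (vec_index (v i) a)) = 0"
proof -
  let ?N = "length w + 3" and ?X = "word_point g' g w i 0" and ?\<alpha> = "length w"
  have w0: "w ! 0 \<in> {..<g'} \<times> {..<g}" using w nth_mem[of 0 w] by (cases w) auto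
  \<comment> \<open>The unit in row \<open>(i, 0)\<close> belongs to the first letter of \<open>w\<close>, or else is the further unit.\<close>
  obtain j t where j: "j < g" "t < ?N"
    and rel: "\<And>k r. word_rel w i 0 k r j t \<longleftrightarrow> k = i \<and> r = 0"
  proof (cases "fst (w ! 0) = i")
    case True
    then obtain j where j: "w ! 0 = (i, j)" by (cases "w ! 0") auto
    show thesis
    proof (rule that[of j 1])
      show "word_rel w i 0 k r j 1 \<longleftrightarrow> k = i \<and> r = 0" for k r
        using w j by (cases r) (auto simp: word_rel_def)
    qed (use w0 j in auto)
  next
    case False
    show thesis
    proof (rule that[of 0 "?\<alpha> + 2"])
      show "word_rel w i 0 k r 0 (?\<alpha> + 2) \<longleftrightarrow> k = i \<and> r = 0" for k r
        using False by (auto simp: word_rel_def)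
    qed (use pos in auto)
  qed
  have q: "c * ?N + ?\<alpha> < d * ?N" using c by (intro block_index_less) auto
  have "(\<Sum>p<d' * ?N. cnj (vec_index (tensor_unit d' ?N (v i) 0) p) * nc_coeff g' g ?N b ?X ?\<alpha> p (c * ?N + ?\<alpha>)) = 0"
  proof (rule linear_imp_coeff_zero[OF _ word_point_closed_ball[OF w(1)] _ _ _ w(1)])
    show "p < d' * ?N \<and> c * ?N + ?\<alpha> < d * ?N" if "p \<in> {..<d' * ?N}" for p using q that by simp
    fix z :: complex assume z: "cmod z < 1"
    note Gz = disc_analyticD(1)[OF hol _ word_point_closed_ball[OF w(1), of i 0] z, simplified]
    have "mat_adjoint (\<phi> (z \<cdot>\<^sub>m ?X)) *\<^sub>v tensor_unit d' ?N (v i) 0 = cnj z \<cdot>\<^sub>v tensor_unit d ?N (u j) t"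
      using j i by (intro rigid_tensor_unit(2)[OF _ word_point_closed_ball[OF w(1)] j i _ _ z])
        (auto simp: index_word_point rel)
    from arg_cong[OF this, of "\<lambda>y. cnj (vec_index y (c * ?N + ?\<alpha>))"]
    show "(\<Sum>p<d' * ?N. cnj (vec_index (tensor_unit d' ?N (v i) 0) p) * \<phi> (z \<cdot>\<^sub>m ?X) $$ (p, c * ?N + ?\<alpha>)) =
        z * cnj (vec_index (tensor_unit d ?N (u j) t) (c * ?N + ?\<alpha>))"
      using index_mat_vec[OF mat_adjoint_carrier[OF Gz] tensor_unit_carrier q]
        carrier_vecD[OF tensor_unit_carrier[of d ?N "u j" t]] q carrier_matD[OF Gz]
      by (simp add: mult.commute)
  qed simp_all
  also have "(\<Sum>p<d' * ?N. cnj (vec_index (tensor_unit d' ?N (v i) 0) p) * nc_coeff g' g ?N b ?X ?\<alpha> p (c * ?N + ?\<alpha>)) =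
      (\<Sum>a<d'. \<Sum>s<?N. if s = 0 then cnj (vec_index (v i) a) * nc_coeff g' g ?N b ?X ?\<alpha> (a * ?N + s) (c * ?N + ?\<alpha>) else 0)"
    unfolding sum_lessThan_blocks by (intro sum.cong refl) (simp add: index_tensor_unit)
  also have "\<dots> = (\<Sum>a<d'. b w $$ (a, c) * cnj (vec_index (v i) a))"
    by (intro sum.cong refl) (simp add: nc_coeff_word_point[OF w _ c, simplified])
  finally show ?thesis .
qed

lemma phi_nc_series: "nc_series g' g d' d \<phi> b 1"
  by (rule nc_taylor_nc_series[OF hol taylor])

lemma phi_sums:
  assumes "N > 0" "X \<in> int_ball g' g N" "p < d' * N" "q < d * N"
  shows "(\<lambda>\<alpha>. nc_coeff g' g N b X \<alpha> p q) sums (\<phi> X $$ (p, q))"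
  using phi_nc_series assms unfolding nc_series_def nc_coeff_def int_ball_def by auto

text \<open>A linear functional of the entries that annihilates all coefficients of degree other than 1
  only sees the linear part.\<close>

lemma sums_linear_part:
  assumes X: "N > 0" "X \<in> int_ball g' g N" and I: "finite I"
    and P: "\<And>r. r \<in> I \<Longrightarrow> p r < d' * N \<and> q r < d * N"
    and zero: "\<And>\<alpha>. \<alpha> \<noteq> 1 \<Longrightarrow> (\<Sum>r\<in>I. nc_coeff g' g N b X \<alpha> (p r) (q r) * k r) = 0"
  shows "(\<Sum>r\<in>I. \<phi> X $$ (p r, q r) * k r) = (\<Sum>r\<in>I. lin_part N X $$ (p r, q r) * k r)"
proof -
  have "(\<lambda>\<alpha>. \<Sum>r\<in>I. nc_coeff g' g N b X \<alpha> (p r) (q r) * k r) sums (\<Sum>r\<in>I. \<phi> X $$ (p r, q r) * k r)"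
    using P by (intro sums_sum sums_mult2 phi_sums X) auto
  moreover have "(\<lambda>\<alpha>. \<Sum>r\<in>I. nc_coeff g' g N b X \<alpha> (p r) (q r) * k r) sums
      (\<Sum>\<alpha>\<in>{1}. \<Sum>r\<in>I. nc_coeff g' g N b X \<alpha> (p r) (q r) * k r)"
    using zero by (intro sums_finite) auto
  ultimately have "(\<Sum>r\<in>I. \<phi> X $$ (p r, q r) * k r) = (\<Sum>r\<in>I. nc_coeff g' g N b X 1 (p r) (q r) * k r)"
    using sums_unique2 by fastforce
  also have "\<dots> = (\<Sum>r\<in>I. lin_part N X $$ (p r, q r) * k r)"
    using P by (intro sum.cong refl) (simp add: lin_part_def)
  finally show ?thesis .
qed

text \<open>In terms of vectors, \<open>\<phi>(X)(u\<^sub>j \<otimes> e\<^sub>t) = \<Sum>\<^sub>i v\<^sub>i \<otimes> X\<^sub>i\<^sub>j e\<^sub>t\<close>.\<close>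

lemma phi_column:
  assumes N: "N > 0" "X \<in> int_ball g' g N" and j: "j < g" and i: "a < d'" "s < N" "t < N"
  shows "(\<Sum>c<d. \<phi> X $$ (a * N + s, c * N + t) * vec_index (u j) c) = (\<Sum>i<g'. vec_index (v i) a * X $$ (i * N + s, j * N + t))"
  unfolding lin_part_column[OF j i, symmetric]
proof (rule sums_linear_part[OF N])
  show "a * N + s < d' * N \<and> c * N + t < d * N" if "c \<in> {..<d}" for c using that i by (simp add: block_index_less)
  fix \<alpha> :: nat assume \<alpha>: "\<alpha> \<noteq> 1"
  have "(\<Sum>c<d. nc_coeff g' g N b X \<alpha> (a * N + s) (c * N + t) * vec_index (u j) c) =
      (\<Sum>c<d. \<Sum>w\<in>words g' g \<alpha>. b w $$ (a, c) * word_eval N X w $$ (s, t) * vec_index (u j) c)"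
    unfolding nc_coeff_def sum_distrib_right using i
    by (intro sum.cong refl) (simp add: index_kron[OF b_carrier word_eval_carrier])
  also have "\<dots> = (\<Sum>w\<in>words g' g \<alpha>. (\<Sum>c<d. b w $$ (a, c) * vec_index (u j) c) * word_eval N X w $$ (s, t))"
    by (subst sum.swap) (simp add: sum_distrib_left sum_distrib_right mult_ac)
  also have "\<dots> = 0"
  proof (rule sum.neutral, rule ballI)
    fix w assume w: "w \<in> words g' g \<alpha>"
    show "(\<Sum>c<d. b w $$ (a, c) * vec_index (u j) c) * word_eval N X w $$ (s, t) = 0"
    proof (cases "\<alpha> = 0")
      case True
      then show ?thesis using w i by (simp add: b0)
    next
      case False
      then have "length w \<ge> 2" "set w \<subseteq> {..<g'} \<times> {..<g}" using w \<alpha> by (auto simp: words_def)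
      then show ?thesis using coeff_column_zero[OF _ _ j i(1)] by simp
    qed
  qed
  finally show "(\<Sum>c<d. nc_coeff g' g N b X \<alpha> (a * N + s) (c * N + t) * vec_index (u j) c) = 0" .
qed simp

text \<open>In terms of vectors, \<open>\<phi>(X)\<^sup>*(v\<^sub>k \<otimes> e\<^sub>s) = \<Sum>\<^sub>j u\<^sub>j \<otimes> X\<^sub>k\<^sub>j\<^sup>* e\<^sub>s\<close>.\<close>

lemma phi_row:
  assumes N: "N > 0" "X \<in> int_ball g' g N" and k: "k < g'" and i: "s < N" "c < d" "t < N"
  shows "(\<Sum>a<d'. \<phi> X $$ (a * N + s, c * N + t) * cnj (vec_index (v k) a)) = (\<Sum>j<g. cnj (vec_index (u j) c) * X $$ (k * N + s, j * N + t))"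
  unfolding lin_part_row[OF k i, symmetric]
proof (rule sums_linear_part[OF N])
  show "a * N + s < d' * N \<and> c * N + t < d * N" if "a \<in> {..<d'}" for a using that i by (simp add: block_index_less)
  fix \<alpha> :: nat assume \<alpha>: "\<alpha> \<noteq> 1"
  have "(\<Sum>a<d'. nc_coeff g' g N b X \<alpha> (a * N + s) (c * N + t) * cnj (vec_index (v k) a)) =
      (\<Sum>a<d'. \<Sum>w\<in>words g' g \<alpha>. b w $$ (a, c) * word_eval N X w $$ (s, t) * cnj (vec_index (v k) a))"
    unfolding nc_coeff_def sum_distrib_right using i
    by (intro sum.cong refl) (simp add: index_kron[OF b_carrier word_eval_carrier])
  also have "\<dots> = (\<Sum>w\<in>words g' g \<alpha>. (\<Sum>a<d'. b w $$ (a, c) * cnj (vec_index (v k) a)) * word_eval N X w $$ (s, t))"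
    by (subst sum.swap) (simp add: sum_distrib_left sum_distrib_right mult_ac)
  also have "\<dots> = 0"
  proof (rule sum.neutral, rule ballI)
    fix w assume w: "w \<in> words g' g \<alpha>"
    show "(\<Sum>a<d'. b w $$ (a, c) * cnj (vec_index (v k) a)) * word_eval N X w $$ (s, t) = 0"
    proof (cases "\<alpha> = 0")
      case True
      then show ?thesis using w i by (simp add: b0)
    next
      case False
      then have "length w \<ge> 2" "set w \<subseteq> {..<g'} \<times> {..<g}" using w \<alpha> by (auto simp: words_def)
      then show ?thesis using coeff_row_zero[OF _ _ k i(2)] by simp
    qed
  qed
  finally show "(\<Sum>a<d'. nc_coeff g' g N b X \<alpha> (a * N + s) (c * N + t) * cnj (vec_index (v k) a)) = 0" .
qed simp

end

section \<open>Completion of orthonormal vectors\<close>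

text \<open>The first \<open>k\<close> members of \<open>x\<close> are orthonormal vectors of \<open>\<complex>\<^sup>n\<close>; the other members are arbitrary.\<close>

definition orthonormal :: "nat \<Rightarrow> nat \<Rightarrow> (nat \<Rightarrow> complex Matrix.vec) \<Rightarrow> bool" where
  "orthonormal n k x \<longleftrightarrow> (\<forall>i<k. x i \<in> carrier_vec n) \<and> (\<forall>i<k. \<forall>j<k. x i \<bullet>c x j = (if i = j then 1 else 0))"

lemma zero_row_kernel:
  fixes M :: "complex mat"
  assumes M: "M \<in> carrier_mat n n" and r: "r < n" "\<And>j. j < n \<Longrightarrow> M $$ (r, j) = 0"
  obtains y where "y \<in> carrier_vec n" "y \<noteq> 0\<^sub>v n" "M *\<^sub>v y = 0\<^sub>v n"
proof -
  have T: "transpose_mat M \<in> carrier_mat n n" using M by simp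
  have "transpose_mat M *\<^sub>v unit_vec n r = 0\<^sub>v n"
  proof (rule eq_vecI)
    fix j assume "j < dim_vec (0\<^sub>v n)"
    then have j: "j < n" by simp
    have "vec_index (transpose_mat M *\<^sub>v unit_vec n r) j = (\<Sum>l<n. if l = r then transpose_mat M $$ (j, l) else 0)"
      unfolding index_mat_vec[OF T unit_vec_carrier j] using r(1) by (intro sum.cong refl) auto
    then show "vec_index (transpose_mat M *\<^sub>v unit_vec n r) j = vec_index (0\<^sub>v n) j"
      using M r j by simp
  qed (use M in simp)
  moreover have "unit_vec n r \<noteq> (0\<^sub>v n :: complex Matrix.vec)" using r(1) by simp
  ultimately have "Determinant.det (transpose_mat M) = 0"
    using det_0_iff_vec_prod_zero_field[OF T] unit_vec_carrier by blast
  then have "Determinant.det M = 0" using Determinant.det_transpose[OF M] by simp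
  then show thesis using det_0_iff_vec_prod_zero_field[OF M] that by blast
qed

text \<open>Otherwise the \<open>k > n\<close> vectors, as columns padded with zero rows to a square matrix, satisfy a linear
  relation.\<close>

lemma orthonormal_le:
  assumes x: "orthonormal n k x"
  shows "k \<le> n"
proof (rule ccontr)
  assume "\<not> k \<le> n"
  then have nk: "n < k" by simp
  let ?M = "Matrix.mat k k (\<lambda>(r, j). if r < n then vec_index (x j) r else 0)"
  obtain y where y: "y \<in> carrier_vec k" "y \<noteq> 0\<^sub>v k" "?M *\<^sub>v y = 0\<^sub>v k"
    by (rule zero_row_kernel[of ?M k n]) (use nk in auto)
  have lin: "(\<Sum>j<k. vec_index (x j) r * vec_index y j) = 0" if "r < n" for r
  proof -
    have "vec_index (?M *\<^sub>v y) r = (\<Sum>j<k. ?M $$ (r, j) * vec_index y j)"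
      by (rule index_mat_vec[of ?M k k]) (use y nk that in auto)
    also have "\<dots> = (\<Sum>j<k. vec_index (x j) r * vec_index y j)" using that nk by (intro sum.cong refl) simp
    finally show ?thesis using y(3) that nk by simp
  qed
  have "vec_index y l = 0" if l: "l < k" for l
  proof -
    have xx: "(\<Sum>r<n. vec_index (x j) r * cnj (vec_index (x l) r)) = (if j = l then 1 else 0)" if "j < k" for j
      using x that l cscalar_prod_sum[of "x j" n "x l"] by (simp add: orthonormal_def)
    have "vec_index y l = (\<Sum>j<k. (\<Sum>r<n. vec_index (x j) r * cnj (vec_index (x l) r)) * vec_index y j)"
      using l by (simp add: xx if_distrib[of "\<lambda>t. t * _"] cong: if_cong)
    also have "\<dots> = (\<Sum>r<n. (\<Sum>j<k. vec_index (x j) r * vec_index y j) * cnj (vec_index (x l) r))"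
      unfolding sum_distrib_right by (subst sum.swap) (simp add: mult_ac)
    also have "\<dots> = 0" by (simp add: lin)
    finally show ?thesis .
  qed
  then have "y = 0\<^sub>v k" using y(1) by (intro eq_vecI) auto
  then show False using y(2) by simp
qed

text \<open>A vector orthogonal to fewer than \<open>n\<close> vectors is in the kernel of a square matrix with a zero row.\<close>

lemma orthonormal_extend:
  assumes x: "orthonormal n k x" and k: "k < n"
  obtains y where "orthonormal n (Suc k) (x(k := y))"
proof -
  let ?M = "Matrix.mat n n (\<lambda>(j, r). if j < k then cnj (vec_index (x j) r) else 0)"
  obtain y where y: "y \<in> carrier_vec n" "y \<noteq> 0\<^sub>v n" "?M *\<^sub>v y = 0\<^sub>v n"
    by (rule zero_row_kernel[of ?M n k]) (use k in auto)
  have xc: "x j \<in> carrier_vec n" if "j < k" for j using x that by (simp add: orthonormal_def)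
  have yx: "y \<bullet>c x j = 0" if j: "j < k" for j
  proof -
    have "vec_index (?M *\<^sub>v y) j = (\<Sum>r<n. ?M $$ (j, r) * vec_index y r)"
      by (rule index_mat_vec[of ?M n n]) (use y k j in auto)
    also have "\<dots> = y \<bullet>c x j"
      unfolding cscalar_prod_sum[OF y(1) xc[OF j]] using k j by (intro sum.cong refl) simp
    finally show ?thesis using y(3) k j by simp
  qed
  have ny: "vnorm y > 0" using vnorm_eq_0[OF y(1)] y(2) vnorm_nonneg[of y] by linarith
  let ?c = "complex_of_real (1 / vnorm y)"
  define y' where "y' = ?c \<cdot>\<^sub>v y"
  have y': "y' \<in> carrier_vec n" using y by (simp add: y'_def)
  have "vnorm y' = 1" using ny by (simp add: y'_def norm_divide)
  then have "y' \<bullet>c y' = 1" by (simp add: cscalar_prod_self)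
  moreover have y'x: "y' \<bullet>c x j = 0" if "j < k" for j
    unfolding y'_def using cscalar_prod_smult(1)[OF y(1) xc[OF that]] yx[OF that] by simp
  moreover have "x j \<bullet>c y' = 0" if "j < k" for j
    using cscalar_prod_cnj[OF y' xc[OF that]] y'x[OF that] by simp
  ultimately have "orthonormal n (Suc k) (x(k := y'))"
    using x y' by (auto simp: orthonormal_def less_Suc_eq)
  then show thesis by (rule that)
qed

lemma orthonormal_completion:
  assumes x: "orthonormal n k x"
  obtains x' where "orthonormal n n x'" "\<And>j. j < k \<Longrightarrow> x' j = x j"
proof -
  have "\<exists>x'. orthonormal n (k + m) x' \<and> (\<forall>j<k. x' j = x j)" if "k + m \<le> n" for m
    using that
  proof (induction m)
    case 0
    then show ?case using x by auto
  next
    case (Suc m)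
    then obtain x' where x': "orthonormal n (k + m) x'" "\<forall>j<k. x' j = x j" by auto
    obtain y where "orthonormal n (Suc (k + m)) (x'(k + m := y))"
      using orthonormal_extend[OF x'(1)] Suc.prems by auto
    then have "orthonormal n (k + Suc m) (x'(k + m := y))" by simp
    moreover have "\<forall>j<k. (x'(k + m := y)) j = x j" using x'(2) by simp
    ultimately show ?case by blast
  qed
  from this[of "n - k"] orthonormal_le[OF x] that show thesis by auto
qed

lemma unitary_completion:
  assumes x: "orthonormal n k x"
  obtains U where "unitary_mat n U" "\<And>j c. j < k \<Longrightarrow> c < n \<Longrightarrow> U $$ (c, j) = vec_index (x j) c"
proof -
  obtain x' where x': "orthonormal n n x'" "\<And>j. j < k \<Longrightarrow> x' j = x j"
    by (rule orthonormal_completion[OF x]) auto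
  define U where "U = Matrix.mat n n (\<lambda>(c, j). vec_index (x' j) c)"
  have U: "U \<in> carrier_mat n n" by (simp add: U_def)
  have "mat_adjoint U * U = 1\<^sub>m n"
  proof (rule eq_matI)
    fix i j assume "i < dim_row (1\<^sub>m n)" "j < dim_col (1\<^sub>m n)"
    then have ij: "i < n" "j < n" by auto
    have "(mat_adjoint U * U) $$ (i, j) = (\<Sum>c<n. mat_adjoint U $$ (i, c) * U $$ (c, j))"
      by (rule index_mat_mat[OF mat_adjoint_carrier[OF U] U ij])
    also have "\<dots> = (\<Sum>c<n. vec_index (x' j) c * cnj (vec_index (x' i) c))"
      using ij by (intro sum.cong refl) (simp add: U_def)
    also have "\<dots> = x' j \<bullet>c x' i"
      using x'(1) ij by (subst cscalar_prod_sum[of _ n]) (auto simp: orthonormal_def)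
    finally show "(mat_adjoint U * U) $$ (i, j) = 1\<^sub>m n $$ (i, j)"
      using x'(1) ij by (auto simp: orthonormal_def)
  qed (use U in auto)
  moreover from mat_mult_left_right_inverse[OF mat_adjoint_carrier[OF U] U this]
  have "U * mat_adjoint U = 1\<^sub>m n" .
  ultimately have "unitary_mat n U" using U by (simp add: unitary_mat_def)
  moreover have "U $$ (c, j) = vec_index (x j) c" if "j < k" "c < n" for j c
    using that x'(2) orthonormal_le[OF x] by (simp add: U_def)
  ultimately show thesis by (rule that)
qed

text \<open>The \<open>l\<close> columns of \<open>U\<close> starting with column \<open>k\<close>.\<close>

definition columns :: "nat \<Rightarrow> nat \<Rightarrow> nat \<Rightarrow> complex mat \<Rightarrow> complex mat" where
  "columns n k l U = Matrix.mat n l (\<lambda>(c, j). U $$ (c, k + j))"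

lemma columns_carrier [simp]: "columns n k l U \<in> carrier_mat n l"
  by (simp add: columns_def)

lemma op_norm_columns:
  assumes U: "unitary_mat n U" and kl: "k + l \<le> n"
  shows "op_norm (columns n k l U) \<le> 1"
proof -
  have Uc: "U \<in> carrier_mat n n" using U by (simp add: unitary_mat_def)
  have one: "mat_adjoint (columns n k l U) * columns n k l U = 1\<^sub>m l"
  proof (rule eq_matI)
    fix i j assume "i < dim_row (1\<^sub>m l)" "j < dim_col (1\<^sub>m l)"
    then have ij: "i < l" "j < l" by auto
    have "(mat_adjoint (columns n k l U) * columns n k l U) $$ (i, j) =
        (\<Sum>c<n. mat_adjoint (columns n k l U) $$ (i, c) * columns n k l U $$ (c, j))"
      by (rule index_mat_mat[OF mat_adjoint_carrier[OF columns_carrier] columns_carrier ij])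
    also have "\<dots> = (\<Sum>c<n. mat_adjoint U $$ (k + i, c) * U $$ (c, k + j))"
      using ij kl Uc by (intro sum.cong refl) (simp add: columns_def)
    also have "\<dots> = (mat_adjoint U * U) $$ (k + i, k + j)"
      using ij kl by (intro index_mat_mat[OF mat_adjoint_carrier[OF Uc] Uc, symmetric]) auto
    finally show "(mat_adjoint (columns n k l U) * columns n k l U) $$ (i, j) = 1\<^sub>m l $$ (i, j)"
      using U ij kl by (simp add: unitary_mat_def del: index_mult_mat(1))
  qed (auto simp: columns_def)
  show ?thesis
  proof (rule op_norm_leI[OF columns_carrier])
    fix x :: "complex Matrix.vec" assume x: "x \<in> carrier_vec l"
    let ?C = "columns n k l U"
    have "complex_of_real ((vnorm (?C *\<^sub>v x))\<^sup>2) = x \<bullet>c (mat_adjoint ?C *\<^sub>v (?C *\<^sub>v x))"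
      unfolding cscalar_prod_self[symmetric]
      by (rule cscalar_prod_adjoint[OF columns_carrier x mult_mat_vec_carrier[OF columns_carrier x]])
    also have "mat_adjoint ?C *\<^sub>v (?C *\<^sub>v x) = x"
      using assoc_mult_mat_vec[OF mat_adjoint_carrier[OF columns_carrier[of n k l U]] columns_carrier[of n k l U] x] one x by simp
    finally have "(vnorm (?C *\<^sub>v x))\<^sup>2 = (vnorm x)\<^sup>2" unfolding cscalar_prod_self of_real_eq_iff .
    then show "vnorm (?C *\<^sub>v x) \<le> 1 * vnorm x" by (simp add: power2_eq_iff_nonneg)
  qed simp
qed

section \<open>Compressions\<close>

text \<open>The map \<open>F \<mapsto> (P \<otimes> 1) F (Q \<otimes> 1)\<close>.\<close>

definition compress :: "complex mat \<Rightarrow> complex mat \<Rightarrow> nat \<Rightarrow> complex mat \<Rightarrow> complex mat" where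
  "compress P Q N F = kron P (1\<^sub>m N) * F * kron Q (1\<^sub>m N)"

lemma compress_carrier:
  "P \<in> carrier_mat k' m \<Longrightarrow> Q \<in> carrier_mat n k \<Longrightarrow> F \<in> carrier_mat (m * N) (n * N) \<Longrightarrow>
    compress P Q N F \<in> carrier_mat (k' * N) (k * N)"
  unfolding compress_def by (auto intro!: carrier_matI)

lemma sum_delta_mult: "n < N \<Longrightarrow> (\<Sum>p<N. A * 1\<^sub>m N $$ (n, p) * z p) = A * z n"
    "n < N \<Longrightarrow> (\<Sum>p<N. z p * (A * 1\<^sub>m N $$ (p, n))) = z n * A" for A :: complex and n N :: nat
proof -
  assume n: "n < N"
  have "(\<Sum>p<N. A * 1\<^sub>m N $$ (n, p) * z p) = (\<Sum>p<N. if p = n then A * z p else 0)"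
    using n by (intro sum.cong refl) auto
  then show "(\<Sum>p<N. A * 1\<^sub>m N $$ (n, p) * z p) = A * z n" using n by simp
  have "(\<Sum>p<N. z p * (A * 1\<^sub>m N $$ (p, n))) = (\<Sum>p<N. if p = n then z p * A else 0)"
    using n by (intro sum.cong refl) auto
  then show "(\<Sum>p<N. z p * (A * 1\<^sub>m N $$ (p, n))) = z n * A" using n by simp
qed

lemma index_compress:
  assumes P: "P \<in> carrier_mat k' m" and Q: "Q \<in> carrier_mat n k" and F: "F \<in> carrier_mat (m * N) (n * N)"
    and i: "i < k'" "s < N" "j < k" "t < N"
  shows "compress P Q N F $$ (i * N + s, j * N + t) = (\<Sum>c<n. (\<Sum>a<m. P $$ (i, a) * F $$ (a * N + s, c * N + t)) * Q $$ (c, j))"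
proof -
  have PF: "kron P (1\<^sub>m N) * F \<in> carrier_mat (k' * N) (n * N)"
    by (rule mult_carrier_mat[OF kron_carrier[OF P one_carrier_mat] F])
  have left: "(kron P (1\<^sub>m N) * F) $$ (i * N + s, q) = (\<Sum>a<m. P $$ (i, a) * F $$ (a * N + s, q))" if "q < n * N" for q
  proof -
    have "(kron P (1\<^sub>m N) * F) $$ (i * N + s, q) = (\<Sum>a<m. \<Sum>r<N. kron P (1\<^sub>m N) $$ (i * N + s, a * N + r) * F $$ (a * N + r, q))"
      unfolding index_mat_mat[OF kron_carrier[OF P one_carrier_mat] F block_index_less[OF i(1,2)] that] sum_lessThan_blocks ..
    also have "\<dots> = (\<Sum>a<m. \<Sum>r<N. P $$ (i, a) * 1\<^sub>m N $$ (s, r) * F $$ (a * N + r, q))"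
      using i by (intro sum.cong refl) (simp add: index_kron[OF P one_carrier_mat])
    finally show ?thesis by (simp only: sum_delta_mult(1)[OF i(2)])
  qed
  have "compress P Q N F $$ (i * N + s, j * N + t) =
      (\<Sum>c<n. \<Sum>r<N. (kron P (1\<^sub>m N) * F) $$ (i * N + s, c * N + r) * kron Q (1\<^sub>m N) $$ (c * N + r, j * N + t))"
    unfolding compress_def
      index_mat_mat[OF PF kron_carrier[OF Q one_carrier_mat] block_index_less[OF i(1,2)] block_index_less[OF i(3,4)]] sum_lessThan_blocks ..
  also have "\<dots> = (\<Sum>c<n. \<Sum>r<N. (kron P (1\<^sub>m N) * F) $$ (i * N + s, c * N + r) * (Q $$ (c, j) * 1\<^sub>m N $$ (r, t)))"
    using i by (intro sum.cong refl) (simp add: index_kron[OF Q one_carrier_mat] del: index_mult_mat)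
  also have "\<dots> = (\<Sum>c<n. (kron P (1\<^sub>m N) * F) $$ (i * N + s, c * N + t) * Q $$ (c, j))"
    by (simp only: sum_delta_mult(2)[OF i(4)])
  also have "\<dots> = (\<Sum>c<n. (\<Sum>a<m. P $$ (i, a) * F $$ (a * N + s, c * N + t)) * Q $$ (c, j))"
    using i by (intro sum.cong refl) (simp add: left block_index_less del: index_mult_mat)
  finally show ?thesis .
qed

lemma op_norm_compress:
  assumes P: "P \<in> carrier_mat k' m" "op_norm P \<le> 1" and Q: "Q \<in> carrier_mat n k" "op_norm Q \<le> 1"
    and F: "F \<in> carrier_mat (m * N) (n * N)"
  shows "op_norm (compress P Q N F) \<le> op_norm F"
proof -
  have kP: "op_norm (kron P (1\<^sub>m N)) \<le> 1" using op_norm_kron_one_le[OF P(1)] P(2) by (rule order_trans)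
  have kQ: "op_norm (kron Q (1\<^sub>m N)) \<le> 1" using op_norm_kron_one_le[OF Q(1)] Q(2) by (rule order_trans)
  have PF: "kron P (1\<^sub>m N) * F \<in> carrier_mat (k' * N) (n * N)"
    by (rule mult_carrier_mat[OF kron_carrier[OF P(1) one_carrier_mat] F])
  have "op_norm (compress P Q N F) \<le> op_norm (kron P (1\<^sub>m N) * F) * op_norm (kron Q (1\<^sub>m N))"
    unfolding compress_def by (rule op_norm_mult[OF PF kron_carrier[OF Q(1) one_carrier_mat]])
  also have "\<dots> \<le> op_norm (kron P (1\<^sub>m N) * F)" using kQ op_norm_nonneg by (simp add: mult_left_le)
  also have "\<dots> \<le> op_norm (kron P (1\<^sub>m N)) * op_norm F" by (rule op_norm_mult[OF kron_carrier[OF P(1) one_carrier_mat] F])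
  also have "\<dots> \<le> op_norm F" using kP op_norm_nonneg[of F] by (simp add: mult_left_le_one_le op_norm_nonneg)
  finally show ?thesis .
qed

lemma (in inverse_closed_algebra) mat_alg_compress:
  assumes "P \<in> carrier_mat k' m" "Q \<in> carrier_mat n k" "mat_alg (m * N) (n * N) F"
  shows "mat_alg (k' * N) (k * N) (\<lambda>z. compress P Q N (F z))"
  unfolding compress_def
  by (rule mat_alg_mult[OF mat_alg_mult[OF mat_alg_const[OF kron_carrier[OF assms(1) one_carrier_mat]] assms(3)]
        mat_alg_const[OF kron_carrier[OF assms(2) one_carrier_mat]]])

lemma mat_analytic_alt:
  "W \<subseteq> cspace K \<Longrightarrow> mat_analytic K W m n a \<longleftrightarrow> inverse_closed_algebra.mat_alg W (analytic_several K W) m n a"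
  unfolding mat_analytic_def inverse_closed_algebra.mat_alg_def[OF inverse_closed_algebra_analytic_several] ..

lemma mat_continuous_alt:
  "mat_continuous S m n a \<longleftrightarrow> inverse_closed_algebra.mat_alg S (continuous_on S) m n a"
  unfolding mat_continuous_def inverse_closed_algebra.mat_alg_def[OF inverse_closed_algebra_continuous] ..

text \<open>To transfer analyticity from \<open>F\<close> to \<open>H\<close> it is enough to do so in every inverse-closed algebra.\<close>

lemma nc_analytic_transfer:
  assumes F: "nc_analytic g' g k' k F"
    and car: "\<And>N X. N > 0 \<Longrightarrow> X \<in> int_ball g' g N \<Longrightarrow> H X \<in> carrier_mat (m' * N) (m * N)"
    and ser: "nc_series g' g m' m H b e"
    and alg: "\<And>N (S :: (nat \<Rightarrow> complex) set) alg a. N > 0 \<Longrightarrow> inverse_closed_algebra S alg \<Longrightarrow> a ` S \<subseteq> int_ball g' g N \<Longrightarrow>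
      inverse_closed_algebra.mat_alg S alg (k' * N) (k * N) (F \<circ> a) \<Longrightarrow>
      inverse_closed_algebra.mat_alg S alg (m' * N) (m * N) (H \<circ> a)"
  shows "nc_analytic g' g m' m H"
  unfolding nc_analytic_def
proof (intro conjI allI impI ballI)
  show "H X \<in> carrier_mat (m' * N) (m * N)" if "N > 0" "X \<in> int_ball g' g N" for N X by (rule car[OF that])
  show "\<exists>a \<epsilon>. nc_series g' g m' m H a \<epsilon>" using ser by blast
  fix N K :: nat and W and a :: "(nat \<Rightarrow> complex) \<Rightarrow> complex mat"
  assume N: "0 < N" and K: "0 < K"
    and "cdomain K W \<and> mat_analytic K W (g' * N) (g * N) a \<and> a ` W \<subseteq> int_ball g' g N"
  then have W: "cdomain K W" and a: "mat_analytic K W (g' * N) (g * N) a" "a ` W \<subseteq> int_ball g' g N" by auto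
  have WK: "W \<subseteq> cspace K" using W openin_imp_subset by (auto simp: cdomain_def)
  note Fa = nc_analytic_compose[OF F N K W a]
  show "mat_analytic K W (m' * N) (m * N) (H \<circ> a)"
    using Fa(1) alg[OF N inverse_closed_algebra_analytic_several[OF WK] a(2)] unfolding mat_analytic_alt[OF WK] by blast
  assume "mat_continuous (closure W) (g' * N) (g * N) a \<and> a ` closure W \<subseteq> int_ball g' g N"
  then have "mat_continuous (closure W) (k' * N) (k * N) (F \<circ> a)" "a ` closure W \<subseteq> int_ball g' g N" using Fa(2) by auto
  then show "mat_continuous (closure W) (m' * N) (m * N) (H \<circ> a)"
    using alg[OF N inverse_closed_algebra_continuous] unfolding mat_continuous_alt by blast
qed

lemma nc_analytic_compress:
  assumes F: "nc_analytic g' g m n F" and g': "g' > 0" and P: "P \<in> carrier_mat k' m" and Q: "Q \<in> carrier_mat n k"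
    and b: "nc_series g' g m n F b e"
  shows "nc_analytic g' g k' k (\<lambda>X. compress P Q (dim_row X div g') (F X))"
proof (rule nc_analytic_transfer[OF F])
  have Fc: "F X \<in> carrier_mat (m * N) (n * N)" if "N > 0" "X \<in> int_ball g' g N" for N X
    using F that by (auto simp: nc_analytic_def)
  have N: "dim_row X div g' = N" if "X \<in> carrier_mat (g' * N) (g * N)" for X :: "complex mat" and N using that g' by simp
  show "compress P Q (dim_row X div g') (F X) \<in> carrier_mat (k' * N) (k * N)" if "N > 0" "X \<in> int_ball g' g N" for N X
    using that(2) compress_carrier[OF P Q Fc[OF that]] by (simp add: int_ball_def)  (metis N)
  show "inverse_closed_algebra.mat_alg S alg (k' * N) (k * N) ((\<lambda>X. compress P Q (dim_row X div g') (F X)) \<circ> a)"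
    if "N > 0" "inverse_closed_algebra S alg" "a ` S \<subseteq> int_ball g' g N"
      "inverse_closed_algebra.mat_alg S alg (m * N) (n * N) (F \<circ> a)" for N S alg and a :: "(nat \<Rightarrow> complex) \<Rightarrow> complex mat"
  proof (rule inverse_closed_algebra.mat_alg_cong[OF that(2)])
    show "inverse_closed_algebra.mat_alg S alg (k' * N) (k * N) (\<lambda>z. compress P Q N ((F \<circ> a) z))"
      by (rule inverse_closed_algebra.mat_alg_compress[OF that(2) P Q that(4)])
    show "compress P Q N ((F \<circ> a) z) = ((\<lambda>X. compress P Q (dim_row X div g') (F X)) \<circ> a) z" if "z \<in> S" for z
      using that \<open>a ` S \<subseteq> int_ball g' g N\<close> N[of "a z" N] by (auto simp: int_ball_def)
  qed
  have bc: "b w \<in> carrier_mat m n" for w using b by (simp add: nc_series_def)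
  have Pb: "P * b w \<in> carrier_mat k' n" for w by (rule mult_carrier_mat[OF P bc])
  have PbQ: "P * b w * Q \<in> carrier_mat k' k" for w by (rule mult_carrier_mat[OF Pb Q])
  show "nc_series g' g k' k (\<lambda>X. compress P Q (dim_row X div g') (F X)) (\<lambda>w. P * b w * Q) (min 1 e)"
    unfolding nc_series_def
  proof (intro conjI allI impI ballI PbQ)
    \<comment> \<open>The radius is capped at 1, since the size of \<open>F X\<close> is only known in the open unit ball.\<close>
    show "0 < min 1 e" using b by (simp add: nc_series_def)
    fix N :: nat and X p q
    assume N0: "0 < N" and X: "X \<in> carrier_mat (g' * N) (g * N)" "op_norm X < min 1 e" and pq: "p < k' * N" "q < k * N"
    obtain i s j t where i: "i < k'" "s < N" "p = i * N + s" "j < k" "t < N" "q = j * N + t"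
      using pq by (metis block_index_cases)
    let ?K = "\<lambda>w. kron (b w) (word_eval N X w)"
    have "kron (P * b w * Q) (word_eval N X w) $$ (p, q) =
        (\<Sum>c<n. (\<Sum>a<m. P $$ (i, a) * ?K w $$ (a * N + s, c * N + t)) * Q $$ (c, j))" for w
    proof -
      have "kron (P * b w * Q) (word_eval N X w) $$ (p, q) = (\<Sum>c<n. (\<Sum>a<m. P $$ (i, a) * b w $$ (a, c)) * Q $$ (c, j)) * word_eval N X w $$ (s, t)"
        unfolding i(3,6) index_kron[OF PbQ word_eval_carrier i(1,4,2,5)] index_mat_mat[OF Pb Q i(1,4)]
        using i by (simp add: index_mat_mat[OF P bc] del: index_mult_mat)
      also have "\<dots> = (\<Sum>c<n. (\<Sum>a<m. P $$ (i, a) * ?K w $$ (a * N + s, c * N + t)) * Q $$ (c, j))"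
        unfolding sum_distrib_right using i
        by (intro sum.cong refl) (simp add: index_kron[OF bc word_eval_carrier] mult_ac)
      finally show ?thesis .
    qed
    then have eq: "(\<Sum>w\<in>words g' g \<alpha>. kron (P * b w * Q) (word_eval N X w) $$ (p, q)) =
        (\<Sum>c<n. (\<Sum>a<m. P $$ (i, a) * (\<Sum>w\<in>words g' g \<alpha>. ?K w $$ (a * N + s, c * N + t))) * Q $$ (c, j))" for \<alpha>
    proof -
      assume K: "\<And>w. kron (P * b w * Q) (word_eval N X w) $$ (p, q) =
        (\<Sum>c<n. (\<Sum>a<m. P $$ (i, a) * ?K w $$ (a * N + s, c * N + t)) * Q $$ (c, j))"
      have "(\<Sum>w\<in>words g' g \<alpha>. \<Sum>c<n. (\<Sum>a<m. P $$ (i, a) * ?K w $$ (a * N + s, c * N + t)) * Q $$ (c, j)) =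
          (\<Sum>c<n. \<Sum>w\<in>words g' g \<alpha>. (\<Sum>a<m. P $$ (i, a) * ?K w $$ (a * N + s, c * N + t)) * Q $$ (c, j))"
        by (rule sum.swap)
      also have "\<dots> = (\<Sum>c<n. (\<Sum>a<m. P $$ (i, a) * (\<Sum>w\<in>words g' g \<alpha>. ?K w $$ (a * N + s, c * N + t))) * Q $$ (c, j))"
        unfolding sum_distrib_right[symmetric] sum_distrib_left
        by (intro sum.cong refl arg_cong2[of _ _ _ _ "(*)"]) (rule sum.swap)
      finally show ?thesis unfolding K .
    qed
    have XB: "X \<in> int_ball g' g N" using X by (simp add: int_ball_def)
    have "(\<lambda>\<alpha>. \<Sum>c<n. (\<Sum>a<m. P $$ (i, a) * (\<Sum>w\<in>words g' g \<alpha>. ?K w $$ (a * N + s, c * N + t))) * Q $$ (c, j)) sums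
        (\<Sum>c<n. (\<Sum>a<m. P $$ (i, a) * F X $$ (a * N + s, c * N + t)) * Q $$ (c, j))"
      using b N0 X i unfolding nc_series_def
      by (intro sums_sum sums_mult sums_mult2) (auto simp: block_index_less)
    then show "(\<lambda>\<alpha>. \<Sum>w\<in>words g' g \<alpha>. kron (P * b w * Q) (word_eval N X w) $$ (p, q)) sums
        compress P Q (dim_row X div g') (F X) $$ (p, q)"
      unfolding eq N[OF X(1)] index_compress[OF P Q Fc[OF N0 XB] i(1,2,4,5), folded i(3,6)] .
  qed
qed

section \<open>The structure of ball maps that vanish at the origin\<close>

context ball_map_frame
begin

lemma orthonormal_u: "orthonormal d g u"
  using u u_orthogonal by (auto simp: orthonormal_def cscalar_prod_self)

lemma orthonormal_v: "orthonormal d' g' v"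
  using v v_orthogonal by (auto simp: orthonormal_def cscalar_prod_self)

lemma size_le: "g' \<le> d'" "g \<le> d"
  using orthonormal_le[OF orthonormal_v] orthonormal_le[OF orthonormal_u] by auto

lemma nc_analytic_zero:
  assumes "nc_analytic g' g d' d \<phi>"
  shows "nc_at_0 g' g \<phi> = 0\<^sub>m d' d"
  using nc_series_at_0[OF phi_nc_series assms] b0 by simp

text \<open>Completing the frames to unitaries \<open>U\<close> and \<open>V\<close> brings \<open>\<phi>\<close> into block form.\<close>

context
  fixes U V :: "complex mat"
  assumes U: "unitary_mat d U" "\<And>j c. j < g \<Longrightarrow> c < d \<Longrightarrow> U $$ (c, j) = vec_index (u j) c"
    and V: "unitary_mat d' V" "\<And>i a. i < g' \<Longrightarrow> a < d' \<Longrightarrow> V $$ (a, i) = vec_index (v i) a"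
begin

lemma UV_carrier [simp]: "U \<in> carrier_mat d d" "V \<in> carrier_mat d' d'"
  using U(1) V(1) by (simp_all add: unitary_mat_def)

lemma U_orthonormal: "j < d \<Longrightarrow> k < d \<Longrightarrow> (\<Sum>c<d. cnj (U $$ (c, j)) * U $$ (c, k)) = (if j = k then 1 else 0)"
  and V_orthonormal: "i < d' \<Longrightarrow> l < d' \<Longrightarrow> (\<Sum>a<d'. cnj (V $$ (a, i)) * V $$ (a, l)) = (if i = l then 1 else 0)"
proof -
  have *: "(\<Sum>c<n. cnj (A $$ (c, j)) * A $$ (c, k)) = (if j = k then 1 else 0)"
    if A: "unitary_mat n A" and jk: "j < n" "k < n" for A n j k
  proof -
    have c: "A \<in> carrier_mat n n" using A by (simp add: unitary_mat_def)
    have "(\<Sum>c<n. cnj (A $$ (c, j)) * A $$ (c, k)) = (mat_adjoint A * A) $$ (j, k)"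
      unfolding index_mat_mat[OF mat_adjoint_carrier[OF c] c jk] using c jk by (intro sum.cong refl) simp
    then show ?thesis using A jk by (simp add: unitary_mat_def del: index_mult_mat(1))
  qed
  show "j < d \<Longrightarrow> k < d \<Longrightarrow> (\<Sum>c<d. cnj (U $$ (c, j)) * U $$ (c, k)) = (if j = k then 1 else 0)" by (rule *[OF U(1)])
  show "i < d' \<Longrightarrow> l < d' \<Longrightarrow> (\<Sum>a<d'. cnj (V $$ (a, i)) * V $$ (a, l)) = (if i = l then 1 else 0)" by (rule *[OF V(1)])
qed

text \<open>The first \<open>g\<close> block columns of \<open>(V \<otimes> 1)\<^sup>* \<phi>(X) (U \<otimes> 1)\<close>.\<close>

lemma entry_first_columns:
  assumes N: "N > 0" "X \<in> int_ball g' g N" and i: "i < d'" "j < g" "s < N" "t < N"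
  shows "(\<Sum>c<d. (\<Sum>a<d'. cnj (V $$ (a, i)) * \<phi> X $$ (a * N + s, c * N + t)) * U $$ (c, j)) =
    (if i < g' then X $$ (i * N + s, j * N + t) else 0)"
proof -
  have "(\<Sum>c<d. (\<Sum>a<d'. cnj (V $$ (a, i)) * \<phi> X $$ (a * N + s, c * N + t)) * U $$ (c, j)) =
      (\<Sum>a<d'. cnj (V $$ (a, i)) * (\<Sum>c<d. \<phi> X $$ (a * N + s, c * N + t) * U $$ (c, j)))"
    unfolding sum_distrib_right sum_distrib_left by (subst sum.swap) (simp add: mult_ac)
  also have "\<dots> = (\<Sum>a<d'. cnj (V $$ (a, i)) * (\<Sum>k<g'. V $$ (a, k) * X $$ (k * N + s, j * N + t)))"
  proof (rule sum.cong[OF refl], rule arg_cong2[of _ _ _ _ "(*)", OF refl])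
    fix a assume "a \<in> {..<d'}"
    then have a: "a < d'" by simp
    have "(\<Sum>c<d. \<phi> X $$ (a * N + s, c * N + t) * U $$ (c, j)) = (\<Sum>c<d. \<phi> X $$ (a * N + s, c * N + t) * vec_index (u j) c)"
      using i by (intro sum.cong refl) (simp add: U(2))
    also have "\<dots> = (\<Sum>k<g'. V $$ (a, k) * X $$ (k * N + s, j * N + t))"
      unfolding phi_column[OF N i(2) a i(3,4)] using a by (intro sum.cong refl) (simp add: V(2))
    finally show "(\<Sum>c<d. \<phi> X $$ (a * N + s, c * N + t) * U $$ (c, j)) = (\<Sum>k<g'. V $$ (a, k) * X $$ (k * N + s, j * N + t))" .
  qed
  also have "\<dots> = (\<Sum>k<g'. (\<Sum>a<d'. cnj (V $$ (a, i)) * V $$ (a, k)) * X $$ (k * N + s, j * N + t))"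
    unfolding sum_distrib_left sum_distrib_right by (subst sum.swap) (simp add: mult_ac)
  also have "\<dots> = (\<Sum>k<g'. if k = i then X $$ (k * N + s, j * N + t) else 0)"
    using i size_le by (intro sum.cong refl) (auto simp: V_orthonormal)
  also have "\<dots> = (if i < g' then X $$ (i * N + s, j * N + t) else 0)" by auto
  finally show ?thesis .
qed

text \<open>The rest of its first \<open>g'\<close> block rows.\<close>

lemma entry_first_rows:
  assumes N: "N > 0" "X \<in> int_ball g' g N" and i: "i < g'" "j < d" "s < N" "t < N" and j: "g \<le> j"
  shows "(\<Sum>c<d. (\<Sum>a<d'. cnj (V $$ (a, i)) * \<phi> X $$ (a * N + s, c * N + t)) * U $$ (c, j)) = 0"
proof -
  have "(\<Sum>c<d. (\<Sum>a<d'. cnj (V $$ (a, i)) * \<phi> X $$ (a * N + s, c * N + t)) * U $$ (c, j)) =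
      (\<Sum>c<d. (\<Sum>k<g. cnj (U $$ (c, k)) * X $$ (i * N + s, k * N + t)) * U $$ (c, j))"
  proof (rule sum.cong[OF refl], rule arg_cong2[of _ _ _ _ "(*)", OF _ refl])
    fix c assume "c \<in> {..<d}"
    then have c: "c < d" by simp
    have "(\<Sum>a<d'. cnj (V $$ (a, i)) * \<phi> X $$ (a * N + s, c * N + t)) =
        (\<Sum>a<d'. \<phi> X $$ (a * N + s, c * N + t) * cnj (vec_index (v i) a))"
      using i by (intro sum.cong refl) (simp add: V(2))
    also have "\<dots> = (\<Sum>k<g. cnj (U $$ (c, k)) * X $$ (i * N + s, k * N + t))"
      unfolding phi_row[OF N i(1) i(3) c i(4)] using c by (intro sum.cong refl) (simp add: U(2))
    finally show "(\<Sum>a<d'. cnj (V $$ (a, i)) * \<phi> X $$ (a * N + s, c * N + t)) =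
      (\<Sum>k<g. cnj (U $$ (c, k)) * X $$ (i * N + s, k * N + t))" .
  qed
  also have "\<dots> = (\<Sum>k<g. (\<Sum>c<d. cnj (U $$ (c, k)) * U $$ (c, j)) * X $$ (i * N + s, k * N + t))"
    unfolding sum_distrib_right by (subst sum.swap) (simp add: mult_ac)
  also have "\<dots> = 0" using i j size_le by (intro sum.neutral) (auto simp: U_orthonormal)
  finally show ?thesis .
qed

text \<open>The lower right block of \<open>(V \<otimes> 1)\<^sup>* \<phi>(X) (U \<otimes> 1)\<close>. It may have no rows or no columns.\<close>

definition \<psi> :: "complex mat \<Rightarrow> complex mat" where
  "\<psi> X = compress (mat_adjoint (columns d' g' (d' - g') V)) (columns d g (d - g) U) (dim_row X div g') (\<phi> X)"

lemma psi_factors_carrier: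
  "mat_adjoint (columns d' g' (d' - g') V) \<in> carrier_mat (d' - g') d'" "columns d g (d - g) U \<in> carrier_mat d (d - g)"
  by simp_all

lemma phi_carrier: "N > 0 \<Longrightarrow> X \<in> int_ball g' g N \<Longrightarrow> \<phi> X \<in> carrier_mat (d' * N) (d * N)"
proof -
  assume N: "N > 0" and "X \<in> int_ball g' g N"
  then obtain r :: real and Y where r: "0 < r" "r < 1" "Y \<in> closed_ball g' g N" "X = complex_of_real r \<cdot>\<^sub>m Y"
    by (blast elim: int_ball_eq_smult)
  show "\<phi> X \<in> carrier_mat (d' * N) (d * N)"
    unfolding r(4) by (rule disc_analyticD(1)[OF hol N r(3)]) (use r in simp)
qed

lemma psi_eq: "X \<in> int_ball g' g N \<Longrightarrow>
    \<psi> X = compress (mat_adjoint (columns d' g' (d' - g') V)) (columns d g (d - g) U) N (\<phi> X)"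
  using pos by (auto simp: \<psi>_def int_ball_def)

lemma psi_contraction:
  assumes "N > 0" "X \<in> int_ball g' g N" shows "op_norm (\<psi> X) \<le> 1"
proof -
  have "op_norm (\<psi> X) \<le> op_norm (\<phi> X)"
    unfolding psi_eq[OF assms(2)]
    by (rule op_norm_compress[OF psi_factors_carrier(1) _ psi_factors_carrier(2) _ phi_carrier[OF assms]])
      (use op_norm_columns[OF U(1), of g "d - g"] op_norm_columns[OF V(1), of g' "d' - g'"] size_le in \<open>simp_all add: op_norm_adjoint\<close>)
  then show ?thesis using contr[OF assms] by simp
qed

lemma block_form:
  assumes N: "N > 0" "X \<in> int_ball g' g N"
  shows "\<phi> X = kron V (1\<^sub>m N) * four_block_mat X (0\<^sub>m (g' * N) ((d - g) * N)) (0\<^sub>m ((d' - g') * N) (g * N)) (\<psi> X)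
    * mat_adjoint (kron U (1\<^sub>m N))"
proof -
  let ?F = "four_block_mat X (0\<^sub>m (g' * N) ((d - g) * N)) (0\<^sub>m ((d' - g') * N) (g * N)) (\<psi> X)"
  note Gc = phi_carrier[OF N]
  have X: "X \<in> carrier_mat (g' * N) (g * N)" using N(2) by (simp add: int_ball_def)
  have psi_c: "\<psi> X \<in> carrier_mat ((d' - g') * N) ((d - g) * N)"
    unfolding psi_eq[OF N(2)] by (rule compress_carrier[OF psi_factors_carrier Gc])
  have sizes: "g' * N + (d' - g') * N = d' * N" "g * N + (d - g) * N = d * N"
    using size_le by (simp_all add: distrib_right[symmetric])
  have F: "?F \<in> carrier_mat (d' * N) (d * N)"
    using four_block_carrier_mat[OF X psi_c] unfolding sizes .
  have V': "mat_adjoint V \<in> carrier_mat d' d'" by simp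
  have "compress (mat_adjoint V) U N (\<phi> X) = ?F"
  proof (rule eq_block_matI[OF compress_carrier[OF V' UV_carrier(1) Gc] F])
    fix i j s t assume i: "i < d'" "j < d" "s < N" "t < N"
    have "compress (mat_adjoint V) U N (\<phi> X) $$ (i * N + s, j * N + t) =
        (\<Sum>c<d. (\<Sum>a<d'. cnj (V $$ (a, i)) * \<phi> X $$ (a * N + s, c * N + t)) * U $$ (c, j))"
      unfolding index_compress[OF V' UV_carrier(1) Gc i(1,3,2,4)]
      using i carrier_matD[OF UV_carrier(2)] by (intro sum.cong refl arg_cong2[of _ _ _ _ "(*)"]) simp
    also have "\<dots> = ?F $$ (i * N + s, j * N + t)"
    proof -
      have rows: "i * N + s < g' * N \<longleftrightarrow> i < g'" "j * N + t < g * N \<longleftrightarrow> j < g"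
      proof -
        have "\<not> i * N + s < g' * N" if "\<not> i < g'"
          using mult_le_mono1[of g' i N] that by linarith
        moreover have "\<not> j * N + t < g * N" if "\<not> j < g"
          using mult_le_mono1[of g j N] that by linarith
        ultimately show "i * N + s < g' * N \<longleftrightarrow> i < g'" "j * N + t < g * N \<longleftrightarrow> j < g"
          using block_index_less[OF _ i(3)] block_index_less[OF _ i(4)] by blast+
      qed
      have bound: "i * N + s < g' * N + (d' - g') * N" "j * N + t < g * N + (d - g) * N"
        unfolding sizes using i by (simp_all add: block_index_less)
      have entry: "?F $$ (i * N + s, j * N + t) =
         (if i < g' then if j < g then X $$ (i * N + s, j * N + t) else 0
          else if j < g then 0 else \<psi> X $$ (i * N + s - g' * N, j * N + t - g * N))"
      proof -
        have dims: "dim_row X = g' * N" "dim_col X = g * N" "dim_row (\<psi> X) = (d' - g') * N" "dim_col (\<psi> X) = (d - g) * N"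
          using X psi_c by auto
        have "i * N + s - g' * N < (d' - g') * N" if "\<not> i < g'" using bound(1) that rows by linarith
        moreover have "j * N + t - g * N < (d - g) * N" if "\<not> j < g" using bound(2) that rows by linarith
        ultimately show ?thesis
          using index_mat_four_block(1)[of "i * N + s" X "\<psi> X" "j * N + t" "0\<^sub>m (g' * N) ((d - g) * N)" "0\<^sub>m ((d' - g') * N) (g * N)"]
            bound unfolding dims rows by (auto simp: rows)
      qed
      show ?thesis
      proof (cases "j < g")
        case True
        then show ?thesis unfolding entry using entry_first_columns[OF N i(1) True i(3,4)] by simp
      next
        case False
        then have j: "g \<le> j" by simp
        show ?thesis
        proof (cases "i < g'")
          case True
          then show ?thesis unfolding entry using entry_first_rows[OF N True i(2,3,4) j] False by simp
        next
          case False
          define i' where "i' = i - g'"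
          define j' where "j' = j - g"
          have ij: "i = g' + i'" "j = g + j'" "i' < d' - g'" "j' < d - g"
            using False j i by (auto simp: i'_def j'_def)
          have "\<psi> X $$ (i' * N + s, j' * N + t) =
              (\<Sum>c<d. (\<Sum>a<d'. cnj (V $$ (a, i)) * \<phi> X $$ (a * N + s, c * N + t)) * U $$ (c, j))"
            unfolding psi_eq[OF N(2)] index_compress[OF psi_factors_carrier Gc ij(3) i(3) ij(4) i(4)]
            using ij by (intro sum.cong refl arg_cong2[of _ _ _ _ "(*)"]) (simp_all add: columns_def)
          moreover have "i * N + s - g' * N = i' * N + s" "j * N + t - g * N = j' * N + t"
            unfolding ij(1,2) by (simp_all add: distrib_right)
          ultimately show ?thesis unfolding entry using False j by simp
        qed
      qed
    qed
    finally show "compress (mat_adjoint V) U N (\<phi> X) $$ (i * N + s, j * N + t) = ?F $$ (i * N + s, j * N + t)" .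
  qed
  then have "kron V (1\<^sub>m N) * ?F * mat_adjoint (kron U (1\<^sub>m N)) =
      kron V (1\<^sub>m N) * (kron (mat_adjoint V) (1\<^sub>m N) * \<phi> X * kron U (1\<^sub>m N)) * mat_adjoint (kron U (1\<^sub>m N))"
    by (simp add: compress_def)
  also have "\<dots> = (kron V (1\<^sub>m N) * kron (mat_adjoint V) (1\<^sub>m N)) * \<phi> X * (kron U (1\<^sub>m N) * mat_adjoint (kron U (1\<^sub>m N)))"
    using carrier_matD[OF UV_carrier(1)] carrier_matD[OF UV_carrier(2)] carrier_matD[OF Gc] by (simp add: mat_assoc)
  also have "kron V (1\<^sub>m N) * kron (mat_adjoint V) (1\<^sub>m N) = 1\<^sub>m (d' * N)"
    using kron_mult[OF UV_carrier(2) one_carrier_mat V' one_carrier_mat, of N] V(1) by (simp add: mat_one_mult unitary_mat_def)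
  also have "kron U (1\<^sub>m N) * mat_adjoint (kron U (1\<^sub>m N)) = 1\<^sub>m (d * N)"
    using kron_mult[OF UV_carrier(1) one_carrier_mat mat_adjoint_carrier[OF UV_carrier(1)] one_carrier_mat, of N] U(1)
    by (simp add: mat_adjoint_kron[OF UV_carrier(1) one_carrier_mat] mat_one_mult unitary_mat_def)
  finally show ?thesis using carrier_matD[OF Gc] by (simp add: mat_one_mult)
qed

text \<open>The corner \<open>X\<close> of the block form bounds the norm of radial limits from below.\<close>

lemma radial_limit_norm:
  assumes N: "N > 0" and X: "X \<in> carrier_mat (g' * N) (g * N)" "op_norm X = 1"
    and Y: "radial_limit (d' * N) (d * N) \<phi> X Y"
  shows "op_norm Y = 1"
proof -
  have cb: "X \<in> closed_ball g' g N" using X by (simp add: closed_ball_def)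
  have ib: "complex_of_real r \<cdot>\<^sub>m X \<in> int_ball g' g N" if "0 < r" "r < 1" for r
    by (rule smult_int_ball[OF cb]) (use that in simp)
  have lim: "mat_tendsto (d' * N) (d * N) (\<lambda>r. \<phi> (complex_of_real r \<cdot>\<^sub>m X)) Y"
    by (rule radial_limit_mat_tendsto[OF Y phi_carrier[OF N ib]])
  have Yc: "Y \<in> carrier_mat (d' * N) (d * N)" by (rule mat_tendstoD(1)[OF lim])
  have le: "op_norm Y \<le> 1" by (rule mat_tendsto_contraction[OF lim contr[OF N ib]])
  define P where "P = mat_adjoint (columns d' 0 g' V)"
  define Q where "Q = columns d 0 g U"
  have P: "P \<in> carrier_mat g' d'" "op_norm P \<le> 1"
    using op_norm_columns[OF V(1), of 0 g'] size_le by (simp_all add: P_def op_norm_adjoint)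
  have Q: "Q \<in> carrier_mat d g" "op_norm Q \<le> 1"
    using op_norm_columns[OF U(1), of 0 g] size_le by (simp_all add: Q_def)
  \<comment> \<open>The first \<open>g'\<close> columns of \<open>V\<close> and the first \<open>g\<close> columns of \<open>U\<close> cut out the corner \<open>Z\<close> of \<open>\<phi>(Z)\<close>.\<close>
  have corner: "compress P Q N (\<phi> Z) = Z" if Z: "Z \<in> int_ball g' g N" for Z
  proof (rule eq_block_matI[OF compress_carrier[OF P(1) Q(1) phi_carrier[OF N Z]]])
    show "Z \<in> carrier_mat (g' * N) (g * N)" using Z by (simp add: int_ball_def)
    fix i j s t assume i: "i < g'" "j < g" "s < N" "t < N"
    have "compress P Q N (\<phi> Z) $$ (i * N + s, j * N + t) =
        (\<Sum>c<d. (\<Sum>a<d'. cnj (V $$ (a, i)) * \<phi> Z $$ (a * N + s, c * N + t)) * U $$ (c, j))"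
      unfolding index_compress[OF P(1) Q(1) phi_carrier[OF N Z] i(1,3,2,4)]
      using i by (intro sum.cong refl arg_cong2[of _ _ _ _ "(*)"]) (simp_all add: P_def Q_def columns_def)
    also have "\<dots> = Z $$ (i * N + s, j * N + t)"
      using entry_first_columns[OF N Z _ i(2,3,4), of i] i size_le by simp
    finally show "compress P Q N (\<phi> Z) $$ (i * N + s, j * N + t) = Z $$ (i * N + s, j * N + t)" .
  qed
  have lim1: "mat_tendsto (g' * N) (g * N) (\<lambda>r. compress P Q N (\<phi> (complex_of_real r \<cdot>\<^sub>m X))) (compress P Q N Y)"
    unfolding compress_def
    by (rule mat_tendsto_mult[OF mat_tendsto_mult[OF mat_tendsto_const[OF kron_carrier[OF P(1) one_carrier_mat]] lim]
          mat_tendsto_const[OF kron_carrier[OF Q(1) one_carrier_mat]]])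
  have lim2: "mat_tendsto (g' * N) (g * N) (\<lambda>r. complex_of_real r \<cdot>\<^sub>m X) X"
  proof (rule mat_tendstoI[where H = "\<lambda>p q r. complex_of_real r * X $$ (p, q)"])
    fix p q
    have "((\<lambda>r. complex_of_real r * X $$ (p, q)) \<longlongrightarrow> complex_of_real 1 * X $$ (p, q)) (at_left 1)"
      by (intro tendsto_intros)
    then show "((\<lambda>r. complex_of_real r * X $$ (p, q)) \<longlongrightarrow> X $$ (p, q)) (at_left 1)" by simp
  qed (use X in auto)
  have "compress P Q N Y = X"
    by (rule mat_tendsto_unique[OF lim1 lim2]) (rule corner[OF ib])
  then have "op_norm X \<le> op_norm Y" using op_norm_compress[OF P Q Yc] by simp
  then show ?thesis using X(2) le by simp
qed

end

end

section \<open>Pencil ball maps\<close>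

lemma nc_analytic_ball_auto:
  assumes f: "nc_analytic g' g g' g f" and g': "g' > 0" and A: "linear_pencil g' g d' d A"
    and v: "v \<in> carrier_mat d' d" "op_norm v < 1" and d': "d' > 0"
    and le: "\<And>N X. N > 0 \<Longrightarrow> X \<in> int_ball g' g N \<Longrightarrow> op_norm (pencil_eval g' g d' d A (f X)) \<le> 1"
    and ser: "nc_series g' g d' d (\<lambda>X. ball_auto v (pencil_eval g' g d' d A (f X))) b e"
  shows "nc_analytic g' g d' d (\<lambda>X. ball_auto v (pencil_eval g' g d' d A (f X)))"
proof (rule nc_analytic_transfer[OF f _ ser])
  let ?L = "pencil_eval g' g d' d A"
  have Lc: "?L (f X) \<in> carrier_mat (d' * N) (d * N)" if "N > 0" "X \<in> int_ball g' g N" for N X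
    using f that by (intro pencil_eval_carrier[OF _ g']) (auto simp: nc_analytic_def)
  show "ball_auto v (?L (f X)) \<in> carrier_mat (d' * N) (d * N)" if "N > 0" "X \<in> int_ball g' g N" for N X
    unfolding ball_auto_eq[OF v d' Lc[OF that]]
    by (rule strict_contraction.W_carrier[OF strict_contraction_kron[OF v] Lc[OF that] le[OF that]])
  fix N :: nat and S :: "(nat \<Rightarrow> complex) set" and alg and a :: "(nat \<Rightarrow> complex) \<Rightarrow> complex mat"
  assume N: "N > 0" and S: "inverse_closed_algebra S alg" and a: "a ` S \<subseteq> int_ball g' g N"
    and fa: "inverse_closed_algebra.mat_alg S alg (g' * N) (g * N) (f \<circ> a)"
  interpret inverse_closed_algebra S alg by fact
  have az: "a z \<in> int_ball g' g N" if "z \<in> S" for z using a that by blast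
  have "mat_alg (d' * N) (d * N) (\<lambda>z. ?L ((f \<circ> a) z))" by (rule mat_alg_pencil[OF A g' fa])
  then have "mat_alg (d' * N) (d * N) (\<lambda>z. strict_contraction.W (kron v (1\<^sub>m N)) (d * N) (?L ((f \<circ> a) z)))"
    by (rule mat_alg_W[OF strict_contraction_kron[OF v]]) (use le[OF N az] in simp)
  then show "mat_alg (d' * N) (d * N) ((\<lambda>X. ball_auto v (?L (f X))) \<circ> a)"
    by (rule mat_alg_cong) (simp add: ball_auto_eq[OF v d' Lc[OF N az]])
qed

theorem corollary1p10:
  fixes g' g d' d :: nat
    and A :: "nat \<Rightarrow> nat \<Rightarrow> complex mat"
    and f L \<phi> :: "complex mat \<Rightarrow> complex mat"
    and v :: "complex mat"
  assumes "0 < g'" "0 < g" "0 < d'" "0 < d"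
    and "linear_pencil g' g d' d A"
    and "L = pencil_eval g' g d' d A"
    and "pencil_ball_map g' g d' d A f"
    and "v = L (nc_at_0 g' g f)"
    and "op_norm v < 1"
    and "\<phi> = (\<lambda>X. ball_auto v (L (f X)))"
  shows "(\<forall>N>0. \<forall>X \<in> int_ball g' g N. L (f X) = ball_auto v (\<phi> X)) \<and>
    nc_ball_map g' g d' d \<phi> \<and>
    nc_at_0 g' g \<phi> = 0\<^sub>m d' d \<and>
    g' \<le> d' \<and> g \<le> d \<and>
    (\<exists>U V \<psi>. unitary_mat d U \<and> unitary_mat d' V \<and>
       nc_analytic g' g (d' - g') (d - g) \<psi> \<and>
       contraction_valued g' g \<psi> \<and>
       nc_at_0 g' g \<psi> = 0\<^sub>m (d' - g') (d - g) \<and>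
       (\<forall>N>0. \<forall>X \<in> int_ball g' g N.
          \<phi> X = kron V (1\<^sub>m N)
            * four_block_mat X (0\<^sub>m (g' * N) ((d - g) * N))
                (0\<^sub>m ((d' - g') * N) (g * N)) (\<psi> X)
            * mat_adjoint (kron U (1\<^sub>m N))))"
proof -
  note g'0 = assms(1) and g0 = assms(2) and d'0 = assms(3) and d0 = assms(4) and pencil = assms(5)
  note L = assms(6) and v_def = assms(8) and v_lt = assms(9) and \<phi>_def = assms(10)
  have f: "nc_analytic g' g g' g f"
    and le: "\<And>N X. N > 0 \<Longrightarrow> X \<in> int_ball g' g N \<Longrightarrow> op_norm (L (f X)) \<le> 1"
    and boundary: "\<And>N X Y. N > 0 \<Longrightarrow> X \<in> carrier_mat (g' * N) (g * N) \<Longrightarrow> op_norm X = 1 \<Longrightarrow>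
      radial_limit (g' * N) (g * N) f X Y \<Longrightarrow> op_norm (L Y) = 1"
    using assms(7) unfolding pencil_ball_map_def L by blast+
  obtain a where a: "nc_taylor g' g g' g f a" by (rule nc_analytic_nc_taylor[OF f])
  note f_hol = nc_analytic_disc_analytic[OF f]
  define u where "u = (\<lambda>X. L (f X))"
  have u_hol: "disc_analytic g' g d' d u" unfolding u_def L by (rule disc_analytic_pencil[OF pencil g'0 f_hol])
  have u_taylor: "nc_taylor g' g d' d u (\<lambda>w. L (a w))"
    unfolding u_def L by (rule nc_taylor_pencil[OF pencil g'0 f_hol a])
  have Lc: "L Z \<in> carrier_mat (d' * N) (d * N)" if "Z \<in> carrier_mat (g' * N) (g * N)" for Z N
    unfolding L by (rule pencil_eval_carrier[OF that g'0])
  have fc: "f X \<in> carrier_mat (g' * N) (g * N)" if "N > 0" "X \<in> int_ball g' g N" for N X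
    using f that by (auto simp: nc_analytic_def)
  have uc: "u X \<in> carrier_mat (d' * N) (d * N)" if "N > 0" "X \<in> int_ball g' g N" for N X
    unfolding u_def by (rule Lc[OF fc[OF that]])
  have u_le: "op_norm (u X) \<le> 1" if "N > 0" "X \<in> int_ball g' g N" for N X unfolding u_def by (rule le[OF that])
  have a0: "L (a []) = v"
    unfolding v_def using nc_series_at_0[OF nc_taylor_nc_series[OF f_hol a] f] by simp
  have vc: "v \<in> carrier_mat d' d" using nc_taylorD(1)[OF u_taylor, of "[]"] a0 by simp
  note v = vc v_lt
  have \<phi>: "\<phi> = (\<lambda>X. ball_auto v (u X))" by (simp add: \<phi>_def u_def)
  have hol: "disc_analytic g' g d' d \<phi>" unfolding \<phi> by (rule ball_auto_disc_analytic[OF v d'0 u_hol u_le])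
  obtain b where b: "nc_taylor g' g d' d \<phi> b"
    unfolding \<phi> by (rule ball_auto_nc_taylor[OF v d'0 u_hol u_taylor u_le]) (use a0 v_lt in auto)
  have \<phi>_series: "nc_series g' g d' d \<phi> b 1" by (rule nc_taylor_nc_series[OF hol b])
  have \<phi>_analytic: "nc_analytic g' g d' d \<phi>"
    using \<phi>_series le unfolding \<phi> u_def L by (intro nc_analytic_ball_auto[OF f g'0 pencil v d'0]) auto
  have \<phi>W: "\<phi> X = strict_contraction.W (kron v (1\<^sub>m N)) (d * N) (u X)" if "N > 0" "X \<in> int_ball g' g N" for N X
    unfolding \<phi> by (rule ball_auto_eq[OF v d'0 uc[OF that]])
  have \<phi>_le: "op_norm (\<phi> X) \<le> 1" if "N > 0" "X \<in> int_ball g' g N" for N X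
    unfolding \<phi>W[OF that]
    by (rule strict_contraction.W_contraction[OF strict_contraction_kron[OF v] uc[OF that] u_le[OF that]])
  have involution: "L (f X) = ball_auto v (\<phi> X)" if N: "N > 0" "X \<in> int_ball g' g N" for N X
  proof -
    interpret V: strict_contraction "kron v (1\<^sub>m N)" "d' * N" "d * N" by (rule strict_contraction_kron[OF v])
    have "\<phi> X \<in> carrier_mat (d' * N) (d * N)" unfolding \<phi>W[OF N] by (rule V.W_carrier[OF uc[OF N] u_le[OF N]])
    then have "ball_auto v (\<phi> X) = V.W (\<phi> X)" by (rule ball_auto_eq[OF v d'0])
    also have "\<dots> = u X" unfolding \<phi>W[OF N] by (rule V.W_involution[OF uc[OF N] u_le[OF N]])
    finally show ?thesis by (simp add: u_def)
  qed
  have \<phi>0: "\<phi> (0\<^sub>m g' g) = 0\<^sub>m d' d"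
  proof -
    interpret V: strict_contraction v d' d by unfold_locales (rule v)+
    have "\<phi> (0\<^sub>m g' g) = ball_auto v v" unfolding \<phi> u_def by (simp add: v_def nc_at_0_def)
    also have "\<dots> = V.W v"
      using ball_auto_eq[OF v d'0, of v 1] vc unfolding kron_one_size_1 mult_1_right by blast
    also have "\<dots> = 0\<^sub>m d' d"
    proof (rule V.W_unique[symmetric, OF vc])
      have vv: "v - v = 0\<^sub>m d' d" using vc by (intro eq_matI) auto
      have "V.Di' * (v - v) = 0\<^sub>m d' d" unfolding vv by (rule right_mult_zero_mat[OF V.carrier(4)])
      moreover have "0\<^sub>m d' d * (V.Di * (1\<^sub>m d - mat_adjoint v * v)) = 0\<^sub>m d' d"
        by (rule left_mult_zero_mat[of _ d d]) (use vc V.carrier(2) in \<open>auto intro!: mult_carrier_mat[of _ d d]\<close>)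
      ultimately show "0\<^sub>m d' d * (V.Di * (1\<^sub>m d - mat_adjoint v * v)) = V.Di' * (v - v)" by simp
    qed (use v_lt in simp_all)
    finally show ?thesis .
  qed
  have b0: "b [] = 0\<^sub>m d' d"
    using nc_series_at_0[OF \<phi>_series \<phi>_analytic] \<phi>0 by (simp add: nc_at_0_def)
  \<comment> \<open>As the blocks of \<open>X\<close> multiply to zero, \<open>f(rX)\<close> and \<open>\<phi>(rX)\<close> are affine in \<open>r\<close>. The boundary condition holds for
    the limit of \<open>f(rX)\<close>, and \<open>W_mult\<close> in the limit carries it over to the linear part of \<open>\<phi>\<close>.\<close>
  have isometric: "op_norm (Matrix.mat (d' * N) (d * N) (\<lambda>(p, q). nc_coeff g' g N b X 1 p q)) = 1"
    if N: "N > 0" and X: "X \<in> carrier_mat (g' * N) (g * N)" "op_norm X = 1" and sq: "square_zero g' g N X" for N X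
  proof -
    let ?S = "Matrix.mat (d' * N) (d * N) (\<lambda>(p, q). nc_coeff g' g N b X 1 p q)"
    define Y where "Y = Matrix.mat (g' * N) (g * N) (\<lambda>(p, q). nc_coeff g' g N a X 0 p q + nc_coeff g' g N a X 1 p q)"
    have cb: "X \<in> closed_ball g' g N" using X by (simp add: closed_ball_def)
    have ib: "complex_of_real r \<cdot>\<^sub>m X \<in> int_ball g' g N" if "0 < r" "r < 1" for r
      by (rule smult_int_ball[OF cb]) (use that in simp)
    have lim_affine: "((\<lambda>r. c0 + c1 * complex_of_real r) \<longlongrightarrow> c0 + c1) (at_left 1)" for c0 c1
    proof -
      have "((\<lambda>r. c0 + c1 * complex_of_real r) \<longlongrightarrow> c0 + c1 * complex_of_real 1) (at_left 1)"
        by (intro tendsto_intros)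
      then show ?thesis by simp
    qed
    have f_lim: "mat_tendsto (g' * N) (g * N) (\<lambda>r. f (complex_of_real r \<cdot>\<^sub>m X)) Y"
    proof (rule mat_tendstoI[where H = "\<lambda>p q r. nc_coeff g' g N a X 0 p q + nc_coeff g' g N a X 1 p q * complex_of_real r"])
      show "f (complex_of_real r \<cdot>\<^sub>m X) \<in> carrier_mat (g' * N) (g * N)" if "0 < r" "r < 1" for r by (rule fc[OF N ib[OF that]])
      fix p q assume pq: "p < g' * N" "q < g * N"
      show "((\<lambda>r. nc_coeff g' g N a X 0 p q + nc_coeff g' g N a X 1 p q * complex_of_real r) \<longlongrightarrow> Y $$ (p, q)) (at_left 1)"
        using lim_affine pq by (simp add: Y_def)
      show "nc_coeff g' g N a X 0 p q + nc_coeff g' g N a X 1 p q * complex_of_real r = f (complex_of_real r \<cdot>\<^sub>m X) $$ (p, q)"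
        if "0 < r" "r < 1" for r
        by (rule square_zero_affine[OF f_hol a N cb sq pq, symmetric]) (use that in simp)
    qed (simp add: Y_def)
    have Yc: "Y \<in> carrier_mat (g' * N) (g * N)" by (simp add: Y_def)
    have "radial_limit (g' * N) (g * N) f X Y"
      using mat_tendstoD(3)[OF f_lim] Yc by (simp add: radial_limit_def)
    from boundary[OF N X this] have LY: "op_norm (L Y) = 1" .
    interpret V: strict_contraction "kron v (1\<^sub>m N)" "d' * N" "d * N" by (rule strict_contraction_kron[OF v])
    have u_lim: "mat_tendsto (d' * N) (d * N) (\<lambda>r. u (complex_of_real r \<cdot>\<^sub>m X)) (L Y)"
      unfolding u_def L by (rule mat_tendsto_pencil[OF pencil g'0 f_lim])
    have b0_coeff: "nc_coeff g' g N b X 0 p q = 0" if pq: "p < d' * N" "q < d * N" for p q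
    proof -
      obtain a s c t where i: "a < d'" "s < N" "p = a * N + s" "c < d" "t < N" "q = c * N + t"
        using pq by (metis block_index_cases)
      show ?thesis using i by (simp add: nc_coeff_def b0 index_kron[of _ d' d _ N N])
    qed
    have \<phi>_lim: "mat_tendsto (d' * N) (d * N) (\<lambda>r. \<phi> (complex_of_real r \<cdot>\<^sub>m X)) ?S"
    proof (rule mat_tendstoI[where H = "\<lambda>p q r. 0 + nc_coeff g' g N b X 1 p q * complex_of_real r"])
      show "\<phi> (complex_of_real r \<cdot>\<^sub>m X) \<in> carrier_mat (d' * N) (d * N)" if "0 < r" "r < 1" for r
        by (rule disc_analyticD(1)[OF hol N cb]) (use that in simp)
      fix p q assume pq: "p < d' * N" "q < d * N"
      show "((\<lambda>r. 0 + nc_coeff g' g N b X 1 p q * complex_of_real r) \<longlongrightarrow> ?S $$ (p, q)) (at_left 1)"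
        using lim_affine[of 0] pq by simp
      show "0 + nc_coeff g' g N b X 1 p q * complex_of_real r = \<phi> (complex_of_real r \<cdot>\<^sub>m X) $$ (p, q)"
        if "0 < r" "r < 1" for r
        using square_zero_affine[OF hol b N cb sq pq, of "complex_of_real r"] that by (simp add: b0_coeff[OF pq])
    qed simp
    have "?S * (V.Di * (1\<^sub>m (d * N) - mat_adjoint (kron v (1\<^sub>m N)) * L Y)) = V.Di' * (kron v (1\<^sub>m N) - L Y)"
    proof (rule mat_tendsto_unique)
      show "mat_tendsto (d' * N) (d * N)
          (\<lambda>r. \<phi> (complex_of_real r \<cdot>\<^sub>m X) * (V.Di * (1\<^sub>m (d * N) - mat_adjoint (kron v (1\<^sub>m N)) * u (complex_of_real r \<cdot>\<^sub>m X))))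
          (?S * (V.Di * (1\<^sub>m (d * N) - mat_adjoint (kron v (1\<^sub>m N)) * L Y)))"
        by (rule mat_tendsto_mult[OF \<phi>_lim mat_tendsto_mult[OF mat_tendsto_const[OF V.carrier(2)]
              mat_tendsto_diff[OF mat_tendsto_const[OF one_carrier_mat] mat_tendsto_mult[OF mat_tendsto_const[OF V.VsV(3)] u_lim]]]])
      show "mat_tendsto (d' * N) (d * N) (\<lambda>r. V.Di' * (kron v (1\<^sub>m N) - u (complex_of_real r \<cdot>\<^sub>m X))) (V.Di' * (kron v (1\<^sub>m N) - L Y))"
        by (rule mat_tendsto_mult[OF mat_tendsto_const[OF V.carrier(4)] mat_tendsto_diff[OF mat_tendsto_const[OF V.V] u_lim]])
      fix r :: real assume r: "0 < r" "r < 1"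
      show "\<phi> (complex_of_real r \<cdot>\<^sub>m X) * (V.Di * (1\<^sub>m (d * N) - mat_adjoint (kron v (1\<^sub>m N)) * u (complex_of_real r \<cdot>\<^sub>m X))) =
          V.Di' * (kron v (1\<^sub>m N) - u (complex_of_real r \<cdot>\<^sub>m X))"
        unfolding \<phi>W[OF N ib[OF r]] by (rule V.W_mult[OF uc[OF N ib[OF r]] u_le[OF N ib[OF r]]])
    qed
    then have "?S = V.W (L Y)" using LY by (intro V.W_unique[OF Lc[OF Yc]]) auto
    then show ?thesis using V.W_norm_one[OF Lc[OF Yc]] LY by simp
  qed
  interpret B: ball_map_zero g' g d' d \<phi> b
    by unfold_locales (fact g'0 g0 d'0 d0 hol b b0 | rule \<phi>_le isometric; assumption)+
  obtain x y where xy: "\<And>j. j < g \<Longrightarrow> x j \<in> carrier_vec d \<and> vnorm (x j) = 1"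
    "\<And>i. i < g' \<Longrightarrow> y i \<in> carrier_vec d' \<and> vnorm (y i) = 1"
    "\<And>i j. i < g' \<Longrightarrow> j < g \<Longrightarrow> B.B i j *\<^sub>v x j = y i"
    by (rule B.obtain_isometric_vectors) blast
  interpret F: ball_map_frame g' g d' d \<phi> b x y
    by unfold_locales (use xy in auto)
  obtain U where U: "unitary_mat d U" "\<And>j c. j < g \<Longrightarrow> c < d \<Longrightarrow> U $$ (c, j) = vec_index (x j) c"
    by (rule unitary_completion[OF F.orthonormal_u]) blast
  obtain V where V: "unitary_mat d' V" "\<And>i a. i < g' \<Longrightarrow> a < d' \<Longrightarrow> V $$ (a, i) = vec_index (y i) a"
    by (rule unitary_completion[OF F.orthonormal_v]) blast
  define \<psi> where "\<psi> = F.\<psi> U V"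
  have \<psi>_alt: "\<psi> = (\<lambda>X. compress (mat_adjoint (columns d' g' (d' - g') V)) (columns d g (d - g) U) (dim_row X div g') (\<phi> X))"
    unfolding \<psi>_def by (rule ext) (rule F.\<psi>_def[OF U V])
  have \<psi>_analytic: "nc_analytic g' g (d' - g') (d - g) \<psi>"
    unfolding \<psi>_alt by (rule nc_analytic_compress[OF \<phi>_analytic g'0 _ _ \<phi>_series]) simp_all
  have \<psi>0: "nc_at_0 g' g \<psi> = 0\<^sub>m (d' - g') (d - g)"
  proof -
    have "nc_at_0 g' g \<psi> = mat_adjoint (columns d' g' (d' - g') V) * 0\<^sub>m d' d * columns d g (d - g) U"
      unfolding nc_at_0_def \<psi>_alt \<phi>0 compress_def using g'0 by (simp add: kron_one_size_1[unfolded One_nat_def])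
    then show ?thesis
      using right_mult_zero_mat[OF mat_adjoint_carrier[OF columns_carrier], of d' g' "d' - g'" V d]
        left_mult_zero_mat[OF columns_carrier, of "d' - g'" d g "d - g" U] by simp
  qed
  have ball_map: "nc_ball_map g' g d' d \<phi>"
    unfolding nc_ball_map_def contraction_valued_def
  proof (intro conjI allI impI ballI \<phi>_analytic)
    show "op_norm (\<phi> X) \<le> 1" if "N > 0" "X \<in> int_ball g' g N" for N X by (rule \<phi>_le[OF that])
    fix N X t Y
    assume N: "0 < N" and X: "X \<in> carrier_mat (g' * N) (g * N)"
      and Y: "op_norm X = 1 \<and> radial_limit (d' * N) (d * N) \<phi> (cis t \<cdot>\<^sub>m X) Y"
    have "op_norm (cis t \<cdot>\<^sub>m X) = 1" using Y by (simp add: op_norm_smult[OF X])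
    from F.radial_limit_norm[OF U V N smult_carrier_mat[OF X] this conjunct2[OF Y]] show "op_norm Y = 1" .
  qed
  have "contraction_valued g' g \<psi>"
    unfolding contraction_valued_def \<psi>_def by (intro allI impI ballI) (rule F.psi_contraction[OF U V])
  moreover have "\<forall>N>0. \<forall>X \<in> int_ball g' g N. \<phi> X = kron V (1\<^sub>m N)
      * four_block_mat X (0\<^sub>m (g' * N) ((d - g) * N)) (0\<^sub>m ((d' - g') * N) (g * N)) (\<psi> X)
      * mat_adjoint (kron U (1\<^sub>m N))"
    unfolding \<psi>_def by (intro allI impI ballI) (rule F.block_form[OF U V])
  ultimately have "\<exists>U V \<psi>. unitary_mat d U \<and> unitary_mat d' V \<and>
       nc_analytic g' g (d' - g') (d - g) \<psi> \<and>
       contraction_valued g' g \<psi> \<and>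
       nc_at_0 g' g \<psi> = 0\<^sub>m (d' - g') (d - g) \<and>
       (\<forall>N>0. \<forall>X \<in> int_ball g' g N.
          \<phi> X = kron V (1\<^sub>m N)
            * four_block_mat X (0\<^sub>m (g' * N) ((d - g) * N))
                (0\<^sub>m ((d' - g') * N) (g * N)) (\<psi> X)
            * mat_adjoint (kron U (1\<^sub>m N)))"
    by (intro exI conjI) (rule U(1) V(1) \<psi>_analytic \<psi>0 | assumption)+
  then show ?thesis
    using involution ball_map F.nc_analytic_zero[OF \<phi>_analytic] F.size_le by blast
qed

end
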